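(* Let $K$ be a commutative ring and let $M|N$ be a depth two, irreducible Frobenius extension of $K$-algebras. Then $A=\mathrm{End}({}_NM_N)$ and $B=(M\otimes_NM)^N$, with the $K$-bialgebra structures in the context, are Hopf algebras dual to one another (via the pairing $\langle b,\alpha\rangle=b^1\alpha(b^2)\in K$), acting as on module algebras on $M$ (from the left, by $\alpha\triangleright m=\alpha(m)$) and on $\mathrm{End}({}_NM)$ (from the right, by $\xi\triangleleft b=b^1\xi(b^2\,-)$) respectively; moreover $M_1\cong M\rtimes A$ as rings.
   Context: A $K$-algebra extension $N\to M$ is irreducible if its centralizer $R=C_M(N)$ is trivial, $R=K1_M$; here $K$ is identified with $R$ via $k\mapsto k1_M$. It is D2 (depth two) if $M\otimes_NM$ is isomorphic to a direct summand of $\oplus^n\,{}_NM_M$ as an $N$-$M$-bimodule and of $\oplus^m\,{}_MM_N$ as an $M$-$N$-bimodule, for some $n,m\ge1$. It is Frobenius if there are an $N$-$N$-bimodule map $E:M\to N$ and finitely many $x_i,y_i\in M$ with $\sum_ix_iE(y_im)=m=\sum_iE(mx_i)y_i$ for all $m\in M$. Elements of $B=\{b\in M\otimes_NM:nb=bn\ \forall n\in N\}$ are written $b=b^1\otimes b^2$. Let $b_i\in B$, $\beta_i\in A$ be a left D2 quasibasis: finite families with $\sum_ib_i^1\otimes b_i^2\beta_i(m)=m\otimes1$ for all $m\in M$ (it exists for D2 extensions). Bialgebra $A$ over $K$: multiplication is composition, $\Delta(\alpha)=\sum_i\alpha(-\,b_i^1)b_i^2\otimes_K\beta_i$, $\varepsilon(\alpha)=\alpha(1)\in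 R=K$. Bialgebra $B$ over $K$: $bb'={b'}^1b^1\otimes b^2{b'}^2$, unit $1\otimes1$, $\Delta(b)=\sum_ib_i\otimes_K(\beta_i(b^1)\otimes b^2)$, $\varepsilon(b)=b^1b^2$. Duality of $A$ and $B$ means that $b\mapsto\langle b,-\rangle$ is an isomorphism $B\to\mathrm{Hom}_K(A,K)$ with $\langle bb',a\rangle=\langle b,a_{(1)}\rangle\langle b',a_{(2)}\rangle$ and $\langle b,aa'\rangle=\langle b_{(1)},a\rangle\langle b_{(2)},a'\rangle$ (and units corresponding to counits). $M_1=M\otimes_NM$ is the ring with multiplication $(m\otimes m')(m''\otimes m''')=mE(m'm'')\otimes m'''$ and unit $\sum_ix_i\otimes y_i$. $M\rtimes A$ is $M\otimes_KA$ with multiplication $(m\rtimes\alpha)(m'\rtimes\alpha')=m\,\alpha_{(1)}(m')\rtimes\alpha_{(2)}\alpha'$. *)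

theory Defs
  imports "HOL-Algebra.QuotRing" "HOL-Algebra.Module" "HOL-Algebra.Free_Abelian_Groups"
begin

section \<open>Bimodules\<close>

text \<open>
  As for \<^type>\<open>module\<close> in \<^theory>\<open>HOL-Algebra.Module\<close>, the multiplicative fields inherited
  from \<^type>\<open>ring\<close> play no role in a bimodule.
\<close>

record ('l, 'r, 'a) bimodule = "'a ring" +
  lact :: "'l \<Rightarrow> 'a \<Rightarrow> 'a"
  ract :: "'a \<Rightarrow> 'r \<Rightarrow> 'a"

text \<open>A ring \<open>M\<close> as a bimodule by restriction along \<open>f\<close> on the left and \<open>g\<close> on the right.\<close>

definition ring_bimodule ::
  "('l \<Rightarrow> 'a) \<Rightarrow> ('r \<Rightarrow> 'a) \<Rightarrow> ('a, 'm) ring_scheme \<Rightarrow> ('l, 'r, 'a) bimodule" where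
  "ring_bimodule f g M =
    \<lparr>carrier = carrier M, monoid.mult = monoid.mult M, one = \<one>\<^bsub>M\<^esub>,
     ring.zero = \<zero>\<^bsub>M\<^esub>, ring.add = ring.add M,
     lact = (\<lambda>l x. f l \<otimes>\<^bsub>M\<^esub> x), ract = (\<lambda>x r. x \<otimes>\<^bsub>M\<^esub> g r)\<rparr>"

definition symmetric_bimodule :: "('k, 'a, 'm) module_scheme \<Rightarrow> ('k, 'k, 'a) bimodule" where
  "symmetric_bimodule X =
    \<lparr>carrier = carrier X, monoid.mult = monoid.mult X, one = \<one>\<^bsub>X\<^esub>,
     ring.zero = \<zero>\<^bsub>X\<^esub>, ring.add = ring.add X,
     lact = (\<lambda>k x. k \<odot>\<^bsub>X\<^esub> x), ract = (\<lambda>x k. k \<odot>\<^bsub>X\<^esub> x)\<rparr>"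

definition bimodule_hom ::
  "('l, 'u) ring_scheme \<Rightarrow> ('r, 'v) ring_scheme \<Rightarrow> ('l, 'r, 'a, 'm) bimodule_scheme
    \<Rightarrow> ('l, 'r, 'b, 'n) bimodule_scheme \<Rightarrow> ('a \<Rightarrow> 'b) set" where
  "bimodule_hom L R X Y =
    {f \<in> carrier X \<rightarrow>\<^sub>E carrier Y.
      (\<forall>x \<in> carrier X. \<forall>y \<in> carrier X. f (x \<oplus>\<^bsub>X\<^esub> y) = f x \<oplus>\<^bsub>Y\<^esub> f y) \<and>
      (\<forall>l \<in> carrier L. \<forall>x \<in> carrier X. f (lact X l x) = lact Y l (f x)) \<and>
      (\<forall>r \<in> carrier R. \<forall>x \<in> carrier X. f (ract X x r) = ract Y (f x) r)}"

definition bimodule_power ::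
  "nat \<Rightarrow> ('l, 'r, 'a, 'm) bimodule_scheme \<Rightarrow> ('l, 'r, nat \<Rightarrow> 'a) bimodule" where
  "bimodule_power n X =
    \<lparr>carrier = {..<n} \<rightarrow>\<^sub>E carrier X, monoid.mult = undefined, one = undefined,
     ring.zero = (\<lambda>i \<in> {..<n}. \<zero>\<^bsub>X\<^esub>), ring.add = (\<lambda>v w. \<lambda>i \<in> {..<n}. v i \<oplus>\<^bsub>X\<^esub> w i),
     lact = (\<lambda>l v. \<lambda>i \<in> {..<n}. lact X l (v i)),
     ract = (\<lambda>v r. \<lambda>i \<in> {..<n}. ract X (v i) r)\<rparr>"

definition subbimodule ::
  "('l, 'u) ring_scheme \<Rightarrow> ('r, 'v) ring_scheme \<Rightarrow> 'a set
    \<Rightarrow> ('l, 'r, 'a, 'm) bimodule_scheme \<Rightarrow> bool" where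
  "subbimodule L R P X \<longleftrightarrow>
    subgroup P (add_monoid X) \<and>
    (\<forall>l \<in> carrier L. \<forall>x \<in> P. lact X l x \<in> P) \<and>
    (\<forall>r \<in> carrier R. \<forall>x \<in> P. ract X x r \<in> P)"

definition direct_summand ::
  "('l, 'u) ring_scheme \<Rightarrow> ('r, 'v) ring_scheme \<Rightarrow> 'a set
    \<Rightarrow> ('l, 'r, 'a, 'm) bimodule_scheme \<Rightarrow> bool" where
  "direct_summand L R P X \<longleftrightarrow>
    subbimodule L R P X \<and>
    (\<exists>Q. subbimodule L R Q X \<and> P \<inter> Q = {\<zero>\<^bsub>X\<^esub>} \<and> P <+>\<^bsub>X\<^esub> Q = carrier X)"

definition iso_to_direct_summand ::
  "('l, 'u) ring_scheme \<Rightarrow> ('r, 'v) ring_scheme \<Rightarrow> ('l, 'r, 'a, 'm) bimodule_scheme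
    \<Rightarrow> ('l, 'r, 'b, 'n) bimodule_scheme \<Rightarrow> bool" where
  "iso_to_direct_summand L R Y X \<longleftrightarrow>
    (\<exists>P. direct_summand L R P X \<and> (\<exists>f \<in> bimodule_hom L R Y X. bij_betw f (carrier Y) P))"


section \<open>Tensor products\<close>

text \<open>
  The tensor product of a right \<open>S\<close>-module \<open>X\<close> and a left \<open>S\<close>-module \<open>Y\<close> is the quotient of the
  free abelian group on pairs by the bilinearity and balancing relations; its elements are cosets
  of finitely supported integer-valued functions.
\<close>

definition tensor_rels ::
  "('s, 'u) ring_scheme \<Rightarrow> ('l, 's, 'a, 'm) bimodule_scheme \<Rightarrow> ('s, 'r, 'b, 'n) bimodule_scheme
    \<Rightarrow> ('a \<times> 'b \<Rightarrow>\<^sub>0 int) set" where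
  "tensor_rels S X Y =
    {frag_of (x \<oplus>\<^bsub>X\<^esub> x', y) - frag_of (x, y) - frag_of (x', y) | x x' y.
       x \<in> carrier X \<and> x' \<in> carrier X \<and> y \<in> carrier Y} \<union>
    {frag_of (x, y \<oplus>\<^bsub>Y\<^esub> y') - frag_of (x, y) - frag_of (x, y') | x y y'.
       x \<in> carrier X \<and> y \<in> carrier Y \<and> y' \<in> carrier Y} \<union>
    {frag_of (ract X x s, y) - frag_of (x, lact Y s y) | x s y.
       x \<in> carrier X \<and> s \<in> carrier S \<and> y \<in> carrier Y}"

definition tensor_null ::
  "('s, 'u) ring_scheme \<Rightarrow> ('l, 's, 'a, 'm) bimodule_scheme \<Rightarrow> ('s, 'r, 'b, 'n) bimodule_scheme
    \<Rightarrow> ('a \<times> 'b \<Rightarrow>\<^sub>0 int) set" where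
  "tensor_null S X Y =
    generate (free_Abelian_group (carrier X \<times> carrier Y)) (tensor_rels S X Y)"

definition tensor_elem ::
  "('s, 'u) ring_scheme \<Rightarrow> ('l, 's, 'a, 'm) bimodule_scheme \<Rightarrow> ('s, 'r, 'b, 'n) bimodule_scheme
    \<Rightarrow> 'a \<Rightarrow> 'b \<Rightarrow> ('a \<times> 'b \<Rightarrow>\<^sub>0 int) set" where
  "tensor_elem S X Y x y =
    tensor_null S X Y #>\<^bsub>free_Abelian_group (carrier X \<times> carrier Y)\<^esub> frag_of (x, y)"

definition tensor_ab ::
  "('s, 'u) ring_scheme \<Rightarrow> ('l, 's, 'a, 'm) bimodule_scheme \<Rightarrow> ('s, 'r, 'b, 'n) bimodule_scheme
    \<Rightarrow> ('a \<times> 'b \<Rightarrow>\<^sub>0 int) set ring" where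
  "tensor_ab S X Y =
    (let Q = free_Abelian_group (carrier X \<times> carrier Y) Mod tensor_null S X Y
     in \<lparr>carrier = carrier Q, monoid.mult = undefined, one = undefined,
         ring.zero = \<one>\<^bsub>Q\<^esub>, ring.add = monoid.mult Q\<rparr>)"

text \<open>
  \<open>tensor_lift G f t\<close> is the sum of all \<open>f t\<^sup>1 t\<^sup>2\<close> in Sweedler-style notation
  \<open>t = t\<^sup>1 \<otimes> t\<^sup>2\<close>, computed in the additive group of \<open>G\<close>
  from an arbitrary representative of the coset \<open>t\<close>. It is the value at \<open>t\<close> of the homomorphism
  induced by \<open>f\<close>, and is only meaningful if \<open>f\<close> is biadditive and balanced.
\<close>

definition tensor_lift ::
  "('g, 'm) ring_scheme \<Rightarrow> ('a \<Rightarrow> 'b \<Rightarrow> 'g) \<Rightarrow> ('a \<times> 'b \<Rightarrow>\<^sub>0 int) set \<Rightarrow> 'g" where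
  "tensor_lift G f t =
    (let p = (SOME p. p \<in> t)
     in \<Oplus>\<^bsub>G\<^esub>z \<in> Poly_Mapping.keys p. add_pow G (Poly_Mapping.lookup p z) (f (fst z) (snd z)))"

definition tensor ::
  "('s, 'u) ring_scheme \<Rightarrow> ('l, 's, 'a, 'm) bimodule_scheme \<Rightarrow> ('s, 'r, 'b, 'n) bimodule_scheme
    \<Rightarrow> ('l, 'r, ('a \<times> 'b \<Rightarrow>\<^sub>0 int) set) bimodule" where
  "tensor S X Y =
    (let T = tensor_ab S X Y
     in \<lparr>carrier = carrier T, monoid.mult = monoid.mult T, one = \<one>\<^bsub>T\<^esub>,
         ring.zero = \<zero>\<^bsub>T\<^esub>, ring.add = ring.add T,
         lact = (\<lambda>l. tensor_lift T (\<lambda>x y. tensor_elem S X Y (lact X l x) y)),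
         ract = (\<lambda>t r. tensor_lift T (\<lambda>x y. tensor_elem S X Y x (ract Y y r)) t)\<rparr>)"


section \<open>Algebras over a commutative ring\<close>

text \<open>Associative and unital; \<^const>\<open>algebra\<close> from the library also requires commutativity.\<close>

locale assoc_algebra = module R M + ring M for R (structure) and M (structure) +
  assumes smult_mult_left:
    "\<lbrakk>k \<in> carrier R; x \<in> carrier M; y \<in> carrier M\<rbrakk>
      \<Longrightarrow> (k \<odot>\<^bsub>M\<^esub> x) \<otimes>\<^bsub>M\<^esub> y = k \<odot>\<^bsub>M\<^esub> (x \<otimes>\<^bsub>M\<^esub> y)"
  and smult_mult_right:
    "\<lbrakk>k \<in> carrier R; x \<in> carrier M; y \<in> carrier M\<rbrakk>
      \<Longrightarrow> x \<otimes>\<^bsub>M\<^esub> (k \<odot>\<^bsub>M\<^esub> y) = k \<odot>\<^bsub>M\<^esub> (x \<otimes>\<^bsub>M\<^esub> y)"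

definition linear_maps ::
  "('k, 'u) ring_scheme \<Rightarrow> ('k, 'a, 'm) module_scheme \<Rightarrow> ('k, 'b, 'n) module_scheme
    \<Rightarrow> ('a \<Rightarrow> 'b) set" where
  "linear_maps K X Y =
    {f \<in> carrier X \<rightarrow>\<^sub>E carrier Y.
      (\<forall>x \<in> carrier X. \<forall>y \<in> carrier X. f (x \<oplus>\<^bsub>X\<^esub> y) = f x \<oplus>\<^bsub>Y\<^esub> f y) \<and>
      (\<forall>k \<in> carrier K. \<forall>x \<in> carrier X. f (k \<odot>\<^bsub>X\<^esub> x) = k \<odot>\<^bsub>Y\<^esub> f x)}"

definition ring_module :: "('k, 'u) ring_scheme \<Rightarrow> ('k, 'k) module" where
  "ring_module K =
    \<lparr>carrier = carrier K, monoid.mult = monoid.mult K, one = \<one>\<^bsub>K\<^esub>,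
     ring.zero = \<zero>\<^bsub>K\<^esub>, ring.add = ring.add K,
     module.smult = monoid.mult K\<rparr>"

definition algebra_hom ::
  "('k, 'u) ring_scheme \<Rightarrow> ('k, 'a, 'm) module_scheme \<Rightarrow> ('k, 'b, 'n) module_scheme
    \<Rightarrow> ('a \<Rightarrow> 'b) set" where
  "algebra_hom K X Y =
    {f \<in> ring_hom X Y. \<forall>k \<in> carrier K. \<forall>x \<in> carrier X. f (k \<odot>\<^bsub>X\<^esub> x) = k \<odot>\<^bsub>Y\<^esub> f x}"

definition elem_K ::
  "('k, 'u) ring_scheme \<Rightarrow> ('k, 'a, 'm) module_scheme \<Rightarrow> ('k, 'b, 'n) module_scheme
    \<Rightarrow> 'a \<Rightarrow> 'b \<Rightarrow> ('a \<times> 'b \<Rightarrow>\<^sub>0 int) set" where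
  "elem_K K X Y = tensor_elem K (symmetric_bimodule X) (symmetric_bimodule Y)"

definition tensor_K ::
  "('k, 'u) ring_scheme \<Rightarrow> ('k, 'a, 'm) module_scheme \<Rightarrow> ('k, 'b, 'n) module_scheme
    \<Rightarrow> ('k, ('a \<times> 'b \<Rightarrow>\<^sub>0 int) set) module" where
  "tensor_K K X Y =
    (let T = tensor K (symmetric_bimodule X) (symmetric_bimodule Y)
     in \<lparr>carrier = carrier T,
         monoid.mult = (\<lambda>s t.
           tensor_lift T (\<lambda>x y. tensor_lift T (\<lambda>x' y'.
             elem_K K X Y (x \<otimes>\<^bsub>X\<^esub> x') (y \<otimes>\<^bsub>Y\<^esub> y')) t) s),
         one = elem_K K X Y \<one>\<^bsub>X\<^esub> \<one>\<^bsub>Y\<^esub>, ring.zero = \<zero>\<^bsub>T\<^esub>, ring.add = ring.add T, module.smult = lact T\<rparr>)"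


section \<open>Hopf algebras\<close>

text \<open>
  Both sides are compared in \<open>H \<otimes> (H \<otimes> H)\<close>, so the associator is absorbed into the left-hand side.
\<close>

definition coassociative ::
  "('k, 'u) ring_scheme \<Rightarrow> ('k, 'h, 'm) module_scheme
    \<Rightarrow> ('h \<Rightarrow> ('h \<times> 'h \<Rightarrow>\<^sub>0 int) set) \<Rightarrow> bool" where
  "coassociative K H \<Delta> \<longleftrightarrow>
    (let H2 = tensor_K K H H; H3 = tensor_K K H H2 in
     \<forall>h \<in> carrier H.
       tensor_lift H3 (\<lambda>a c. tensor_lift H3 (\<lambda>a1 a2.
         elem_K K H H2 a1 (elem_K K H H a2 c)) (\<Delta> a)) (\<Delta> h) =
       tensor_lift H3 (\<lambda>a c. elem_K K H H2 a (\<Delta> c)) (\<Delta> h))"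

definition counital ::
  "('k, 'h, 'm) module_scheme
    \<Rightarrow> ('h \<Rightarrow> ('h \<times> 'h \<Rightarrow>\<^sub>0 int) set) \<Rightarrow> ('h \<Rightarrow> 'k) \<Rightarrow> bool" where
  "counital H \<Delta> \<epsilon> \<longleftrightarrow>
    (\<forall>h \<in> carrier H.
      tensor_lift H (\<lambda>a c. \<epsilon> a \<odot>\<^bsub>H\<^esub> c) (\<Delta> h) = h \<and>
      tensor_lift H (\<lambda>a c. \<epsilon> c \<odot>\<^bsub>H\<^esub> a) (\<Delta> h) = h)"

definition bialgebra ::
  "('k, 'u) ring_scheme \<Rightarrow> ('k, 'h, 'm) module_scheme
    \<Rightarrow> ('h \<Rightarrow> ('h \<times> 'h \<Rightarrow>\<^sub>0 int) set) \<Rightarrow> ('h \<Rightarrow> 'k) \<Rightarrow> bool" where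
  "bialgebra K H \<Delta> \<epsilon> \<longleftrightarrow>
    assoc_algebra K H \<and>
    \<Delta> \<in> algebra_hom K H (tensor_K K H H) \<and>
    \<epsilon> \<in> algebra_hom K H (ring_module K) \<and>
    coassociative K H \<Delta> \<and> counital H \<Delta> \<epsilon>"

definition antipode ::
  "('k, 'u) ring_scheme \<Rightarrow> ('k, 'h, 'm) module_scheme
    \<Rightarrow> ('h \<Rightarrow> ('h \<times> 'h \<Rightarrow>\<^sub>0 int) set) \<Rightarrow> ('h \<Rightarrow> 'k) \<Rightarrow> ('h \<Rightarrow> 'h) \<Rightarrow> bool" where
  "antipode K H \<Delta> \<epsilon> S \<longleftrightarrow>
    S \<in> linear_maps K H H \<and>
    (\<forall>h \<in> carrier H.
      tensor_lift H (\<lambda>a c. S a \<otimes>\<^bsub>H\<^esub> c) (\<Delta> h) = \<epsilon> h \<odot>\<^bsub>H\<^esub> \<one>\<^bsub>H\<^esub> \<and>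
      tensor_lift H (\<lambda>a c. a \<otimes>\<^bsub>H\<^esub> S c) (\<Delta> h) = \<epsilon> h \<odot>\<^bsub>H\<^esub> \<one>\<^bsub>H\<^esub>)"

definition hopf_algebra ::
  "('k, 'u) ring_scheme \<Rightarrow> ('k, 'h, 'm) module_scheme
    \<Rightarrow> ('h \<Rightarrow> ('h \<times> 'h \<Rightarrow>\<^sub>0 int) set) \<Rightarrow> ('h \<Rightarrow> 'k) \<Rightarrow> bool" where
  "hopf_algebra K H \<Delta> \<epsilon> \<longleftrightarrow> bialgebra K H \<Delta> \<epsilon> \<and> (\<exists>S. antipode K H \<Delta> \<epsilon> S)"

definition dual_bialgebras ::
  "('k, 'u) ring_scheme
    \<Rightarrow> ('k, 'b, 'm) module_scheme \<Rightarrow> ('b \<Rightarrow> ('b \<times> 'b \<Rightarrow>\<^sub>0 int) set) \<Rightarrow> ('b \<Rightarrow> 'k)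
    \<Rightarrow> ('k, 'a, 'n) module_scheme \<Rightarrow> ('a \<Rightarrow> ('a \<times> 'a \<Rightarrow>\<^sub>0 int) set) \<Rightarrow> ('a \<Rightarrow> 'k)
    \<Rightarrow> ('b \<Rightarrow> 'a \<Rightarrow> 'k) \<Rightarrow> bool" where
  "dual_bialgebras K B \<Delta>B \<epsilon>B A \<Delta>A \<epsilon>A pair \<longleftrightarrow>
    bij_betw (\<lambda>b. restrict (pair b) (carrier A)) (carrier B) (linear_maps K A (ring_module K)) \<and>
    (\<forall>b \<in> carrier B. \<forall>b' \<in> carrier B. \<forall>a \<in> carrier A.
      pair (b \<oplus>\<^bsub>B\<^esub> b') a = pair b a \<oplus>\<^bsub>K\<^esub> pair b' a) \<and>
    (\<forall>k \<in> carrier K. \<forall>b \<in> carrier B. \<forall>a \<in> carrier A.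
      pair (k \<odot>\<^bsub>B\<^esub> b) a = k \<otimes>\<^bsub>K\<^esub> pair b a) \<and>
    (\<forall>b \<in> carrier B. \<forall>b' \<in> carrier B. \<forall>a \<in> carrier A.
      pair (b \<otimes>\<^bsub>B\<^esub> b') a =
      tensor_lift K (\<lambda>a1 a2. pair b a1 \<otimes>\<^bsub>K\<^esub> pair b' a2) (\<Delta>A a)) \<and>
    (\<forall>b \<in> carrier B. \<forall>a \<in> carrier A. \<forall>a' \<in> carrier A.
      pair b (a \<otimes>\<^bsub>A\<^esub> a') =
      tensor_lift K (\<lambda>b1 b2. pair b1 a \<otimes>\<^bsub>K\<^esub> pair b2 a') (\<Delta>B b)) \<and>
    (\<forall>a \<in> carrier A. pair \<one>\<^bsub>B\<^esub> a = \<epsilon>A a) \<and>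
    (\<forall>b \<in> carrier B. pair b \<one>\<^bsub>A\<^esub> = \<epsilon>B b)"

definition bilinear_maps ::
  "('k, 'u) ring_scheme \<Rightarrow> ('k, 'a, 'm) module_scheme \<Rightarrow> ('k, 'b, 'n) module_scheme
    \<Rightarrow> ('k, 'c, 'o) module_scheme \<Rightarrow> ('a \<Rightarrow> 'b \<Rightarrow> 'c) set" where
  "bilinear_maps K X Y Z =
    {f. (\<forall>x \<in> carrier X. restrict (f x) (carrier Y) \<in> linear_maps K Y Z) \<and>
        (\<forall>y \<in> carrier Y. (\<lambda>x \<in> carrier X. f x y) \<in> linear_maps K X Z)}"

definition left_module_algebra ::
  "('k, 'u) ring_scheme
    \<Rightarrow> ('k, 'h, 'm) module_scheme \<Rightarrow> ('h \<Rightarrow> ('h \<times> 'h \<Rightarrow>\<^sub>0 int) set) \<Rightarrow> ('h \<Rightarrow> 'k)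
    \<Rightarrow> ('k, 'x, 'n) module_scheme \<Rightarrow> ('h \<Rightarrow> 'x \<Rightarrow> 'x) \<Rightarrow> bool" where
  "left_module_algebra K H \<Delta> \<epsilon> X act \<longleftrightarrow>
    bialgebra K H \<Delta> \<epsilon> \<and> assoc_algebra K X \<and> act \<in> bilinear_maps K H X X \<and>
    (\<forall>x \<in> carrier X. act \<one>\<^bsub>H\<^esub> x = x) \<and>
    (\<forall>g \<in> carrier H. \<forall>h \<in> carrier H. \<forall>x \<in> carrier X. act (g \<otimes>\<^bsub>H\<^esub> h) x = act g (act h x)) \<and>
    (\<forall>h \<in> carrier H. \<forall>x \<in> carrier X. \<forall>y \<in> carrier X.
      act h (x \<otimes>\<^bsub>X\<^esub> y) = tensor_lift X (\<lambda>h1 h2. act h1 x \<otimes>\<^bsub>X\<^esub> act h2 y) (\<Delta> h)) \<and>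
    (\<forall>h \<in> carrier H. act h \<one>\<^bsub>X\<^esub> = \<epsilon> h \<odot>\<^bsub>X\<^esub> \<one>\<^bsub>X\<^esub>)"

definition right_module_algebra ::
  "('k, 'u) ring_scheme
    \<Rightarrow> ('k, 'h, 'm) module_scheme \<Rightarrow> ('h \<Rightarrow> ('h \<times> 'h \<Rightarrow>\<^sub>0 int) set) \<Rightarrow> ('h \<Rightarrow> 'k)
    \<Rightarrow> ('k, 'x, 'n) module_scheme \<Rightarrow> ('x \<Rightarrow> 'h \<Rightarrow> 'x) \<Rightarrow> bool" where
  "right_module_algebra K H \<Delta> \<epsilon> X act \<longleftrightarrow>
    bialgebra K H \<Delta> \<epsilon> \<and> assoc_algebra K X \<and> act \<in> bilinear_maps K X H X \<and>
    (\<forall>x \<in> carrier X. act x \<one>\<^bsub>H\<^esub> = x) \<and>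
    (\<forall>g \<in> carrier H. \<forall>h \<in> carrier H. \<forall>x \<in> carrier X. act x (g \<otimes>\<^bsub>H\<^esub> h) = act (act x g) h) \<and>
    (\<forall>h \<in> carrier H. \<forall>x \<in> carrier X. \<forall>y \<in> carrier X.
      act (x \<otimes>\<^bsub>X\<^esub> y) h = tensor_lift X (\<lambda>h1 h2. act x h1 \<otimes>\<^bsub>X\<^esub> act y h2) (\<Delta> h)) \<and>
    (\<forall>h \<in> carrier H. act \<one>\<^bsub>X\<^esub> h = \<epsilon> h \<odot>\<^bsub>X\<^esub> \<one>\<^bsub>X\<^esub>)"

definition smash_product ::
  "('k, 'u) ring_scheme \<Rightarrow> ('k, 'x, 'n) module_scheme
    \<Rightarrow> ('k, 'h, 'm) module_scheme \<Rightarrow> ('h \<Rightarrow> ('h \<times> 'h \<Rightarrow>\<^sub>0 int) set)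
    \<Rightarrow> ('h \<Rightarrow> 'x \<Rightarrow> 'x) \<Rightarrow> ('k, ('x \<times> 'h \<Rightarrow>\<^sub>0 int) set) module" where
  "smash_product K X H \<Delta> act =
    (let T = tensor_K K X H
     in T\<lparr>monoid.mult := (\<lambda>s t.
            tensor_lift T (\<lambda>x h. tensor_lift T (\<lambda>x' h'. tensor_lift T (\<lambda>h1 h2.
              elem_K K X H (x \<otimes>\<^bsub>X\<^esub> act h1 x') (h2 \<otimes>\<^bsub>H\<^esub> h')) (\<Delta> h)) t) s)\<rparr>)"


section \<open>Depth two, irreducible and Frobenius extensions\<close>

text \<open>
  An extension is a \<open>K\<close>-algebra homomorphism \<open>\<phi> : N \<rightarrow> M\<close>, not required to be injective.
\<close>

definition algebra_extension ::
  "('k, 'u) ring_scheme \<Rightarrow> ('k, 'n, 'v) module_scheme \<Rightarrow> ('k, 'm, 'w) module_scheme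
    \<Rightarrow> ('n \<Rightarrow> 'm) \<Rightarrow> bool" where
  "algebra_extension K N M \<phi> \<longleftrightarrow>
    assoc_algebra K N \<and> assoc_algebra K M \<and> \<phi> \<in> algebra_hom K N M"

definition centralizer ::
  "('n, 'v) ring_scheme \<Rightarrow> ('m, 'w) ring_scheme \<Rightarrow> ('n \<Rightarrow> 'm) \<Rightarrow> 'm set" where
  "centralizer N M \<phi> = {m \<in> carrier M. \<forall>n \<in> carrier N. \<phi> n \<otimes>\<^bsub>M\<^esub> m = m \<otimes>\<^bsub>M\<^esub> \<phi> n}"

text \<open>The injectivity clause is what allows \<open>K\<close> to be identified with the centralizer.\<close>

definition irreducible_extension ::
  "('k, 'u) ring_scheme \<Rightarrow> ('n, 'v) ring_scheme \<Rightarrow> ('k, 'm, 'w) module_scheme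
    \<Rightarrow> ('n \<Rightarrow> 'm) \<Rightarrow> bool" where
  "irreducible_extension K N M \<phi> \<longleftrightarrow>
    centralizer N M \<phi> = (\<lambda>k. k \<odot>\<^bsub>M\<^esub> \<one>\<^bsub>M\<^esub>) ` carrier K \<and>
    inj_on (\<lambda>k. k \<odot>\<^bsub>M\<^esub> \<one>\<^bsub>M\<^esub>) (carrier K)"

definition scalar_of :: "('k, 'u) ring_scheme \<Rightarrow> ('k, 'm, 'w) module_scheme \<Rightarrow> 'm \<Rightarrow> 'k" where
  "scalar_of K M = the_inv_into (carrier K) (\<lambda>k. k \<odot>\<^bsub>M\<^esub> \<one>\<^bsub>M\<^esub>)"

text \<open>
  The elements of a tensor product over \<open>N\<close> do not depend on the outer actions, so \<open>MxM\<close> has the same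
  elements, sums and pure tensors as the \<open>N\<close>-\<open>M\<close>- and \<open>M\<close>-\<open>N\<close>-bimodules used in \<open>depth_two\<close> below.
\<close>

definition MxM ::
  "('n, 'v) ring_scheme \<Rightarrow> ('m, 'w) ring_scheme \<Rightarrow> ('n \<Rightarrow> 'm)
    \<Rightarrow> ('m, 'm, ('m \<times> 'm \<Rightarrow>\<^sub>0 int) set) bimodule" where
  "MxM N M \<phi> = tensor N (ring_bimodule id \<phi> M) (ring_bimodule \<phi> id M)"

definition elem_N ::
  "('n, 'v) ring_scheme \<Rightarrow> ('m, 'w) ring_scheme \<Rightarrow> ('n \<Rightarrow> 'm)
    \<Rightarrow> 'm \<Rightarrow> 'm \<Rightarrow> ('m \<times> 'm \<Rightarrow>\<^sub>0 int) set" where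
  "elem_N N M \<phi> = tensor_elem N (ring_bimodule id \<phi> M) (ring_bimodule \<phi> id M)"

definition depth_two ::
  "('n, 'v) ring_scheme \<Rightarrow> ('m, 'w) ring_scheme \<Rightarrow> ('n \<Rightarrow> 'm) \<Rightarrow> bool" where
  "depth_two N M \<phi> \<longleftrightarrow>
    (\<exists>n \<ge> 1. iso_to_direct_summand N M
      (tensor N (ring_bimodule \<phi> \<phi> M) (ring_bimodule \<phi> id M))
      (bimodule_power n (ring_bimodule \<phi> id M))) \<and>
    (\<exists>m \<ge> 1. iso_to_direct_summand M N
      (tensor N (ring_bimodule id \<phi> M) (ring_bimodule \<phi> \<phi> M))
      (bimodule_power m (ring_bimodule id \<phi> M)))"

definition frobenius_system ::
  "('n, 'v) ring_scheme \<Rightarrow> ('m, 'w) ring_scheme \<Rightarrow> ('n \<Rightarrow> 'm)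
    \<Rightarrow> ('m \<Rightarrow> 'n) \<Rightarrow> nat \<Rightarrow> (nat \<Rightarrow> 'm) \<Rightarrow> (nat \<Rightarrow> 'm) \<Rightarrow> bool" where
  "frobenius_system N M \<phi> E r x y \<longleftrightarrow>
    E \<in> bimodule_hom N N (ring_bimodule \<phi> \<phi> M) (ring_bimodule id id N) \<and>
    (\<forall>i < r. x i \<in> carrier M \<and> y i \<in> carrier M) \<and>
    (\<forall>m \<in> carrier M.
      (\<Oplus>\<^bsub>M\<^esub>i \<in> {..<r}. x i \<otimes>\<^bsub>M\<^esub> \<phi> (E (y i \<otimes>\<^bsub>M\<^esub> m))) = m \<and>
      (\<Oplus>\<^bsub>M\<^esub>i \<in> {..<r}. \<phi> (E (m \<otimes>\<^bsub>M\<^esub> x i)) \<otimes>\<^bsub>M\<^esub> y i) = m)"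

definition frobenius_extension ::
  "('n, 'v) ring_scheme \<Rightarrow> ('m, 'w) ring_scheme \<Rightarrow> ('n \<Rightarrow> 'm) \<Rightarrow> bool" where
  "frobenius_extension N M \<phi> \<longleftrightarrow> (\<exists>E r x y. frobenius_system N M \<phi> E r x y)"

definition basic_construction ::
  "('n, 'v) ring_scheme \<Rightarrow> ('m, 'w) ring_scheme \<Rightarrow> ('n \<Rightarrow> 'm)
    \<Rightarrow> ('m \<Rightarrow> 'n) \<Rightarrow> nat \<Rightarrow> (nat \<Rightarrow> 'm) \<Rightarrow> (nat \<Rightarrow> 'm) \<Rightarrow> ('m \<times> 'm \<Rightarrow>\<^sub>0 int) set ring" where
  "basic_construction N M \<phi> E r x y =
    (let T = MxM N M \<phi>
     in \<lparr>carrier = carrier T,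
         monoid.mult = (\<lambda>s t.
           tensor_lift T (\<lambda>u v. tensor_lift T (\<lambda>u' v'.
             elem_N N M \<phi> (u \<otimes>\<^bsub>M\<^esub> \<phi> (E (v \<otimes>\<^bsub>M\<^esub> u'))) v') t) s),
         one = (\<Oplus>\<^bsub>T\<^esub>i \<in> {..<r}. elem_N N M \<phi> (x i) (y i)),
         ring.zero = \<zero>\<^bsub>T\<^esub>, ring.add = ring.add T\<rparr>)"


section \<open>The bialgebras of a depth two irreducible extension\<close>

definition endo_algebra ::
  "('k, 'm, 'w) module_scheme \<Rightarrow> ('m \<Rightarrow> 'm) set \<Rightarrow> ('k, 'm \<Rightarrow> 'm) module" where
  "endo_algebra M S =
    \<lparr>carrier = S, monoid.mult = compose (carrier M), one = (\<lambda>m \<in> carrier M. m),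
     ring.zero = (\<lambda>m \<in> carrier M. \<zero>\<^bsub>M\<^esub>), ring.add = (\<lambda>f g. \<lambda>m \<in> carrier M. f m \<oplus>\<^bsub>M\<^esub> g m),
     module.smult = (\<lambda>k f. \<lambda>m \<in> carrier M. k \<odot>\<^bsub>M\<^esub> f m)\<rparr>"

definition End_NN ::
  "('n, 'v) ring_scheme \<Rightarrow> ('k, 'm, 'w) module_scheme \<Rightarrow> ('n \<Rightarrow> 'm)
    \<Rightarrow> ('k, 'm \<Rightarrow> 'm) module" where
  "End_NN N M \<phi> =
    endo_algebra M (bimodule_hom N N (ring_bimodule \<phi> \<phi> M) (ring_bimodule \<phi> \<phi> M))"

definition End_N ::
  "('n, 'v) ring_scheme \<Rightarrow> ('k, 'm, 'w) module_scheme \<Rightarrow> ('n \<Rightarrow> 'm)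
    \<Rightarrow> ('k, 'm \<Rightarrow> 'm) module" where
  "End_N N M \<phi> =
    endo_algebra M
      {f \<in> carrier M \<rightarrow>\<^sub>E carrier M.
        (\<forall>x \<in> carrier M. \<forall>y \<in> carrier M. f (x \<oplus>\<^bsub>M\<^esub> y) = f x \<oplus>\<^bsub>M\<^esub> f y) \<and>
        (\<forall>n \<in> carrier N. \<forall>x \<in> carrier M. f (\<phi> n \<otimes>\<^bsub>M\<^esub> x) = \<phi> n \<otimes>\<^bsub>M\<^esub> f x)}"

definition tensor_square_centralizer ::
  "('n, 'v) ring_scheme \<Rightarrow> ('k, 'm, 'w) module_scheme \<Rightarrow> ('n \<Rightarrow> 'm)
    \<Rightarrow> ('k, ('m \<times> 'm \<Rightarrow>\<^sub>0 int) set) module" where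
  "tensor_square_centralizer N M \<phi> =
    (let T = MxM N M \<phi>
     in \<lparr>carrier = {b \<in> carrier T. \<forall>n \<in> carrier N. lact T (\<phi> n) b = ract T b (\<phi> n)},
         monoid.mult = (\<lambda>b b'.
           tensor_lift T (\<lambda>u' v'. tensor_lift T (\<lambda>u v.
             elem_N N M \<phi> (u' \<otimes>\<^bsub>M\<^esub> u) (v \<otimes>\<^bsub>M\<^esub> v')) b) b'),
         one = elem_N N M \<phi> \<one>\<^bsub>M\<^esub> \<one>\<^bsub>M\<^esub>, ring.zero = \<zero>\<^bsub>T\<^esub>, ring.add = ring.add T,
         module.smult = (\<lambda>k. lact T (k \<odot>\<^bsub>M\<^esub> \<one>\<^bsub>M\<^esub>))\<rparr>)"

definition left_D2_quasibasis ::
  "('n, 'v) ring_scheme \<Rightarrow> ('k, 'm, 'w) module_scheme \<Rightarrow> ('n \<Rightarrow> 'm)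
    \<Rightarrow> nat \<Rightarrow> (nat \<Rightarrow> ('m \<times> 'm \<Rightarrow>\<^sub>0 int) set) \<Rightarrow> (nat \<Rightarrow> 'm \<Rightarrow> 'm) \<Rightarrow> bool" where
  "left_D2_quasibasis N M \<phi> d b \<beta> \<longleftrightarrow>
    (\<forall>i < d. b i \<in> carrier (tensor_square_centralizer N M \<phi>) \<and>
             \<beta> i \<in> carrier (End_NN N M \<phi>)) \<and>
    (\<forall>m \<in> carrier M.
      (\<Oplus>\<^bsub>MxM N M \<phi>\<^esub>i \<in> {..<d}. ract (MxM N M \<phi>) (b i) (\<beta> i m)) = elem_N N M \<phi> m \<one>\<^bsub>M\<^esub>)"

text \<open>
  The comultiplications are written with a left D2 quasibasis \<open>b, \<beta>\<close> of length \<open>d\<close>, as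
  \<open>\<Delta>(\<alpha>) = \<Sum>\<^sub>i \<alpha>(- b\<^sub>i\<^sup>1) b\<^sub>i\<^sup>2 \<otimes> \<beta>\<^sub>i\<close> and \<open>\<Delta>(c) = \<Sum>\<^sub>i b\<^sub>i \<otimes> (\<beta>\<^sub>i(c\<^sup>1) \<otimes> c\<^sup>2)\<close>.
\<close>

definition comult_A ::
  "('k, 'u) ring_scheme \<Rightarrow> ('n, 'v) ring_scheme \<Rightarrow> ('k, 'm, 'w) module_scheme \<Rightarrow> ('n \<Rightarrow> 'm)
    \<Rightarrow> nat \<Rightarrow> (nat \<Rightarrow> ('m \<times> 'm \<Rightarrow>\<^sub>0 int) set) \<Rightarrow> (nat \<Rightarrow> 'm \<Rightarrow> 'm)
    \<Rightarrow> ('m \<Rightarrow> 'm) \<Rightarrow> (('m \<Rightarrow> 'm) \<times> ('m \<Rightarrow> 'm) \<Rightarrow>\<^sub>0 int) set" where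
  "comult_A K N M \<phi> d b \<beta> \<alpha> =
    (let A = End_NN N M \<phi>
     in \<Oplus>\<^bsub>tensor_K K A A\<^esub>i \<in> {..<d}.
          elem_K K A A
            (\<lambda>m \<in> carrier M. tensor_lift M (\<lambda>u v. \<alpha> (m \<otimes>\<^bsub>M\<^esub> u) \<otimes>\<^bsub>M\<^esub> v) (b i)) (\<beta> i))"

definition counit_A ::
  "('k, 'u) ring_scheme \<Rightarrow> ('k, 'm, 'w) module_scheme \<Rightarrow> ('m \<Rightarrow> 'm) \<Rightarrow> 'k" where
  "counit_A K M \<alpha> = scalar_of K M (\<alpha> \<one>\<^bsub>M\<^esub>)"

definition comult_B ::
  "('k, 'u) ring_scheme \<Rightarrow> ('n, 'v) ring_scheme \<Rightarrow> ('k, 'm, 'w) module_scheme \<Rightarrow> ('n \<Rightarrow> 'm)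
    \<Rightarrow> nat \<Rightarrow> (nat \<Rightarrow> ('m \<times> 'm \<Rightarrow>\<^sub>0 int) set) \<Rightarrow> (nat \<Rightarrow> 'm \<Rightarrow> 'm)
    \<Rightarrow> ('m \<times> 'm \<Rightarrow>\<^sub>0 int) set
    \<Rightarrow> (('m \<times> 'm \<Rightarrow>\<^sub>0 int) set \<times> ('m \<times> 'm \<Rightarrow>\<^sub>0 int) set \<Rightarrow>\<^sub>0 int) set" where
  "comult_B K N M \<phi> d b \<beta> c =
    (let B = tensor_square_centralizer N M \<phi>
     in \<Oplus>\<^bsub>tensor_K K B B\<^esub>i \<in> {..<d}.
          elem_K K B B (b i)
            (tensor_lift (MxM N M \<phi>) (\<lambda>u v. elem_N N M \<phi> (\<beta> i u) v) c))"

definition counit_B ::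
  "('k, 'u) ring_scheme \<Rightarrow> ('k, 'm, 'w) module_scheme \<Rightarrow> ('m \<times> 'm \<Rightarrow>\<^sub>0 int) set \<Rightarrow> 'k" where
  "counit_B K M b = scalar_of K M (tensor_lift M (\<lambda>u v. u \<otimes>\<^bsub>M\<^esub> v) b)"

definition pairing ::
  "('k, 'u) ring_scheme \<Rightarrow> ('k, 'm, 'w) module_scheme
    \<Rightarrow> ('m \<times> 'm \<Rightarrow>\<^sub>0 int) set \<Rightarrow> ('m \<Rightarrow> 'm) \<Rightarrow> 'k" where
  "pairing K M b \<alpha> = scalar_of K M (tensor_lift M (\<lambda>u v. u \<otimes>\<^bsub>M\<^esub> \<alpha> v) b)"

definition right_action_B ::
  "('m, 'w) ring_scheme \<Rightarrow> ('m \<Rightarrow> 'm) \<Rightarrow> ('m \<times> 'm \<Rightarrow>\<^sub>0 int) set \<Rightarrow> 'm \<Rightarrow> 'm" where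
  "right_action_B M \<xi> b =
    (\<lambda>m \<in> carrier M. tensor_lift M (\<lambda>u v. u \<otimes>\<^bsub>M\<^esub> \<xi> (v \<otimes>\<^bsub>M\<^esub> m)) b)"

end

(* By irreducibility both pairings <b, alpha> = b^1 alpha(b^2) and alpha(b^1) b^2 on B x A take
   values in K. Evaluated on a right depth two quasibasis, the first one exhibits A and B as
   finitely generated projective duals of each other; a left quasibasis gives the coproduct of A,
   which is characterised by alpha(m m') = alpha_(1)(m) alpha_(2)(m'). Since the pairing turns each
   multiplication into the other coproduct, the bialgebra axioms of A and B follow by
   nondegeneracy. The second pairing yields the antipode S of A through
   <b, S alpha> = alpha(b^1) b^2, and the transpose of S is the antipode of B. Finally M_1 and the
   smash product act faithfully on M, by (m (x) m') z = m E(m' z) and (m # alpha) z = m alpha(z);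
   in both cases the image consists of the right N-linear endomorphisms of M, so the two rings
   are isomorphic. *)
theory Submission imports Defs begin

section \<open>Additive maps\<close>

text \<open>Two obstacles shape the proof. First, \<open>tensor_lift\<close> evaluates an arbitrary
  representative, so a Sweedler expression is meaningful only once its integrand is known to be
  additive and balanced. Identities are then compared on pure tensors, hence stated for every t in M
  (x) M and not only for t in B: elements of B are in general not sums of pure tensors lying in B.
  Second, K is a commutative ring rather than a field, so separating elements of A (x) A or A (x) (A
  (x) A) by functionals requires dual bases. Multiplicativity of the coproduct of A rests on
  uniqueness: every w in A (x) A with \<alpha>(m m') = w_1(m) w_2(m') takes the same values under
  the pairing as the coproduct of \<alpha>, and the product of two coproducts has this property for
  the composite. The axioms for B are those for A with the roles exchanged, because the abstract
  list of pairing identities is equivalent to its mirror image. The two antipode identities for A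
  are checked differently: \<alpha>_1 S(\<alpha>_2) by evaluation on M, S(\<alpha>_1) \<alpha>_2 by
  pairing with B.\<close>

definition additive_map :: "('a, 'm) ring_scheme \<Rightarrow> ('b, 'n) ring_scheme \<Rightarrow> ('a \<Rightarrow> 'b) \<Rightarrow> bool" where
  "additive_map G H h \<longleftrightarrow>
    (\<forall>x \<in> carrier G. h x \<in> carrier H) \<and>
    (\<forall>x \<in> carrier G. \<forall>y \<in> carrier G. h (x \<oplus>\<^bsub>G\<^esub> y) = h x \<oplus>\<^bsub>H\<^esub> h y)"

lemma additive_mapI:
  assumes "\<And>x. x \<in> carrier G \<Longrightarrow> h x \<in> carrier H"
    and "\<And>x y. \<lbrakk>x \<in> carrier G; y \<in> carrier G\<rbrakk> \<Longrightarrow> h (x \<oplus>\<^bsub>G\<^esub> y) = h x \<oplus>\<^bsub>H\<^esub> h y"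
  shows "additive_map G H h"
  using assms by (simp add: additive_map_def)

lemma additive_map_closed: "\<lbrakk>additive_map G H h; x \<in> carrier G\<rbrakk> \<Longrightarrow> h x \<in> carrier H"
  by (simp add: additive_map_def)

lemma additive_map_add:
  "\<lbrakk>additive_map G H h; x \<in> carrier G; y \<in> carrier G\<rbrakk> \<Longrightarrow> h (x \<oplus>\<^bsub>G\<^esub> y) = h x \<oplus>\<^bsub>H\<^esub> h y"
  by (simp add: additive_map_def)

lemma additive_map_comp:
  assumes "additive_map G H g" "additive_map H I h"
  shows "additive_map G I (\<lambda>x. h (g x))"
  using assms by (simp add: additive_map_def)

lemma additive_map_sum:
  assumes "abelian_group H" "additive_map G H g" "additive_map G H h"
  shows "additive_map G H (\<lambda>x. g x \<oplus>\<^bsub>H\<^esub> h x)"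
proof -
  interpret H: abelian_group H by fact
  show ?thesis
    using assms(2,3) by (auto simp: additive_map_def H.a_ac)
qed

lemma additive_map_zero:
  assumes "abelian_group G" "abelian_group H" "additive_map G H h"
  shows "h \<zero>\<^bsub>G\<^esub> = \<zero>\<^bsub>H\<^esub>"
proof -
  interpret G: abelian_group G by fact
  interpret H: abelian_group H by fact
  have c: "h \<zero>\<^bsub>G\<^esub> \<in> carrier H" using assms(3) by (simp add: additive_map_closed)
  have "h \<zero>\<^bsub>G\<^esub> \<oplus>\<^bsub>H\<^esub> h \<zero>\<^bsub>G\<^esub> = h \<zero>\<^bsub>G\<^esub>"
    using additive_map_add[OF assms(3) G.zero_closed G.zero_closed] by simp
  then show ?thesis using c by (metis H.add.r_cancel_one')
qed

lemma additive_map_finsum: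
  assumes "abelian_group G" "abelian_group H" "additive_map G H h"
    and "\<And>i. i \<in> A \<Longrightarrow> f i \<in> carrier G"
  shows "h (\<Oplus>\<^bsub>G\<^esub>i \<in> A. f i) = (\<Oplus>\<^bsub>H\<^esub>i \<in> A. h (f i))"
proof -
  interpret G: abelian_group G by fact
  interpret H: abelian_group H by fact
  show ?thesis
  proof (cases "finite A")
    case True
    then show ?thesis using assms(4)
    proof (induction A rule: finite_induct)
      case empty
      then show ?case using additive_map_zero[OF assms(1-3)] by simp
    next
      case (insert x F)
      then show ?case
        using assms(3) by (simp add: Pi_def additive_map_add additive_map_closed)
    qed
  next
    case False
    then show ?thesis using additive_map_zero[OF assms(1-3)] by simp
  qed
qed

lemma additive_map_finsum_fun:
  assumes "abelian_group H" "\<And>i. i \<in> A \<Longrightarrow> additive_map G H (h i)"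
  shows "additive_map G H (\<lambda>x. \<Oplus>\<^bsub>H\<^esub>i \<in> A. h i x)"
proof -
  interpret H: abelian_group H by fact
  show ?thesis
  proof (rule additive_mapI)
    fix x assume "x \<in> carrier G"
    then show "(\<Oplus>\<^bsub>H\<^esub>i \<in> A. h i x) \<in> carrier H"
      using assms(2) by (intro H.finsum_closed) (auto intro: additive_map_closed)
  next
    fix x y assume xy: "x \<in> carrier G" "y \<in> carrier G"
    have "(\<Oplus>\<^bsub>H\<^esub>i \<in> A. h i (x \<oplus>\<^bsub>G\<^esub> y)) = (\<Oplus>\<^bsub>H\<^esub>i \<in> A. h i x \<oplus>\<^bsub>H\<^esub> h i y)"
      using xy assms(2)
      by (intro H.finsum_cong') (auto intro!: additive_map_add H.a_closed intro: additive_map_closed)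
    also have "\<dots> = (\<Oplus>\<^bsub>H\<^esub>i \<in> A. h i x) \<oplus>\<^bsub>H\<^esub> (\<Oplus>\<^bsub>H\<^esub>i \<in> A. h i y)"
      using xy assms(2) by (intro H.finsum_addf) (auto intro: additive_map_closed)
    finally show "(\<Oplus>\<^bsub>H\<^esub>i \<in> A. h i (x \<oplus>\<^bsub>G\<^esub> y)) =
      (\<Oplus>\<^bsub>H\<^esub>i \<in> A. h i x) \<oplus>\<^bsub>H\<^esub> (\<Oplus>\<^bsub>H\<^esub>i \<in> A. h i y)" .
  qed
qed

text \<open>One tensor product underlies several records (\<open>tensor_ab\<close>,
  \<open>tensor\<close>, \<open>tensor_K\<close>, \<open>MxM\<close>, the basic construction, the
  smash product) with different products and scalar actions. Only the three fields compared here
  enter \<open>finsum\<close> and \<open>tensor_lift\<close>, so results transfer between these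
  records.\<close>

definition same_add :: "('a, 'm) ring_scheme \<Rightarrow> ('a, 'n) ring_scheme \<Rightarrow> bool" where
  "same_add G H \<longleftrightarrow> carrier G = carrier H \<and> ring.zero G = ring.zero H \<and> ring.add G = ring.add H"

lemma same_add_sym: "same_add G H \<Longrightarrow> same_add H G"
  by (simp add: same_add_def)

lemma same_add_abelian_group:
  assumes "same_add G H" "abelian_group H"
  shows "abelian_group G"
proof -
  interpret H: abelian_group H by fact
  show ?thesis
    by (rule abelian_groupI) (use assms(1) in \<open>auto simp: same_add_def H.a_ac intro: H.l_neg\<close>)
qed

lemma same_add_finsum:
  assumes "same_add G H"
  shows "finsum G f A = finsum H f A"
  using assms by (simp add: finsum_def finprod_def same_add_def)

lemma same_add_tensor_lift:
  assumes "same_add G H"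
  shows "tensor_lift G = tensor_lift H"
proof -
  \<comment> \<open>Unfolded down to natural powers and inverses, an integer multiple reads nothing
    but carrier, zero and addition.\<close>
  have "add_pow G k x = add_pow H k x" for k :: int and x
    using assms by (simp add: add_pow_def same_add_def nat_pow_def int_pow_def m_inv_def Let_def)
  then show ?thesis
    by (simp add: tensor_lift_def same_add_finsum[OF assms] fun_eq_iff)
qed

lemma (in ring) additive_map_scale:
  "a \<in> carrier R \<Longrightarrow> additive_map R R (\<lambda>x. a \<otimes> x)" "a \<in> carrier R \<Longrightarrow> additive_map R R (\<lambda>x. x \<otimes> a)"
  by (simp_all add: additive_map_def r_distr l_distr)

section \<open>The universal property of tensor products\<close>

text \<open>This is the condition under which \<open>tensor_lift G f\<close> is independent of the
  representative picked by \<open>SOME\<close>. Nothing is imposed outside the carriers, so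
  unrestricted lambda terms can serve as integrands.\<close>

definition balanced_map ::
  "('s, 'u) ring_scheme \<Rightarrow> ('l, 's, 'a, 'm) bimodule_scheme \<Rightarrow> ('s, 'r, 'b, 'n) bimodule_scheme
    \<Rightarrow> ('g, 'v) ring_scheme \<Rightarrow> ('a \<Rightarrow> 'b \<Rightarrow> 'g) \<Rightarrow> bool" where
  "balanced_map S X Y G f \<longleftrightarrow>
    (\<forall>y \<in> carrier Y. additive_map X G (\<lambda>x. f x y)) \<and>
    (\<forall>x \<in> carrier X. additive_map Y G (f x)) \<and>
    (\<forall>x \<in> carrier X. \<forall>s \<in> carrier S. \<forall>y \<in> carrier Y. f (ract X x s) y = f x (lact Y s y))"

lemma balanced_mapI:
  assumes "\<And>x y. \<lbrakk>x \<in> carrier X; y \<in> carrier Y\<rbrakk> \<Longrightarrow> f x y \<in> carrier G"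
    and "\<And>x x' y. \<lbrakk>x \<in> carrier X; x' \<in> carrier X; y \<in> carrier Y\<rbrakk>
      \<Longrightarrow> f (x \<oplus>\<^bsub>X\<^esub> x') y = f x y \<oplus>\<^bsub>G\<^esub> f x' y"
    and "\<And>x y y'. \<lbrakk>x \<in> carrier X; y \<in> carrier Y; y' \<in> carrier Y\<rbrakk>
      \<Longrightarrow> f x (y \<oplus>\<^bsub>Y\<^esub> y') = f x y \<oplus>\<^bsub>G\<^esub> f x y'"
    and "\<And>x s y. \<lbrakk>x \<in> carrier X; s \<in> carrier S; y \<in> carrier Y\<rbrakk>
      \<Longrightarrow> f (ract X x s) y = f x (lact Y s y)"
  shows "balanced_map S X Y G f"
  using assms by (simp add: balanced_map_def additive_map_def)

lemma balanced_map_closed: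
  "\<lbrakk>balanced_map S X Y G f; x \<in> carrier X; y \<in> carrier Y\<rbrakk> \<Longrightarrow> f x y \<in> carrier G"
  by (simp add: balanced_map_def additive_map_def)

lemma balanced_map_comp:
  assumes "balanced_map S X Y G f" "additive_map G H h"
  shows "balanced_map S X Y H (\<lambda>x y. h (f x y))"
  using assms by (simp add: balanced_map_def additive_map_def)

text \<open>\<open>T\<close> is fixed only up to \<open>same_add\<close>, so one development covers
  all records built on the same quotient. Closure of the inner actions puts the balancing relators
  into the free abelian group.\<close>

locale tensor_space =
  fixes S :: "('s, 'u) ring_scheme" and X :: "('l, 's, 'a, 'm) bimodule_scheme"
    and Y :: "('s, 'r, 'b, 'n) bimodule_scheme" and T :: "(('a \<times> 'b \<Rightarrow>\<^sub>0 int) set, 'v) ring_scheme"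
  assumes abelian_X: "abelian_group X" and abelian_Y: "abelian_group Y"
    and ract_closed: "\<lbrakk>x \<in> carrier X; s \<in> carrier S\<rbrakk> \<Longrightarrow> ract X x s \<in> carrier X"
    and lact_closed: "\<lbrakk>s \<in> carrier S; y \<in> carrier Y\<rbrakk> \<Longrightarrow> lact Y s y \<in> carrier Y"
    and same_T: "same_add T (tensor_ab S X Y)"
begin

sublocale X: abelian_group X by (rule abelian_X)
sublocale Y: abelian_group Y by (rule abelian_Y)

abbreviation (input) "free_grp \<equiv> free_Abelian_group (carrier X \<times> carrier Y)"
abbreviation (input) "null_grp \<equiv> tensor_null S X Y"

lemma keys_add_frag:
  assumes "a \<in> Z" "b \<in> Z"
  shows "Poly_Mapping.keys (frag_of a + frag_of b) \<subseteq> Z"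
  by (rule order_trans[OF keys_add]) (use assms in \<open>simp add: keys_frag_of\<close>)

lemma keys_diff_frag:
  assumes "a \<in> Z" "Poly_Mapping.keys p \<subseteq> Z"
  shows "Poly_Mapping.keys (frag_of a - p) \<subseteq> Z"
  by (rule order_trans[OF keys_diff]) (use assms in \<open>simp add: keys_frag_of\<close>)

lemma tensor_rels_closed: "tensor_rels S X Y \<subseteq> carrier free_grp"
proof
  fix p assume "p \<in> tensor_rels S X Y"
  then show "p \<in> carrier free_grp"
    unfolding tensor_rels_def
    by (elim UnE CollectE exE conjE)
      (simp_all add: diff_diff_add keys_add_frag keys_diff_frag keys_frag_of ract_closed lact_closed)
qed

lemma subgroup_null: "subgroup null_grp free_grp"
  unfolding tensor_null_def
  by (rule group.generate_is_subgroup) (simp_all add: tensor_rels_closed)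

lemma normal_null: "normal null_grp free_grp"
  using abelian_free_Abelian_group subgroup_null by (rule comm_group.subgroup_imp_normal)

lemma comm_group_quotient: "comm_group (free_grp Mod null_grp)"
  using abelian_free_Abelian_group subgroup_null by (rule comm_group.abelian_FactGroup)

lemma carrier_T: "carrier T = carrier (free_grp Mod null_grp)"
  and zero_T: "\<zero>\<^bsub>T\<^esub> = \<one>\<^bsub>free_grp Mod null_grp\<^esub>"
  and add_T: "s \<oplus>\<^bsub>T\<^esub> t = s \<otimes>\<^bsub>free_grp Mod null_grp\<^esub> t"
  using same_T by (simp_all add: same_add_def tensor_ab_def Let_def)

lemma abelian_T: "abelian_group T"
proof -
  interpret Q: comm_group "free_grp Mod null_grp" by (rule comm_group_quotient)
  show ?thesis
    by (rule abelian_groupI)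
      (auto simp add: carrier_T zero_T add_T Q.m_assoc Q.m_comm Q.m_lcomm intro: Q.l_inv_ex
        simp del: mult_FactGroup one_FactGroup)
qed

sublocale T: abelian_group T by (rule abelian_T)

abbreviation (input) elem where "elem \<equiv> tensor_elem S X Y"

lemma coset_add:
  assumes "Poly_Mapping.keys p \<subseteq> carrier X \<times> carrier Y" "Poly_Mapping.keys q \<subseteq> carrier X \<times> carrier Y"
  shows "null_grp #>\<^bsub>free_grp\<^esub> (p + q) = (null_grp #>\<^bsub>free_grp\<^esub> p) \<oplus>\<^bsub>T\<^esub> (null_grp #>\<^bsub>free_grp\<^esub> q)"
  using hom_mult[OF normal.r_coset_hom_Mod[OF normal_null], of p q] assms
  by (simp add: add_T)

lemma coset_closed:
  "Poly_Mapping.keys p \<subseteq> carrier X \<times> carrier Y \<Longrightarrow> null_grp #>\<^bsub>free_grp\<^esub> p \<in> carrier T"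
  by (auto simp: carrier_T carrier_FactGroup)

lemma coset_uminus:
  assumes "Poly_Mapping.keys p \<subseteq> carrier X \<times> carrier Y"
  shows "null_grp #>\<^bsub>free_grp\<^esub> (- p) = \<ominus>\<^bsub>T\<^esub> (null_grp #>\<^bsub>free_grp\<^esub> p)"
proof -
  have "null_grp #>\<^bsub>free_grp\<^esub> (0 :: 'a \<times> 'b \<Rightarrow>\<^sub>0 int) = null_grp"
    using group.coset_mult_one[OF group_free_Abelian_group subgroup.subset[OF subgroup_null]] by simp
  then have "(null_grp #>\<^bsub>free_grp\<^esub> (- p)) \<oplus>\<^bsub>T\<^esub> (null_grp #>\<^bsub>free_grp\<^esub> p) = \<zero>\<^bsub>T\<^esub>"
    using coset_add[of "- p" p] assms by (simp add: zero_T keys_minus)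
  then show ?thesis
    using assms coset_closed[of p] coset_closed[of "- p"]
    by (intro T.minus_equality[symmetric]) (simp_all add: keys_minus)
qed

lemma coset_diff:
  assumes "Poly_Mapping.keys p \<subseteq> carrier X \<times> carrier Y" "Poly_Mapping.keys q \<subseteq> carrier X \<times> carrier Y"
  shows "null_grp #>\<^bsub>free_grp\<^esub> (p - q) = (null_grp #>\<^bsub>free_grp\<^esub> p) \<ominus>\<^bsub>T\<^esub> (null_grp #>\<^bsub>free_grp\<^esub> q)"
  using coset_add[of p "- q"] assms by (simp add: keys_minus coset_uminus T.minus_eq)

lemma elem_closed: "\<lbrakk>x \<in> carrier X; y \<in> carrier Y\<rbrakk> \<Longrightarrow> elem x y \<in> carrier T"
  unfolding tensor_elem_def by (rule coset_closed) (simp add: keys_frag_of)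

lemma coset_rels:
  assumes "p \<in> tensor_rels S X Y"
  shows "null_grp #>\<^bsub>free_grp\<^esub> p = \<zero>\<^bsub>T\<^esub>"
proof -
  have "p \<in> null_grp" unfolding tensor_null_def using assms by (rule generate.incl)
  then show ?thesis
    using group.coset_join2[OF group_free_Abelian_group _ subgroup_null]
      subgroup.subset[OF subgroup_null] by (auto simp: zero_T)
qed

lemma eq_if_diff_zero:
  assumes "\<zero>\<^bsub>T\<^esub> = s \<ominus>\<^bsub>T\<^esub> t" "s \<in> carrier T" "t \<in> carrier T"
  shows "s = t"
  using T.minus_equality[of s "\<ominus>\<^bsub>T\<^esub> t"] assms by (simp add: T.minus_eq)

lemma elem_add_left:
  assumes "x \<in> carrier X" "x' \<in> carrier X" "y \<in> carrier Y"
  shows "elem (x \<oplus>\<^bsub>X\<^esub> x') y = elem x y \<oplus>\<^bsub>T\<^esub> elem x' y"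
proof -
  \<comment> \<open>The relator is written with a sum subtracted instead of two successive
    differences, so that the rules for cosets of differences and sums apply.\<close>
  let ?p = "frag_of (x \<oplus>\<^bsub>X\<^esub> x', y) - (frag_of (x, y) + frag_of (x', y)) :: _ \<Rightarrow>\<^sub>0 int"
  have k: "Poly_Mapping.keys (frag_of (x, y) + frag_of (x', y) :: _ \<Rightarrow>\<^sub>0 int) \<subseteq> carrier X \<times> carrier Y"
    by (rule order_trans[OF keys_add]) (use assms in \<open>simp add: keys_frag_of\<close>)
  have "?p \<in> tensor_rels S X Y"
    unfolding tensor_rels_def diff_diff_add[symmetric] using assms by blast
  then have "\<zero>\<^bsub>T\<^esub> = elem (x \<oplus>\<^bsub>X\<^esub> x') y \<ominus>\<^bsub>T\<^esub> (elem x y \<oplus>\<^bsub>T\<^esub> elem x' y)"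
    using assms k coset_rels[of ?p] unfolding tensor_elem_def
    by (simp add: coset_diff coset_add keys_frag_of)
  then show ?thesis
    by (rule eq_if_diff_zero) (use assms in \<open>simp_all add: elem_closed ract_closed lact_closed\<close>)
qed

lemma elem_add_right:
  assumes "x \<in> carrier X" "y \<in> carrier Y" "y' \<in> carrier Y"
  shows "elem x (y \<oplus>\<^bsub>Y\<^esub> y') = elem x y \<oplus>\<^bsub>T\<^esub> elem x y'"
proof -
  let ?p = "frag_of (x, y \<oplus>\<^bsub>Y\<^esub> y') - (frag_of (x, y) + frag_of (x, y')) :: _ \<Rightarrow>\<^sub>0 int"
  have k: "Poly_Mapping.keys (frag_of (x, y) + frag_of (x, y') :: _ \<Rightarrow>\<^sub>0 int) \<subseteq> carrier X \<times> carrier Y"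
    by (rule order_trans[OF keys_add]) (use assms in \<open>simp add: keys_frag_of\<close>)
  have "?p \<in> tensor_rels S X Y"
    unfolding tensor_rels_def diff_diff_add[symmetric] using assms by blast
  then have "\<zero>\<^bsub>T\<^esub> = elem x (y \<oplus>\<^bsub>Y\<^esub> y') \<ominus>\<^bsub>T\<^esub> (elem x y \<oplus>\<^bsub>T\<^esub> elem x y')"
    using assms k coset_rels[of ?p] unfolding tensor_elem_def
    by (simp add: coset_diff coset_add keys_frag_of)
  then show ?thesis
    by (rule eq_if_diff_zero) (use assms in \<open>simp_all add: elem_closed ract_closed lact_closed\<close>)
qed

lemma elem_balanced:
  assumes "x \<in> carrier X" "s \<in> carrier S" "y \<in> carrier Y"
  shows "elem (ract X x s) y = elem x (lact Y s y)"
proof -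
  let ?p = "frag_of (ract X x s, y) - frag_of (x, lact Y s y) :: _ \<Rightarrow>\<^sub>0 int"
  have "?p \<in> tensor_rels S X Y" using assms by (auto simp: tensor_rels_def)
  then have "\<zero>\<^bsub>T\<^esub> = elem (ract X x s) y \<ominus>\<^bsub>T\<^esub> elem x (lact Y s y)"
    using assms coset_rels[of ?p] unfolding tensor_elem_def
    by (simp add: coset_diff keys_frag_of ract_closed lact_closed)
  then show ?thesis
    by (rule eq_if_diff_zero) (use assms in \<open>simp_all add: elem_closed ract_closed lact_closed\<close>)
qed

lemma balanced_map_elem: "balanced_map S X Y T elem"
  by (rule balanced_mapI) (simp_all add: elem_closed elem_add_left elem_add_right elem_balanced)

lemma elem_zero_left: "y \<in> carrier Y \<Longrightarrow> elem \<zero>\<^bsub>X\<^esub> y = \<zero>\<^bsub>T\<^esub>"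
  using balanced_map_elem abelian_X abelian_T
  by (intro additive_map_zero[where h = "\<lambda>x. elem x y"]) (auto simp: balanced_map_def)

lemma elem_uminus_left:
  assumes "x \<in> carrier X" "y \<in> carrier Y"
  shows "elem (\<ominus>\<^bsub>X\<^esub> x) y = \<ominus>\<^bsub>T\<^esub> elem x y"
proof -
  have "elem (\<ominus>\<^bsub>X\<^esub> x) y \<oplus>\<^bsub>T\<^esub> elem x y = \<zero>\<^bsub>T\<^esub>"
    using assms by (simp flip: elem_add_left add: X.l_neg elem_zero_left)
  then show ?thesis
    using assms by (intro T.minus_equality[symmetric]) (auto intro: elem_closed)
qed

text \<open>Pure tensors already account for zero and negatives, since 0 = 0 (x) 0 and -(x (x) y) =
  (-x) (x) y; closure under sums then reaches everything.\<close>

lemma tensor_induct [consumes 1, case_names elem add]: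
  assumes t: "t \<in> carrier T"
    and elem: "\<And>x y. \<lbrakk>x \<in> carrier X; y \<in> carrier Y\<rbrakk> \<Longrightarrow> P (elem x y)"
    and add: "\<And>s t. \<lbrakk>s \<in> carrier T; t \<in> carrier T; P s; P t\<rbrakk> \<Longrightarrow> P (s \<oplus>\<^bsub>T\<^esub> t)"
  shows "P t"
proof -
  obtain p where p: "Poly_Mapping.keys p \<subseteq> carrier X \<times> carrier Y" "t = null_grp #>\<^bsub>free_grp\<^esub> p"
    using t by (auto simp: carrier_T carrier_FactGroup)
  \<comment> \<open>Induction on the free abelian group has a difference step, whereas
    \<open>P\<close> is only known to be stable under sums. Carrying the negative along turns p - q
    into p + (-q).\<close>
  have "P (null_grp #>\<^bsub>free_grp\<^esub> p) \<and> P (\<ominus>\<^bsub>T\<^esub> (null_grp #>\<^bsub>free_grp\<^esub> p))"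
    using p(1)
  proof (induction p rule: free_Abelian_group_induct[consumes 1])
    case 1
    have z: "null_grp #>\<^bsub>free_grp\<^esub> 0 = \<zero>\<^bsub>T\<^esub>"
      using coset_diff[of 0 0] coset_closed[of 0] by (simp add: T.minus_eq T.r_neg)
    have "P \<zero>\<^bsub>T\<^esub>" using elem[OF X.zero_closed Y.zero_closed] by (simp add: elem_zero_left)
    moreover have "\<ominus>\<^bsub>T\<^esub> \<zero>\<^bsub>T\<^esub> = \<zero>\<^bsub>T\<^esub>" using coset_uminus[of 0] z by simp
    ultimately show ?case using z by metis
  next
    case (2 p q)
    have c: "null_grp #>\<^bsub>free_grp\<^esub> p \<in> carrier T" "null_grp #>\<^bsub>free_grp\<^esub> q \<in> carrier T"
      using 2(1,2) by (auto intro: coset_closed)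
    have "\<ominus>\<^bsub>T\<^esub> ((null_grp #>\<^bsub>free_grp\<^esub> p) \<ominus>\<^bsub>T\<^esub> (null_grp #>\<^bsub>free_grp\<^esub> q)) =
      \<ominus>\<^bsub>T\<^esub> (null_grp #>\<^bsub>free_grp\<^esub> p) \<oplus>\<^bsub>T\<^esub> (null_grp #>\<^bsub>free_grp\<^esub> q)"
      using c by (simp add: T.minus_eq T.minus_add)
    then show ?case
      using 2 c add by (simp add: coset_diff T.minus_eq)
  next
    case (3 z)
    then obtain x y where z: "z = (x, y)" "x \<in> carrier X" "y \<in> carrier Y" by auto
    have "P (elem x y)" using z(2,3) by (rule elem)
    moreover have "P (\<ominus>\<^bsub>T\<^esub> elem x y)"
      using elem[of "\<ominus>\<^bsub>X\<^esub> x" y] z(2,3) by (simp add: elem_uminus_left)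
    ultimately show ?case using z(1) by (simp add: tensor_elem_def)
  qed
  then show ?thesis using p(2) by simp
qed

text \<open>Freeness extends f to a homomorphism h on formal sums. It kills the relators, hence the
  subgroup they generate, so it is constant on cosets, and \<open>tensor_lift\<close> is h computed
  at one representative.\<close>

lemma tensor_lift_universal:
  fixes G :: "('g, 'w) ring_scheme"
  assumes G: "abelian_group G" and f: "balanced_map S X Y G f"
  shows "additive_map T G (tensor_lift G f) \<and>
    (\<forall>x \<in> carrier X. \<forall>y \<in> carrier Y. tensor_lift G f (elem x y) = f x y)"
proof -
  interpret G: abelian_group G by fact
  have fc: "f x y \<in> carrier G" if "x \<in> carrier X" "y \<in> carrier Y" for x y
    using f that by (rule balanced_map_closed)
  have "(\<lambda>z. f (fst z) (snd z)) ` (carrier X \<times> carrier Y) \<subseteq> carrier (add_monoid G)"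
    using fc by auto
  from comm_group.free_Abelian_group_universal[OF G.a_comm_group this]
  obtain h where h: "h \<in> hom free_grp (add_monoid G)"
    and hf: "\<And>z. z \<in> carrier X \<times> carrier Y \<Longrightarrow> h (frag_of z) = f (fst z) (snd z)" by blast
  interpret h: group_hom free_grp "add_monoid G" h
    by (simp add: group_hom_def group_hom_axioms_def h G.a_group)
  have h_add: "h (p + q) = h p \<oplus>\<^bsub>G\<^esub> h q"
    if "Poly_Mapping.keys p \<subseteq> carrier X \<times> carrier Y" "Poly_Mapping.keys q \<subseteq> carrier X \<times> carrier Y" for p q
    using h.hom_mult[of p q] that by simp
  have h_minus: "h (- p) = \<ominus>\<^bsub>G\<^esub> h p"
    if "Poly_Mapping.keys p \<subseteq> carrier X \<times> carrier Y" for p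
    using h.hom_inv[of p] that by (simp add: a_inv_def)
  have h_diff: "h (p - q) = h p \<ominus>\<^bsub>G\<^esub> h q"
    if "Poly_Mapping.keys p \<subseteq> carrier X \<times> carrier Y" "Poly_Mapping.keys q \<subseteq> carrier X \<times> carrier Y" for p q
    using h_add[of p "- q"] h_minus[of q] that by (simp add: keys_minus G.minus_eq)
  have h_rels: "h p = \<zero>\<^bsub>G\<^esub>" if "p \<in> tensor_rels S X Y" for p
  proof -
    show ?thesis
      using that f unfolding tensor_rels_def
      by (elim UnE CollectE exE conjE)
        (auto simp: diff_diff_add h_diff h_add keys_add_frag keys_frag_of hf fc ract_closed lact_closed
          balanced_map_def additive_map_def G.minus_eq G.r_neg)
  qed
  have h_null: "h p = \<zero>\<^bsub>G\<^esub>" if "p \<in> null_grp" for p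
  proof -
    have "subgroup (kernel free_grp (add_monoid G) h) free_grp" by (rule h.subgroup_kernel)
    moreover have "tensor_rels S X Y \<subseteq> kernel free_grp (add_monoid G) h"
      using subsetD[OF tensor_rels_closed] h_rels unfolding kernel_def by simp blast
    ultimately have "null_grp \<subseteq> kernel free_grp (add_monoid G) h"
      unfolding tensor_null_def by (intro group.generate_subgroup_incl[OF group_free_Abelian_group])
    then show ?thesis using that by (auto simp: kernel_def)
  qed
  \<comment> \<open>The bound on the support is proved simultaneously because h is additive only on
    formal sums supported in the carriers.\<close>
  have h_sum: "h (\<Sum>z\<in>I. frag_cmul (c z) (frag_of z)) = (\<Oplus>\<^bsub>G\<^esub>z \<in> I. add_pow G (c z) (f (fst z) (snd z)))
      \<and> Poly_Mapping.keys (\<Sum>z\<in>I. frag_cmul (c z) (frag_of z)) \<subseteq> carrier X \<times> carrier Y"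
    if "finite I" "I \<subseteq> carrier X \<times> carrier Y" for I and c :: "'a \<times> 'b \<Rightarrow> int"
    using that
  proof (induction I rule: finite_induct)
    case empty
    then show ?case using h.hom_one by simp
  next
    case (insert z I)
    have kz: "Poly_Mapping.keys (frag_cmul (c z) (frag_of z)) \<subseteq> carrier X \<times> carrier Y"
      using insert.prems by (auto intro!: order_trans[OF keys_cmul] simp: keys_frag_of)
    have "h (frag_cmul (c z) (frag_of z)) = add_pow G (c z) (f (fst z) (snd z))"
      using h.hom_int_pow[of "frag_of z" "c z"] insert.prems
      by (simp add: keys_frag_of hf add_pow_def int_pow_free_Abelian_group)
    moreover have "(\<Oplus>\<^bsub>G\<^esub>z \<in> insert z I. add_pow G (c z) (f (fst z) (snd z))) =
        add_pow G (c z) (f (fst z) (snd z)) \<oplus>\<^bsub>G\<^esub> (\<Oplus>\<^bsub>G\<^esub>z \<in> I. add_pow G (c z) (f (fst z) (snd z)))"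
      using insert fc by (intro G.finsum_insert Pi_I G.add.int_pow_closed) auto
    moreover have "Poly_Mapping.keys (frag_cmul (c z) (frag_of z) + (\<Sum>z\<in>I. frag_cmul (c z) (frag_of z)))
        \<subseteq> carrier X \<times> carrier Y"
      using insert kz by (intro order_trans[OF keys_add]) auto
    ultimately show ?case
      using insert kz by (simp add: h_add)
  qed
  have lift: "tensor_lift G f t = h p"
    if p: "Poly_Mapping.keys p \<subseteq> carrier X \<times> carrier Y" and t: "t = null_grp #>\<^bsub>free_grp\<^esub> p" for t p
  proof -
    \<comment> \<open>This is the representative chosen inside \<open>tensor_lift\<close>; it
      differs from p by an element of the null subgroup, where h vanishes.\<close>
    define q where "q = (SOME q. q \<in> t)"
    have "p \<in> t"
      unfolding t using p subgroup_null
      by (intro group.rcos_self[OF group_free_Abelian_group]) simp_all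
    then have "q \<in> t" unfolding q_def by (rule someI)
    then obtain u where u: "u \<in> null_grp" "q = u + p"
      unfolding t r_coset_def by auto
    have ku: "Poly_Mapping.keys u \<subseteq> carrier X \<times> carrier Y"
      using subsetD[OF subgroup.subset[OF subgroup_null] u(1)] by simp
    then have kq: "Poly_Mapping.keys q \<subseteq> carrier X \<times> carrier Y"
      unfolding u(2) using p by (intro order_trans[OF keys_add]) auto
    have "h q = h p"
      using u ku p h_add[of u p] h_null[of u] h.hom_closed[of p] by simp
    moreover have "h q = tensor_lift G f t"
    proof -
      have "q = (\<Sum>z\<in>Poly_Mapping.keys q. frag_cmul (Poly_Mapping.lookup q z) (frag_of z))"
        by (subst (1) frag_expansion) (simp add: frag_extend_def)
      then show ?thesis
        using h_sum[OF finite_keys kq, of "Poly_Mapping.lookup q"]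
        by (simp add: tensor_lift_def q_def Let_def)
    qed
    ultimately show ?thesis by simp
  qed
  show ?thesis
  proof (intro conjI ballI additive_mapI)
    fix t assume "t \<in> carrier T"
    then obtain p where p: "Poly_Mapping.keys p \<subseteq> carrier X \<times> carrier Y" "t = null_grp #>\<^bsub>free_grp\<^esub> p"
      by (auto simp: carrier_T carrier_FactGroup)
    then show "tensor_lift G f t \<in> carrier G"
      using lift h.hom_closed[of p] by simp
  next
    fix s t assume "s \<in> carrier T" "t \<in> carrier T"
    then obtain p q where p: "Poly_Mapping.keys p \<subseteq> carrier X \<times> carrier Y" "s = null_grp #>\<^bsub>free_grp\<^esub> p"
      and q: "Poly_Mapping.keys q \<subseteq> carrier X \<times> carrier Y" "t = null_grp #>\<^bsub>free_grp\<^esub> q"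
      by (auto simp: carrier_T carrier_FactGroup)
    have "Poly_Mapping.keys (p + q) \<subseteq> carrier X \<times> carrier Y"
      using p q by (intro order_trans[OF keys_add]) auto
    then show "tensor_lift G f (s \<oplus>\<^bsub>T\<^esub> t) = tensor_lift G f s \<oplus>\<^bsub>G\<^esub> tensor_lift G f t"
      using lift[OF p] lift[OF q] lift[of "p + q"] p q by (simp add: h_add coset_add)
  next
    fix x y assume "x \<in> carrier X" "y \<in> carrier Y"
    then show "tensor_lift G f (elem x y) = f x y"
      using lift[of "frag_of (x, y)"] by (simp add: tensor_elem_def keys_frag_of hf)
  qed
qed

lemma additive_map_lift:
  "\<lbrakk>abelian_group G; balanced_map S X Y G f\<rbrakk> \<Longrightarrow> additive_map T G (tensor_lift G f)"
  using tensor_lift_universal by blast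

lemma lift_elem:
  "\<lbrakk>abelian_group G; balanced_map S X Y G f; x \<in> carrier X; y \<in> carrier Y\<rbrakk>
    \<Longrightarrow> tensor_lift G f (elem x y) = f x y"
  using tensor_lift_universal by blast

lemma lift_closed:
  "\<lbrakk>abelian_group G; balanced_map S X Y G f; t \<in> carrier T\<rbrakk> \<Longrightarrow> tensor_lift G f t \<in> carrier G"
  by (rule additive_map_closed[OF additive_map_lift])

lemma lift_add:
  "\<lbrakk>abelian_group G; balanced_map S X Y G f; s \<in> carrier T; t \<in> carrier T\<rbrakk>
    \<Longrightarrow> tensor_lift G f (s \<oplus>\<^bsub>T\<^esub> t) = tensor_lift G f s \<oplus>\<^bsub>G\<^esub> tensor_lift G f t"
  by (rule additive_map_add[OF additive_map_lift])

lemma lift_finsum: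
  assumes "abelian_group G" "balanced_map S X Y G f" "\<And>i. i \<in> I \<Longrightarrow> t i \<in> carrier T"
  shows "tensor_lift G f (\<Oplus>\<^bsub>T\<^esub>i \<in> I. t i) = (\<Oplus>\<^bsub>G\<^esub>i \<in> I. tensor_lift G f (t i))"
  using abelian_T assms(1) additive_map_lift[OF assms(1,2)] assms(3) by (rule additive_map_finsum)

text \<open>The standard way to prove a Sweedler identity here: show that both sides are additive in
  the tensor, then compute on x (x) y.\<close>

lemma additive_map_eqI:
  assumes "additive_map T G g" "additive_map T G h" "t \<in> carrier T"
    and "\<And>x y. \<lbrakk>x \<in> carrier X; y \<in> carrier Y\<rbrakk> \<Longrightarrow> g (elem x y) = h (elem x y)"
  shows "g t = h t"
  using assms(3) by (induction rule: tensor_induct) (simp_all add: assms(4) additive_map_add[OF assms(1)] additive_map_add[OF assms(2)])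

text \<open>An additive map moves inside a Sweedler sum, since both sides are additive in t and
  agree on pure tensors.\<close>

lemma lift_comp:
  assumes "abelian_group G" "abelian_group H" "balanced_map S X Y G f" "additive_map G H h"
    and "t \<in> carrier T"
  shows "h (tensor_lift G f t) = tensor_lift H (\<lambda>x y. h (f x y)) t"
proof -
  have hf: "balanced_map S X Y H (\<lambda>x y. h (f x y))"
    using assms(3,4) by (rule balanced_map_comp)
  show ?thesis
  proof (rule additive_map_eqI[OF _ _ assms(5)])
    show "additive_map T H (\<lambda>t. h (tensor_lift G f t))"
      using additive_map_lift[OF assms(1,3)] assms(4) by (rule additive_map_comp)
    show "additive_map T H (tensor_lift H (\<lambda>x y. h (f x y)))"
      using assms(2) hf by (rule additive_map_lift)
  qed (simp add: lift_elem[OF assms(1,3)] lift_elem[OF assms(2) hf])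
qed

text \<open>Both lifts use the same chosen representative, and its keys lie in the carriers, so the
  two finite sums agree term by term. Integrands can thus be rewritten before their balancedness has
  been discussed.\<close>

lemma lift_cong:
  assumes G: "abelian_group G" and t: "t \<in> carrier T"
    and fg: "\<And>x y. \<lbrakk>x \<in> carrier X; y \<in> carrier Y\<rbrakk> \<Longrightarrow> f x y = g x y"
    and g: "\<And>x y. \<lbrakk>x \<in> carrier X; y \<in> carrier Y\<rbrakk> \<Longrightarrow> g x y \<in> carrier G"
  shows "tensor_lift G f t = tensor_lift G g t"
proof -
  interpret G: abelian_group G by fact
  obtain p where p: "Poly_Mapping.keys p \<subseteq> carrier X \<times> carrier Y" "t = null_grp #>\<^bsub>free_grp\<^esub> p"
    using t by (auto simp: carrier_T carrier_FactGroup)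
  define q where "q = (SOME q. q \<in> t)"
  have "p \<in> t"
    unfolding p(2) using p(1) subgroup_null
    by (intro group.rcos_self[OF group_free_Abelian_group]) simp_all
  then have "q \<in> t" unfolding q_def by (rule someI)
  then obtain u where u: "u \<in> null_grp" "q = u + p"
    unfolding p(2) r_coset_def by auto
  have "Poly_Mapping.keys u \<subseteq> carrier X \<times> carrier Y"
    using subsetD[OF subgroup.subset[OF subgroup_null] u(1)] by simp
  then have "Poly_Mapping.keys q \<subseteq> carrier X \<times> carrier Y"
    unfolding u(2) using p(1) by (intro order_trans[OF keys_add]) auto
  then show ?thesis
    unfolding tensor_lift_def Let_def q_def[symmetric]
    by (intro G.finsum_cong') (use fg g in auto)
qed

lemma balanced_map_cong:
  assumes "balanced_map S X Y G g"
    and "\<And>x y. \<lbrakk>x \<in> carrier X; y \<in> carrier Y\<rbrakk> \<Longrightarrow> f x y = g x y"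
  shows "balanced_map S X Y G f"
  using assms(1) unfolding balanced_map_def additive_map_def
  by (auto simp: assms(2) ract_closed lact_closed)

lemma balanced_map_finsum:
  assumes "abelian_group G" "\<And>i. i \<in> I \<Longrightarrow> balanced_map S X Y G (f i)"
  shows "balanced_map S X Y G (\<lambda>x y. \<Oplus>\<^bsub>G\<^esub>i \<in> I. f i x y)"
proof -
  interpret G: abelian_group G by fact
  have "(\<Oplus>\<^bsub>G\<^esub>i \<in> I. f i (ract X x s) y) = (\<Oplus>\<^bsub>G\<^esub>i \<in> I. f i x (lact Y s y))"
    if "x \<in> carrier X" "s \<in> carrier S" "y \<in> carrier Y" for x s y
    using that assms(2)
    by (intro G.finsum_cong') (auto simp: balanced_map_def additive_map_def lact_closed)
  then show ?thesis
    using assms by (auto simp: balanced_map_def intro!: additive_map_finsum_fun)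
qed

lemma lift_finsum_fun:
  assumes "abelian_group G" "\<And>i. i \<in> I \<Longrightarrow> balanced_map S X Y G (f i)" "t \<in> carrier T"
  shows "tensor_lift G (\<lambda>x y. \<Oplus>\<^bsub>G\<^esub>i \<in> I. f i x y) t = (\<Oplus>\<^bsub>G\<^esub>i \<in> I. tensor_lift G (f i) t)"
proof (rule additive_map_eqI[OF _ _ assms(3)])
  interpret G: abelian_group G by fact
  show "additive_map T G (tensor_lift G (\<lambda>x y. \<Oplus>\<^bsub>G\<^esub>i \<in> I. f i x y))"
    using assms(1,2) by (intro additive_map_lift balanced_map_finsum)
  show "additive_map T G (\<lambda>t. \<Oplus>\<^bsub>G\<^esub>i \<in> I. tensor_lift G (f i) t)"
    using assms(1,2) by (intro additive_map_finsum_fun additive_map_lift)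
  fix x y assume xy: "x \<in> carrier X" "y \<in> carrier Y"
  have "tensor_lift G (\<lambda>x y. \<Oplus>\<^bsub>G\<^esub>i \<in> I. f i x y) (elem x y) = (\<Oplus>\<^bsub>G\<^esub>i \<in> I. f i x y)"
    by (rule lift_elem[OF assms(1) balanced_map_finsum[OF assms(1)] xy]) (rule assms(2))
  also have "\<dots> = (\<Oplus>\<^bsub>G\<^esub>i \<in> I. tensor_lift G (f i) (elem x y))"
    using xy balanced_map_closed[OF assms(2)]
    by (intro G.finsum_cong') (simp_all add: lift_elem[OF assms(1,2)] Pi_def)
  finally show "tensor_lift G (\<lambda>x y. \<Oplus>\<^bsub>G\<^esub>i \<in> I. f i x y) (elem x y) =
    (\<Oplus>\<^bsub>G\<^esub>i \<in> I. tensor_lift G (f i) (elem x y))" .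
qed

end

context tensor_space
begin

text \<open>For a pure tensor the claim is the hypothesis on f, and it survives sums of tensors
  because a sum of additive maps is additive.\<close>

lemma additive_map_lift_param:
  assumes "abelian_group G" "t \<in> carrier T"
    and bal: "\<And>p. p \<in> carrier P \<Longrightarrow> balanced_map S X Y G (f p)"
    and add: "\<And>x y. \<lbrakk>x \<in> carrier X; y \<in> carrier Y\<rbrakk> \<Longrightarrow> additive_map P G (\<lambda>p. f p x y)"
    and P: "abelian_group P"
  shows "additive_map P G (\<lambda>p. tensor_lift G (f p) t)"
proof -
  interpret G: abelian_group G by fact
  interpret P: abelian_group P by fact
  show ?thesis
    using assms(2)
  proof (induction rule: tensor_induct)
    case (elem x y)
    then show ?case
      using add[of x y] bal by (simp add: additive_map_def lift_elem[OF assms(1)])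
  next
    case (add s t)
    have "additive_map P G (\<lambda>p. tensor_lift G (f p) s \<oplus>\<^bsub>G\<^esub> tensor_lift G (f p) t)"
      using assms(1) add(3,4) by (rule additive_map_sum)
    then show ?case
      using add(1,2) bal by (simp add: additive_map_def lift_add[OF assms(1)])
  qed
qed

lemma lift_param_eq:
  assumes "abelian_group G" "t \<in> carrier T"
    and "balanced_map S X Y G f" "balanced_map S X Y G g"
    and "\<And>x y. \<lbrakk>x \<in> carrier X; y \<in> carrier Y\<rbrakk> \<Longrightarrow> f x y = g x y"
  shows "tensor_lift G f t = tensor_lift G g t"
  using assms by (intro lift_cong) (auto intro: balanced_map_closed[of S X Y])

text \<open>Makes nested lifts legitimate: the value of an inner lift, as a function of the outer
  variables, is again an admissible integrand.\<close>

lemma balanced_map_lift_param: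
  assumes G: "abelian_group G" and t: "t \<in> carrier T"
    and X': "abelian_group X'" and Y': "abelian_group Y'"
    and "\<And>x s. \<lbrakk>x \<in> carrier X'; s \<in> carrier S'\<rbrakk> \<Longrightarrow> ract X' x s \<in> carrier X'"
    and "\<And>s y. \<lbrakk>s \<in> carrier S'; y \<in> carrier Y'\<rbrakk> \<Longrightarrow> lact Y' s y \<in> carrier Y'"
    and bal: "\<And>x' y'. \<lbrakk>x' \<in> carrier X'; y' \<in> carrier Y'\<rbrakk> \<Longrightarrow> balanced_map S X Y G (f x' y')"
    and bal': "\<And>x y. \<lbrakk>x \<in> carrier X; y \<in> carrier Y\<rbrakk> \<Longrightarrow> balanced_map S' X' Y' G (\<lambda>x' y'. f x' y' x y)"
  shows "balanced_map S' X' Y' G (\<lambda>x' y'. tensor_lift G (f x' y') t)"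
proof -
  have "tensor_lift G (f (ract X' x s) y) t = tensor_lift G (f x (lact Y' s y)) t"
    if "x \<in> carrier X'" "s \<in> carrier S'" "y \<in> carrier Y'" for x s y
    using that assms by (intro lift_param_eq) (auto simp: balanced_map_def)
  moreover have "additive_map X' G (\<lambda>x'. tensor_lift G (f x' y') t)" if "y' \<in> carrier Y'" for y'
    using that bal bal' X' by (intro additive_map_lift_param[OF G t]) (auto simp: balanced_map_def)
  moreover have "additive_map Y' G (\<lambda>y'. tensor_lift G (f x' y') t)" if "x' \<in> carrier X'" for x'
    using that bal bal' Y' by (intro additive_map_lift_param[OF G t]) (auto simp: balanced_map_def)
  ultimately show ?thesis by (simp add: balanced_map_def)
qed

end

section \<open>Tensor products of modules over a commutative ring\<close>

lemma symmetric_bimodule_simps [simp]: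
  "carrier (symmetric_bimodule X) = carrier X" "\<zero>\<^bsub>symmetric_bimodule X\<^esub> = \<zero>\<^bsub>X\<^esub>"
  "x \<oplus>\<^bsub>symmetric_bimodule X\<^esub> y = x \<oplus>\<^bsub>X\<^esub> y"
  "lact (symmetric_bimodule X) k x = k \<odot>\<^bsub>X\<^esub> x" "ract (symmetric_bimodule X) x k = k \<odot>\<^bsub>X\<^esub> x"
  by (simp_all add: symmetric_bimodule_def)

lemma additive_map_symmetric_bimodule [simp]:
  "additive_map (symmetric_bimodule X) G h = additive_map X G h"
  by (simp add: additive_map_def)

lemma same_add_symmetric_bimodule: "same_add (symmetric_bimodule X) X"
  by (simp add: same_add_def symmetric_bimodule_def)

abbreviation balanced_K ::
  "('k, 'u) ring_scheme \<Rightarrow> ('k, 'a, 'm) module_scheme \<Rightarrow> ('k, 'b, 'n) module_scheme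
    \<Rightarrow> ('g, 'v) ring_scheme \<Rightarrow> ('a \<Rightarrow> 'b \<Rightarrow> 'g) \<Rightarrow> bool" where
  "balanced_K K X Y \<equiv> balanced_map K (symmetric_bimodule X) (symmetric_bimodule Y)"

locale tensor_modules = X: module K X + Y: module K Y for K X Y
begin

sublocale tensor: tensor_space K "symmetric_bimodule X" "symmetric_bimodule Y" "tensor_K K X Y"
proof (rule tensor_space.intro)
  show "abelian_group (symmetric_bimodule X)" "abelian_group (symmetric_bimodule Y)"
    using same_add_abelian_group[OF same_add_symmetric_bimodule] X.abelian_group_axioms
      Y.abelian_group_axioms by blast+
  show "same_add (tensor_K K X Y) (tensor_ab K (symmetric_bimodule X) (symmetric_bimodule Y))"
    by (simp add: same_add_def tensor_K_def tensor_def Let_def)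
qed simp_all

lemma same_add_tensor_K:
  "same_add (tensor_K K X Y) (tensor K (symmetric_bimodule X) (symmetric_bimodule Y))"
  by (simp add: same_add_def tensor_K_def Let_def)

lemma same_add_tensor_ab:
  "same_add (tensor_ab K (symmetric_bimodule X) (symmetric_bimodule Y)) (tensor_K K X Y)"
  by (simp add: same_add_def tensor_K_def tensor_def Let_def)

lemmas elem_closed = tensor.elem_closed[folded elem_K_def, simplified]
  and elem_add_left = tensor.elem_add_left[folded elem_K_def, simplified]
  and elem_add_right = tensor.elem_add_right[folded elem_K_def, simplified]
  and elem_balanced = tensor.elem_balanced[folded elem_K_def, simplified]
  and lift_elem = tensor.lift_elem[folded elem_K_def, simplified]
  and tensor_induct = tensor.tensor_induct[folded elem_K_def, simplified, consumes 1, case_names elem add]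
  and additive_map_eqI = tensor.additive_map_eqI[folded elem_K_def, simplified]
  and lift_cong = tensor.lift_cong[simplified]

lemma smult_tensor_K:
  "k \<odot>\<^bsub>tensor_K K X Y\<^esub> t = tensor_lift (tensor_K K X Y) (\<lambda>x y. elem_K K X Y (k \<odot>\<^bsub>X\<^esub> x) y) t"
  unfolding elem_K_def
  by (simp add: tensor_K_def tensor_def Let_def)
    (subst same_add_tensor_lift[OF same_add_tensor_ab], simp add: tensor_K_def tensor_def Let_def)

lemma balanced_smult:
  assumes "k \<in> carrier K"
  shows "balanced_K K X Y (tensor_K K X Y) (\<lambda>x y. elem_K K X Y (k \<odot>\<^bsub>X\<^esub> x) y)"
  by (rule balanced_mapI)
    (use assms in \<open>simp_all add: elem_closed elem_add_left elem_add_right elem_balanced X.smult_r_distr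
      X.smult_assoc1[symmetric] X.R.m_comm flip: elem_balanced\<close>)

lemma smult_elem:
  "\<lbrakk>k \<in> carrier K; x \<in> carrier X; y \<in> carrier Y\<rbrakk>
    \<Longrightarrow> k \<odot>\<^bsub>tensor_K K X Y\<^esub> elem_K K X Y x y = elem_K K X Y (k \<odot>\<^bsub>X\<^esub> x) y"
  by (simp add: smult_tensor_K lift_elem[OF tensor.abelian_T balanced_smult])

lemma additive_smult:
  "k \<in> carrier K \<Longrightarrow> additive_map (tensor_K K X Y) (tensor_K K X Y) (\<lambda>t. k \<odot>\<^bsub>tensor_K K X Y\<^esub> t)"
  unfolding smult_tensor_K by (rule tensor.additive_map_lift[OF tensor.abelian_T balanced_smult])

lemma module_tensor_K: "module K (tensor_K K X Y)"
proof (rule moduleI)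
  show "cring K" "abelian_group (tensor_K K X Y)" by (rule X.R.cring_axioms tensor.abelian_T)+
  note add = additive_map_add[OF additive_smult] and closed = additive_map_closed[OF additive_smult]
  show "k \<odot>\<^bsub>tensor_K K X Y\<^esub> t \<in> carrier (tensor_K K X Y)"
    if "k \<in> carrier K" "t \<in> carrier (tensor_K K X Y)" for k t
    using that by (rule closed)
  show "k \<odot>\<^bsub>tensor_K K X Y\<^esub> (s \<oplus>\<^bsub>tensor_K K X Y\<^esub> t) =
      k \<odot>\<^bsub>tensor_K K X Y\<^esub> s \<oplus>\<^bsub>tensor_K K X Y\<^esub> k \<odot>\<^bsub>tensor_K K X Y\<^esub> t"
    if "k \<in> carrier K" "s \<in> carrier (tensor_K K X Y)" "t \<in> carrier (tensor_K K X Y)" for k s t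
    using that by (rule add)
  show "(k \<oplus>\<^bsub>K\<^esub> l) \<odot>\<^bsub>tensor_K K X Y\<^esub> t = k \<odot>\<^bsub>tensor_K K X Y\<^esub> t \<oplus>\<^bsub>tensor_K K X Y\<^esub> l \<odot>\<^bsub>tensor_K K X Y\<^esub> t"
    if kl: "k \<in> carrier K" "l \<in> carrier K" and t: "t \<in> carrier (tensor_K K X Y)" for k l t
    using t
    by (rule additive_map_eqI[where G = "tensor_K K X Y", rotated 2])
      (use kl in \<open>simp_all add: additive_smult additive_map_sum tensor.abelian_T smult_elem X.smult_l_distr
        elem_add_left\<close>)
  show "(k \<otimes>\<^bsub>K\<^esub> l) \<odot>\<^bsub>tensor_K K X Y\<^esub> t = k \<odot>\<^bsub>tensor_K K X Y\<^esub> (l \<odot>\<^bsub>tensor_K K X Y\<^esub> t)"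
    if kl: "k \<in> carrier K" "l \<in> carrier K" and t: "t \<in> carrier (tensor_K K X Y)" for k l t
    using t
    by (rule additive_map_eqI[where G = "tensor_K K X Y", rotated 2])
      (use kl in \<open>simp_all add: additive_smult additive_map_comp[OF additive_smult additive_smult]
        smult_elem X.smult_assoc1\<close>)
  show "\<one>\<^bsub>K\<^esub> \<odot>\<^bsub>tensor_K K X Y\<^esub> t = t" if t: "t \<in> carrier (tensor_K K X Y)" for t
    using t
    by (rule additive_map_eqI[where G = "tensor_K K X Y", rotated 2])
      (simp_all add: additive_smult additive_map_def[of _ _ "\<lambda>x. x"] smult_elem)
qed

lemma balanced_KI:
  assumes "\<And>x y. \<lbrakk>x \<in> carrier X; y \<in> carrier Y\<rbrakk> \<Longrightarrow> f x y \<in> carrier G"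
    and "\<And>x x' y. \<lbrakk>x \<in> carrier X; x' \<in> carrier X; y \<in> carrier Y\<rbrakk>
      \<Longrightarrow> f (x \<oplus>\<^bsub>X\<^esub> x') y = f x y \<oplus>\<^bsub>G\<^esub> f x' y"
    and "\<And>x y y'. \<lbrakk>x \<in> carrier X; y \<in> carrier Y; y' \<in> carrier Y\<rbrakk>
      \<Longrightarrow> f x (y \<oplus>\<^bsub>Y\<^esub> y') = f x y \<oplus>\<^bsub>G\<^esub> f x y'"
    and "\<And>k x y. \<lbrakk>k \<in> carrier K; x \<in> carrier X; y \<in> carrier Y\<rbrakk>
      \<Longrightarrow> f (k \<odot>\<^bsub>X\<^esub> x) y = f x (k \<odot>\<^bsub>Y\<^esub> y)"
  shows "balanced_K K X Y G f"
  using assms by (intro balanced_mapI) simp_all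

text \<open>A dual basis e_i, f_i of the first factor gives x (x) y = sum_i e_i (x) f_i(x) y by
  moving scalars across the tensor sign. Over a commutative ring this replaces coordinates with
  respect to a basis.\<close>

lemma tensor_expand:
  assumes I: "finite I"
    and x: "\<And>i. i \<in> I \<Longrightarrow> e i \<in> carrier X"
    and f: "\<And>i. i \<in> I \<Longrightarrow> additive_map X K (f i)"
    and f_smult: "\<And>i k x. \<lbrakk>i \<in> I; k \<in> carrier K; x \<in> carrier X\<rbrakk> \<Longrightarrow> f i (k \<odot>\<^bsub>X\<^esub> x) = k \<otimes>\<^bsub>K\<^esub> f i x"
    and basis: "\<And>x. x \<in> carrier X \<Longrightarrow> (\<Oplus>\<^bsub>X\<^esub>i \<in> I. f i x \<odot>\<^bsub>X\<^esub> e i) = x"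
    and t: "t \<in> carrier (tensor_K K X Y)"
  shows "(\<Oplus>\<^bsub>tensor_K K X Y\<^esub>i \<in> I. elem_K K X Y (e i) (tensor_lift Y (\<lambda>x y. f i x \<odot>\<^bsub>Y\<^esub> y) t)) = t"
proof -
  have fc: "f i x \<in> carrier K" if "i \<in> I" "x \<in> carrier X" for i x
    using f that by (auto intro: additive_map_closed)
  have bal: "balanced_K K X Y Y (\<lambda>x y. f i x \<odot>\<^bsub>Y\<^esub> y)" if "i \<in> I" for i
    using that fc
    by (intro balanced_KI) (simp_all add: additive_map_add[OF f] Y.smult_l_distr Y.smult_r_distr f_smult
        Y.smult_assoc1[symmetric] X.R.m_comm)
  have addr: "additive_map Y (tensor_K K X Y) (elem_K K X Y x)" if "x \<in> carrier X" for x
    using that by (simp add: additive_map_def elem_closed elem_add_right)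
  have addl: "additive_map X (tensor_K K X Y) (\<lambda>x. elem_K K X Y x y)" if "y \<in> carrier Y" for y
    using that by (simp add: additive_map_def elem_closed elem_add_left)
  show ?thesis
    using _ _ t
  proof (rule additive_map_eqI)
    show "additive_map (tensor_K K X Y) (tensor_K K X Y)
      (\<lambda>t. \<Oplus>\<^bsub>tensor_K K X Y\<^esub>i \<in> I. elem_K K X Y (e i) (tensor_lift Y (\<lambda>x y. f i x \<odot>\<^bsub>Y\<^esub> y) t))"
      by (intro additive_map_finsum_fun tensor.abelian_T additive_map_comp[OF _ addr]
          tensor.additive_map_lift[OF Y.abelian_group_axioms]) (simp_all add: x bal)
    show "additive_map (tensor_K K X Y) (tensor_K K X Y) (\<lambda>t. t)"
      by (simp add: additive_map_def)
    fix a y assume ay: "a \<in> carrier X" "y \<in> carrier Y"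
    have "(\<Oplus>\<^bsub>tensor_K K X Y\<^esub>i \<in> I. elem_K K X Y (e i) (tensor_lift Y (\<lambda>x y. f i x \<odot>\<^bsub>Y\<^esub> y) (elem_K K X Y a y)))
      = (\<Oplus>\<^bsub>tensor_K K X Y\<^esub>i \<in> I. elem_K K X Y (f i a \<odot>\<^bsub>X\<^esub> e i) y)"
      using ay x fc
      by (intro tensor.T.finsum_cong')
        (auto simp: lift_elem[OF Y.abelian_group_axioms bal] elem_balanced elem_closed)
    also have "\<dots> = elem_K K X Y (\<Oplus>\<^bsub>X\<^esub>i \<in> I. f i a \<odot>\<^bsub>X\<^esub> e i) y"
      using ay x fc
      by (intro additive_map_finsum[OF X.abelian_group_axioms tensor.abelian_T addl, symmetric]) auto
    finally show "(\<Oplus>\<^bsub>tensor_K K X Y\<^esub>i \<in> I. elem_K K X Y (e i) (tensor_lift Y (\<lambda>x y. f i x \<odot>\<^bsub>Y\<^esub> y) (elem_K K X Y a y)))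
      = elem_K K X Y a y"
      using ay basis by simp
  qed
qed

end

context tensor_space
begin

text \<open>Two Sweedler sums over possibly different tensor products may be interchanged. After
  reduction to a pure t, the outer lift disappears on one side and the inner one on the
  other.\<close>

lemma lift_swap:
  fixes f :: "'a \<Rightarrow> 'b \<Rightarrow> 'c \<Rightarrow> 'd \<Rightarrow> 'g"
    and S' :: "('s2, 'u2) ring_scheme" and X' :: "('l2, 's2, 'c, 'm2) bimodule_scheme"
    and Y' :: "('s2, 'r2, 'd, 'n2) bimodule_scheme"
  assumes T': "tensor_space S' X' Y' T'" and G: "abelian_group G"
    and t: "t \<in> carrier T" and t': "t' \<in> carrier T'"
    and bal: "\<And>x' y'. \<lbrakk>x' \<in> carrier X'; y' \<in> carrier Y'\<rbrakk>
      \<Longrightarrow> balanced_map S X Y G (\<lambda>x y. f x y x' y')"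
    and bal': "\<And>x y. \<lbrakk>x \<in> carrier X; y \<in> carrier Y\<rbrakk> \<Longrightarrow> balanced_map S' X' Y' G (f x y)"
  shows "tensor_lift G (\<lambda>x y. tensor_lift G (f x y) t') t =
    tensor_lift G (\<lambda>x' y'. tensor_lift G (\<lambda>x y. f x y x' y') t) t'"
proof -
  interpret T': tensor_space S' X' Y' T' by fact
  have 1: "balanced_map S X Y G (\<lambda>x y. tensor_lift G (f x y) t')"
    by (rule T'.balanced_map_lift_param[OF G t' abelian_X abelian_Y])
      (simp_all add: bal bal' ract_closed lact_closed)
  have bal2: "balanced_map S' X' Y' G (\<lambda>x' y'. tensor_lift G (\<lambda>x y. f x y x' y') s)"
    if "s \<in> carrier T" for s
    by (rule balanced_map_lift_param[OF G that T'.abelian_X T'.abelian_Y])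
      (simp_all add: bal bal' T'.ract_closed T'.lact_closed)
  show ?thesis
  proof (rule additive_map_eqI[OF _ _ t])
    show "additive_map T G (tensor_lift G (\<lambda>x y. tensor_lift G (f x y) t'))"
      using G 1 by (rule additive_map_lift)
    show "additive_map T G (\<lambda>t. tensor_lift G (\<lambda>x' y'. tensor_lift G (\<lambda>x y. f x y x' y') t) t')"
      using G t' bal2 by (rule T'.additive_map_lift_param)
        (simp_all add: additive_map_lift[OF G] bal abelian_T)
    fix x y assume xy: "x \<in> carrier X" "y \<in> carrier Y"
    have "tensor_lift G (\<lambda>x' y'. tensor_lift G (\<lambda>x y. f x y x' y') (elem x y)) t' = tensor_lift G (f x y) t'"
      using xy bal balanced_map_closed[OF bal']
      by (intro T'.lift_cong[OF G t']) (simp_all add: lift_elem[OF G])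
    then show "tensor_lift G (\<lambda>x y. tensor_lift G (f x y) t') (elem x y) =
        tensor_lift G (\<lambda>x' y'. tensor_lift G (\<lambda>x y. f x y x' y') (elem x y)) t'"
      using lift_elem[OF G 1 xy] by simp
  qed
qed

end

locale tensor_algebras = X: assoc_algebra K X + Y: assoc_algebra K Y for K X Y
begin

sublocale tensor_modules K X Y ..

abbreviation (input) "XY \<equiv> tensor_K K X Y"

lemma balanced_mult_left:
  "\<lbrakk>x \<in> carrier X; y \<in> carrier Y; balanced_K K X Y G f\<rbrakk>
    \<Longrightarrow> balanced_K K X Y G (\<lambda>x' y'. f (x \<otimes>\<^bsub>X\<^esub> x') (y \<otimes>\<^bsub>Y\<^esub> y'))"
  by (simp add: balanced_map_def additive_map_def X.r_distr Y.r_distr X.smult_mult_right Y.smult_mult_right)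

lemma balanced_mult_right:
  "\<lbrakk>x \<in> carrier X; y \<in> carrier Y; balanced_K K X Y G f\<rbrakk>
    \<Longrightarrow> balanced_K K X Y G (\<lambda>x' y'. f (x' \<otimes>\<^bsub>X\<^esub> x) (y' \<otimes>\<^bsub>Y\<^esub> y))"
  by (simp add: balanced_map_def additive_map_def X.l_distr Y.l_distr X.smult_mult_left Y.smult_mult_left)

lemma balanced_elem: "balanced_K K X Y XY (elem_K K X Y)"
  unfolding elem_K_def by (rule tensor.balanced_map_elem)

lemma mult_tensor_K:
  "s \<otimes>\<^bsub>XY\<^esub> t = tensor_lift XY (\<lambda>x y. tensor_lift XY (\<lambda>x' y'.
      elem_K K X Y (x \<otimes>\<^bsub>X\<^esub> x') (y \<otimes>\<^bsub>Y\<^esub> y')) t) s"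
  by (subst (1) tensor_K_def)
    (simp add: Let_def same_add_tensor_lift[OF same_add_tensor_K])

lemma balanced_lift_mult:
  assumes "abelian_group G" "balanced_K K X Y G f" "t \<in> carrier XY"
  shows "balanced_K K X Y G (\<lambda>x y. tensor_lift G (\<lambda>x' y'. f (x \<otimes>\<^bsub>X\<^esub> x') (y \<otimes>\<^bsub>Y\<^esub> y')) t)"
  using assms(1,3)
  by (rule tensor.balanced_map_lift_param[OF _ _ tensor.abelian_X tensor.abelian_Y])
    (simp_all add: balanced_mult_left[OF _ _ assms(2)] balanced_mult_right[OF _ _ assms(2)])

lemma mult_tensor_closed:
  assumes "s \<in> carrier XY" "t \<in> carrier XY"
  shows "s \<otimes>\<^bsub>XY\<^esub> t \<in> carrier XY"
  unfolding mult_tensor_K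
  using assms by (intro tensor.lift_closed tensor.abelian_T balanced_lift_mult balanced_elem)

text \<open>The product in X (x) Y is itself a nested lift with integrand \<open>elem_K\<close>;
  pushing the lift of f through both layers replaces \<open>elem_K\<close> by f.\<close>

lemma lift_mult:
  assumes G: "abelian_group G" and f: "balanced_K K X Y G f"
    and s: "s \<in> carrier XY" and t: "t \<in> carrier XY"
  shows "tensor_lift G f (s \<otimes>\<^bsub>XY\<^esub> t) =
    tensor_lift G (\<lambda>x y. tensor_lift G (\<lambda>x' y'. f (x \<otimes>\<^bsub>X\<^esub> x') (y \<otimes>\<^bsub>Y\<^esub> y')) t) s"
proof -
  note add = tensor.additive_map_lift[OF G f]
  have "tensor_lift G f (s \<otimes>\<^bsub>XY\<^esub> t) = tensor_lift G (\<lambda>x y. tensor_lift G f (tensor_lift XY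
      (\<lambda>x' y'. elem_K K X Y (x \<otimes>\<^bsub>X\<^esub> x') (y \<otimes>\<^bsub>Y\<^esub> y')) t)) s"
    unfolding mult_tensor_K
    by (rule tensor.lift_comp[OF tensor.abelian_T G balanced_lift_mult[OF tensor.abelian_T balanced_elem t] add s])
  also have "\<dots> = tensor_lift G (\<lambda>x y. tensor_lift G (\<lambda>x' y'. f (x \<otimes>\<^bsub>X\<^esub> x') (y \<otimes>\<^bsub>Y\<^esub> y')) t) s"
  proof (rule lift_cong[OF G s])
    fix x y assume xy: "x \<in> carrier X" "y \<in> carrier Y"
    have "tensor_lift G f (tensor_lift XY (\<lambda>x' y'. elem_K K X Y (x \<otimes>\<^bsub>X\<^esub> x') (y \<otimes>\<^bsub>Y\<^esub> y')) t) =
      tensor_lift G (\<lambda>x' y'. tensor_lift G f (elem_K K X Y (x \<otimes>\<^bsub>X\<^esub> x') (y \<otimes>\<^bsub>Y\<^esub> y'))) t"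
      by (rule tensor.lift_comp[OF tensor.abelian_T G balanced_mult_left[OF xy balanced_elem] add t])
    also have "\<dots> = tensor_lift G (\<lambda>x' y'. f (x \<otimes>\<^bsub>X\<^esub> x') (y \<otimes>\<^bsub>Y\<^esub> y')) t"
      using xy by (intro lift_cong[OF G t])
        (simp_all add: lift_elem[OF G f] balanced_map_closed[OF f, simplified])
    finally show "tensor_lift G f (tensor_lift XY (\<lambda>x' y'. elem_K K X Y (x \<otimes>\<^bsub>X\<^esub> x') (y \<otimes>\<^bsub>Y\<^esub> y')) t) =
      tensor_lift G (\<lambda>x' y'. f (x \<otimes>\<^bsub>X\<^esub> x') (y \<otimes>\<^bsub>Y\<^esub> y')) t" .
    show "tensor_lift G (\<lambda>x' y'. f (x \<otimes>\<^bsub>X\<^esub> x') (y \<otimes>\<^bsub>Y\<^esub> y')) t \<in> carrier G"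
      by (rule tensor.lift_closed[OF G balanced_mult_left[OF xy f] t])
  qed
  finally show ?thesis .
qed

lemma one_tensor_K: "\<one>\<^bsub>XY\<^esub> = elem_K K X Y \<one>\<^bsub>X\<^esub> \<one>\<^bsub>Y\<^esub>"
  by (simp add: tensor_K_def Let_def)

end

section \<open>Dual pairs of bialgebras\<close>

text \<open>The list is equivalent to its mirror image under exchanging A, g with B, c. The
  coproducts are only required to be transposes of the multiplications; their linearity,
  coassociativity and counit laws are derived. \<open>pair_one_mult\<close>,
  \<open>pair_mult_one\<close> and \<open>pair_one_one\<close> encode that the counits are
  multiplicative and unital, and \<open>pair_mult_mult\<close> encodes multiplicativity of \<Delta>A
  tested against b (x) b'.\<close>

locale dual_pair = A: assoc_algebra K A + B: assoc_algebra K B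
  for K :: "('k, 'u) ring_scheme" and A :: "('k, 'a, 'v) module_scheme"
    and B :: "('k, 'b, 'w) module_scheme" +
  fixes pair :: "'b \<Rightarrow> 'a \<Rightarrow> 'k" and n :: nat and c :: "nat \<Rightarrow> 'b" and g :: "nat \<Rightarrow> 'a"
    and \<Delta>A :: "'a \<Rightarrow> ('a \<times> 'a \<Rightarrow>\<^sub>0 int) set" and \<epsilon>A :: "'a \<Rightarrow> 'k"
    and \<Delta>B :: "'b \<Rightarrow> ('b \<times> 'b \<Rightarrow>\<^sub>0 int) set" and \<epsilon>B :: "'b \<Rightarrow> 'k"
  assumes pair_additive_left: "a \<in> carrier A \<Longrightarrow> additive_map B K (\<lambda>b. pair b a)"
    and pair_additive_right: "b \<in> carrier B \<Longrightarrow> additive_map A K (pair b)"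
    and pair_smult_left: "\<lbrakk>k \<in> carrier K; b \<in> carrier B; a \<in> carrier A\<rbrakk>
      \<Longrightarrow> pair (k \<odot>\<^bsub>B\<^esub> b) a = k \<otimes>\<^bsub>K\<^esub> pair b a"
    and pair_smult_right: "\<lbrakk>k \<in> carrier K; b \<in> carrier B; a \<in> carrier A\<rbrakk>
      \<Longrightarrow> pair b (k \<odot>\<^bsub>A\<^esub> a) = k \<otimes>\<^bsub>K\<^esub> pair b a"
    and c_closed: "i < n \<Longrightarrow> c i \<in> carrier B" and g_closed: "i < n \<Longrightarrow> g i \<in> carrier A"
    and A_basis: "a \<in> carrier A \<Longrightarrow> (\<Oplus>\<^bsub>A\<^esub>i \<in> {..<n}. pair (c i) a \<odot>\<^bsub>A\<^esub> g i) = a"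
    and B_basis: "b \<in> carrier B \<Longrightarrow> (\<Oplus>\<^bsub>B\<^esub>i \<in> {..<n}. pair b (g i) \<odot>\<^bsub>B\<^esub> c i) = b"
    and \<Delta>A_closed: "a \<in> carrier A \<Longrightarrow> \<Delta>A a \<in> carrier (tensor_K K A A)"
    and \<Delta>B_closed: "b \<in> carrier B \<Longrightarrow> \<Delta>B b \<in> carrier (tensor_K K B B)"
    and pair_mult_left: "\<lbrakk>b \<in> carrier B; b' \<in> carrier B; a \<in> carrier A\<rbrakk>
      \<Longrightarrow> pair (b \<otimes>\<^bsub>B\<^esub> b') a = tensor_lift K (\<lambda>a1 a2. pair b a1 \<otimes>\<^bsub>K\<^esub> pair b' a2) (\<Delta>A a)"
    and pair_mult_right: "\<lbrakk>b \<in> carrier B; a \<in> carrier A; a' \<in> carrier A\<rbrakk>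
      \<Longrightarrow> pair b (a \<otimes>\<^bsub>A\<^esub> a') = tensor_lift K (\<lambda>b1 b2. pair b1 a \<otimes>\<^bsub>K\<^esub> pair b2 a') (\<Delta>B b)"
    and \<epsilon>A_eq: "a \<in> carrier A \<Longrightarrow> \<epsilon>A a = pair \<one>\<^bsub>B\<^esub> a"
    and \<epsilon>B_eq: "b \<in> carrier B \<Longrightarrow> \<epsilon>B b = pair b \<one>\<^bsub>A\<^esub>"
    and pair_one_mult: "\<lbrakk>a \<in> carrier A; a' \<in> carrier A\<rbrakk>
      \<Longrightarrow> pair \<one>\<^bsub>B\<^esub> (a \<otimes>\<^bsub>A\<^esub> a') = pair \<one>\<^bsub>B\<^esub> a \<otimes>\<^bsub>K\<^esub> pair \<one>\<^bsub>B\<^esub> a'"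
    and pair_mult_one: "\<lbrakk>b \<in> carrier B; b' \<in> carrier B\<rbrakk>
      \<Longrightarrow> pair (b \<otimes>\<^bsub>B\<^esub> b') \<one>\<^bsub>A\<^esub> = pair b \<one>\<^bsub>A\<^esub> \<otimes>\<^bsub>K\<^esub> pair b' \<one>\<^bsub>A\<^esub>"
    and pair_one_one: "pair \<one>\<^bsub>B\<^esub> \<one>\<^bsub>A\<^esub> = \<one>\<^bsub>K\<^esub>"
    and pair_mult_mult: "\<lbrakk>b \<in> carrier B; b' \<in> carrier B; a \<in> carrier A; a' \<in> carrier A\<rbrakk>
      \<Longrightarrow> pair (b \<otimes>\<^bsub>B\<^esub> b') (a \<otimes>\<^bsub>A\<^esub> a') =
        tensor_lift K (\<lambda>a1 a2. tensor_lift K (\<lambda>a1' a2'.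
          pair b (a1 \<otimes>\<^bsub>A\<^esub> a1') \<otimes>\<^bsub>K\<^esub> pair b' (a2 \<otimes>\<^bsub>A\<^esub> a2')) (\<Delta>A a')) (\<Delta>A a)"
begin

sublocale AA: tensor_algebras K A A ..
sublocale BB: tensor_algebras K B B ..

abbreviation (input) "A2 \<equiv> tensor_K K A A"
abbreviation (input) "B2 \<equiv> tensor_K K B B"

lemma abelian_K: "abelian_group K" ..
lemma abelian_A: "abelian_group A" ..
lemma abelian_B: "abelian_group B" ..

lemma pair_closed [simp]: "\<lbrakk>b \<in> carrier B; a \<in> carrier A\<rbrakk> \<Longrightarrow> pair b a \<in> carrier K"
  using pair_additive_right by (auto intro: additive_map_closed)

lemma pair_add_left: "\<lbrakk>b \<in> carrier B; b' \<in> carrier B; a \<in> carrier A\<rbrakk>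
    \<Longrightarrow> pair (b \<oplus>\<^bsub>B\<^esub> b') a = pair b a \<oplus>\<^bsub>K\<^esub> pair b' a"
  using pair_additive_left by (auto intro: additive_map_add)

lemma pair_add_right: "\<lbrakk>b \<in> carrier B; a \<in> carrier A; a' \<in> carrier A\<rbrakk>
    \<Longrightarrow> pair b (a \<oplus>\<^bsub>A\<^esub> a') = pair b a \<oplus>\<^bsub>K\<^esub> pair b a'"
  using pair_additive_right by (auto intro: additive_map_add)

text \<open>By \<open>A_basis\<close>, an element is determined by its finitely many coefficients
  <c_i, a>.\<close>

lemma A_eqI:
  assumes "a \<in> carrier A" "a' \<in> carrier A" "\<And>b. b \<in> carrier B \<Longrightarrow> pair b a = pair b a'"
  shows "a = a'"
proof -
  have "(\<Oplus>\<^bsub>A\<^esub>i \<in> {..<n}. pair (c i) a \<odot>\<^bsub>A\<^esub> g i) = (\<Oplus>\<^bsub>A\<^esub>i \<in> {..<n}. pair (c i) a' \<odot>\<^bsub>A\<^esub> g i)"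
    using assms by (intro A.finsum_cong') (auto simp: c_closed g_closed)
  then show ?thesis using assms A_basis by simp
qed

text \<open>Pairing the A-leg with b leaves an element of Y, which the family \<Phi> determines.
  Doing this for b = c_i yields all coefficients in \<open>tensor_expand\<close>, and these rebuild
  the tensor. It is applied with Y = A and with Y = A (x) A.\<close>

lemma tensor_A_eqI:
  assumes Y: "module K Y"
    and \<Phi>: "\<And>\<phi>. \<phi> \<in> \<Phi> \<Longrightarrow> additive_map Y K \<phi>"
      "\<And>\<phi> k y. \<lbrakk>\<phi> \<in> \<Phi>; k \<in> carrier K; y \<in> carrier Y\<rbrakk> \<Longrightarrow> \<phi> (k \<odot>\<^bsub>Y\<^esub> y) = k \<otimes>\<^bsub>K\<^esub> \<phi> y"
    and sep: "\<And>y y'. \<lbrakk>y \<in> carrier Y; y' \<in> carrier Y; \<And>\<phi>. \<phi> \<in> \<Phi> \<Longrightarrow> \<phi> y = \<phi> y'\<rbrakk> \<Longrightarrow> y = y'"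
    and s: "s \<in> carrier (tensor_K K A Y)" and t: "t \<in> carrier (tensor_K K A Y)"
    and eq: "\<And>b \<phi>. \<lbrakk>b \<in> carrier B; \<phi> \<in> \<Phi>\<rbrakk> \<Longrightarrow>
      tensor_lift K (\<lambda>x y. pair b x \<otimes>\<^bsub>K\<^esub> \<phi> y) s = tensor_lift K (\<lambda>x y. pair b x \<otimes>\<^bsub>K\<^esub> \<phi> y) t"
  shows "s = t"
proof -
  interpret Y: module K Y by fact
  interpret AY: tensor_modules K A Y ..
  have bal: "balanced_K K A Y Y (\<lambda>x y. pair b x \<odot>\<^bsub>Y\<^esub> y)" if "b \<in> carrier B" for b
    using that by (intro AY.balanced_KI) (simp_all add: pair_add_right pair_smult_right Y.smult_l_distr
        Y.smult_r_distr Y.smult_assoc1 A.R.m_comm[of _ "pair b _"])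
  have lift: "tensor_lift K (\<lambda>x y. pair b x \<otimes>\<^bsub>K\<^esub> \<phi> y) u = \<phi> (tensor_lift Y (\<lambda>x y. pair b x \<odot>\<^bsub>Y\<^esub> y) u)"
    if "b \<in> carrier B" "\<phi> \<in> \<Phi>" "u \<in> carrier (tensor_K K A Y)" for b \<phi> u
  proof -
    have "\<phi> (tensor_lift Y (\<lambda>x y. pair b x \<odot>\<^bsub>Y\<^esub> y) u) = tensor_lift K (\<lambda>x y. \<phi> (pair b x \<odot>\<^bsub>Y\<^esub> y)) u"
      using that by (intro AY.tensor.lift_comp[OF Y.abelian_group_axioms abelian_K bal \<Phi>(1)])
    also have "\<dots> = tensor_lift K (\<lambda>x y. pair b x \<otimes>\<^bsub>K\<^esub> \<phi> y) u"
      using that additive_map_closed[OF \<Phi>(1)] by (intro AY.lift_cong[OF abelian_K])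
        (simp_all add: \<Phi>(2))
    finally show ?thesis by simp
  qed
  have st: "tensor_lift Y (\<lambda>x y. pair b x \<odot>\<^bsub>Y\<^esub> y) s = tensor_lift Y (\<lambda>x y. pair b x \<odot>\<^bsub>Y\<^esub> y) t"
    if b: "b \<in> carrier B" for b
    using s t b AY.tensor.lift_closed[OF Y.abelian_group_axioms bal]
    by (intro sep) (simp_all add: eq flip: lift)
  have expand: "u = (\<Oplus>\<^bsub>tensor_K K A Y\<^esub>i \<in> {..<n}. elem_K K A Y (g i) (tensor_lift Y (\<lambda>x y. pair (c i) x \<odot>\<^bsub>Y\<^esub> y) u))"
    if "u \<in> carrier (tensor_K K A Y)" for u
    using that
    by (intro AY.tensor_expand[symmetric]) (simp_all add: g_closed c_closed pair_additive_right pair_smult_right A_basis)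
  have tc: "tensor_lift Y (\<lambda>x y. pair (c i) x \<odot>\<^bsub>Y\<^esub> y) t \<in> carrier Y" if "i < n" for i
    using that by (intro AY.tensor.lift_closed[OF Y.abelian_group_axioms bal] c_closed t)
  have "(\<Oplus>\<^bsub>tensor_K K A Y\<^esub>i \<in> {..<n}. elem_K K A Y (g i) (tensor_lift Y (\<lambda>x y. pair (c i) x \<odot>\<^bsub>Y\<^esub> y) s)) =
    (\<Oplus>\<^bsub>tensor_K K A Y\<^esub>i \<in> {..<n}. elem_K K A Y (g i) (tensor_lift Y (\<lambda>x y. pair (c i) x \<odot>\<^bsub>Y\<^esub> y) t))"
  proof (rule AY.tensor.T.finsum_cong')
    fix i assume "i \<in> {..<n}"
    then show "elem_K K A Y (g i) (tensor_lift Y (\<lambda>x y. pair (c i) x \<odot>\<^bsub>Y\<^esub> y) s) =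
      elem_K K A Y (g i) (tensor_lift Y (\<lambda>x y. pair (c i) x \<odot>\<^bsub>Y\<^esub> y) t)"
      by (simp only: st[OF c_closed] lessThan_iff)
  qed (auto intro!: AY.elem_closed g_closed tc)
  then show ?thesis using expand[OF s] expand[OF t] by argo
qed

section \<open>The coalgebra structure of A, tested against pairs of elements of B\<close>

definition ev :: "'b \<Rightarrow> 'b \<Rightarrow> ('a \<times> 'a \<Rightarrow>\<^sub>0 int) set \<Rightarrow> 'k" where
  "ev b b' = tensor_lift K (\<lambda>x y. pair b x \<otimes>\<^bsub>K\<^esub> pair b' y)"

lemma balanced_pair_pair:
  "\<lbrakk>b \<in> carrier B; b' \<in> carrier B\<rbrakk> \<Longrightarrow> balanced_K K A A K (\<lambda>x y. pair b x \<otimes>\<^bsub>K\<^esub> pair b' y)"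
  by (intro AA.balanced_KI) (simp_all add: pair_add_right pair_smult_right A.R.l_distr A.R.r_distr A.R.m_ac)

lemma ev_additive: "\<lbrakk>b \<in> carrier B; b' \<in> carrier B\<rbrakk> \<Longrightarrow> additive_map A2 K (ev b b')"
  unfolding ev_def by (rule AA.tensor.additive_map_lift[OF abelian_K balanced_pair_pair])

lemma ev_closed: "\<lbrakk>b \<in> carrier B; b' \<in> carrier B; t \<in> carrier A2\<rbrakk> \<Longrightarrow> ev b b' t \<in> carrier K"
  by (rule additive_map_closed[OF ev_additive])

lemma ev_elem: "\<lbrakk>b \<in> carrier B; b' \<in> carrier B; x \<in> carrier A; y \<in> carrier A\<rbrakk>
    \<Longrightarrow> ev b b' (elem_K K A A x y) = pair b x \<otimes>\<^bsub>K\<^esub> pair b' y"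
  unfolding ev_def by (rule AA.lift_elem[OF abelian_K balanced_pair_pair])

lemma ev_smult:
  assumes "k \<in> carrier K" "b \<in> carrier B" "b' \<in> carrier B" "t \<in> carrier A2"
  shows "ev b b' (k \<odot>\<^bsub>A2\<^esub> t) = k \<otimes>\<^bsub>K\<^esub> ev b b' t"
proof (rule AA.additive_map_eqI[OF _ _ assms(4)])
  show "additive_map A2 K (\<lambda>t. ev b b' (k \<odot>\<^bsub>A2\<^esub> t))"
    using assms by (intro additive_map_comp[OF AA.additive_smult ev_additive])
  show "additive_map A2 K (\<lambda>t. k \<otimes>\<^bsub>K\<^esub> ev b b' t)"
    using assms by (intro additive_map_comp[OF ev_additive A.R.additive_map_scale(1)])
qed (use assms in \<open>simp add: AA.smult_elem ev_elem pair_smult_right A.R.m_assoc\<close>)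

lemma A2_eqI:
  assumes "s \<in> carrier A2" "t \<in> carrier A2"
    and "\<And>b b'. \<lbrakk>b \<in> carrier B; b' \<in> carrier B\<rbrakk> \<Longrightarrow> ev b b' s = ev b b' t"
  shows "s = t"
proof (rule tensor_A_eqI[of A "pair ` carrier B", OF _ _ _ _ assms(1,2)])
  show "module K A" ..
  show "x = y" if "x \<in> carrier A" "y \<in> carrier A" "\<And>\<phi>. \<phi> \<in> pair ` carrier B \<Longrightarrow> \<phi> x = \<phi> y" for x y
    using that by (intro A_eqI) auto
qed (use assms(3) in \<open>auto simp: pair_additive_right pair_smult_right ev_def\<close>)

text \<open>In this form \<Delta>A is the transpose of the product of B; together with
  \<open>A2_eqI\<close> it reduces identities in A (x) A to identities between products in
  B.\<close>

lemma ev_\<Delta>A: "\<lbrakk>b \<in> carrier B; b' \<in> carrier B; a \<in> carrier A\<rbrakk> \<Longrightarrow> ev b b' (\<Delta>A a) = pair (b \<otimes>\<^bsub>B\<^esub> b') a"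
  by (simp add: ev_def pair_mult_left)

lemma \<Delta>A_add: "\<lbrakk>a \<in> carrier A; a' \<in> carrier A\<rbrakk> \<Longrightarrow> \<Delta>A (a \<oplus>\<^bsub>A\<^esub> a') = \<Delta>A a \<oplus>\<^bsub>A2\<^esub> \<Delta>A a'"
  by (rule A2_eqI)
    (simp_all add: \<Delta>A_closed additive_map_add[OF ev_additive] ev_\<Delta>A pair_add_right)

lemma \<Delta>A_smult: "\<lbrakk>k \<in> carrier K; a \<in> carrier A\<rbrakk> \<Longrightarrow> \<Delta>A (k \<odot>\<^bsub>A\<^esub> a) = k \<odot>\<^bsub>A2\<^esub> \<Delta>A a"
  by (rule A2_eqI)
    (simp_all add: \<Delta>A_closed additive_map_closed[OF AA.additive_smult] ev_smult ev_\<Delta>A pair_smult_right)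

lemma \<Delta>A_one: "\<Delta>A \<one>\<^bsub>A\<^esub> = \<one>\<^bsub>A2\<^esub>"
  by (rule A2_eqI) (simp_all add: \<Delta>A_closed AA.one_tensor_K AA.elem_closed ev_\<Delta>A ev_elem pair_mult_one)

text \<open>Separation turns the claim into \<open>pair_mult_mult\<close>, the one axiom in which
  both products occur.\<close>

lemma \<Delta>A_mult:
  assumes a: "a \<in> carrier A" "a' \<in> carrier A"
  shows "\<Delta>A (a \<otimes>\<^bsub>A\<^esub> a') = \<Delta>A a \<otimes>\<^bsub>A2\<^esub> \<Delta>A a'"
proof (rule A2_eqI)
  fix b b' assume b: "b \<in> carrier B" "b' \<in> carrier B"
  have "ev b b' (\<Delta>A (a \<otimes>\<^bsub>A\<^esub> a')) = pair (b \<otimes>\<^bsub>B\<^esub> b') (a \<otimes>\<^bsub>A\<^esub> a')"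
    using a b by (simp add: ev_\<Delta>A)
  also have "\<dots> = ev b b' (\<Delta>A a \<otimes>\<^bsub>A2\<^esub> \<Delta>A a')"
    using a b unfolding ev_def
    by (simp add: AA.lift_mult[OF abelian_K balanced_pair_pair] \<Delta>A_closed pair_mult_mult)
  finally show "ev b b' (\<Delta>A (a \<otimes>\<^bsub>A\<^esub> a')) = ev b b' (\<Delta>A a \<otimes>\<^bsub>A2\<^esub> \<Delta>A a')" .
qed (use a in \<open>simp_all add: \<Delta>A_closed AA.mult_tensor_closed\<close>)

text \<open>Tested against b, b', b'', the two sides become <(b b') b'', h> and <b (b' b''), h>, so
  coassociativity of A is associativity of B.\<close>

lemma coassociative_A: "coassociative K A \<Delta>A"
proof -
  let ?H3 = "tensor_K K A A2"
  interpret A2: module K A2 by (rule AA.module_tensor_K)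
  interpret A3: tensor_modules K A A2 ..
  note G = A3.tensor.abelian_T
  have bal_in: "balanced_K K A A ?H3 (\<lambda>a1 a2. elem_K K A A2 a1 (elem_K K A A a2 y))"
    if "y \<in> carrier A" for y
    using that by (intro AA.balanced_KI) (simp_all add: A3.elem_closed AA.elem_closed A3.elem_add_left
        A3.elem_add_right AA.elem_add_left A3.elem_balanced AA.smult_elem)
  \<comment> \<open>The integrand contains \<Delta>A x, so balancedness in the outer variables
    depends on additivity and K-linearity of \<Delta>A proved above.\<close>
  have bal_out: "balanced_K K A A ?H3 (\<lambda>x y. tensor_lift ?H3 (\<lambda>a1 a2. elem_K K A A2 a1 (elem_K K A A a2 y)) (\<Delta>A x))"
  proof (rule AA.balanced_KI)
    fix x x' y assume *: "x \<in> carrier A" "x' \<in> carrier A" "y \<in> carrier A"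
    then show "tensor_lift ?H3 (\<lambda>a1 a2. elem_K K A A2 a1 (elem_K K A A a2 y)) (\<Delta>A (x \<oplus>\<^bsub>A\<^esub> x')) =
      tensor_lift ?H3 (\<lambda>a1 a2. elem_K K A A2 a1 (elem_K K A A a2 y)) (\<Delta>A x) \<oplus>\<^bsub>?H3\<^esub>
      tensor_lift ?H3 (\<lambda>a1 a2. elem_K K A A2 a1 (elem_K K A A a2 y)) (\<Delta>A x')"
      by (simp add: \<Delta>A_add AA.tensor.lift_add[OF G bal_in] \<Delta>A_closed)
  next
    fix x y y' assume *: "x \<in> carrier A" "y \<in> carrier A" "y' \<in> carrier A"
    have "additive_map A ?H3 (\<lambda>y. tensor_lift ?H3 (\<lambda>a1 a2. elem_K K A A2 a1 (elem_K K A A a2 y)) (\<Delta>A x))"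
      using * by (intro AA.tensor.additive_map_lift_param[OF G] bal_in)
        (simp_all add: \<Delta>A_closed additive_map_def A3.elem_closed AA.elem_closed AA.elem_add_right A3.elem_add_right abelian_A)
    then show "tensor_lift ?H3 (\<lambda>a1 a2. elem_K K A A2 a1 (elem_K K A A a2 (y \<oplus>\<^bsub>A\<^esub> y'))) (\<Delta>A x) =
      tensor_lift ?H3 (\<lambda>a1 a2. elem_K K A A2 a1 (elem_K K A A a2 y)) (\<Delta>A x) \<oplus>\<^bsub>?H3\<^esub>
      tensor_lift ?H3 (\<lambda>a1 a2. elem_K K A A2 a1 (elem_K K A A a2 y')) (\<Delta>A x)"
      using * by (simp add: additive_map_def)
  next
    fix k x y assume *: "k \<in> carrier K" "x \<in> carrier A" "y \<in> carrier A"
    have "tensor_lift ?H3 (\<lambda>a1 a2. elem_K K A A2 a1 (elem_K K A A a2 y)) (k \<odot>\<^bsub>A2\<^esub> t) =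
      tensor_lift ?H3 (\<lambda>a1 a2. elem_K K A A2 a1 (elem_K K A A a2 (k \<odot>\<^bsub>A\<^esub> y))) t" if "t \<in> carrier A2" for t
    proof (rule AA.additive_map_eqI[OF _ _ that])
      show "additive_map A2 ?H3 (\<lambda>t. tensor_lift ?H3 (\<lambda>a1 a2. elem_K K A A2 a1 (elem_K K A A a2 y)) (k \<odot>\<^bsub>A2\<^esub> t))"
        using * by (intro additive_map_comp[OF AA.additive_smult] AA.tensor.additive_map_lift[OF G] bal_in)
      show "additive_map A2 ?H3 (tensor_lift ?H3 (\<lambda>a1 a2. elem_K K A A2 a1 (elem_K K A A a2 (k \<odot>\<^bsub>A\<^esub> y))))"
        using * by (intro AA.tensor.additive_map_lift[OF G] bal_in) simp
    qed (use * in \<open>simp add: AA.smult_elem AA.lift_elem[OF G bal_in] A3.elem_balanced AA.elem_closed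
        AA.elem_balanced\<close>)
    then show "tensor_lift ?H3 (\<lambda>a1 a2. elem_K K A A2 a1 (elem_K K A A a2 y)) (\<Delta>A (k \<odot>\<^bsub>A\<^esub> x)) =
      tensor_lift ?H3 (\<lambda>a1 a2. elem_K K A A2 a1 (elem_K K A A a2 (k \<odot>\<^bsub>A\<^esub> y))) (\<Delta>A x)"
      using * by (simp add: \<Delta>A_smult \<Delta>A_closed)
  qed (simp add: AA.tensor.lift_closed[OF G bal_in] \<Delta>A_closed)
  have bal_right: "balanced_K K A A ?H3 (\<lambda>x y. elem_K K A A2 x (\<Delta>A y))"
    by (intro AA.balanced_KI) (simp_all add: A3.elem_closed \<Delta>A_closed A3.elem_add_left A3.elem_add_right
        \<Delta>A_add \<Delta>A_smult A3.elem_balanced)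
  \<comment> \<open>Functionals on A (x) A separating its points by \<open>A2_eqI\<close>; they play
    the role of the family on Y = A (x) A.\<close>
  let ?\<Phi> = "(\<lambda>(b, b'). ev b b') ` (carrier B \<times> carrier B)"
  have eq: "tensor_lift ?H3 (\<lambda>x y. tensor_lift ?H3 (\<lambda>a1 a2. elem_K K A A2 a1 (elem_K K A A a2 y)) (\<Delta>A x)) (\<Delta>A h)
    = tensor_lift ?H3 (\<lambda>x y. elem_K K A A2 x (\<Delta>A y)) (\<Delta>A h)" (is "?L = ?R")
    if h: "h \<in> carrier A" for h
  proof (rule tensor_A_eqI[of A2 ?\<Phi>])
    show "module K A2" by (rule A2.module_axioms)
    show "s = t" if "s \<in> carrier A2" "t \<in> carrier A2" "\<And>\<phi>. \<phi> \<in> ?\<Phi> \<Longrightarrow> \<phi> s = \<phi> t" for s t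
    proof (rule A2_eqI[OF that(1,2)])
      fix b b' assume "b \<in> carrier B" "b' \<in> carrier B"
      then have "ev b b' \<in> ?\<Phi>" by (intro image_eqI[of _ _ "(b, b')"]) simp_all
      then show "ev b b' s = ev b b' t" by (rule that(3))
    qed
    show "?L \<in> carrier ?H3" "?R \<in> carrier ?H3"
      using h by (intro AA.tensor.lift_closed[OF G] bal_out bal_right \<Delta>A_closed; assumption)+
    fix b \<phi> assume b: "b \<in> carrier B" and "\<phi> \<in> ?\<Phi>"
    then obtain b' b'' where b': "b' \<in> carrier B" "b'' \<in> carrier B" and \<phi>: "\<phi> = ev b' b''" by auto
    let ?F = "tensor_lift K (\<lambda>x y. pair b x \<otimes>\<^bsub>K\<^esub> ev b' b'' y)"
    have balF: "balanced_K K A A2 K (\<lambda>x y. pair b x \<otimes>\<^bsub>K\<^esub> ev b' b'' y)"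
      using b b' by (intro A3.balanced_KI) (simp_all add: ev_closed pair_add_right pair_smult_right
          additive_map_add[OF ev_additive] ev_smult A.R.l_distr A.R.r_distr A.R.m_ac)
    note addF = A3.tensor.additive_map_lift[OF abelian_K balF]
    have "?F ?L = tensor_lift K (\<lambda>x y. ?F (tensor_lift ?H3 (\<lambda>a1 a2. elem_K K A A2 a1 (elem_K K A A a2 y)) (\<Delta>A x))) (\<Delta>A h)"
      using h by (intro AA.tensor.lift_comp[OF G abelian_K bal_out addF] \<Delta>A_closed)
    also have "\<dots> = tensor_lift K (\<lambda>x y. pair (b \<otimes>\<^bsub>B\<^esub> b') x \<otimes>\<^bsub>K\<^esub> pair b'' y) (\<Delta>A h)"
    proof (rule AA.lift_cong[OF abelian_K])
      fix x y assume xy: "x \<in> carrier A" "y \<in> carrier A"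
      have "?F (tensor_lift ?H3 (\<lambda>a1 a2. elem_K K A A2 a1 (elem_K K A A a2 y)) (\<Delta>A x)) =
        tensor_lift K (\<lambda>a1 a2. ?F (elem_K K A A2 a1 (elem_K K A A a2 y))) (\<Delta>A x)"
        using xy by (intro AA.tensor.lift_comp[OF G abelian_K bal_in addF] \<Delta>A_closed)
      also have "\<dots> = tensor_lift K (\<lambda>a1 a2. (pair b a1 \<otimes>\<^bsub>K\<^esub> pair b' a2) \<otimes>\<^bsub>K\<^esub> pair b'' y) (\<Delta>A x)"
        using xy b b' by (intro AA.lift_cong[OF abelian_K] \<Delta>A_closed)
          (simp_all add: A3.lift_elem[OF abelian_K balF] AA.elem_closed ev_elem A.R.m_assoc)
      also have "\<dots> = ev b b' (\<Delta>A x) \<otimes>\<^bsub>K\<^esub> pair b'' y"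
        unfolding ev_def using xy b b'
        by (intro AA.tensor.lift_comp[OF abelian_K abelian_K balanced_pair_pair, symmetric]
            A.R.additive_map_scale \<Delta>A_closed) simp_all
      finally show "?F (tensor_lift ?H3 (\<lambda>a1 a2. elem_K K A A2 a1 (elem_K K A A a2 y)) (\<Delta>A x)) =
        pair (b \<otimes>\<^bsub>B\<^esub> b') x \<otimes>\<^bsub>K\<^esub> pair b'' y"
        using xy b b' by (simp add: ev_\<Delta>A)
    qed (use h b b' in \<open>simp_all add: \<Delta>A_closed\<close>)
    also have "\<dots> = pair (b \<otimes>\<^bsub>B\<^esub> b' \<otimes>\<^bsub>B\<^esub> b'') h"
      using h b b' by (simp add: pair_mult_left[of "b \<otimes>\<^bsub>B\<^esub> b'"])
    also have "\<dots> = pair (b \<otimes>\<^bsub>B\<^esub> (b' \<otimes>\<^bsub>B\<^esub> b'')) h"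
      using b b' by (simp add: B.m_assoc)
    also have "\<dots> = tensor_lift K (\<lambda>x y. pair b x \<otimes>\<^bsub>K\<^esub> pair (b' \<otimes>\<^bsub>B\<^esub> b'') y) (\<Delta>A h)"
      using h b b' by (simp add: pair_mult_left[of b])
    also have "\<dots> = tensor_lift K (\<lambda>x y. ?F (elem_K K A A2 x (\<Delta>A y))) (\<Delta>A h)"
      using h b b' by (intro AA.lift_cong[OF abelian_K] \<Delta>A_closed)
        (simp_all add: A3.lift_elem[OF abelian_K balF] \<Delta>A_closed ev_\<Delta>A)
    also have "\<dots> = ?F ?R"
      using h by (intro AA.tensor.lift_comp[OF G abelian_K bal_right addF, symmetric] \<Delta>A_closed)
    finally show "tensor_lift K (\<lambda>x y. pair b x \<otimes>\<^bsub>K\<^esub> \<phi> y) ?L = tensor_lift K (\<lambda>x y. pair b x \<otimes>\<^bsub>K\<^esub> \<phi> y) ?R"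
      by (simp add: \<phi>)
  qed (auto simp: ev_additive ev_smult)
  then show ?thesis by (simp add: coassociative_def Let_def)
qed

text \<open>Since \<epsilon>A pairs with the unit of B, the two counit laws tested against b are the
  unit laws 1 b = b and b 1 = b.\<close>

lemma counital_A: "counital A \<Delta>A \<epsilon>A"
  unfolding counital_def
proof (intro ballI conjI)
  fix h assume h: "h \<in> carrier A"
  have bal: "balanced_K K A A A (\<lambda>x y. \<epsilon>A x \<odot>\<^bsub>A\<^esub> y)"
    by (intro AA.balanced_KI) (simp_all add: \<epsilon>A_eq pair_add_right pair_smult_right A.smult_l_distr
        A.smult_r_distr A.smult_assoc1[symmetric] A.R.m_comm)
  have bal': "balanced_K K A A A (\<lambda>x y. \<epsilon>A y \<odot>\<^bsub>A\<^esub> x)"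
    by (intro AA.balanced_KI) (simp_all add: \<epsilon>A_eq pair_add_right pair_smult_right A.smult_l_distr
        A.smult_r_distr A.smult_assoc1[symmetric] A.R.m_comm)
  show "tensor_lift A (\<lambda>x y. \<epsilon>A x \<odot>\<^bsub>A\<^esub> y) (\<Delta>A h) = h"
  proof (rule A_eqI)
    fix b assume b: "b \<in> carrier B"
    have "pair b (tensor_lift A (\<lambda>x y. \<epsilon>A x \<odot>\<^bsub>A\<^esub> y) (\<Delta>A h)) =
      tensor_lift K (\<lambda>x y. pair b (\<epsilon>A x \<odot>\<^bsub>A\<^esub> y)) (\<Delta>A h)"
      using h b by (intro AA.tensor.lift_comp[OF abelian_A abelian_K bal pair_additive_right] \<Delta>A_closed)
    also have "\<dots> = tensor_lift K (\<lambda>x y. pair \<one>\<^bsub>B\<^esub> x \<otimes>\<^bsub>K\<^esub> pair b y) (\<Delta>A h)"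
      using h b by (intro AA.lift_cong[OF abelian_K] \<Delta>A_closed) (simp_all add: \<epsilon>A_eq pair_smult_right)
    also have "\<dots> = pair b h"
      using h b by (simp flip: pair_mult_left)
    finally show "pair b (tensor_lift A (\<lambda>x y. \<epsilon>A x \<odot>\<^bsub>A\<^esub> y) (\<Delta>A h)) = pair b h" .
  qed (use h in \<open>simp_all add: AA.tensor.lift_closed[OF abelian_A bal] \<Delta>A_closed\<close>)
  show "tensor_lift A (\<lambda>x y. \<epsilon>A y \<odot>\<^bsub>A\<^esub> x) (\<Delta>A h) = h"
  proof (rule A_eqI)
    fix b assume b: "b \<in> carrier B"
    have "pair b (tensor_lift A (\<lambda>x y. \<epsilon>A y \<odot>\<^bsub>A\<^esub> x) (\<Delta>A h)) =
      tensor_lift K (\<lambda>x y. pair b (\<epsilon>A y \<odot>\<^bsub>A\<^esub> x)) (\<Delta>A h)"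
      using h b by (intro AA.tensor.lift_comp[OF abelian_A abelian_K bal' pair_additive_right] \<Delta>A_closed)
    also have "\<dots> = tensor_lift K (\<lambda>x y. pair b x \<otimes>\<^bsub>K\<^esub> pair \<one>\<^bsub>B\<^esub> y) (\<Delta>A h)"
      using h b by (intro AA.lift_cong[OF abelian_K] \<Delta>A_closed) (simp_all add: \<epsilon>A_eq pair_smult_right A.R.m_comm)
    also have "\<dots> = pair b h"
      using h b by (simp flip: pair_mult_left)
    finally show "pair b (tensor_lift A (\<lambda>x y. \<epsilon>A y \<odot>\<^bsub>A\<^esub> x) (\<Delta>A h)) = pair b h" .
  qed (use h in \<open>simp_all add: AA.tensor.lift_closed[OF abelian_A bal'] \<Delta>A_closed\<close>)
qed

lemma bialgebra_A: "bialgebra K A \<Delta>A \<epsilon>A"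
  unfolding bialgebra_def
proof (intro conjI)
  show "assoc_algebra K A" ..
  show "\<Delta>A \<in> algebra_hom K A A2"
    by (auto simp: algebra_hom_def \<Delta>A_smult intro!: ring_hom_memI \<Delta>A_closed \<Delta>A_mult \<Delta>A_add \<Delta>A_one)
  show "\<epsilon>A \<in> algebra_hom K A (ring_module K)"
    by (auto simp: algebra_hom_def ring_module_def \<epsilon>A_eq pair_one_mult pair_add_right pair_smult_right
        pair_one_one intro!: ring_hom_memI)
qed (rule coassociative_A counital_A)+

section \<open>The mirrored structure on B\<close>

lemma balanced_pair_pair_left:
  "\<lbrakk>x \<in> carrier A; y \<in> carrier A\<rbrakk> \<Longrightarrow> balanced_K K B B K (\<lambda>b1 b2. pair b1 x \<otimes>\<^bsub>K\<^esub> pair b2 y)"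
  by (intro BB.balanced_KI) (simp_all add: pair_add_left pair_smult_left A.R.l_distr A.R.r_distr A.R.m_ac)

definition ev' :: "'a \<Rightarrow> 'a \<Rightarrow> ('b \<times> 'b \<Rightarrow>\<^sub>0 int) set \<Rightarrow> 'k" where
  "ev' x y = tensor_lift K (\<lambda>b1 b2. pair b1 x \<otimes>\<^bsub>K\<^esub> pair b2 y)"

lemma ev'_additive: "\<lbrakk>x \<in> carrier A; y \<in> carrier A\<rbrakk> \<Longrightarrow> additive_map B2 K (ev' x y)"
  unfolding ev'_def by (rule BB.tensor.additive_map_lift[OF abelian_K balanced_pair_pair_left])

lemma ev'_closed: "\<lbrakk>x \<in> carrier A; y \<in> carrier A; s \<in> carrier B2\<rbrakk> \<Longrightarrow> ev' x y s \<in> carrier K"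
  by (rule additive_map_closed[OF ev'_additive])

lemma ev'_elem: "\<lbrakk>b \<in> carrier B; b' \<in> carrier B; x \<in> carrier A; y \<in> carrier A\<rbrakk>
    \<Longrightarrow> ev' x y (elem_K K B B b b') = pair b x \<otimes>\<^bsub>K\<^esub> pair b' y"
  unfolding ev'_def by (rule BB.lift_elem[OF abelian_K balanced_pair_pair_left])

lemma ev'_add_left:
  assumes "x \<in> carrier A" "x' \<in> carrier A" "y \<in> carrier A" "s \<in> carrier B2"
  shows "ev' (x \<oplus>\<^bsub>A\<^esub> x') y s = ev' x y s \<oplus>\<^bsub>K\<^esub> ev' x' y s"
  by (rule BB.additive_map_eqI[OF _ _ assms(4)])
    (use assms in \<open>auto simp: ev'_additive ev'_elem pair_add_right A.R.l_distr
      intro!: additive_map_sum abelian_K\<close>)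

lemma ev'_add_right:
  assumes "x \<in> carrier A" "y \<in> carrier A" "y' \<in> carrier A" "s \<in> carrier B2"
  shows "ev' x (y \<oplus>\<^bsub>A\<^esub> y') s = ev' x y s \<oplus>\<^bsub>K\<^esub> ev' x y' s"
  by (rule BB.additive_map_eqI[OF _ _ assms(4)])
    (use assms in \<open>auto simp: ev'_additive ev'_elem pair_add_right A.R.r_distr
      intro!: additive_map_sum abelian_K\<close>)

lemma ev'_smult_left:
  assumes "k \<in> carrier K" "x \<in> carrier A" "y \<in> carrier A" "s \<in> carrier B2"
  shows "ev' (k \<odot>\<^bsub>A\<^esub> x) y s = k \<otimes>\<^bsub>K\<^esub> ev' x y s"
proof (rule BB.additive_map_eqI[OF _ _ assms(4)])
  show "additive_map B2 K (\<lambda>s. k \<otimes>\<^bsub>K\<^esub> ev' x y s)"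
    using assms by (intro additive_map_comp[OF ev'_additive A.R.additive_map_scale(1)])
qed (use assms in \<open>simp_all add: ev'_additive ev'_elem pair_smult_right A.R.m_assoc\<close>)

lemma ev'_smult_right:
  assumes "k \<in> carrier K" "x \<in> carrier A" "y \<in> carrier A" "s \<in> carrier B2"
  shows "ev' x (k \<odot>\<^bsub>A\<^esub> y) s = k \<otimes>\<^bsub>K\<^esub> ev' x y s"
proof (rule BB.additive_map_eqI[OF _ _ assms(4)])
  show "additive_map B2 K (\<lambda>s. k \<otimes>\<^bsub>K\<^esub> ev' x y s)"
    using assms by (intro additive_map_comp[OF ev'_additive A.R.additive_map_scale(1)])
qed (use assms in \<open>simp_all add: ev'_additive ev'_elem pair_smult_right A.R.m_lcomm\<close>)

text \<open>Both sides are biadditive in s and s'. For s = x (x) y and s' = x' (x) y' the left side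
  is <x x', a><y y', a'>; expanding both factors through \<Delta>A and regrouping the four scalars
  in K gives the right side.\<close>

lemma pair_mult_mult_expand:
  assumes a: "a \<in> carrier A" and a': "a' \<in> carrier A" and s: "s \<in> carrier B2" and s': "s' \<in> carrier B2"
  shows "tensor_lift K (\<lambda>b1 b2. tensor_lift K (\<lambda>b1' b2'.
      pair (b1 \<otimes>\<^bsub>B\<^esub> b1') a \<otimes>\<^bsub>K\<^esub> pair (b2 \<otimes>\<^bsub>B\<^esub> b2') a') s') s =
    tensor_lift K (\<lambda>a1 a2. tensor_lift K (\<lambda>a1' a2'. ev' a1 a1' s \<otimes>\<^bsub>K\<^esub> ev' a2 a2' s') (\<Delta>A a')) (\<Delta>A a)"
    (is "?G s s' = ?H s s'")
proof -
  note f = balanced_pair_pair_left[OF a a']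
  have in_bal: "balanced_K K A A K (\<lambda>a1' a2'. ev' x a1' s \<otimes>\<^bsub>K\<^esub> ev' y a2' s')"
    if "x \<in> carrier A" "y \<in> carrier A" "s \<in> carrier B2" "s' \<in> carrier B2" for x y s s'
    using that by (intro AA.balanced_KI) (simp_all add: ev'_closed ev'_add_right ev'_smult_right
        A.R.l_distr A.R.r_distr A.R.m_ac)
  have out_bal: "balanced_K K A A K (\<lambda>a1 a2. tensor_lift K (\<lambda>a1' a2'. ev' a1 a1' s \<otimes>\<^bsub>K\<^esub> ev' a2 a2' s') (\<Delta>A a'))"
    if "s \<in> carrier B2" "s' \<in> carrier B2" for s s'
  proof (rule AA.tensor.balanced_map_lift_param[OF abelian_K \<Delta>A_closed[OF a'] AA.tensor.abelian_X AA.tensor.abelian_Y])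
    fix x y assume "x \<in> carrier (symmetric_bimodule A)" "y \<in> carrier (symmetric_bimodule A)"
    then show "balanced_K K A A K (\<lambda>x' y'. ev' x' x s \<otimes>\<^bsub>K\<^esub> ev' y' y s')"
      using that by (intro AA.balanced_KI) (simp_all add: ev'_closed ev'_add_left ev'_smult_left
          A.R.l_distr A.R.r_distr A.R.m_ac)
  qed (use that in_bal in simp_all)
  have G_left: "additive_map B2 K (\<lambda>s. ?G s s')" if "s' \<in> carrier B2" for s'
    using that by (intro BB.tensor.additive_map_lift abelian_K BB.balanced_lift_mult[OF _ f])
  have G_right: "additive_map B2 K (\<lambda>s'. ?G s s')" if "s \<in> carrier B2" for s
    using that
    by (intro BB.tensor.additive_map_lift_param abelian_K BB.balanced_lift_mult[OF _ f]
        BB.tensor.additive_map_lift BB.balanced_mult_left[OF _ _ f] BB.tensor.abelian_T) simp_all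
  have H_left: "additive_map B2 K (\<lambda>s. ?H s s')" if "s' \<in> carrier B2" for s'
    using that
    by (intro AA.tensor.additive_map_lift_param abelian_K out_bal in_bal \<Delta>A_closed a a'
        additive_map_comp[OF ev'_additive A.R.additive_map_scale(2)] BB.tensor.abelian_T ev'_closed) simp_all
  have H_right: "additive_map B2 K (\<lambda>s'. ?H s s')" if "s \<in> carrier B2" for s
    using that
    by (intro AA.tensor.additive_map_lift_param abelian_K out_bal in_bal \<Delta>A_closed a a'
        additive_map_comp[OF ev'_additive A.R.additive_map_scale(1)] BB.tensor.abelian_T ev'_closed) simp_all
  show ?thesis
  proof (rule BB.additive_map_eqI[OF G_left[OF s'] H_left[OF s'] s])
    fix x y assume xy: "x \<in> carrier B" "y \<in> carrier B"
    then have s: "elem_K K B B x y \<in> carrier B2" by (rule BB.elem_closed)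
    show "?G (elem_K K B B x y) s' = ?H (elem_K K B B x y) s'"
    proof (rule BB.additive_map_eqI[OF G_right[OF s] H_right[OF s] s'])
      fix x' y' assume xy': "x' \<in> carrier B" "y' \<in> carrier B"
      then have s': "elem_K K B B x' y' \<in> carrier B2" by (rule BB.elem_closed)
      have "?G (elem_K K B B x y) (elem_K K B B x' y') = pair (x \<otimes>\<^bsub>B\<^esub> x') a \<otimes>\<^bsub>K\<^esub> pair (y \<otimes>\<^bsub>B\<^esub> y') a'"
        using xy xy' by (simp add: BB.lift_elem[OF abelian_K BB.balanced_lift_mult[OF abelian_K f s']]
            BB.lift_elem[OF abelian_K BB.balanced_mult_left[OF _ _ f]])
      also have "\<dots> = ev x x' (\<Delta>A a) \<otimes>\<^bsub>K\<^esub> ev y y' (\<Delta>A a')"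
        using xy xy' a a' by (simp add: ev_\<Delta>A)
      also have "\<dots> = tensor_lift K (\<lambda>a1 a2. (pair x a1 \<otimes>\<^bsub>K\<^esub> pair x' a2) \<otimes>\<^bsub>K\<^esub> ev y y' (\<Delta>A a')) (\<Delta>A a)"
        unfolding ev_def[of x x'] using xy xy' a a'
        by (intro AA.tensor.lift_comp[OF abelian_K abelian_K balanced_pair_pair] A.R.additive_map_scale
            ev_closed \<Delta>A_closed)
      also have "\<dots> = ?H (elem_K K B B x y) (elem_K K B B x' y')"
      proof (rule AA.lift_cong[OF abelian_K \<Delta>A_closed[OF a]])
        fix a1 a2 assume a12: "a1 \<in> carrier A" "a2 \<in> carrier A"
        have "(pair x a1 \<otimes>\<^bsub>K\<^esub> pair x' a2) \<otimes>\<^bsub>K\<^esub> ev y y' (\<Delta>A a') = tensor_lift K (\<lambda>a1' a2'.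
            (pair x a1 \<otimes>\<^bsub>K\<^esub> pair x' a2) \<otimes>\<^bsub>K\<^esub> (pair y a1' \<otimes>\<^bsub>K\<^esub> pair y' a2')) (\<Delta>A a')"
          unfolding ev_def using xy xy' a' a12
          by (intro AA.tensor.lift_comp[OF abelian_K abelian_K balanced_pair_pair] A.R.additive_map_scale
              \<Delta>A_closed) simp_all
        also have "\<dots> = tensor_lift K (\<lambda>a1' a2'. ev' a1 a1' (elem_K K B B x y) \<otimes>\<^bsub>K\<^esub> ev' a2 a2' (elem_K K B B x' y')) (\<Delta>A a')"
          using xy xy' a12 by (intro AA.lift_cong[OF abelian_K \<Delta>A_closed[OF a']])
            (simp_all add: ev'_elem A.R.m_ac)
        finally show "(pair x a1 \<otimes>\<^bsub>K\<^esub> pair x' a2) \<otimes>\<^bsub>K\<^esub> ev y y' (\<Delta>A a') = \<dots>" .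
        show "tensor_lift K (\<lambda>a1' a2'. ev' a1 a1' (elem_K K B B x y) \<otimes>\<^bsub>K\<^esub> ev' a2 a2' (elem_K K B B x' y')) (\<Delta>A a') \<in> carrier K"
          using a12 s s' by (intro AA.tensor.lift_closed[OF abelian_K in_bal] \<Delta>A_closed a')
      qed
      finally show "?G (elem_K K B B x y) (elem_K K B B x' y') = ?H (elem_K K B B x y) (elem_K K B B x' y')" .
    qed
  qed
qed

text \<open>All axioms but \<open>pair_mult_mult\<close> go over by exchanging letters. That one is
  obtained by expanding at s = \<Delta>B b and s' = \<Delta>B b' and recognising <b, a_1 a_1'> and
  <b', a_2 a_2'> in the result.\<close>

theorem swap: "dual_pair K B A (\<lambda>a b. pair b a) n g c \<Delta>B \<epsilon>B \<Delta>A \<epsilon>A"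
proof (intro dual_pair.intro dual_pair_axioms.intro)
  show "assoc_algebra K A" "assoc_algebra K B" ..
  fix a a' b b' assume ab: "a \<in> carrier A" "a' \<in> carrier A" "b \<in> carrier B" "b' \<in> carrier B"
  have ev'_\<Delta>B: "ev' x y (\<Delta>B b) = pair b (x \<otimes>\<^bsub>A\<^esub> y)" if "x \<in> carrier A" "y \<in> carrier A" "b \<in> carrier B" for x y b
    using that by (simp add: ev'_def pair_mult_right)
  have "tensor_lift K (\<lambda>a1 a2. tensor_lift K (\<lambda>a1' a2'.
      ev' a1 a1' (\<Delta>B b) \<otimes>\<^bsub>K\<^esub> ev' a2 a2' (\<Delta>B b')) (\<Delta>A a')) (\<Delta>A a) = tensor_lift K (\<lambda>a1 a2. tensor_lift K (\<lambda>a1' a2'.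
      pair b (a1 \<otimes>\<^bsub>A\<^esub> a1') \<otimes>\<^bsub>K\<^esub> pair b' (a2 \<otimes>\<^bsub>A\<^esub> a2')) (\<Delta>A a')) (\<Delta>A a)"
  proof (rule AA.lift_cong[OF abelian_K \<Delta>A_closed[OF ab(1)]])
    fix x y assume xy: "x \<in> carrier A" "y \<in> carrier A"
    then show "tensor_lift K (\<lambda>a1' a2'. ev' x a1' (\<Delta>B b) \<otimes>\<^bsub>K\<^esub> ev' y a2' (\<Delta>B b')) (\<Delta>A a') = tensor_lift K (\<lambda>a1' a2'.
      pair b (x \<otimes>\<^bsub>A\<^esub> a1') \<otimes>\<^bsub>K\<^esub> pair b' (y \<otimes>\<^bsub>A\<^esub> a2')) (\<Delta>A a')"
      using ab by (intro AA.lift_cong[OF abelian_K \<Delta>A_closed]) (simp_all add: ev'_\<Delta>B)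
    show "tensor_lift K (\<lambda>a1' a2'. pair b (x \<otimes>\<^bsub>A\<^esub> a1') \<otimes>\<^bsub>K\<^esub> pair b' (y \<otimes>\<^bsub>A\<^esub> a2')) (\<Delta>A a') \<in> carrier K"
      using xy ab by (intro AA.tensor.lift_closed[OF abelian_K] AA.balanced_mult_left balanced_pair_pair \<Delta>A_closed)
  qed
  then show "pair (b \<otimes>\<^bsub>B\<^esub> b') (a \<otimes>\<^bsub>A\<^esub> a') = tensor_lift K (\<lambda>b1 b2. tensor_lift K (\<lambda>b1' b2'.
      pair (b1 \<otimes>\<^bsub>B\<^esub> b1') a \<otimes>\<^bsub>K\<^esub> pair (b2 \<otimes>\<^bsub>B\<^esub> b2') a') (\<Delta>B b')) (\<Delta>B b)"
    using ab by (simp add: pair_mult_mult pair_mult_mult_expand \<Delta>B_closed)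
qed (simp_all add: pair_additive_left pair_additive_right pair_smult_left pair_smult_right c_closed g_closed
    A_basis B_basis \<Delta>A_closed \<Delta>B_closed \<epsilon>A_eq \<epsilon>B_eq pair_one_mult pair_mult_one
    pair_one_one, simp_all add: pair_mult_left pair_mult_right)

lemma bialgebra_B: "bialgebra K B \<Delta>B \<epsilon>B"
  by (rule dual_pair.bialgebra_A[OF swap])

text \<open>Both sides equal the double sum of <b_1, p a_1><b_2, q a_2>; the interchange of the sums
  over \<Delta>B b and \<Delta>A a is what connects them.\<close>

lemma transpose_convolution:
  assumes p: "p \<in> linear_maps K A A" and q: "q \<in> linear_maps K A A"
    and p': "p' \<in> linear_maps K B B" and q': "q' \<in> linear_maps K B B"
    and pp': "\<And>a b. \<lbrakk>a \<in> carrier A; b \<in> carrier B\<rbrakk> \<Longrightarrow> pair (p' b) a = pair b (p a)"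
    and qq': "\<And>a b. \<lbrakk>a \<in> carrier A; b \<in> carrier B\<rbrakk> \<Longrightarrow> pair (q' b) a = pair b (q a)"
    and a: "a \<in> carrier A" and b: "b \<in> carrier B"
  shows "pair (tensor_lift B (\<lambda>b1 b2. p' b1 \<otimes>\<^bsub>B\<^esub> q' b2) (\<Delta>B b)) a =
    pair b (tensor_lift A (\<lambda>a1 a2. p a1 \<otimes>\<^bsub>A\<^esub> q a2) (\<Delta>A a))"
proof -
  have pc: "p x \<in> carrier A" "q x \<in> carrier A" if "x \<in> carrier A" for x
    using p q that by (auto simp: linear_maps_def)
  have p'c: "p' x \<in> carrier B" "q' x \<in> carrier B" if "x \<in> carrier B" for x
    using p' q' that by (auto simp: linear_maps_def)
  have balA: "balanced_K K A A A (\<lambda>a1 a2. p a1 \<otimes>\<^bsub>A\<^esub> q a2)"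
    using p q by (intro AA.balanced_KI) (simp_all add: linear_maps_def pc A.l_distr A.r_distr
        A.smult_mult_left A.smult_mult_right)
  have balB: "balanced_K K B B B (\<lambda>b1 b2. p' b1 \<otimes>\<^bsub>B\<^esub> q' b2)"
    using p' q' by (intro BB.balanced_KI) (simp_all add: linear_maps_def p'c B.l_distr B.r_distr
        B.smult_mult_left B.smult_mult_right)
  have bal1: "balanced_K K B B K (\<lambda>b1 b2. pair b1 (p a1) \<otimes>\<^bsub>K\<^esub> pair b2 (q a2))"
    if "a1 \<in> carrier A" "a2 \<in> carrier A" for a1 a2
    using that pc by (intro balanced_pair_pair_left)
  have bal2: "balanced_K K A A K (\<lambda>a1 a2. pair b1 (p a1) \<otimes>\<^bsub>K\<^esub> pair b2 (q a2))"
    if "b1 \<in> carrier B" "b2 \<in> carrier B" for b1 b2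
    using that p q by (intro AA.balanced_KI) (simp_all add: linear_maps_def pc pair_add_right
        pair_smult_right A.R.l_distr A.R.r_distr A.R.m_ac)
  have "pair (tensor_lift B (\<lambda>b1 b2. p' b1 \<otimes>\<^bsub>B\<^esub> q' b2) (\<Delta>B b)) a =
      tensor_lift K (\<lambda>b1 b2. pair (p' b1 \<otimes>\<^bsub>B\<^esub> q' b2) a) (\<Delta>B b)"
    using a b by (intro BB.tensor.lift_comp[OF abelian_B abelian_K balB pair_additive_left] \<Delta>B_closed)
  also have "\<dots> = tensor_lift K (\<lambda>b1 b2. tensor_lift K (\<lambda>a1 a2. pair b1 (p a1) \<otimes>\<^bsub>K\<^esub> pair b2 (q a2)) (\<Delta>A a)) (\<Delta>B b)"
  proof (rule BB.lift_cong[OF abelian_K \<Delta>B_closed[OF b]])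
    fix b1 b2 assume b12: "b1 \<in> carrier B" "b2 \<in> carrier B"
    have "pair (p' b1 \<otimes>\<^bsub>B\<^esub> q' b2) a = tensor_lift K (\<lambda>a1 a2. pair (p' b1) a1 \<otimes>\<^bsub>K\<^esub> pair (q' b2) a2) (\<Delta>A a)"
      using a b12 by (intro pair_mult_left p'c)
    also have "\<dots> = tensor_lift K (\<lambda>a1 a2. pair b1 (p a1) \<otimes>\<^bsub>K\<^esub> pair b2 (q a2)) (\<Delta>A a)"
      using b12 pc by (intro AA.lift_cong[OF abelian_K \<Delta>A_closed[OF a]]) (simp_all add: pp' qq')
    finally show "pair (p' b1 \<otimes>\<^bsub>B\<^esub> q' b2) a = \<dots>" .
  qed (rule AA.tensor.lift_closed[OF abelian_K bal2 \<Delta>A_closed[OF a]])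
  also have "\<dots> = tensor_lift K (\<lambda>a1 a2. tensor_lift K (\<lambda>b1 b2. pair b1 (p a1) \<otimes>\<^bsub>K\<^esub> pair b2 (q a2)) (\<Delta>B b)) (\<Delta>A a)"
    using a b bal1 bal2
    by (intro BB.tensor.lift_swap[OF AA.tensor.tensor_space_axioms abelian_K] \<Delta>A_closed \<Delta>B_closed) simp_all
  also have "\<dots> = tensor_lift K (\<lambda>a1 a2. pair b (p a1 \<otimes>\<^bsub>A\<^esub> q a2)) (\<Delta>A a)"
    using b pc by (intro AA.lift_cong[OF abelian_K \<Delta>A_closed[OF a]])
      (simp_all flip: pair_mult_right)
  also have "\<dots> = pair b (tensor_lift A (\<lambda>a1 a2. p a1 \<otimes>\<^bsub>A\<^esub> q a2) (\<Delta>A a))"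
    using a b by (intro AA.tensor.lift_comp[OF abelian_A abelian_K balA pair_additive_right, symmetric] \<Delta>A_closed)
  finally show ?thesis .
qed

text \<open>The witness is the transpose of S written in the dual basis. Transposition sends
  convolution to convolution without reversing the factors and fixes unit after counit, so each of
  the two antipode identities carries over separately.\<close>

lemma antipode_B:
  assumes S: "antipode K A \<Delta>A \<epsilon>A S"
  shows "antipode K B \<Delta>B \<epsilon>B (\<lambda>b \<in> carrier B. \<Oplus>\<^bsub>B\<^esub>i \<in> {..<n}. pair b (S (g i)) \<odot>\<^bsub>B\<^esub> c i)"
    (is "antipode _ _ _ _ ?S")
proof -
  interpret swap: dual_pair K B A "\<lambda>a b. pair b a" n g c \<Delta>B \<epsilon>B \<Delta>A \<epsilon>A by (rule swap)
  have Sl: "S \<in> linear_maps K A A" using S by (simp add: antipode_def)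
  have Sc: "S x \<in> carrier A" if "x \<in> carrier A" for x
    using Sl that by (auto simp: linear_maps_def)
  have S'c: "?S b \<in> carrier B" if "b \<in> carrier B" for b
    using that by (auto intro!: B.finsum_closed simp: c_closed g_closed Sc)
  \<comment> \<open>Transposedness follows by moving the scalars <c_i, a> inside S and reassembling
    a from its dual basis expansion.\<close>
  have tr: "pair (?S b) a = pair b (S a)" if a: "a \<in> carrier A" and b: "b \<in> carrier B" for a b
  proof -
    have add: "additive_map A K (\<lambda>a. pair b (S a))"
      using Sl b by (auto simp: additive_map_def linear_maps_def pair_add_right Sc)
    have "pair (?S b) a = (\<Oplus>\<^bsub>K\<^esub>i \<in> {..<n}. pair (pair b (S (g i)) \<odot>\<^bsub>B\<^esub> c i) a)"
      using a b by (simp, intro additive_map_finsum[OF abelian_B abelian_K pair_additive_left])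
        (auto simp: c_closed g_closed Sc)
    also have "\<dots> = (\<Oplus>\<^bsub>K\<^esub>i \<in> {..<n}. pair b (S (pair (c i) a \<odot>\<^bsub>A\<^esub> g i)))"
    proof (rule A.R.finsum_cong')
      fix i assume "i \<in> {..<n}"
      then show "pair (pair b (S (g i)) \<odot>\<^bsub>B\<^esub> c i) a = pair b (S (pair (c i) a \<odot>\<^bsub>A\<^esub> g i))"
        using Sl a b by (simp add: linear_maps_def c_closed g_closed Sc pair_smult_left pair_smult_right A.R.m_comm)
    qed (use a b in \<open>auto simp: c_closed g_closed Sc\<close>)
    also have "\<dots> = pair b (S (\<Oplus>\<^bsub>A\<^esub>i \<in> {..<n}. pair (c i) a \<odot>\<^bsub>A\<^esub> g i))"
      using a by (intro additive_map_finsum[OF abelian_A abelian_K add, symmetric])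
        (auto simp: c_closed g_closed)
    finally show ?thesis using a by (simp add: A_basis)
  qed
  have S'l: "?S \<in> linear_maps K B B"
    unfolding linear_maps_def
  proof (intro CollectI conjI ballI)
    show "?S \<in> carrier B \<rightarrow>\<^sub>E carrier B" using S'c by (simp add: PiE_iff)
    show "?S (x \<oplus>\<^bsub>B\<^esub> y) = ?S x \<oplus>\<^bsub>B\<^esub> ?S y" if "x \<in> carrier B" "y \<in> carrier B" for x y
      using that by (intro swap.A_eqI S'c B.a_closed)
        (simp_all add: tr S'c pair_add_left Sc del: restrict_apply)
    show "?S (k \<odot>\<^bsub>B\<^esub> x) = k \<odot>\<^bsub>B\<^esub> ?S x" if "k \<in> carrier K" "x \<in> carrier B" for k x
      using that by (intro swap.A_eqI S'c B.smult_closed)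
        (simp_all add: tr S'c pair_smult_left Sc del: restrict_apply)
  qed
  \<comment> \<open>Elements of \<open>linear_maps\<close> are extensional, so the identity must be
    cut off outside the carrier; \<open>cong\<close> and \<open>congA\<close> below absorb this
    inside the lifts.\<close>
  have idA: "(\<lambda>a \<in> carrier A. a) \<in> linear_maps K A A" and idB: "(\<lambda>b \<in> carrier B. b) \<in> linear_maps K B B"
    by (auto simp: linear_maps_def)
  show ?thesis
    unfolding antipode_def
  proof (intro conjI ballI S'l)
    fix b assume b: "b \<in> carrier B"
    have balB: "balanced_K K B B B (\<lambda>b1 b2. p b1 \<otimes>\<^bsub>B\<^esub> q b2)"
      if "p \<in> linear_maps K B B" "q \<in> linear_maps K B B" for p q
      using that by (intro BB.balanced_KI) (auto simp: linear_maps_def B.l_distr B.r_distr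
          B.smult_mult_left B.smult_mult_right PiE_iff)
    have cong: "tensor_lift B (\<lambda>b1 b2. p b1 \<otimes>\<^bsub>B\<^esub> b2) (\<Delta>B b) =
        tensor_lift B (\<lambda>b1 b2. p b1 \<otimes>\<^bsub>B\<^esub> (\<lambda>b \<in> carrier B. b) b2) (\<Delta>B b)"
      "tensor_lift B (\<lambda>b1 b2. b1 \<otimes>\<^bsub>B\<^esub> p b2) (\<Delta>B b) =
        tensor_lift B (\<lambda>b1 b2. (\<lambda>b \<in> carrier B. b) b1 \<otimes>\<^bsub>B\<^esub> p b2) (\<Delta>B b)"
      if "\<And>x. x \<in> carrier B \<Longrightarrow> p x \<in> carrier B" for p
      by (rule BB.lift_cong[OF abelian_B \<Delta>B_closed[OF b]]; simp add: that)+
    have congA: "tensor_lift A (\<lambda>b1 b2. S b1 \<otimes>\<^bsub>A\<^esub> b2) (\<Delta>A a) =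
        tensor_lift A (\<lambda>b1 b2. S b1 \<otimes>\<^bsub>A\<^esub> (\<lambda>b \<in> carrier A. b) b2) (\<Delta>A a)"
      "tensor_lift A (\<lambda>b1 b2. b1 \<otimes>\<^bsub>A\<^esub> S b2) (\<Delta>A a) =
        tensor_lift A (\<lambda>b1 b2. (\<lambda>b \<in> carrier A. b) b1 \<otimes>\<^bsub>A\<^esub> S b2) (\<Delta>A a)"
      if "a \<in> carrier A" for a
      by (rule AA.lift_cong[OF abelian_A \<Delta>A_closed[OF that]]; simp add: Sc)+
    have S_eq: "pair b (tensor_lift A (\<lambda>b1 b2. S b1 \<otimes>\<^bsub>A\<^esub> b2) (\<Delta>A a)) = pair (\<epsilon>B b \<odot>\<^bsub>B\<^esub> \<one>\<^bsub>B\<^esub>) a"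
      "pair b (tensor_lift A (\<lambda>b1 b2. b1 \<otimes>\<^bsub>A\<^esub> S b2) (\<Delta>A a)) = pair (\<epsilon>B b \<odot>\<^bsub>B\<^esub> \<one>\<^bsub>B\<^esub>) a"
      if "a \<in> carrier A" for a
      using S that b by (simp_all add: antipode_def \<epsilon>A_eq \<epsilon>B_eq pair_smult_left pair_smult_right A.R.m_comm)
    have r1: "tensor_lift B (\<lambda>b1 b2. ?S b1 \<otimes>\<^bsub>B\<^esub> (\<lambda>b \<in> carrier B. b) b2) (\<Delta>B b) = \<epsilon>B b \<odot>\<^bsub>B\<^esub> \<one>\<^bsub>B\<^esub>"
    proof (rule swap.A_eqI)
      fix a assume a: "a \<in> carrier A"
      have "pair (tensor_lift B (\<lambda>b1 b2. ?S b1 \<otimes>\<^bsub>B\<^esub> (\<lambda>b \<in> carrier B. b) b2) (\<Delta>B b)) a =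
        pair b (tensor_lift A (\<lambda>b1 b2. S b1 \<otimes>\<^bsub>A\<^esub> (\<lambda>b \<in> carrier A. b) b2) (\<Delta>A a))"
        by (rule transpose_convolution[OF Sl idA S'l idB tr _ a b]) simp_all
      then show "pair (tensor_lift B (\<lambda>b1 b2. ?S b1 \<otimes>\<^bsub>B\<^esub> (\<lambda>b \<in> carrier B. b) b2) (\<Delta>B b)) a = pair (\<epsilon>B b \<odot>\<^bsub>B\<^esub> \<one>\<^bsub>B\<^esub>) a"
        using a by (simp only: congA(1)[symmetric] S_eq)
    qed (use b in \<open>simp_all add: \<epsilon>B_eq BB.tensor.lift_closed[OF abelian_B balB[OF S'l idB]] \<Delta>B_closed del: restrict_apply\<close>)
    show "tensor_lift B (\<lambda>b1 b2. ?S b1 \<otimes>\<^bsub>B\<^esub> b2) (\<Delta>B b) = \<epsilon>B b \<odot>\<^bsub>B\<^esub> \<one>\<^bsub>B\<^esub>"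
      by (rule trans[OF cong(1)[of ?S] r1]) (rule S'c)
    have r2: "tensor_lift B (\<lambda>b1 b2. (\<lambda>b \<in> carrier B. b) b1 \<otimes>\<^bsub>B\<^esub> ?S b2) (\<Delta>B b) = \<epsilon>B b \<odot>\<^bsub>B\<^esub> \<one>\<^bsub>B\<^esub>"
    proof (rule swap.A_eqI)
      fix a assume a: "a \<in> carrier A"
      have "pair (tensor_lift B (\<lambda>b1 b2. (\<lambda>b \<in> carrier B. b) b1 \<otimes>\<^bsub>B\<^esub> ?S b2) (\<Delta>B b)) a =
        pair b (tensor_lift A (\<lambda>b1 b2. (\<lambda>b \<in> carrier A. b) b1 \<otimes>\<^bsub>A\<^esub> S b2) (\<Delta>A a))"
        by (rule transpose_convolution[OF idA Sl idB S'l _ tr a b]) simp_all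
      then show "pair (tensor_lift B (\<lambda>b1 b2. (\<lambda>b \<in> carrier B. b) b1 \<otimes>\<^bsub>B\<^esub> ?S b2) (\<Delta>B b)) a = pair (\<epsilon>B b \<odot>\<^bsub>B\<^esub> \<one>\<^bsub>B\<^esub>) a"
        using a by (simp only: congA(2)[symmetric] S_eq)
    qed (use b in \<open>simp_all add: \<epsilon>B_eq BB.tensor.lift_closed[OF abelian_B balB[OF idB S'l]] \<Delta>B_closed del: restrict_apply\<close>)
    show "tensor_lift B (\<lambda>b1 b2. b1 \<otimes>\<^bsub>B\<^esub> ?S b2) (\<Delta>B b) = \<epsilon>B b \<odot>\<^bsub>B\<^esub> \<one>\<^bsub>B\<^esub>"
      by (rule trans[OF cong(2)[of ?S] r2]) (rule S'c)
  qed
qed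

end

context dual_pair
begin

lemma dual_bialgebras: "dual_bialgebras K B \<Delta>B \<epsilon>B A \<Delta>A \<epsilon>A pair"
  unfolding dual_bialgebras_def
proof (intro conjI ballI)
  interpret swap: dual_pair K B A "\<lambda>a b. pair b a" n g c \<Delta>B \<epsilon>B \<Delta>A \<epsilon>A by (rule swap)
  show "bij_betw (\<lambda>b. restrict (pair b) (carrier A)) (carrier B) (linear_maps K A (ring_module K))"
    unfolding bij_betw_def
  proof (intro conjI inj_onI equalityI image_subsetI subsetI)
    fix b b' assume b: "b \<in> carrier B" "b' \<in> carrier B"
      and eq: "restrict (pair b) (carrier A) = restrict (pair b') (carrier A)"
    show "b = b'"
    proof (rule swap.A_eqI[OF b])
      fix a assume "a \<in> carrier A"
      then show "pair b a = pair b' a" using fun_cong[OF eq, of a] by simp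
    qed
  next
    fix b assume "b \<in> carrier B"
    then show "restrict (pair b) (carrier A) \<in> linear_maps K A (ring_module K)"
      by (simp add: linear_maps_def ring_module_def pair_add_right pair_smult_right PiE_iff)
  next
    fix f assume f: "f \<in> linear_maps K A (ring_module K)"
    \<comment> \<open>The preimage of a functional f is read off from the dual basis: its
      coefficients are the values f(g_i).\<close>
    define b where "b = (\<Oplus>\<^bsub>B\<^esub>i \<in> {..<n}. f (g i) \<odot>\<^bsub>B\<^esub> c i)"
    have fc: "f a \<in> carrier K" if "a \<in> carrier A" for a
      using f that by (auto simp: linear_maps_def ring_module_def)
    have fadd: "additive_map A K f"
      using f fc by (simp add: linear_maps_def ring_module_def additive_map_def)
    have fsmult: "f (k \<odot>\<^bsub>A\<^esub> a) = k \<otimes>\<^bsub>K\<^esub> f a" if "k \<in> carrier K" "a \<in> carrier A" for k a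
      using f that by (simp add: linear_maps_def ring_module_def)
    have b: "b \<in> carrier B"
      unfolding b_def by (intro B.finsum_closed) (auto simp: c_closed g_closed fc)
    have "pair b a = f a" if a: "a \<in> carrier A" for a
    proof -
      have "pair b a = (\<Oplus>\<^bsub>K\<^esub>i \<in> {..<n}. pair (f (g i) \<odot>\<^bsub>B\<^esub> c i) a)"
        unfolding b_def using a
        by (intro additive_map_finsum[OF abelian_B abelian_K pair_additive_left]) (auto simp: c_closed g_closed fc)
      also have "\<dots> = (\<Oplus>\<^bsub>K\<^esub>i \<in> {..<n}. f (pair (c i) a \<odot>\<^bsub>A\<^esub> g i))"
        using a by (intro A.R.finsum_cong')
          (auto simp: c_closed g_closed fc fsmult pair_smult_left A.R.m_comm)
      also have "\<dots> = f (\<Oplus>\<^bsub>A\<^esub>i \<in> {..<n}. pair (c i) a \<odot>\<^bsub>A\<^esub> g i)"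
        using a by (intro additive_map_finsum[OF abelian_A abelian_K fadd, symmetric]) (auto simp: c_closed g_closed)
      finally show ?thesis using a by (simp add: A_basis)
    qed
    then have "f = restrict (pair b) (carrier A)"
      using f by (intro ext) (auto simp: linear_maps_def PiE_def extensional_def restrict_def)
    then show "f \<in> (\<lambda>b. restrict (pair b) (carrier A)) ` carrier B" using b by blast
  qed
qed (simp_all add: pair_add_left pair_smult_left \<epsilon>A_eq \<epsilon>B_eq, simp_all add: pair_mult_left pair_mult_right)

end

section \<open>Rings of endomorphisms\<close>

text \<open>Associativity, unit and distributive laws hold for additive operators on V and are
  pulled back by faithfulness. This avoids computing with nested lifts when a product on a tensor
  product is to be shown associative.\<close>

lemma ring_of_faithful_action:
  assumes X: "abelian_group X" and V: "abelian_group V"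
    and closed: "\<And>x y. \<lbrakk>x \<in> carrier X; y \<in> carrier X\<rbrakk> \<Longrightarrow> x \<otimes>\<^bsub>X\<^esub> y \<in> carrier X" "\<one>\<^bsub>X\<^esub> \<in> carrier X"
    and F: "\<And>x. x \<in> carrier X \<Longrightarrow> additive_map V V (F x)"
    and F_add: "\<And>x y v. \<lbrakk>x \<in> carrier X; y \<in> carrier X; v \<in> carrier V\<rbrakk> \<Longrightarrow> F (x \<oplus>\<^bsub>X\<^esub> y) v = F x v \<oplus>\<^bsub>V\<^esub> F y v"
    and F_mult: "\<And>x y v. \<lbrakk>x \<in> carrier X; y \<in> carrier X; v \<in> carrier V\<rbrakk> \<Longrightarrow> F (x \<otimes>\<^bsub>X\<^esub> y) v = F x (F y v)"
    and F_one: "\<And>v. v \<in> carrier V \<Longrightarrow> F \<one>\<^bsub>X\<^esub> v = v"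
    and faithful: "\<And>x y. \<lbrakk>x \<in> carrier X; y \<in> carrier X; \<And>v. v \<in> carrier V \<Longrightarrow> F x v = F y v\<rbrakk> \<Longrightarrow> x = y"
  shows "ring X"
proof -
  interpret X: abelian_group X by fact
  interpret V: abelian_group V by fact
  have Fc: "F x v \<in> carrier V" if "x \<in> carrier X" "v \<in> carrier V" for x v
    using F that by (auto intro: additive_map_closed)
  show ?thesis
    by (intro ringI X monoidI closed faithful)
      (simp_all add: closed F_add F_mult F_one Fc additive_map_add[OF F])
qed

text \<open>X and Y are both identified with the same set of operators on V, in which addition,
  product and unit are the pointwise sum, composition and identity.\<close>

lemma ring_iso_of_faithful_actions:
  assumes X: "ring X" and Y: "ring Y"
    and G: "\<And>y v. \<lbrakk>y \<in> carrier Y; v \<in> carrier V\<rbrakk> \<Longrightarrow> G y v \<in> carrier V"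
    and F_add: "\<And>x y v. \<lbrakk>x \<in> carrier X; y \<in> carrier X; v \<in> carrier V\<rbrakk> \<Longrightarrow> F (x \<oplus>\<^bsub>X\<^esub> y) v = F x v \<oplus>\<^bsub>V\<^esub> F y v"
    and F_mult: "\<And>x y v. \<lbrakk>x \<in> carrier X; y \<in> carrier X; v \<in> carrier V\<rbrakk> \<Longrightarrow> F (x \<otimes>\<^bsub>X\<^esub> y) v = F x (F y v)"
    and F_one: "\<And>v. v \<in> carrier V \<Longrightarrow> F \<one>\<^bsub>X\<^esub> v = v"
    and F_faithful: "\<And>x y. \<lbrakk>x \<in> carrier X; y \<in> carrier X; \<And>v. v \<in> carrier V \<Longrightarrow> F x v = F y v\<rbrakk> \<Longrightarrow> x = y"
    and G_add: "\<And>x y v. \<lbrakk>x \<in> carrier Y; y \<in> carrier Y; v \<in> carrier V\<rbrakk> \<Longrightarrow> G (x \<oplus>\<^bsub>Y\<^esub> y) v = G x v \<oplus>\<^bsub>V\<^esub> G y v"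
    and G_mult: "\<And>x y v. \<lbrakk>x \<in> carrier Y; y \<in> carrier Y; v \<in> carrier V\<rbrakk> \<Longrightarrow> G (x \<otimes>\<^bsub>Y\<^esub> y) v = G x (G y v)"
    and G_one: "\<And>v. v \<in> carrier V \<Longrightarrow> G \<one>\<^bsub>Y\<^esub> v = v"
    and G_faithful: "\<And>x y. \<lbrakk>x \<in> carrier Y; y \<in> carrier Y; \<And>v. v \<in> carrier V \<Longrightarrow> G x v = G y v\<rbrakk> \<Longrightarrow> x = y"
    and XY: "\<And>x. x \<in> carrier X \<Longrightarrow> \<exists>y \<in> carrier Y. \<forall>v \<in> carrier V. G y v = F x v"
    and YX: "\<And>y. y \<in> carrier Y \<Longrightarrow> \<exists>x \<in> carrier X. \<forall>v \<in> carrier V. F x v = G y v"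
  shows "X \<simeq> Y"
proof -
  interpret X: ring X by fact
  interpret Y: ring Y by fact
  \<comment> \<open>An arbitrary choice of elements with the same operator; faithfulness of G makes
    it unique and hence a homomorphism.\<close>
  obtain h where h: "\<And>x. x \<in> carrier X \<Longrightarrow> h x \<in> carrier Y"
    and hG: "\<And>x v. \<lbrakk>x \<in> carrier X; v \<in> carrier V\<rbrakk> \<Longrightarrow> G (h x) v = F x v"
    using XY by metis
  have Fc: "F x v \<in> carrier V" if "x \<in> carrier X" "v \<in> carrier V" for x v
    using G[OF h] that by (simp flip: hG)
  have "h \<in> ring_hom X Y"
    by (rule ring_hom_memI; (intro G_faithful)?)
      (simp_all add: h hG F_add F_mult F_one G_add G_mult G_one Fc)
  moreover have "bij_betw h (carrier X) (carrier Y)"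
  proof (intro bij_betw_imageI inj_onI equalityI image_subsetI subsetI h)
    fix x y assume "x \<in> carrier X" "y \<in> carrier X" "h x = h y"
    then show "x = y" using hG by (intro F_faithful) (auto, metis)
  next
    fix y assume y: "y \<in> carrier Y"
    obtain x where x: "x \<in> carrier X" "\<And>v. v \<in> carrier V \<Longrightarrow> F x v = G y v" using YX[OF y] by blast
    then have "y = h x" using y by (intro G_faithful) (simp_all add: h hG)
    then show "y \<in> h ` carrier X" using x(1) by blast
  qed
  ultimately show ?thesis
    unfolding is_ring_iso_def ring_iso_def by blast
qed

lemma endo_algebra_simps [simp]:
  "carrier (endo_algebra M S) = S" "f \<otimes>\<^bsub>endo_algebra M S\<^esub> g = compose (carrier M) f g"
  "\<one>\<^bsub>endo_algebra M S\<^esub> = (\<lambda>m \<in> carrier M. m)" "\<zero>\<^bsub>endo_algebra M S\<^esub> = (\<lambda>m \<in> carrier M. \<zero>\<^bsub>M\<^esub>)"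
  "f \<oplus>\<^bsub>endo_algebra M S\<^esub> g = (\<lambda>m \<in> carrier M. f m \<oplus>\<^bsub>M\<^esub> g m)"
  "k \<odot>\<^bsub>endo_algebra M S\<^esub> f = (\<lambda>m \<in> carrier M. k \<odot>\<^bsub>M\<^esub> f m)"
  by (simp_all add: endo_algebra_def)

lemma assoc_algebra_endo_algebra:
  assumes M: "module K M" and S: "S \<subseteq> linear_maps K M M"
    and zero: "(\<lambda>m \<in> carrier M. \<zero>\<^bsub>M\<^esub>) \<in> S" and one: "(\<lambda>m \<in> carrier M. m) \<in> S"
    and add: "\<And>f g. \<lbrakk>f \<in> S; g \<in> S\<rbrakk> \<Longrightarrow> (\<lambda>m \<in> carrier M. f m \<oplus>\<^bsub>M\<^esub> g m) \<in> S"
    and comp: "\<And>f g. \<lbrakk>f \<in> S; g \<in> S\<rbrakk> \<Longrightarrow> compose (carrier M) f g \<in> S"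
    and smult: "\<And>k f. \<lbrakk>k \<in> carrier K; f \<in> S\<rbrakk> \<Longrightarrow> (\<lambda>m \<in> carrier M. k \<odot>\<^bsub>M\<^esub> f m) \<in> S"
  shows "assoc_algebra K (endo_algebra M S)"
proof -
  interpret M: module K M by fact
  let ?E = "endo_algebra M S"
  have Sc: "f m \<in> carrier M" if "f \<in> S" "m \<in> carrier M" for f m
    using S that by (auto simp: linear_maps_def)
  have Sadd: "f (x \<oplus>\<^bsub>M\<^esub> y) = f x \<oplus>\<^bsub>M\<^esub> f y" if "f \<in> S" "x \<in> carrier M" "y \<in> carrier M" for f x y
    using S that by (auto simp: linear_maps_def)
  have Ssmult: "f (k \<odot>\<^bsub>M\<^esub> x) = k \<odot>\<^bsub>M\<^esub> f x" if "f \<in> S" "k \<in> carrier K" "x \<in> carrier M" for f k x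
    using S that by (auto simp: linear_maps_def)
  have eqI: "f = g" if "f \<in> S" "g \<in> S" "\<And>m. m \<in> carrier M \<Longrightarrow> f m = g m" for f g
    using that S by (intro extensionalityI[of _ "carrier M"]) (auto simp: linear_maps_def PiE_def)
  have ab: "abelian_group ?E"
  proof (rule abelian_groupI)
    fix f assume f: "f \<in> carrier ?E"
    \<comment> \<open>The additive inverse is scalar multiplication by -1, so closure under scalars
      supplies it.\<close>
    have "(\<lambda>m \<in> carrier M. (\<ominus>\<^bsub>K\<^esub> \<one>\<^bsub>K\<^esub>) \<odot>\<^bsub>M\<^esub> f m) \<in> S"
      using f by (intro smult) simp_all
    moreover have "(\<lambda>m \<in> carrier M. (\<ominus>\<^bsub>K\<^esub> \<one>\<^bsub>K\<^esub>) \<odot>\<^bsub>M\<^esub> f m) \<oplus>\<^bsub>?E\<^esub> f = \<zero>\<^bsub>?E\<^esub>"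
      using f Sc by (auto simp: M.smult_l_minus M.l_neg intro!: restrict_ext)
    ultimately show "\<exists>g \<in> carrier ?E. g \<oplus>\<^bsub>?E\<^esub> f = \<zero>\<^bsub>?E\<^esub>"
      by (intro bexI[of _ "\<lambda>m \<in> carrier M. (\<ominus>\<^bsub>K\<^esub> \<one>\<^bsub>K\<^esub>) \<odot>\<^bsub>M\<^esub> f m"]) simp_all
  next
    fix f assume "f \<in> carrier ?E"
    then show "\<zero>\<^bsub>?E\<^esub> \<oplus>\<^bsub>?E\<^esub> f = f"
      using zero add[OF zero, of f] Sc by (intro eqI) simp_all
  qed (use add zero Sc in \<open>auto simp: M.a_ac intro!: restrict_ext\<close>)
  have mod: "module K ?E"
    by (rule moduleI[OF M.R.cring_axioms ab])
      (use smult Sc in \<open>auto simp: M.smult_l_distr M.smult_r_distr M.smult_assoc1 intro!: restrict_ext eqI\<close>)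
  have ring: "ring ?E"
    by (rule ring_of_faithful_action[OF ab M.abelian_group_axioms, where F = "\<lambda>f. f"])
      (use comp one Sc in \<open>auto simp: additive_map_def Sadd compose_eq intro: eqI\<close>)
  show ?thesis
    by (intro assoc_algebra.intro mod ring assoc_algebra_axioms.intro)
      (auto simp: compose_def Sc Ssmult intro!: restrict_ext)
qed

section \<open>Split embeddings into powers\<close>

text \<open>Turns the summand condition into a finite family with sum_i g_i f_i = id: f_i is the
  i-th coordinate of the embedding into the power, and g_i is the retraction of that embedding after
  the i-th coordinate injection.\<close>

lemma iso_to_direct_summand_power:
  assumes X: "abelian_group X" and Y: "abelian_group Y"
    and Xl: "\<And>l. l \<in> carrier L \<Longrightarrow> additive_map X X (lact X l)"
    and Xr: "\<And>r. r \<in> carrier R \<Longrightarrow> additive_map X X (\<lambda>x. ract X x r)"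
    and Yl: "\<And>l y. \<lbrakk>l \<in> carrier L; y \<in> carrier Y\<rbrakk> \<Longrightarrow> lact Y l y \<in> carrier Y"
    and Yr: "\<And>r y. \<lbrakk>r \<in> carrier R; y \<in> carrier Y\<rbrakk> \<Longrightarrow> ract Y y r \<in> carrier Y"
    and iso: "iso_to_direct_summand L R Y (bimodule_power n X)"
  obtains f g where "\<And>i. i < n \<Longrightarrow> f i \<in> bimodule_hom L R Y X" "\<And>i. i < n \<Longrightarrow> g i \<in> bimodule_hom L R X Y"
    "\<And>y. y \<in> carrier Y \<Longrightarrow> (\<Oplus>\<^bsub>Y\<^esub>i \<in> {..<n}. g i (f i y)) = y"
proof -
  interpret X: abelian_group X by fact
  interpret Y: abelian_group Y by fact
  let ?Z = "bimodule_power n X"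
  have Zsimps: "carrier ?Z = ({..<n} \<rightarrow>\<^sub>E carrier X)" "\<zero>\<^bsub>?Z\<^esub> = (\<lambda>i \<in> {..<n}. \<zero>\<^bsub>X\<^esub>)"
    "v \<oplus>\<^bsub>?Z\<^esub> w = (\<lambda>i \<in> {..<n}. v i \<oplus>\<^bsub>X\<^esub> w i)" "lact ?Z l v = (\<lambda>i \<in> {..<n}. lact X l (v i))"
    "ract ?Z v r = (\<lambda>i \<in> {..<n}. ract X (v i) r)" for v w l r
    by (simp_all add: bimodule_power_def)
  have Z: "abelian_group ?Z"
  proof (rule abelian_groupI)
    fix v assume "v \<in> carrier ?Z"
    then show "\<exists>w \<in> carrier ?Z. w \<oplus>\<^bsub>?Z\<^esub> v = \<zero>\<^bsub>?Z\<^esub>"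
      by (intro bexI[of _ "\<lambda>i \<in> {..<n}. \<ominus>\<^bsub>X\<^esub> v i"]) (auto simp: Zsimps X.l_neg PiE_iff intro!: restrict_ext)
  next
    fix v assume "v \<in> carrier ?Z"
    then show "\<zero>\<^bsub>?Z\<^esub> \<oplus>\<^bsub>?Z\<^esub> v = v"
      by (intro extensionalityI[of _ "{..<n}"]) (auto simp: Zsimps PiE_iff)
  qed (auto simp: Zsimps X.a_ac PiE_iff intro!: restrict_ext)
  interpret Z: abelian_group ?Z by (rule Z)
  obtain P where sum: "direct_summand L R P ?Z"
    and ex_h: "\<exists>h \<in> bimodule_hom L R Y ?Z. bij_betw h (carrier Y) P"
    using iso unfolding iso_to_direct_summand_def by blast
  obtain h where h: "h \<in> bimodule_hom L R Y ?Z" and hP: "bij_betw h (carrier Y) P"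
    using ex_h by blast
  have P: "subbimodule L R P ?Z" using sum by (simp add: direct_summand_def)
  obtain Q where Q: "subbimodule L R Q ?Z"
    and PQ: "P \<inter> Q = {\<zero>\<^bsub>?Z\<^esub>}" "P <+>\<^bsub>?Z\<^esub> Q = carrier ?Z"
    using sum[unfolded direct_summand_def, THEN conjunct2] by (elim exE conjE)
  have P': "subgroup P (add_monoid ?Z)" and Q': "subgroup Q (add_monoid ?Z)"
    using P Q by (simp_all add: subbimodule_def)
  have Psub: "P \<subseteq> carrier ?Z" "Q \<subseteq> carrier ?Z"
    using subgroup.subset[OF P'] subgroup.subset[OF Q'] by simp_all
  have Padd: "v \<oplus>\<^bsub>?Z\<^esub> w \<in> P" if "v \<in> P" "w \<in> P" for v w
    using subgroup.m_closed[OF P' that] by simp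
  have Qadd: "v \<oplus>\<^bsub>?Z\<^esub> w \<in> Q" if "v \<in> Q" "w \<in> Q" for v w
    using subgroup.m_closed[OF Q' that] by simp
  have Pneg: "\<ominus>\<^bsub>?Z\<^esub> v \<in> P" if "v \<in> P" for v
    using subgroup.m_inv_closed[OF P' that] by (simp add: a_inv_def)
  have Qneg: "\<ominus>\<^bsub>?Z\<^esub> v \<in> Q" if "v \<in> Q" for v
    using subgroup.m_inv_closed[OF Q' that] by (simp add: a_inv_def)
  have Q0: "\<zero>\<^bsub>?Z\<^esub> \<in> Q" using PQ(1) by blast
  \<comment> \<open>From p + q = p' + q' one gets p - p' = q' - q, which lies in both P and Q and is
    therefore zero.\<close>
  have uniq: "p = p'"
    if "p \<in> P" "q \<in> Q" "p' \<in> P" "q' \<in> Q" "p \<oplus>\<^bsub>?Z\<^esub> q = p' \<oplus>\<^bsub>?Z\<^esub> q'" for p q p' q'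
  proof -
    have c: "p \<in> carrier ?Z" "q \<in> carrier ?Z" "p' \<in> carrier ?Z" "q' \<in> carrier ?Z"
      using that Psub by auto
    have "p \<oplus>\<^bsub>?Z\<^esub> \<ominus>\<^bsub>?Z\<^esub> p' = (p \<oplus>\<^bsub>?Z\<^esub> q) \<oplus>\<^bsub>?Z\<^esub> \<ominus>\<^bsub>?Z\<^esub> q \<oplus>\<^bsub>?Z\<^esub> \<ominus>\<^bsub>?Z\<^esub> p'"
      using c by (simp add: Z.a_assoc Z.r_neg)
    also have "\<dots> = (p' \<oplus>\<^bsub>?Z\<^esub> \<ominus>\<^bsub>?Z\<^esub> p') \<oplus>\<^bsub>?Z\<^esub> (q' \<oplus>\<^bsub>?Z\<^esub> \<ominus>\<^bsub>?Z\<^esub> q)"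
      unfolding that(5) using c by (simp add: Z.a_ac)
    also have "\<dots> = q' \<oplus>\<^bsub>?Z\<^esub> \<ominus>\<^bsub>?Z\<^esub> q"
      using c by (simp add: Z.r_neg)
    finally have "p \<oplus>\<^bsub>?Z\<^esub> \<ominus>\<^bsub>?Z\<^esub> p' \<in> Q" using that by (simp only: Qadd Qneg)
    moreover have "p \<oplus>\<^bsub>?Z\<^esub> \<ominus>\<^bsub>?Z\<^esub> p' \<in> P" using that by (simp only: Padd Pneg)
    ultimately have "p \<oplus>\<^bsub>?Z\<^esub> \<ominus>\<^bsub>?Z\<^esub> p' = \<zero>\<^bsub>?Z\<^esub>" using PQ(1) by blast
    then have "\<ominus>\<^bsub>?Z\<^esub> (\<ominus>\<^bsub>?Z\<^esub> p') = p" using c by (intro Z.minus_equality) simp_all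
    then show ?thesis using c by simp
  qed
  have "\<exists>p \<in> P. \<exists>q \<in> Q. v = p \<oplus>\<^bsub>?Z\<^esub> q" if "v \<in> carrier ?Z" for v
  proof -
    have "v \<in> P <+>\<^bsub>?Z\<^esub> Q" using that PQ(2) by simp
    then show ?thesis by (simp add: set_add_def set_mult_def)
  qed
  \<comment> \<open>The components along P and Q are picked by choice; linearity of the projection
    comes from uniqueness of the P-component.\<close>
  then obtain \<pi> \<kappa> where \<pi>: "\<And>v. v \<in> carrier ?Z \<Longrightarrow> \<pi> v \<in> P \<and> \<kappa> v \<in> Q \<and> v = \<pi> v \<oplus>\<^bsub>?Z\<^esub> \<kappa> v"
    by metis
  have \<pi>_eq: "\<pi> v = p" if "p \<in> P" "q \<in> Q" "v = p \<oplus>\<^bsub>?Z\<^esub> q" for v p q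
  proof -
    have "v \<in> carrier ?Z" using that Psub by (simp add: subsetD)
    then show ?thesis using uniq[of "\<pi> v" "\<kappa> v" p q] \<pi>[of v] that by metis
  qed
  have \<pi>_P: "\<pi> p = p" if "p \<in> P" for p
    by (rule \<pi>_eq[of p "\<zero>\<^bsub>?Z\<^esub>"]) (use that Q0 subsetD[OF Psub(1) that] in simp_all)
  have \<pi>_add: "\<pi> (v \<oplus>\<^bsub>?Z\<^esub> w) = \<pi> v \<oplus>\<^bsub>?Z\<^esub> \<pi> w" if "v \<in> carrier ?Z" "w \<in> carrier ?Z" for v w
  proof (rule \<pi>_eq[where q = "\<kappa> v \<oplus>\<^bsub>?Z\<^esub> \<kappa> w"])
    have "v \<oplus>\<^bsub>?Z\<^esub> w = (\<pi> v \<oplus>\<^bsub>?Z\<^esub> \<kappa> v) \<oplus>\<^bsub>?Z\<^esub> (\<pi> w \<oplus>\<^bsub>?Z\<^esub> \<kappa> w)"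
      using \<pi> that by metis
    moreover have "\<pi> v \<in> carrier ?Z" "\<kappa> v \<in> carrier ?Z" "\<pi> w \<in> carrier ?Z" "\<kappa> w \<in> carrier ?Z"
      using \<pi> that Psub by auto
    ultimately show "v \<oplus>\<^bsub>?Z\<^esub> w = (\<pi> v \<oplus>\<^bsub>?Z\<^esub> \<pi> w) \<oplus>\<^bsub>?Z\<^esub> (\<kappa> v \<oplus>\<^bsub>?Z\<^esub> \<kappa> w)"
      by (simp add: Z.a_ac)
  qed (simp_all add: \<pi> that Padd Qadd)
  have Zl: "additive_map ?Z ?Z (lact ?Z l)" if "l \<in> carrier L" for l
    using Xl[OF that] by (auto simp: additive_map_def Zsimps PiE_iff intro!: restrict_ext)
  have Zr: "additive_map ?Z ?Z (\<lambda>v. ract ?Z v r)" if "r \<in> carrier R" for r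
    using Xr[OF that] by (auto simp: additive_map_def Zsimps PiE_iff intro!: restrict_ext)
  have \<pi>c: "\<pi> v \<in> carrier ?Z" "\<kappa> v \<in> carrier ?Z" if "v \<in> carrier ?Z" for v
    using \<pi>[OF that] Psub by (simp_all add: subsetD)
  have \<pi>_l: "\<pi> (lact ?Z l v) = lact ?Z l (\<pi> v)" if l: "l \<in> carrier L" and v: "v \<in> carrier ?Z" for l v
  proof (rule \<pi>_eq)
    show "lact ?Z l v = lact ?Z l (\<pi> v) \<oplus>\<^bsub>?Z\<^esub> lact ?Z l (\<kappa> v)"
      using \<pi>[OF v] additive_map_add[OF Zl[OF l] \<pi>c[OF v]] by simp
  qed (use P Q \<pi>[OF v] l in \<open>simp_all add: subbimodule_def\<close>)
  have \<pi>_r: "\<pi> (ract ?Z v r) = ract ?Z (\<pi> v) r" if r: "r \<in> carrier R" and v: "v \<in> carrier ?Z" for r v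
  proof (rule \<pi>_eq)
    show "ract ?Z v r = ract ?Z (\<pi> v) r \<oplus>\<^bsub>?Z\<^esub> ract ?Z (\<kappa> v) r"
      using \<pi>[OF v] additive_map_add[OF Zr[OF r] \<pi>c[OF v]] by simp
  qed (use P Q \<pi>[OF v] r in \<open>simp_all add: subbimodule_def\<close>)
  define h' where "h' = the_inv_into (carrier Y) h"
  have inj: "inj_on h (carrier Y)" and img: "h ` carrier Y = P" using hP by (auto simp: bij_betw_def)
  have h'h: "h' (h y) = y" if "y \<in> carrier Y" for y
    unfolding h'_def using inj that by (rule the_inv_into_f_f)
  have hc: "h y \<in> carrier ?Z" if "y \<in> carrier Y" for y
    using h that by (auto simp: bimodule_hom_def)
  have hadd: "h (x \<oplus>\<^bsub>Y\<^esub> y) = h x \<oplus>\<^bsub>?Z\<^esub> h y" if "x \<in> carrier Y" "y \<in> carrier Y" for x y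
    using h that by (auto simp: bimodule_hom_def)
  have hl: "h (lact Y l y) = lact ?Z l (h y)" if "l \<in> carrier L" "y \<in> carrier Y" for l y
    using h that by (auto simp: bimodule_hom_def)
  have hr: "h (ract Y y r) = ract ?Z (h y) r" if "r \<in> carrier R" "y \<in> carrier Y" for r y
    using h that by (auto simp: bimodule_hom_def)
  \<comment> \<open>The retraction of h: projection onto P followed by the inverse of h on its
    image.\<close>
  define s where "s v = h' (\<pi> v)" for v
  have s: "s v \<in> carrier Y \<and> h (s v) = \<pi> v" if "v \<in> carrier ?Z" for v
    using \<pi>[OF that] img h'h by (auto simp: s_def)
  have s_eqI: "s v = y" if "v \<in> carrier ?Z" "y \<in> carrier Y" "\<pi> v = h y" for v y
    using s[OF that(1)] that inj by (metis inj_onD)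
  have sh: "s (h y) = y" if "y \<in> carrier Y" for y
    using that img by (intro s_eqI hc \<pi>_P) auto
  have s_add: "s (v \<oplus>\<^bsub>?Z\<^esub> w) = s v \<oplus>\<^bsub>Y\<^esub> s w" if "v \<in> carrier ?Z" "w \<in> carrier ?Z" for v w
    using that s by (intro s_eqI Z.a_closed) (simp_all add: \<pi>_add hadd)
  have s_l: "s (lact ?Z l v) = lact Y l (s v)" if "l \<in> carrier L" "v \<in> carrier ?Z" for l v
    using that s by (intro s_eqI additive_map_closed[OF Zl] Yl) (simp_all add: \<pi>_l hl)
  have s_r: "s (ract ?Z v r) = ract Y (s v) r" if "r \<in> carrier R" "v \<in> carrier ?Z" for r v
    using that s by (intro s_eqI additive_map_closed[OF Zr] Yr) (simp_all add: \<pi>_r hr)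
  \<comment> \<open>Coordinate injections X to the power, with zero in the other positions.\<close>
  define \<iota> where "\<iota> i x = (\<lambda>j \<in> {..<n}. if j = i then x else \<zero>\<^bsub>X\<^esub>)" for i :: nat and x
  have \<iota>c: "\<iota> i x \<in> carrier ?Z" if "x \<in> carrier X" for i x
    using that by (auto simp: \<iota>_def Zsimps)
  have \<iota>_add: "\<iota> i (x \<oplus>\<^bsub>X\<^esub> y) = \<iota> i x \<oplus>\<^bsub>?Z\<^esub> \<iota> i y" for i x y
    by (auto simp: \<iota>_def Zsimps intro!: restrict_ext)
  have \<iota>_l: "\<iota> i (lact X l x) = lact ?Z l (\<iota> i x)" if "l \<in> carrier L" for i l x
    using additive_map_zero[OF X X Xl[OF that]] by (auto simp: \<iota>_def Zsimps intro!: restrict_ext)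
  have \<iota>_r: "\<iota> i (ract X x r) = ract ?Z (\<iota> i x) r" if "r \<in> carrier R" for i r x
    using additive_map_zero[OF X X Xr[OF that]] by (auto simp: \<iota>_def Zsimps intro!: restrict_ext)
  have \<iota>_sum: "(\<Oplus>\<^bsub>?Z\<^esub>i \<in> {..<n}. \<iota> i (v i)) = v" if v: "v \<in> carrier ?Z" for v
  proof (rule extensionalityI[of _ "{..<n}"])
    have c: "(\<Oplus>\<^bsub>?Z\<^esub>i \<in> {..<n}. \<iota> i (v i)) \<in> carrier ?Z"
    proof (intro Z.finsum_closed Pi_I \<iota>c)
      fix i assume "i \<in> {..<n}"
      then show "v i \<in> carrier X" using v by (simp add: Zsimps PiE_iff)
    qed
    then show "(\<Oplus>\<^bsub>?Z\<^esub>i \<in> {..<n}. \<iota> i (v i)) \<in> extensional {..<n}"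
      by (simp add: Zsimps PiE_iff)
    show "v \<in> extensional {..<n}" using v by (simp add: Zsimps PiE_iff)
    fix j assume j: "j \<in> {..<n}"
    have ev: "additive_map ?Z X (\<lambda>w. w j)" using j by (auto simp: additive_map_def Zsimps)
    have "(\<Oplus>\<^bsub>?Z\<^esub>i \<in> {..<n}. \<iota> i (v i)) j = (\<Oplus>\<^bsub>X\<^esub>i \<in> {..<n}. \<iota> i (v i) j)"
      using v by (intro additive_map_finsum[OF Z X ev] \<iota>c) (auto simp: Zsimps)
    also have "\<dots> = (\<Oplus>\<^bsub>X\<^esub>i \<in> {..<n}. if j = i then v i else \<zero>\<^bsub>X\<^esub>)"
      using j v by (intro X.finsum_cong') (auto simp: \<iota>_def Zsimps PiE_iff)
    also have "\<dots> = v j"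
      using j v by (intro X.finsum_singleton) (auto simp: Zsimps PiE_iff)
    finally show "(\<Oplus>\<^bsub>?Z\<^esub>i \<in> {..<n}. \<iota> i (v i)) j = v j" .
  qed
  have sadd: "additive_map ?Z Y s" using s s_add by (auto simp: additive_map_def)
  show ?thesis
  proof (rule that[of "\<lambda>i. \<lambda>y \<in> carrier Y. h y i" "\<lambda>i. \<lambda>x \<in> carrier X. s (\<iota> i x)"])
    fix i assume i: "i < n"
    show "(\<lambda>y \<in> carrier Y. h y i) \<in> bimodule_hom L R Y X"
      using i hc by (auto simp: bimodule_hom_def hadd hl hr Yl Yr Zsimps PiE_iff)
    show "(\<lambda>x \<in> carrier X. s (\<iota> i x)) \<in> bimodule_hom L R X Y"
      using s \<iota>c
      by (auto simp: bimodule_hom_def \<iota>_add s_add \<iota>_l s_l \<iota>_r s_r PiE_iff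
          additive_map_closed[OF Xl] additive_map_closed[OF Xr])
  next
    fix y assume y: "y \<in> carrier Y"
    have hX: "h y i \<in> carrier X" if "i < n" for i
      using hc[OF y] that by (auto simp: Zsimps)
    have "(\<Oplus>\<^bsub>Y\<^esub>i \<in> {..<n}. (\<lambda>x \<in> carrier X. s (\<iota> i x)) ((\<lambda>y \<in> carrier Y. h y i) y)) = (\<Oplus>\<^bsub>Y\<^esub>i \<in> {..<n}. s (\<iota> i (h y i)))"
      using y hX s \<iota>c by (intro Y.finsum_cong') auto
    also have "\<dots> = s (\<Oplus>\<^bsub>?Z\<^esub>i \<in> {..<n}. \<iota> i (h y i))"
      using hX by (intro additive_map_finsum[OF Z Y sadd, symmetric] \<iota>c) auto
    also have "\<dots> = y" using y by (simp add: \<iota>_sum hc sh)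
    finally show "(\<Oplus>\<^bsub>Y\<^esub>i \<in> {..<n}. (\<lambda>x \<in> carrier X. s (\<iota> i x)) ((\<lambda>y \<in> carrier Y. h y i) y)) = y" .
  qed
qed

section \<open>The tensor square of an extension\<close>

lemma ring_bimodule_simps [simp]:
  "carrier (ring_bimodule f g M) = carrier M" "\<zero>\<^bsub>ring_bimodule f g M\<^esub> = \<zero>\<^bsub>M\<^esub>"
  "x \<oplus>\<^bsub>ring_bimodule f g M\<^esub> y = x \<oplus>\<^bsub>M\<^esub> y"
  "lact (ring_bimodule f g M) l x = f l \<otimes>\<^bsub>M\<^esub> x" "ract (ring_bimodule f g M) x r = x \<otimes>\<^bsub>M\<^esub> g r"
  by (simp_all add: ring_bimodule_def)

lemma same_add_ring_bimodule: "same_add (ring_bimodule f g M) M"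
  by (simp add: same_add_def ring_bimodule_def)

text \<open>The relations mention only the inner actions of N, so the N-M and M-N versions of the
  tensor square in the depth two condition live on the same group as \<open>MxM\<close>.\<close>

lemma tensor_ab_ring_bimodule:
  "tensor_ab N (ring_bimodule f \<phi> M) (ring_bimodule \<phi> g M) =
    tensor_ab N (ring_bimodule f' \<phi> M) (ring_bimodule \<phi> g' M)"
  by (simp add: tensor_ab_def tensor_null_def tensor_rels_def)

lemma tensor_elem_ring_bimodule:
  "tensor_elem N (ring_bimodule f \<phi> M) (ring_bimodule \<phi> g M) = elem_N N M \<phi>"
  by (intro ext) (simp add: elem_N_def tensor_elem_def tensor_null_def tensor_rels_def)

lemma tensor_simps:
  "carrier (tensor S X Y) = carrier (tensor_ab S X Y)"
  "\<zero>\<^bsub>tensor S X Y\<^esub> = \<zero>\<^bsub>tensor_ab S X Y\<^esub>"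
  "ring.add (tensor S X Y) = ring.add (tensor_ab S X Y)"
  "lact (tensor S X Y) l t = tensor_lift (tensor_ab S X Y) (\<lambda>x y. tensor_elem S X Y (lact X l x) y) t"
  "ract (tensor S X Y) t r = tensor_lift (tensor_ab S X Y) (\<lambda>x y. tensor_elem S X Y x (ract Y y r)) t"
  by (simp_all add: tensor_def Let_def)

locale alg_extension =
  fixes K :: "('k, 'u) ring_scheme" and N :: "('k, 'n, 'v) module_scheme"
    and M :: "('k, 'm, 'w) module_scheme" and \<phi> :: "'n \<Rightarrow> 'm"
  assumes algebra_extension: "algebra_extension K N M \<phi>"
begin

sublocale N: assoc_algebra K N using algebra_extension by (simp add: algebra_extension_def)
sublocale M: assoc_algebra K M using algebra_extension by (simp add: algebra_extension_def)

lemma phi_closed [simp]: "n \<in> carrier N \<Longrightarrow> \<phi> n \<in> carrier M"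
  and phi_one: "\<phi> \<one>\<^bsub>N\<^esub> = \<one>\<^bsub>M\<^esub>"
  and phi_smult: "\<lbrakk>k \<in> carrier K; n \<in> carrier N\<rbrakk> \<Longrightarrow> \<phi> (k \<odot>\<^bsub>N\<^esub> n) = k \<odot>\<^bsub>M\<^esub> \<phi> n"
  using algebra_extension
  by (auto simp: algebra_extension_def algebra_hom_def ring_hom_def)

text \<open>Scalars act through the image of N, namely through k 1_N. Hence additive left N-linear
  maps on M are automatically K-linear, which the definitions of A and End(_N M) do not
  state.\<close>

lemma smult_eq_phi:
  assumes "k \<in> carrier K" "m \<in> carrier M"
  shows "k \<odot>\<^bsub>M\<^esub> m = \<phi> (k \<odot>\<^bsub>N\<^esub> \<one>\<^bsub>N\<^esub>) \<otimes>\<^bsub>M\<^esub> m" "k \<odot>\<^bsub>M\<^esub> m = m \<otimes>\<^bsub>M\<^esub> \<phi> (k \<odot>\<^bsub>N\<^esub> \<one>\<^bsub>N\<^esub>)"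
  using assms by (simp_all add: phi_smult phi_one M.smult_mult_left M.smult_mult_right)

abbreviation (input) "T \<equiv> MxM N M \<phi>"
abbreviation balN where "balN \<equiv> balanced_map N (ring_bimodule id \<phi> M) (ring_bimodule \<phi> id M)"
abbreviation tens (infix \<open>\<otimes>N\<close> 66) where "x \<otimes>N y \<equiv> elem_N N M \<phi> x y"
abbreviation left_mult (infixr \<open>\<triangleright>\<close> 67) where "m \<triangleright> t \<equiv> lact (MxM N M \<phi>) m t"
abbreviation right_mult (infixl \<open>\<triangleleft>\<close> 66) where "t \<triangleleft> m \<equiv> ract (MxM N M \<phi>) t m"

sublocale tensor: tensor_space N "ring_bimodule id \<phi> M" "ring_bimodule \<phi> id M" "MxM N M \<phi>"
proof (rule tensor_space.intro)
  show "abelian_group (ring_bimodule id \<phi> M)" "abelian_group (ring_bimodule \<phi> id M)"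
    using same_add_abelian_group[OF same_add_ring_bimodule] M.abelian_group_axioms by blast+
  show "same_add (MxM N M \<phi>) (tensor_ab N (ring_bimodule id \<phi> M) (ring_bimodule \<phi> id M))"
    by (simp add: same_add_def MxM_def tensor_simps)
qed simp_all

lemma abelian_M: "abelian_group M" ..
lemmas abelian_T = tensor.abelian_T

lemma same_add_T: "same_add (tensor_ab N (ring_bimodule f \<phi> M) (ring_bimodule \<phi> g M)) (MxM N M \<phi>)"
  using same_add_sym[OF tensor.same_T] tensor_ab_ring_bimodule by metis

lemmas tens_closed = tensor.elem_closed[folded elem_N_def, simplified]
  and tens_add_left = tensor.elem_add_left[folded elem_N_def, simplified]
  and tens_add_right = tensor.elem_add_right[folded elem_N_def, simplified]
  and tens_balanced = tensor.elem_balanced[folded elem_N_def, simplified]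
  and lift_tens = tensor.lift_elem[folded elem_N_def, simplified]
  and additive_map_eqI = tensor.additive_map_eqI[folded elem_N_def, simplified]
  and lift_cong = tensor.lift_cong[simplified]

lemma balNI:
  assumes "\<And>x y. \<lbrakk>x \<in> carrier M; y \<in> carrier M\<rbrakk> \<Longrightarrow> f x y \<in> carrier G"
    and "\<And>x x' y. \<lbrakk>x \<in> carrier M; x' \<in> carrier M; y \<in> carrier M\<rbrakk> \<Longrightarrow> f (x \<oplus>\<^bsub>M\<^esub> x') y = f x y \<oplus>\<^bsub>G\<^esub> f x' y"
    and "\<And>x y y'. \<lbrakk>x \<in> carrier M; y \<in> carrier M; y' \<in> carrier M\<rbrakk> \<Longrightarrow> f x (y \<oplus>\<^bsub>M\<^esub> y') = f x y \<oplus>\<^bsub>G\<^esub> f x y'"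
    and "\<And>x n y. \<lbrakk>x \<in> carrier M; n \<in> carrier N; y \<in> carrier M\<rbrakk> \<Longrightarrow> f (x \<otimes>\<^bsub>M\<^esub> \<phi> n) y = f x (\<phi> n \<otimes>\<^bsub>M\<^esub> y)"
  shows "balN G f"
  using assms by (intro balanced_mapI) simp_all

lemma balN_closed: "\<lbrakk>balN G f; x \<in> carrier M; y \<in> carrier M\<rbrakk> \<Longrightarrow> f x y \<in> carrier G"
  by (auto intro: balanced_map_closed)

lemma balN_tens: "balN T (elem_N N M \<phi>)"
  unfolding elem_N_def by (rule tensor.balanced_map_elem)

lemma balN_left: "\<lbrakk>balN G f; m \<in> carrier M\<rbrakk> \<Longrightarrow> balN G (\<lambda>x y. f (m \<otimes>\<^bsub>M\<^esub> x) y)"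
  by (simp add: balanced_map_def additive_map_def M.r_distr M.m_assoc[symmetric])

lemma balN_right: "\<lbrakk>balN G f; m \<in> carrier M\<rbrakk> \<Longrightarrow> balN G (\<lambda>x y. f x (y \<otimes>\<^bsub>M\<^esub> m))"
  by (simp add: balanced_map_def additive_map_def M.l_distr M.m_assoc)

lemma left_mult_eq: "m \<triangleright> t = tensor_lift T (\<lambda>x y. m \<otimes>\<^bsub>M\<^esub> x \<otimes>N y) t"
  and right_mult_eq: "t \<triangleleft> m = tensor_lift T (\<lambda>x y. x \<otimes>N y \<otimes>\<^bsub>M\<^esub> m) t"
  by (simp_all only: same_add_tensor_lift[OF same_add_T[where f = id and g = id], symmetric])
    (simp_all add: MxM_def tensor_simps tensor_elem_ring_bimodule)

lemma left_mult_additive: "m \<in> carrier M \<Longrightarrow> additive_map T T (\<lambda>t. m \<triangleright> t)"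
  and right_mult_additive: "m \<in> carrier M \<Longrightarrow> additive_map T T (\<lambda>t. t \<triangleleft> m)"
  unfolding left_mult_eq right_mult_eq
  by (simp_all add: tensor.additive_map_lift abelian_T balN_left balN_right balN_tens)

lemma left_mult_closed: "\<lbrakk>m \<in> carrier M; t \<in> carrier T\<rbrakk> \<Longrightarrow> m \<triangleright> t \<in> carrier T"
  and right_mult_closed: "\<lbrakk>m \<in> carrier M; t \<in> carrier T\<rbrakk> \<Longrightarrow> t \<triangleleft> m \<in> carrier T"
  by (rule additive_map_closed[OF left_mult_additive] additive_map_closed[OF right_mult_additive]; assumption)+

lemma left_mult_tens: "\<lbrakk>m \<in> carrier M; x \<in> carrier M; y \<in> carrier M\<rbrakk> \<Longrightarrow> m \<triangleright> (x \<otimes>N y) = m \<otimes>\<^bsub>M\<^esub> x \<otimes>N y"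
  and right_mult_tens: "\<lbrakk>m \<in> carrier M; x \<in> carrier M; y \<in> carrier M\<rbrakk> \<Longrightarrow> (x \<otimes>N y) \<triangleleft> m = x \<otimes>N y \<otimes>\<^bsub>M\<^esub> m"
  unfolding left_mult_eq right_mult_eq
  by (simp_all add: lift_tens abelian_T balN_left balN_right balN_tens)

lemma lift_left_mult:
  assumes G: "abelian_group G" and f: "balN G f" and m: "m \<in> carrier M" and t: "t \<in> carrier T"
  shows "tensor_lift G f (m \<triangleright> t) = tensor_lift G (\<lambda>x y. f (m \<otimes>\<^bsub>M\<^esub> x) y) t"
proof (rule additive_map_eqI[OF _ _ t])
  show "additive_map T G (\<lambda>t. tensor_lift G f (m \<triangleright> t))"
    using left_mult_additive[OF m] tensor.additive_map_lift[OF G f] by (rule additive_map_comp)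
  show "additive_map T G (tensor_lift G (\<lambda>x y. f (m \<otimes>\<^bsub>M\<^esub> x) y))"
    by (rule tensor.additive_map_lift[OF G balN_left[OF f m]])
qed (simp add: m left_mult_tens lift_tens[OF G f] lift_tens[OF G balN_left[OF f m]])

lemma lift_right_mult:
  assumes G: "abelian_group G" and f: "balN G f" and m: "m \<in> carrier M" and t: "t \<in> carrier T"
  shows "tensor_lift G f (t \<triangleleft> m) = tensor_lift G (\<lambda>x y. f x (y \<otimes>\<^bsub>M\<^esub> m)) t"
proof (rule additive_map_eqI[OF _ _ t])
  show "additive_map T G (\<lambda>t. tensor_lift G f (t \<triangleleft> m))"
    using right_mult_additive[OF m] tensor.additive_map_lift[OF G f] by (rule additive_map_comp)
  show "additive_map T G (tensor_lift G (\<lambda>x y. f x (y \<otimes>\<^bsub>M\<^esub> m)))"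
    by (rule tensor.additive_map_lift[OF G balN_right[OF f m]])
qed (simp add: m right_mult_tens lift_tens[OF G f] lift_tens[OF G balN_right[OF f m]])

lemma left_mult_additive_left: "t \<in> carrier T \<Longrightarrow> additive_map M T (\<lambda>m. m \<triangleright> t)"
  unfolding left_mult_eq
  by (intro tensor.additive_map_lift_param abelian_T balN_left balN_tens abelian_M)
    (simp_all add: additive_map_def tens_closed tens_add_left M.l_distr)

lemma right_mult_additive_right: "t \<in> carrier T \<Longrightarrow> additive_map M T (\<lambda>m. t \<triangleleft> m)"
  unfolding right_mult_eq
  by (intro tensor.additive_map_lift_param abelian_T balN_right balN_tens abelian_M)
    (simp_all add: additive_map_def tens_closed tens_add_right M.r_distr)

lemma left_mult_assoc:
  assumes "m \<in> carrier M" "m' \<in> carrier M" "t \<in> carrier T"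
  shows "m \<otimes>\<^bsub>M\<^esub> m' \<triangleright> t = m \<triangleright> m' \<triangleright> t"
  by (rule additive_map_eqI[OF left_mult_additive additive_map_comp[OF left_mult_additive left_mult_additive] assms(3)])
    (use assms in \<open>simp_all add: left_mult_tens M.m_assoc\<close>)

lemma right_mult_assoc:
  assumes "m \<in> carrier M" "m' \<in> carrier M" "t \<in> carrier T"
  shows "t \<triangleleft> (m \<otimes>\<^bsub>M\<^esub> m') = t \<triangleleft> m \<triangleleft> m'"
  by (rule additive_map_eqI[OF right_mult_additive additive_map_comp[OF right_mult_additive right_mult_additive] assms(3)])
    (use assms in \<open>simp_all add: right_mult_tens M.m_assoc\<close>)

lemma left_right_mult:
  assumes "m \<in> carrier M" "m' \<in> carrier M" "t \<in> carrier T"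
  shows "(m \<triangleright> t) \<triangleleft> m' = m \<triangleright> (t \<triangleleft> m')"
  by (rule additive_map_eqI[OF additive_map_comp[OF left_mult_additive right_mult_additive]
        additive_map_comp[OF right_mult_additive left_mult_additive] assms(3)])
    (use assms in \<open>simp_all add: right_mult_tens left_mult_tens\<close>)

lemma left_mult_one: "t \<in> carrier T \<Longrightarrow> \<one>\<^bsub>M\<^esub> \<triangleright> t = t"
  by (rule additive_map_eqI[OF left_mult_additive, of _ "\<lambda>t. t"]) (simp_all add: additive_map_def left_mult_tens)

lemma right_mult_one: "t \<in> carrier T \<Longrightarrow> t \<triangleleft> \<one>\<^bsub>M\<^esub> = t"
  by (rule additive_map_eqI[OF right_mult_additive, of _ "\<lambda>t. t"]) (simp_all add: additive_map_def right_mult_tens)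

subsection \<open>Endomorphism algebras\<close>

abbreviation (input) "A \<equiv> End_NN N M \<phi>"
abbreviation (input) "EN \<equiv> End_N N M \<phi>"

lemma A_iff: "\<alpha> \<in> carrier A \<longleftrightarrow> \<alpha> \<in> carrier M \<rightarrow>\<^sub>E carrier M \<and>
    (\<forall>x \<in> carrier M. \<forall>y \<in> carrier M. \<alpha> (x \<oplus>\<^bsub>M\<^esub> y) = \<alpha> x \<oplus>\<^bsub>M\<^esub> \<alpha> y) \<and>
    (\<forall>n \<in> carrier N. \<forall>x \<in> carrier M. \<alpha> (\<phi> n \<otimes>\<^bsub>M\<^esub> x) = \<phi> n \<otimes>\<^bsub>M\<^esub> \<alpha> x) \<and>
    (\<forall>n \<in> carrier N. \<forall>x \<in> carrier M. \<alpha> (x \<otimes>\<^bsub>M\<^esub> \<phi> n) = \<alpha> x \<otimes>\<^bsub>M\<^esub> \<phi> n)"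
  by (simp add: End_NN_def bimodule_hom_def)

lemma EN_iff: "\<xi> \<in> carrier EN \<longleftrightarrow> \<xi> \<in> carrier M \<rightarrow>\<^sub>E carrier M \<and>
    (\<forall>x \<in> carrier M. \<forall>y \<in> carrier M. \<xi> (x \<oplus>\<^bsub>M\<^esub> y) = \<xi> x \<oplus>\<^bsub>M\<^esub> \<xi> y) \<and>
    (\<forall>n \<in> carrier N. \<forall>x \<in> carrier M. \<xi> (\<phi> n \<otimes>\<^bsub>M\<^esub> x) = \<phi> n \<otimes>\<^bsub>M\<^esub> \<xi> x)"
  by (simp add: End_N_def)

lemma A_EN: "\<alpha> \<in> carrier A \<Longrightarrow> \<alpha> \<in> carrier EN"
  by (simp add: A_iff EN_iff)

lemma EN_closed: "\<lbrakk>\<xi> \<in> carrier EN; x \<in> carrier M\<rbrakk> \<Longrightarrow> \<xi> x \<in> carrier M"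
  and EN_add: "\<lbrakk>\<xi> \<in> carrier EN; x \<in> carrier M; y \<in> carrier M\<rbrakk> \<Longrightarrow> \<xi> (x \<oplus>\<^bsub>M\<^esub> y) = \<xi> x \<oplus>\<^bsub>M\<^esub> \<xi> y"
  and EN_left: "\<lbrakk>\<xi> \<in> carrier EN; n \<in> carrier N; x \<in> carrier M\<rbrakk> \<Longrightarrow> \<xi> (\<phi> n \<otimes>\<^bsub>M\<^esub> x) = \<phi> n \<otimes>\<^bsub>M\<^esub> \<xi> x"
  by (auto simp: EN_iff)

lemmas A_closed = EN_closed[OF A_EN] and A_add = EN_add[OF A_EN] and A_left = EN_left[OF A_EN]

lemma A_right: "\<lbrakk>\<alpha> \<in> carrier A; n \<in> carrier N; x \<in> carrier M\<rbrakk> \<Longrightarrow> \<alpha> (x \<otimes>\<^bsub>M\<^esub> \<phi> n) = \<alpha> x \<otimes>\<^bsub>M\<^esub> \<phi> n"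
  by (simp add: A_iff)

lemma EN_smult: "\<lbrakk>\<xi> \<in> carrier EN; k \<in> carrier K; x \<in> carrier M\<rbrakk> \<Longrightarrow> \<xi> (k \<odot>\<^bsub>M\<^esub> x) = k \<odot>\<^bsub>M\<^esub> \<xi> x"
  by (simp add: smult_eq_phi(1) EN_left EN_closed)

lemmas A_smult = EN_smult[OF A_EN]

lemma EN_additive: "\<xi> \<in> carrier EN \<Longrightarrow> additive_map M M \<xi>"
  by (simp add: additive_map_def EN_closed EN_add)

lemmas A_additive = EN_additive[OF A_EN]

lemma EN_PiE: "\<xi> \<in> carrier EN \<Longrightarrow> \<xi> \<in> carrier M \<rightarrow>\<^sub>E carrier M"
  by (simp add: EN_iff)

lemmas A_PiE = EN_PiE[OF A_EN]

lemma EN_eqI: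
  assumes "\<xi> \<in> carrier EN" "\<eta> \<in> carrier EN" "\<And>m. m \<in> carrier M \<Longrightarrow> \<xi> m = \<eta> m"
  shows "\<xi> = \<eta>"
  using assms by (intro extensionalityI[of _ "carrier M"]) (auto simp: EN_iff PiE_def)

lemmas A_eqI = EN_eqI[OF A_EN A_EN]

lemma A_simps [simp]:
  "\<alpha> \<otimes>\<^bsub>A\<^esub> \<beta> = compose (carrier M) \<alpha> \<beta>" "\<one>\<^bsub>A\<^esub> = (\<lambda>m \<in> carrier M. m)" "\<zero>\<^bsub>A\<^esub> = (\<lambda>m \<in> carrier M. \<zero>\<^bsub>M\<^esub>)"
  "\<alpha> \<oplus>\<^bsub>A\<^esub> \<beta> = (\<lambda>m \<in> carrier M. \<alpha> m \<oplus>\<^bsub>M\<^esub> \<beta> m)" "k \<odot>\<^bsub>A\<^esub> \<alpha> = (\<lambda>m \<in> carrier M. k \<odot>\<^bsub>M\<^esub> \<alpha> m)"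
  by (simp_all add: End_NN_def)

lemma EN_simps [simp]:
  "\<alpha> \<otimes>\<^bsub>EN\<^esub> \<beta> = compose (carrier M) \<alpha> \<beta>" "\<one>\<^bsub>EN\<^esub> = (\<lambda>m \<in> carrier M. m)" "\<zero>\<^bsub>EN\<^esub> = (\<lambda>m \<in> carrier M. \<zero>\<^bsub>M\<^esub>)"
  "\<alpha> \<oplus>\<^bsub>EN\<^esub> \<beta> = (\<lambda>m \<in> carrier M. \<alpha> m \<oplus>\<^bsub>M\<^esub> \<beta> m)" "k \<odot>\<^bsub>EN\<^esub> \<alpha> = (\<lambda>m \<in> carrier M. k \<odot>\<^bsub>M\<^esub> \<alpha> m)"
  by (simp_all add: End_N_def)

lemma smult_mult_M:
  assumes "k \<in> carrier K" "x \<in> carrier M" "y \<in> carrier M"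
  shows "k \<odot>\<^bsub>M\<^esub> (x \<otimes>\<^bsub>M\<^esub> y) = x \<otimes>\<^bsub>M\<^esub> (k \<odot>\<^bsub>M\<^esub> y)" "k \<odot>\<^bsub>M\<^esub> (x \<otimes>\<^bsub>M\<^esub> y) = k \<odot>\<^bsub>M\<^esub> x \<otimes>\<^bsub>M\<^esub> y"
  using assms by (simp_all add: M.smult_mult_left M.smult_mult_right)

lemma EN_ops:
  assumes "\<xi> \<in> carrier EN" "\<eta> \<in> carrier EN" "k \<in> carrier K"
  shows "(\<lambda>m \<in> carrier M. \<zero>\<^bsub>M\<^esub>) \<in> carrier EN" "(\<lambda>m \<in> carrier M. m) \<in> carrier EN"
    "(\<lambda>m \<in> carrier M. \<xi> m \<oplus>\<^bsub>M\<^esub> \<eta> m) \<in> carrier EN" "compose (carrier M) \<xi> \<eta> \<in> carrier EN"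
    "(\<lambda>m \<in> carrier M. k \<odot>\<^bsub>M\<^esub> \<xi> m) \<in> carrier EN"
  using assms(3) EN_closed[OF assms(1)] EN_closed[OF assms(2)] EN_add[OF assms(1)] EN_add[OF assms(2)]
    EN_left[OF assms(1)] EN_left[OF assms(2)]
  by (auto simp: EN_iff compose_def M.a_ac M.r_distr M.smult_r_distr smult_mult_M(1))

lemma A_ops:
  assumes "\<xi> \<in> carrier A" "\<eta> \<in> carrier A" "k \<in> carrier K"
  shows "(\<lambda>m \<in> carrier M. \<zero>\<^bsub>M\<^esub>) \<in> carrier A" "(\<lambda>m \<in> carrier M. m) \<in> carrier A"
    "(\<lambda>m \<in> carrier M. \<xi> m \<oplus>\<^bsub>M\<^esub> \<eta> m) \<in> carrier A" "compose (carrier M) \<xi> \<eta> \<in> carrier A"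
    "(\<lambda>m \<in> carrier M. k \<odot>\<^bsub>M\<^esub> \<xi> m) \<in> carrier A"
proof -
  have split: "f \<in> carrier A" if "f \<in> carrier EN"
    "\<And>n x. \<lbrakk>n \<in> carrier N; x \<in> carrier M\<rbrakk> \<Longrightarrow> f (x \<otimes>\<^bsub>M\<^esub> \<phi> n) = f x \<otimes>\<^bsub>M\<^esub> \<phi> n" for f
    using that by (simp add: A_iff EN_iff)
  note ops = EN_ops[OF A_EN[OF assms(1)] A_EN[OF assms(2)] assms(3)]
  show "(\<lambda>m \<in> carrier M. \<zero>\<^bsub>M\<^esub>) \<in> carrier A" "(\<lambda>m \<in> carrier M. m) \<in> carrier A"
    "(\<lambda>m \<in> carrier M. \<xi> m \<oplus>\<^bsub>M\<^esub> \<eta> m) \<in> carrier A" "compose (carrier M) \<xi> \<eta> \<in> carrier A"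
    "(\<lambda>m \<in> carrier M. k \<odot>\<^bsub>M\<^esub> \<xi> m) \<in> carrier A"
    by (intro split ops;
      use assms A_closed[OF assms(1)] A_closed[OF assms(2)] A_right[OF assms(1)] A_right[OF assms(2)] in
        \<open>simp add: compose_def M.l_distr smult_mult_M(2)\<close>)+
qed

lemma A_nonempty: "(\<lambda>m \<in> carrier M. m) \<in> carrier A" "(\<lambda>m \<in> carrier M. \<zero>\<^bsub>M\<^esub>) \<in> carrier A"
  by (auto simp: A_iff)

lemma assoc_algebra_EN: "assoc_algebra K EN"
proof -
  have "assoc_algebra K (endo_algebra M (carrier EN))"
  proof (rule assoc_algebra_endo_algebra)
    show "module K M" by (rule M.module_axioms)
    show "carrier EN \<subseteq> linear_maps K M M"
      using EN_PiE EN_add EN_smult unfolding linear_maps_def by blast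
  qed (simp_all add: A_EN[OF A_nonempty(2)] A_EN[OF A_nonempty(1)] EN_ops EN_ops(3,4)[OF _ _ N.R.one_closed])
  then show ?thesis by (simp add: End_N_def)
qed

lemma assoc_algebra_A: "assoc_algebra K A"
proof -
  have "assoc_algebra K (endo_algebra M (carrier A))"
  proof (rule assoc_algebra_endo_algebra)
    show "module K M" by (rule M.module_axioms)
    show "carrier A \<subseteq> linear_maps K M M"
      using A_PiE A_add A_smult unfolding linear_maps_def by blast
  qed (simp_all add: A_nonempty(2) A_nonempty(1) A_ops A_ops(3,4)[OF _ _ N.R.one_closed])
  then show ?thesis by (simp add: End_NN_def)
qed

sublocale A: assoc_algebra K A by (rule assoc_algebra_A)
sublocale EN: assoc_algebra K EN by (rule assoc_algebra_EN)

lemma A_eval_additive: "m \<in> carrier M \<Longrightarrow> additive_map A M (\<lambda>\<alpha>. \<alpha> m)"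
  by (simp add: additive_map_def A_closed)

subsection \<open>The centralizer of the tensor square\<close>

abbreviation (input) "B \<equiv> tensor_square_centralizer N M \<phi>"

lemma B_iff: "b \<in> carrier B \<longleftrightarrow> b \<in> carrier T \<and> (\<forall>n \<in> carrier N. \<phi> n \<triangleright> b = b \<triangleleft> \<phi> n)"
  by (simp add: tensor_square_centralizer_def Let_def)

lemma B_T: "b \<in> carrier B \<Longrightarrow> b \<in> carrier T"
  by (simp add: B_iff)

lemma B_simps:
  "\<one>\<^bsub>B\<^esub> = \<one>\<^bsub>M\<^esub> \<otimes>N \<one>\<^bsub>M\<^esub>" "\<zero>\<^bsub>B\<^esub> = \<zero>\<^bsub>T\<^esub>" "ring.add B = ring.add T" "k \<odot>\<^bsub>B\<^esub> b = (k \<odot>\<^bsub>M\<^esub> \<one>\<^bsub>M\<^esub>) \<triangleright> b"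
  by (simp_all add: tensor_square_centralizer_def Let_def)

text \<open>The condition n b = b n in the form needed inside lifts: an element of N can be moved
  from the front of the first leg to the end of the second.\<close>

lemma B_lift_invariant:
  assumes "b \<in> carrier B" "n \<in> carrier N" "abelian_group G" "balN G f"
  shows "tensor_lift G (\<lambda>x y. f (\<phi> n \<otimes>\<^bsub>M\<^esub> x) y) b = tensor_lift G (\<lambda>x y. f x (y \<otimes>\<^bsub>M\<^esub> \<phi> n)) b"
  using assms
  by (simp flip: lift_left_mult lift_right_mult add: B_iff)

lemma scalar_closed [simp]: "k \<in> carrier K \<Longrightarrow> k \<odot>\<^bsub>M\<^esub> \<one>\<^bsub>M\<^esub> \<in> carrier M"
  by simp

lemma scalar_comm:
  "\<lbrakk>k \<in> carrier K; m \<in> carrier M\<rbrakk> \<Longrightarrow> m \<otimes>\<^bsub>M\<^esub> (k \<odot>\<^bsub>M\<^esub> \<one>\<^bsub>M\<^esub>) = (k \<odot>\<^bsub>M\<^esub> \<one>\<^bsub>M\<^esub>) \<otimes>\<^bsub>M\<^esub> m"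
  by (simp add: M.smult_mult_left M.smult_mult_right)

lemma B_smult_closed:
  assumes "k \<in> carrier K" "b \<in> carrier B"
  shows "(k \<odot>\<^bsub>M\<^esub> \<one>\<^bsub>M\<^esub>) \<triangleright> b \<in> carrier B"
proof -
  have b: "b \<in> carrier T" using assms by (simp add: B_T)
  have "\<phi> n \<triangleright> (k \<odot>\<^bsub>M\<^esub> \<one>\<^bsub>M\<^esub>) \<triangleright> b = ((k \<odot>\<^bsub>M\<^esub> \<one>\<^bsub>M\<^esub>) \<triangleright> b) \<triangleleft> \<phi> n" if n: "n \<in> carrier N" for n
  proof -
    have "\<phi> n \<triangleright> (k \<odot>\<^bsub>M\<^esub> \<one>\<^bsub>M\<^esub>) \<triangleright> b = (k \<odot>\<^bsub>M\<^esub> \<one>\<^bsub>M\<^esub>) \<otimes>\<^bsub>M\<^esub> \<phi> n \<triangleright> b"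
      using assms b n by (simp only: left_mult_assoc[symmetric] scalar_closed phi_closed scalar_comm)
    also have "\<dots> = (k \<odot>\<^bsub>M\<^esub> \<one>\<^bsub>M\<^esub>) \<triangleright> (b \<triangleleft> \<phi> n)"
      using assms b n by (simp only: left_mult_assoc scalar_closed phi_closed B_iff)
    finally show ?thesis using assms b n by (simp only: left_right_mult scalar_closed phi_closed)
  qed
  then show ?thesis using assms b by (simp add: B_iff left_mult_closed)
qed

lemma abelian_B: "abelian_group B"
proof (rule abelian_groupI)
  fix b assume b: "b \<in> carrier B"
  \<comment> \<open>Negation in B is multiplication by the scalar -1, which preserves B because
    scalars are central in M.\<close>
  have m1: "\<ominus>\<^bsub>K\<^esub> \<one>\<^bsub>K\<^esub> \<in> carrier K" by simp
  have "((\<ominus>\<^bsub>K\<^esub> \<one>\<^bsub>K\<^esub>) \<odot>\<^bsub>M\<^esub> \<one>\<^bsub>M\<^esub>) \<triangleright> b \<oplus>\<^bsub>T\<^esub> b = ((\<ominus>\<^bsub>K\<^esub> \<one>\<^bsub>K\<^esub>) \<odot>\<^bsub>M\<^esub> \<one>\<^bsub>M\<^esub> \<oplus>\<^bsub>M\<^esub> \<one>\<^bsub>M\<^esub>) \<triangleright> b"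
    using b m1 additive_map_add[OF left_mult_additive_left[OF B_T[OF b]], of "(\<ominus>\<^bsub>K\<^esub> \<one>\<^bsub>K\<^esub>) \<odot>\<^bsub>M\<^esub> \<one>\<^bsub>M\<^esub>" "\<one>\<^bsub>M\<^esub>"]
    by (simp add: left_mult_one B_T)
  also have "\<dots> = \<zero>\<^bsub>T\<^esub>"
    using additive_map_zero[OF abelian_M abelian_T left_mult_additive_left[OF B_T[OF b]]]
    by (simp add: M.smult_l_minus M.l_neg)
  finally show "\<exists>y \<in> carrier B. y \<oplus>\<^bsub>B\<^esub> b = \<zero>\<^bsub>B\<^esub>"
    using B_smult_closed[OF m1 b] by (auto simp: B_simps)
qed (auto simp: B_simps B_iff tensor.T.a_ac additive_map_zero[OF abelian_T abelian_T left_mult_additive]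
    additive_map_zero[OF abelian_T abelian_T right_mult_additive]
    additive_map_add[OF left_mult_additive] additive_map_add[OF right_mult_additive])

lemma B_inclusion: "additive_map B T (\<lambda>b. b)"
  by (simp add: additive_map_def B_T B_simps)

lemma B_finsum:
  assumes "\<And>i. i \<in> I \<Longrightarrow> b i \<in> carrier B"
  shows "finsum B b I = finsum T b I"
  by (rule additive_map_finsum[OF abelian_B abelian_T B_inclusion assms])

text \<open>\<open>ins b t\<close> is t^1 b^1 (x) b^2 t^2: b is inserted between the legs of t. It
  extends multiplication by b from B to all of M (x) M, so that identities may be checked on pure
  tensors; n b = b n makes it balanced.\<close>

definition ins :: "('m \<times> 'm \<Rightarrow>\<^sub>0 int) set \<Rightarrow> ('m \<times> 'm \<Rightarrow>\<^sub>0 int) set \<Rightarrow> ('m \<times> 'm \<Rightarrow>\<^sub>0 int) set" where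
  "ins b = tensor_lift T (\<lambda>u v. u \<triangleright> b \<triangleleft> v)"

lemma balN_ins: "b \<in> carrier B \<Longrightarrow> balN T (\<lambda>u v. u \<triangleright> b \<triangleleft> v)"
  using B_T[of b]
  by (intro balNI)
    (simp_all add: left_mult_closed right_mult_closed additive_map_add[OF left_mult_additive_left]
      additive_map_add[OF right_mult_additive_right] additive_map_add[OF right_mult_additive]
      additive_map_add[OF left_mult_additive] left_mult_assoc right_mult_assoc left_right_mult B_iff)

lemma ins_additive: "b \<in> carrier B \<Longrightarrow> additive_map T T (ins b)"
  unfolding ins_def by (rule tensor.additive_map_lift[OF abelian_T balN_ins])

lemma ins_closed: "\<lbrakk>b \<in> carrier B; t \<in> carrier T\<rbrakk> \<Longrightarrow> ins b t \<in> carrier T"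
  by (rule additive_map_closed[OF ins_additive])

lemma ins_tens: "\<lbrakk>b \<in> carrier B; x \<in> carrier M; y \<in> carrier M\<rbrakk> \<Longrightarrow> ins b (x \<otimes>N y) = x \<triangleright> b \<triangleleft> y"
  unfolding ins_def by (rule lift_tens[OF abelian_T balN_ins])

text \<open>Insertion takes place between the legs and does not disturb outer factors. So
  \<open>ins b\<close> is an M-M-bimodule endomorphism of M (x) M; it takes 1 (x) 1 to b, and B
  embeds in this way into these endomorphisms.\<close>

lemma ins_left_mult:
  assumes "b \<in> carrier B" "m \<in> carrier M" "t \<in> carrier T"
  shows "ins b (m \<triangleright> t) = m \<triangleright> ins b t"
  by (rule additive_map_eqI[OF additive_map_comp[OF left_mult_additive ins_additive]
        additive_map_comp[OF ins_additive left_mult_additive] assms(3)])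
    (use assms in \<open>simp_all add: ins_tens left_mult_tens left_mult_assoc left_right_mult B_T left_mult_closed
      right_mult_closed\<close>)

lemma ins_right_mult:
  assumes "b \<in> carrier B" "m \<in> carrier M" "t \<in> carrier T"
  shows "ins b (t \<triangleleft> m) = ins b t \<triangleleft> m"
  by (rule additive_map_eqI[OF additive_map_comp[OF right_mult_additive ins_additive]
        additive_map_comp[OF ins_additive right_mult_additive] assms(3)])
    (use assms in \<open>simp_all add: ins_tens right_mult_tens right_mult_assoc B_T left_mult_closed\<close>)

lemma ins_B: "\<lbrakk>b \<in> carrier B; b' \<in> carrier B\<rbrakk> \<Longrightarrow> ins b b' \<in> carrier B"
  by (simp add: B_iff[of "ins b b'"] B_iff[of b'] ins_closed flip: ins_left_mult ins_right_mult)

lemma mult_B: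
  assumes b: "b \<in> carrier B" and b': "b' \<in> carrier B"
  shows "b \<otimes>\<^bsub>B\<^esub> b' = ins b b'"
proof -
  have "b \<otimes>\<^bsub>B\<^esub> b' = tensor_lift T (\<lambda>u' v'. tensor_lift T (\<lambda>u v. u' \<otimes>\<^bsub>M\<^esub> u \<otimes>N v \<otimes>\<^bsub>M\<^esub> v') b) b'"
    by (simp add: tensor_square_centralizer_def Let_def)
  also have "\<dots> = ins b b'"
    unfolding ins_def
  proof (rule lift_cong[OF abelian_T B_T[OF b']])
    fix u v assume uv: "u \<in> carrier M" "v \<in> carrier M"
    show "tensor_lift T (\<lambda>x y. u \<otimes>\<^bsub>M\<^esub> x \<otimes>N y \<otimes>\<^bsub>M\<^esub> v) b = u \<triangleright> b \<triangleleft> v"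
      unfolding right_mult_eq
      using uv B_T[OF b] by (simp add: lift_left_mult abelian_T balN_right balN_tens)
    show "u \<triangleright> b \<triangleleft> v \<in> carrier T"
      using uv B_T[OF b] by (simp add: left_mult_closed right_mult_closed)
  qed
  finally show ?thesis .
qed

lemma ins_ins:
  assumes "b \<in> carrier B" "b' \<in> carrier B" "t \<in> carrier T"
  shows "ins (ins b b') t = ins b (ins b' t)"
  by (rule additive_map_eqI[OF ins_additive additive_map_comp[OF ins_additive ins_additive] assms(3)])
    (use assms in \<open>simp_all add: ins_B ins_tens ins_left_mult ins_right_mult B_T left_mult_closed\<close>)

lemma ins_add:
  assumes "b \<in> carrier B" "b' \<in> carrier B" "t \<in> carrier T"
  shows "ins (b \<oplus>\<^bsub>T\<^esub> b') t = ins b t \<oplus>\<^bsub>T\<^esub> ins b' t"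
proof -
  have "b \<oplus>\<^bsub>T\<^esub> b' \<in> carrier B"
    using abelian_groupE(1)[OF abelian_B assms(1,2)] by (simp add: B_simps)
  then show ?thesis
    by (intro additive_map_eqI[OF ins_additive additive_map_sum[OF abelian_T ins_additive ins_additive] assms(3)])
      (use assms in \<open>simp_all add: ins_tens additive_map_add[OF left_mult_additive]
        additive_map_add[OF right_mult_additive] B_T left_mult_closed\<close>)
qed

lemma one_B: "\<one>\<^bsub>M\<^esub> \<otimes>N \<one>\<^bsub>M\<^esub> \<in> carrier B"
  using tens_balanced[of "\<one>\<^bsub>M\<^esub>" _ "\<one>\<^bsub>M\<^esub>"]
  by (simp add: B_iff tens_closed left_mult_tens right_mult_tens)

lemma ins_one: "t \<in> carrier T \<Longrightarrow> ins (\<one>\<^bsub>M\<^esub> \<otimes>N \<one>\<^bsub>M\<^esub>) t = t"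
  by (rule additive_map_eqI[OF ins_additive[OF one_B], of "\<lambda>t. t"])
    (simp_all add: additive_map_def ins_tens one_B left_mult_tens right_mult_tens)

lemma ins_one_right: "b \<in> carrier B \<Longrightarrow> ins b (\<one>\<^bsub>M\<^esub> \<otimes>N \<one>\<^bsub>M\<^esub>) = b"
  by (simp add: ins_tens left_mult_one right_mult_one B_T)

text \<open>B acts on M (x) M by \<open>ins\<close>, with product going to composition. The action
  is faithful because \<open>ins b\<close> recovers b at 1 (x) 1.\<close>

lemma assoc_algebra_B: "assoc_algebra K B"
proof (intro assoc_algebra.intro assoc_algebra_axioms.intro)
  show "module K B"
    by (rule moduleI[OF N.R.cring_axioms abelian_B])
      (auto simp: B_simps B_smult_closed B_T additive_map_add[OF left_mult_additive]
        M.smult_l_distr additive_map_add[OF left_mult_additive_left] left_mult_one M.smult_assoc1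
        M.smult_mult_left simp flip: left_mult_assoc)
  have faithful: "b = b'" if "b \<in> carrier B" "b' \<in> carrier B" "\<And>t. t \<in> carrier T \<Longrightarrow> ins b t = ins b' t" for b b'
    using that(3)[OF B_T[OF one_B]] by (simp add: ins_one_right that)
  show "ring B"
    by (rule ring_of_faithful_action[OF abelian_B abelian_T, where F = ins, OF _ _ _ _ _ _ faithful])
      (simp_all add: mult_B ins_B B_simps one_B ins_additive ins_add ins_ins ins_one)
  fix k b b' assume *: "k \<in> carrier K" "b \<in> carrier B" "b' \<in> carrier B"
  then show "b \<otimes>\<^bsub>B\<^esub> (k \<odot>\<^bsub>B\<^esub> b') = k \<odot>\<^bsub>B\<^esub> (b \<otimes>\<^bsub>B\<^esub> b')"
    by (simp add: mult_B B_simps B_smult_closed ins_left_mult B_T)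
  have "ins ((k \<odot>\<^bsub>M\<^esub> \<one>\<^bsub>M\<^esub>) \<triangleright> b) t = (k \<odot>\<^bsub>M\<^esub> \<one>\<^bsub>M\<^esub>) \<triangleright> ins b t" if "t \<in> carrier T" for t
    by (rule additive_map_eqI[OF ins_additive additive_map_comp[OF ins_additive left_mult_additive] that])
      (use * in \<open>simp_all add: B_smult_closed ins_tens left_mult_closed right_mult_closed B_T
        scalar_comm flip: left_mult_assoc left_right_mult\<close>)
  then show "(k \<odot>\<^bsub>B\<^esub> b) \<otimes>\<^bsub>B\<^esub> b' = k \<odot>\<^bsub>B\<^esub> (b \<otimes>\<^bsub>B\<^esub> b')"
    using * by (simp add: mult_B B_simps B_smult_closed B_T)
qed

sublocale B: assoc_algebra K B by (rule assoc_algebra_B)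

section \<open>Tensors acting on endomorphisms\<close>

lemma balN_A_EN: "\<lbrakk>\<alpha> \<in> carrier A; \<xi> \<in> carrier EN\<rbrakk> \<Longrightarrow> balN M (\<lambda>u v. \<alpha> u \<otimes>\<^bsub>M\<^esub> \<xi> v)"
  by (rule balNI)
    (simp_all add: A_closed EN_closed A_add EN_add M.l_distr M.r_distr A_right EN_left M.m_assoc)

lemma balN_EN: "\<xi> \<in> carrier EN \<Longrightarrow> balN M (\<lambda>u v. u \<otimes>\<^bsub>M\<^esub> \<xi> v)"
  by (rule balNI) (simp_all add: EN_closed EN_add M.l_distr M.r_distr EN_left M.m_assoc)

lemma balN_A: "\<alpha> \<in> carrier A \<Longrightarrow> balN M (\<lambda>u v. \<alpha> u \<otimes>\<^bsub>M\<^esub> v)"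
  by (rule balNI) (simp_all add: A_closed A_add M.l_distr M.r_distr A_right M.m_assoc)

lemma balN_EN_translate: "\<lbrakk>\<xi> \<in> carrier EN; m \<in> carrier M\<rbrakk> \<Longrightarrow> balN M (\<lambda>u v. u \<otimes>\<^bsub>M\<^esub> \<xi> (v \<otimes>\<^bsub>M\<^esub> m))"
  by (rule balNI) (simp_all add: EN_closed EN_add M.l_distr M.r_distr EN_left M.m_assoc)

text \<open>\<open>act \<xi> t m\<close> is t^1 \<xi>(t^2 m), for arbitrary t and without
  restriction to the carrier. It unifies three things: on t in B the right action on End(_N M), at m
  = 1 the pairing, and with \<xi> a Frobenius homomorphism the operators of the basic
  construction.\<close>

definition act :: "('m \<Rightarrow> 'm) \<Rightarrow> ('m \<times> 'm \<Rightarrow>\<^sub>0 int) set \<Rightarrow> 'm \<Rightarrow> 'm" where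
  "act \<xi> b m = tensor_lift M (\<lambda>u v. u \<otimes>\<^bsub>M\<^esub> \<xi> (v \<otimes>\<^bsub>M\<^esub> m)) b"

lemma act_closed: "\<lbrakk>\<xi> \<in> carrier EN; t \<in> carrier T; m \<in> carrier M\<rbrakk> \<Longrightarrow> act \<xi> t m \<in> carrier M"
  unfolding act_def by (rule tensor.lift_closed[OF abelian_M balN_EN_translate])

lemma act_additive: "\<lbrakk>\<xi> \<in> carrier EN; m \<in> carrier M\<rbrakk> \<Longrightarrow> additive_map T M (\<lambda>t. act \<xi> t m)"
  unfolding act_def by (rule tensor.additive_map_lift[OF abelian_M balN_EN_translate])

lemma act_additive_right: "\<lbrakk>\<xi> \<in> carrier EN; t \<in> carrier T\<rbrakk> \<Longrightarrow> additive_map M M (act \<xi> t)"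
  unfolding act_def
  by (rule tensor.additive_map_lift_param[OF abelian_M _ balN_EN_translate])
    (simp_all add: additive_map_def EN_closed EN_add M.r_distr abelian_M)

lemma act_additive_left: "\<lbrakk>t \<in> carrier T; m \<in> carrier M\<rbrakk> \<Longrightarrow> additive_map EN M (\<lambda>\<xi>. act \<xi> t m)"
  unfolding act_def
  by (rule tensor.additive_map_lift_param[OF abelian_M _ balN_EN_translate])
    (simp_all add: additive_map_def EN_closed M.r_distr EN.abelian_group_axioms del: EN_simps,
      simp add: EN_closed M.r_distr)

lemma act_tens: "\<lbrakk>\<xi> \<in> carrier EN; m \<in> carrier M; x \<in> carrier M; y \<in> carrier M\<rbrakk>
    \<Longrightarrow> act \<xi> (x \<otimes>N y) m = x \<otimes>\<^bsub>M\<^esub> \<xi> (y \<otimes>\<^bsub>M\<^esub> m)"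
  unfolding act_def by (rule lift_tens[OF abelian_M balN_EN_translate])

lemma act_left_mult:
  assumes "\<xi> \<in> carrier EN" "m \<in> carrier M" "x \<in> carrier M" "t \<in> carrier T"
  shows "act \<xi> (x \<triangleright> t) m = x \<otimes>\<^bsub>M\<^esub> act \<xi> t m"
  by (rule additive_map_eqI[OF additive_map_comp[OF left_mult_additive act_additive]
        additive_map_comp[OF act_additive] assms(4)])
    (use assms in \<open>auto simp: additive_map_def M.r_distr left_mult_tens act_tens EN_closed M.m_assoc\<close>)

lemma act_right_mult:
  assumes "\<xi> \<in> carrier EN" "m \<in> carrier M" "x \<in> carrier M" "t \<in> carrier T"
  shows "act \<xi> (t \<triangleleft> x) m = act \<xi> t (x \<otimes>\<^bsub>M\<^esub> m)"
  by (rule additive_map_eqI[OF additive_map_comp[OF right_mult_additive act_additive]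
        act_additive assms(4)])
    (use assms in \<open>auto simp: right_mult_tens act_tens M.m_assoc\<close>)

text \<open>For b in B, t^2 n is traded for n t^1: act \<xi> b (n m) = act \<xi> (b n) m = act \<xi>
  (n b) m = n act \<xi> b m.\<close>

lemma act_EN:
  assumes "\<xi> \<in> carrier EN" "b \<in> carrier B"
  shows "(\<lambda>m \<in> carrier M. act \<xi> b m) \<in> carrier EN"
  using assms additive_map_add[OF act_additive_right[OF assms(1) B_T[OF assms(2)]]]
  by (auto simp: EN_iff[of "restrict _ _"] act_closed B_T)
    (metis B_iff act_left_mult act_right_mult phi_closed)

lemma act_A:
  assumes "\<alpha> \<in> carrier A" "b \<in> carrier B"
  shows "(\<lambda>m \<in> carrier M. act \<alpha> b m) \<in> carrier A"
proof -
  have "act \<alpha> b (x \<otimes>\<^bsub>M\<^esub> \<phi> n) = act \<alpha> b x \<otimes>\<^bsub>M\<^esub> \<phi> n" if "x \<in> carrier M" "n \<in> carrier N" for x n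
  proof (rule additive_map_eqI[OF act_additive _ B_T[OF assms(2)]])
    show "additive_map T M (\<lambda>t. act \<alpha> t x \<otimes>\<^bsub>M\<^esub> \<phi> n)"
      using that by (intro additive_map_comp[OF act_additive[OF A_EN[OF assms(1)]] M.additive_map_scale(2)]) simp_all
  qed (use assms that in \<open>simp_all add: A_EN act_tens A_closed A_right M.m_assoc[symmetric]\<close>)
  then show ?thesis
    using act_EN[OF A_EN[OF assms(1)] assms(2)] by (simp add: A_iff EN_iff)
qed

text \<open>On a pure tensor x (x) y both sides are x b^1 \<xi>(b^2 y m). For t in B this is the law
  for a right action, because \<open>ins b t\<close> is then the product b t.\<close>

lemma act_ins:
  assumes "\<xi> \<in> carrier EN" "b \<in> carrier B" "t \<in> carrier T" "m \<in> carrier M"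
  shows "act \<xi> (ins b t) m = act (\<lambda>m \<in> carrier M. act \<xi> b m) t m"
  by (rule additive_map_eqI[OF additive_map_comp[OF ins_additive act_additive]
        act_additive assms(3)])
    (use assms in \<open>simp_all add: act_EN ins_tens act_tens act_left_mult act_right_mult left_mult_closed B_T\<close>)

end

section \<open>Irreducible extensions\<close>

locale irreducible_alg_extension = alg_extension K N M \<phi>
  for K :: "('k, 'u) ring_scheme" and N :: "('k, 'n, 'v) module_scheme"
    and M :: "('k, 'm, 'w) module_scheme" and \<phi> :: "'n \<Rightarrow> 'm" +
  assumes irreducible: "irreducible_extension K N M \<phi>"
begin

abbreviation (input) "R \<equiv> centralizer N M \<phi>"
abbreviation \<iota> where "\<iota> k \<equiv> k \<odot>\<^bsub>M\<^esub> \<one>\<^bsub>M\<^esub>"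
abbreviation (input) "\<sigma> \<equiv> scalar_of K M"
abbreviation (input) "pr \<equiv> pairing K M"

text \<open>Identities between scalars are verified after embedding K into M, where the pairing
  becomes the honest element b^1 \<alpha>(b^2).\<close>

lemma iota_inj: "\<lbrakk>\<iota> k = \<iota> l; k \<in> carrier K; l \<in> carrier K\<rbrakk> \<Longrightarrow> k = l"
  using irreducible by (auto simp: irreducible_extension_def dest: inj_onD)

lemma scalar_iota: "k \<in> carrier K \<Longrightarrow> \<sigma> (\<iota> k) = k"
  using irreducible the_inv_into_f_f[of \<iota> "carrier K" k] by (simp add: irreducible_extension_def scalar_of_def)

lemma R_iota: "R = \<iota> ` carrier K"
  using irreducible by (simp add: irreducible_extension_def)

lemma scalar_in_K: "r \<in> R \<Longrightarrow> \<sigma> r \<in> carrier K" and iota_scalar: "r \<in> R \<Longrightarrow> \<iota> (\<sigma> r) = r"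
  by (auto simp: R_iota scalar_iota)

lemma R_closed: "r \<in> R \<Longrightarrow> r \<in> carrier M"
  by (auto simp: centralizer_def)

lemma scalar_smult: "\<lbrakk>r \<in> R; m \<in> carrier M\<rbrakk> \<Longrightarrow> \<sigma> r \<odot>\<^bsub>M\<^esub> m = r \<otimes>\<^bsub>M\<^esub> m"
  by (auto simp: R_iota scalar_iota M.smult_mult_left)

lemma R_comm: "\<lbrakk>r \<in> R; m \<in> carrier M\<rbrakk> \<Longrightarrow> m \<otimes>\<^bsub>M\<^esub> r = r \<otimes>\<^bsub>M\<^esub> m"
  by (auto simp: R_iota scalar_comm)

text \<open>By irreducibility a centralizing element is a scalar, and N-linear maps are
  K-linear.\<close>

lemma EN_R: "\<lbrakk>\<xi> \<in> carrier EN; r \<in> R; m \<in> carrier M\<rbrakk> \<Longrightarrow> \<xi> (r \<otimes>\<^bsub>M\<^esub> m) = r \<otimes>\<^bsub>M\<^esub> \<xi> m"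
  by (auto simp: R_iota M.smult_mult_left EN_smult EN_closed)

lemma iota_mult: "\<lbrakk>k \<in> carrier K; l \<in> carrier K\<rbrakk> \<Longrightarrow> \<iota> (k \<otimes>\<^bsub>K\<^esub> l) = \<iota> k \<otimes>\<^bsub>M\<^esub> \<iota> l"
  by (simp add: M.smult_mult_left M.smult_assoc1)

lemma iota_additive: "additive_map K M \<iota>"
  by (simp add: additive_map_def M.smult_l_distr)

lemma abelian_K: "abelian_group K" ..

lemma A_one_R: "\<alpha> \<in> carrier A \<Longrightarrow> \<alpha> \<one>\<^bsub>M\<^esub> \<in> R"
  using A_left[of \<alpha> _ "\<one>\<^bsub>M\<^esub>"] A_right[of \<alpha> _ "\<one>\<^bsub>M\<^esub>"] by (simp add: centralizer_def A_closed)

lemma act_R: "\<lbrakk>\<alpha> \<in> carrier A; b \<in> carrier B\<rbrakk> \<Longrightarrow> act \<alpha> b \<one>\<^bsub>M\<^esub> \<in> R"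
  using A_one_R[OF act_A] by simp

lemma pairing_eq:
  assumes "\<alpha> \<in> carrier EN" "b \<in> carrier T"
  shows "pr b \<alpha> = \<sigma> (act \<alpha> b \<one>\<^bsub>M\<^esub>)"
proof -
  have "tensor_lift M (\<lambda>u v. u \<otimes>\<^bsub>M\<^esub> \<alpha> v) b = act \<alpha> b \<one>\<^bsub>M\<^esub>"
    unfolding act_def using assms by (intro lift_cong[OF abelian_M]) (simp_all add: EN_closed)
  then show ?thesis by (simp add: pairing_def)
qed

lemma pairing_closed [simp]: "\<lbrakk>b \<in> carrier B; \<alpha> \<in> carrier A\<rbrakk> \<Longrightarrow> pr b \<alpha> \<in> carrier K"
  by (simp add: pairing_eq A_EN B_T scalar_in_K act_R)

lemma iota_pairing: "\<lbrakk>b \<in> carrier B; \<alpha> \<in> carrier A\<rbrakk> \<Longrightarrow> \<iota> (pr b \<alpha>) = act \<alpha> b \<one>\<^bsub>M\<^esub>"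
  by (simp add: pairing_eq A_EN B_T iota_scalar act_R)

lemma pairing_smult: "\<lbrakk>b \<in> carrier B; \<alpha> \<in> carrier A; m \<in> carrier M\<rbrakk> \<Longrightarrow> pr b \<alpha> \<odot>\<^bsub>M\<^esub> m = act \<alpha> b \<one>\<^bsub>M\<^esub> \<otimes>\<^bsub>M\<^esub> m"
  by (simp add: pairing_eq A_EN B_T scalar_smult act_R)

lemma act_additive_A: "\<lbrakk>t \<in> carrier T; m \<in> carrier M\<rbrakk> \<Longrightarrow> additive_map A M (\<lambda>\<alpha>. act \<alpha> t m)"
  using act_additive_left[of t m] by (simp add: additive_map_def A_EN)

lemma act_smult:
  assumes "k \<in> carrier K" "\<alpha> \<in> carrier A" "t \<in> carrier T" "m \<in> carrier M"
  shows "act (k \<odot>\<^bsub>A\<^esub> \<alpha>) t m = k \<odot>\<^bsub>M\<^esub> act \<alpha> t m"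
proof (rule additive_map_eqI[OF act_additive _ assms(3)])
  show "k \<odot>\<^bsub>A\<^esub> \<alpha> \<in> carrier EN" using A.smult_closed[OF assms(1,2)] by (rule A_EN)
  show "additive_map T M (\<lambda>t. k \<odot>\<^bsub>M\<^esub> act \<alpha> t m)"
    using assms by (intro additive_map_comp[OF act_additive[OF A_EN]])
      (simp_all add: additive_map_def M.smult_r_distr)
next
  fix x y assume "x \<in> carrier M" "y \<in> carrier M"
  then show "act (k \<odot>\<^bsub>A\<^esub> \<alpha>) (x \<otimes>N y) m = k \<odot>\<^bsub>M\<^esub> act \<alpha> (x \<otimes>N y) m"
    using assms A.smult_closed[OF assms(1,2)]
    by (simp add: act_tens A_EN A_closed M.smult_mult_right)
qed (use assms in simp_all)

lemma pairing_additive_left: "\<alpha> \<in> carrier A \<Longrightarrow> additive_map B K (\<lambda>b. pr b \<alpha>)"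
proof (rule additive_mapI)
  fix b b' assume *: "\<alpha> \<in> carrier A" "b \<in> carrier B" "b' \<in> carrier B"
  then show "pr (b \<oplus>\<^bsub>B\<^esub> b') \<alpha> = pr b \<alpha> \<oplus>\<^bsub>K\<^esub> pr b' \<alpha>"
    using additive_map_add[OF act_additive[OF A_EN[OF *(1)] M.one_closed] B_T[OF *(2)] B_T[OF *(3)]]
    by (intro iota_inj) (simp_all add: iota_pairing additive_map_add[OF iota_additive], simp add: B_simps)
qed simp

lemma pairing_additive_right: "b \<in> carrier B \<Longrightarrow> additive_map A K (pr b)"
proof (rule additive_mapI)
  fix \<alpha> \<alpha>' assume *: "b \<in> carrier B" "\<alpha> \<in> carrier A" "\<alpha>' \<in> carrier A"
  then show "pr b (\<alpha> \<oplus>\<^bsub>A\<^esub> \<alpha>') = pr b \<alpha> \<oplus>\<^bsub>K\<^esub> pr b \<alpha>'"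
    using additive_map_add[OF act_additive_A[OF B_T[OF *(1)] M.one_closed] *(2,3)]
    by (intro iota_inj) (simp_all add: iota_pairing additive_map_add[OF iota_additive] A.a_closed del: A_simps)
qed simp

lemma pairing_smult_left: "\<lbrakk>k \<in> carrier K; b \<in> carrier B; \<alpha> \<in> carrier A\<rbrakk> \<Longrightarrow> pr (k \<odot>\<^bsub>B\<^esub> b) \<alpha> = k \<otimes>\<^bsub>K\<^esub> pr b \<alpha>"
  by (intro iota_inj) (simp_all add: iota_pairing iota_mult, simp add: B_simps act_left_mult A_EN B_T)

lemma pairing_smult_right: "\<lbrakk>k \<in> carrier K; b \<in> carrier B; \<alpha> \<in> carrier A\<rbrakk> \<Longrightarrow> pr b (k \<odot>\<^bsub>A\<^esub> \<alpha>) = k \<otimes>\<^bsub>K\<^esub> pr b \<alpha>"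
  by (intro iota_inj)
    (simp_all add: iota_pairing iota_mult act_smult B_T A.smult_closed M.smult_mult_left act_closed A_EN del: A_simps)

text \<open>For n in N, an N-N-bilinear f turns n f(b) into f(n b) = f(b n) = f(b) n. Applied to
  f(u, v) = \<alpha>(u) \<alpha>'(v), this makes the second pairing scalar-valued.\<close>

lemma central_lift:
  assumes b: "b \<in> carrier B" and f: "balN M f"
    and left: "\<And>n x y. \<lbrakk>n \<in> carrier N; x \<in> carrier M; y \<in> carrier M\<rbrakk> \<Longrightarrow> f (\<phi> n \<otimes>\<^bsub>M\<^esub> x) y = \<phi> n \<otimes>\<^bsub>M\<^esub> f x y"
    and right: "\<And>n x y. \<lbrakk>n \<in> carrier N; x \<in> carrier M; y \<in> carrier M\<rbrakk> \<Longrightarrow> f x (y \<otimes>\<^bsub>M\<^esub> \<phi> n) = f x y \<otimes>\<^bsub>M\<^esub> \<phi> n"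
  shows "tensor_lift M f b \<in> R"
proof -
  have "\<phi> n \<otimes>\<^bsub>M\<^esub> tensor_lift M f b = tensor_lift M f b \<otimes>\<^bsub>M\<^esub> \<phi> n" if n: "n \<in> carrier N" for n
  proof -
    have "\<phi> n \<otimes>\<^bsub>M\<^esub> tensor_lift M f b = tensor_lift M (\<lambda>x y. \<phi> n \<otimes>\<^bsub>M\<^esub> f x y) b"
      using n B_T[OF b] by (intro tensor.lift_comp[OF abelian_M abelian_M f] M.additive_map_scale) simp_all
    also have "\<dots> = tensor_lift M (\<lambda>x y. f (\<phi> n \<otimes>\<^bsub>M\<^esub> x) y) b"
      using n balN_closed[OF f] by (intro lift_cong[OF abelian_M B_T[OF b]]) (simp_all add: left)
    also have "\<dots> = tensor_lift M (\<lambda>x y. f x (y \<otimes>\<^bsub>M\<^esub> \<phi> n)) b"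
      by (rule B_lift_invariant[OF b n abelian_M f])
    also have "\<dots> = tensor_lift M (\<lambda>x y. f x y \<otimes>\<^bsub>M\<^esub> \<phi> n) b"
      using n balN_closed[OF f] by (intro lift_cong[OF abelian_M B_T[OF b]]) (simp_all add: right)
    also have "\<dots> = tensor_lift M f b \<otimes>\<^bsub>M\<^esub> \<phi> n"
      using n B_T[OF b] by (intro tensor.lift_comp[OF abelian_M abelian_M f, symmetric] M.additive_map_scale) simp_all
    finally show ?thesis .
  qed
  then show ?thesis
    using tensor.lift_closed[OF abelian_M f B_T[OF b]] by (simp add: centralizer_def)
qed

text \<open>\<alpha> (x) id on M (x) M; with \<alpha> = \<beta>_i it produces the second leg of
  \<Delta>B. Its companion \<open>rmap\<close> is id (x) \<alpha> and serves to move a composition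
  factor from A to the other side of the pairing.\<close>

definition lmap :: "('m \<Rightarrow> 'm) \<Rightarrow> ('m \<times> 'm \<Rightarrow>\<^sub>0 int) set \<Rightarrow> ('m \<times> 'm \<Rightarrow>\<^sub>0 int) set" where
  "lmap \<alpha> = tensor_lift T (\<lambda>u v. \<alpha> u \<otimes>N v)"

definition rmap :: "('m \<Rightarrow> 'm) \<Rightarrow> ('m \<times> 'm \<Rightarrow>\<^sub>0 int) set \<Rightarrow> ('m \<times> 'm \<Rightarrow>\<^sub>0 int) set" where
  "rmap \<alpha> = tensor_lift T (\<lambda>u v. u \<otimes>N \<alpha> v)"

lemma balN_lmap: "\<alpha> \<in> carrier A \<Longrightarrow> balN T (\<lambda>u v. \<alpha> u \<otimes>N v)"
  by (rule balNI) (simp_all add: A_closed tens_closed A_add tens_add_left tens_add_right A_right tens_balanced)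

lemma balN_rmap: "\<alpha> \<in> carrier A \<Longrightarrow> balN T (\<lambda>u v. u \<otimes>N \<alpha> v)"
  by (rule balNI) (simp_all add: A_closed tens_closed A_add tens_add_left tens_add_right A_left tens_balanced)

lemma lmap_additive: "\<alpha> \<in> carrier A \<Longrightarrow> additive_map T T (lmap \<alpha>)"
  unfolding lmap_def by (rule tensor.additive_map_lift[OF abelian_T balN_lmap])

lemma rmap_additive: "\<alpha> \<in> carrier A \<Longrightarrow> additive_map T T (rmap \<alpha>)"
  unfolding rmap_def by (rule tensor.additive_map_lift[OF abelian_T balN_rmap])

lemma lmap_tens: "\<lbrakk>\<alpha> \<in> carrier A; u \<in> carrier M; v \<in> carrier M\<rbrakk> \<Longrightarrow> lmap \<alpha> (u \<otimes>N v) = \<alpha> u \<otimes>N v"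
  unfolding lmap_def by (rule lift_tens[OF abelian_T balN_lmap])

lemma rmap_tens: "\<lbrakk>\<alpha> \<in> carrier A; u \<in> carrier M; v \<in> carrier M\<rbrakk> \<Longrightarrow> rmap \<alpha> (u \<otimes>N v) = u \<otimes>N \<alpha> v"
  unfolding rmap_def by (rule lift_tens[OF abelian_T balN_rmap])

lemma B_map_closed:
  assumes f: "additive_map T T f"
    and left: "\<And>n x y. \<lbrakk>n \<in> carrier N; x \<in> carrier M; y \<in> carrier M\<rbrakk> \<Longrightarrow> f (\<phi> n \<triangleright> (x \<otimes>N y)) = \<phi> n \<triangleright> f (x \<otimes>N y)"
    and right: "\<And>n x y. \<lbrakk>n \<in> carrier N; x \<in> carrier M; y \<in> carrier M\<rbrakk> \<Longrightarrow> f ((x \<otimes>N y) \<triangleleft> \<phi> n) = f (x \<otimes>N y) \<triangleleft> \<phi> n"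
    and b: "b \<in> carrier B"
  shows "f b \<in> carrier B"
proof -
  have "f (\<phi> n \<triangleright> b) = \<phi> n \<triangleright> f b" "f (b \<triangleleft> \<phi> n) = f b \<triangleleft> \<phi> n" if n: "n \<in> carrier N" for n
  proof -
    show "f (\<phi> n \<triangleright> b) = \<phi> n \<triangleright> f b"
      using n by (intro additive_map_eqI[OF additive_map_comp[OF left_mult_additive f]
            additive_map_comp[OF f left_mult_additive] B_T[OF b]] left) simp_all
    show "f (b \<triangleleft> \<phi> n) = f b \<triangleleft> \<phi> n"
      using n by (intro additive_map_eqI[OF additive_map_comp[OF right_mult_additive f]
            additive_map_comp[OF f right_mult_additive] B_T[OF b]] right) simp_all
  qed
  then show ?thesis
    using b additive_map_closed[OF f] by (simp add: B_iff[of "f b"] B_T) (metis B_iff)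
qed

lemma lmap_B: "\<lbrakk>\<alpha> \<in> carrier A; b \<in> carrier B\<rbrakk> \<Longrightarrow> lmap \<alpha> b \<in> carrier B"
  by (rule B_map_closed[OF lmap_additive])
    (simp_all add: left_mult_tens right_mult_tens lmap_tens A_left A_closed)

lemma rmap_B: "\<lbrakk>\<alpha> \<in> carrier A; b \<in> carrier B\<rbrakk> \<Longrightarrow> rmap \<alpha> b \<in> carrier B"
  by (rule B_map_closed[OF rmap_additive])
    (simp_all add: left_mult_tens right_mult_tens rmap_tens A_right A_closed)

section \<open>Consequences of factoring \<alpha>(m m') through A (x) A\<close>

sublocale AA: tensor_algebras K A A ..
sublocale BB: tensor_algebras K B B ..

text \<open>The M-valued integrands on A (x) A that occur below are mostly products of two such
  maps, one in each leg; \<open>balanced_AM\<close> then settles their balancedness at once.\<close>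

definition linear_AM :: "(('m \<Rightarrow> 'm) \<Rightarrow> 'm) \<Rightarrow> bool" where
  "linear_AM p \<longleftrightarrow> additive_map A M p \<and> (\<forall>k \<in> carrier K. \<forall>\<alpha> \<in> carrier A. p (k \<odot>\<^bsub>A\<^esub> \<alpha>) = k \<odot>\<^bsub>M\<^esub> p \<alpha>)"

lemma linear_AM_eval: "m \<in> carrier M \<Longrightarrow> linear_AM (\<lambda>\<alpha>. \<alpha> m)"
  by (simp add: linear_AM_def A_eval_additive)

lemma linear_AM_act: "\<lbrakk>t \<in> carrier T; m \<in> carrier M\<rbrakk> \<Longrightarrow> linear_AM (\<lambda>\<alpha>. act \<alpha> t m)"
  using act_smult by (simp add: linear_AM_def act_additive_A del: A_simps)

lemma balanced_AM:
  assumes p: "linear_AM p" and q: "linear_AM q"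
  shows "balanced_K K A A M (\<lambda>a1 a2. p a1 \<otimes>\<^bsub>M\<^esub> q a2)"
proof -
  have "p \<alpha> \<in> carrier M" "q \<alpha> \<in> carrier M" if "\<alpha> \<in> carrier A" for \<alpha>
    using p q that by (auto simp: linear_AM_def additive_map_def)
  then show ?thesis
    using p q by (intro AA.balanced_KI)
      (simp_all add: linear_AM_def additive_map_def M.l_distr M.r_distr M.smult_mult_left M.smult_mult_right del: A_simps)
qed

text \<open>On x (x) y the left side is x \<alpha>(y m) = x w_1(y) w_2(m), and x w_1(y) is the
  operator of w_1 evaluated at 1.\<close>

lemma act_factorization:
  assumes \<alpha>: "\<alpha> \<in> carrier A" and w: "w \<in> carrier (tensor_K K A A)"
    and fact: "\<And>m m'. \<lbrakk>m \<in> carrier M; m' \<in> carrier M\<rbrakk> \<Longrightarrow>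
      \<alpha> (m \<otimes>\<^bsub>M\<^esub> m') = tensor_lift M (\<lambda>a1 a2. a1 m \<otimes>\<^bsub>M\<^esub> a2 m') w"
    and t: "t \<in> carrier T" and m: "m \<in> carrier M"
  shows "act \<alpha> t m = tensor_lift M (\<lambda>a1 a2. act a1 t \<one>\<^bsub>M\<^esub> \<otimes>\<^bsub>M\<^esub> a2 m) w"
proof (rule additive_map_eqI[OF act_additive[OF A_EN[OF \<alpha>] m] _ t])
  show "additive_map T M (\<lambda>t. tensor_lift M (\<lambda>a1 a2. act a1 t \<one>\<^bsub>M\<^esub> \<otimes>\<^bsub>M\<^esub> a2 m) w)"
    using m by (intro AA.tensor.additive_map_lift_param[OF abelian_M w] balanced_AM linear_AM_act linear_AM_eval
        additive_map_comp[OF act_additive M.additive_map_scale(2)] abelian_T)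
      (simp_all add: A_EN A_closed)
  fix x y assume xy: "x \<in> carrier M" "y \<in> carrier M"
  have "act \<alpha> (x \<otimes>N y) m = x \<otimes>\<^bsub>M\<^esub> tensor_lift M (\<lambda>a1 a2. a1 y \<otimes>\<^bsub>M\<^esub> a2 m) w"
    using xy m \<alpha> by (simp add: act_tens A_EN fact)
  also have "\<dots> = tensor_lift M (\<lambda>a1 a2. x \<otimes>\<^bsub>M\<^esub> (a1 y \<otimes>\<^bsub>M\<^esub> a2 m)) w"
    using xy m by (intro AA.tensor.lift_comp[OF abelian_M abelian_M balanced_AM] linear_AM_eval
        M.additive_map_scale w)
  also have "\<dots> = tensor_lift M (\<lambda>a1 a2. act a1 (x \<otimes>N y) \<one>\<^bsub>M\<^esub> \<otimes>\<^bsub>M\<^esub> a2 m) w"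
    using xy m by (intro AA.lift_cong[OF abelian_M w]) (simp_all add: act_tens A_EN A_closed M.m_assoc)
  finally show "act \<alpha> (x \<otimes>N y) m = tensor_lift M (\<lambda>a1 a2. act a1 (x \<otimes>N y) \<one>\<^bsub>M\<^esub> \<otimes>\<^bsub>M\<^esub> a2 m) w" .
qed

text \<open>Here b b' has legs b'^1 b^1 and b^2 b'^2, so <b b', \<alpha>> = b'^1 <b, w_1> w_2(b'^2),
  and the central scalar moves to the front. The statement is for an arbitrary w so that it can be
  used both for a coproduct and for a product of two coproducts.\<close>

lemma pairing_factorization:
  assumes \<alpha>: "\<alpha> \<in> carrier A" and w: "w \<in> carrier (tensor_K K A A)"
    and fact: "\<And>m m'. \<lbrakk>m \<in> carrier M; m' \<in> carrier M\<rbrakk> \<Longrightarrow>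
      \<alpha> (m \<otimes>\<^bsub>M\<^esub> m') = tensor_lift M (\<lambda>a1 a2. a1 m \<otimes>\<^bsub>M\<^esub> a2 m') w"
    and b: "b \<in> carrier B" and b': "b' \<in> carrier B"
  shows "pr (b \<otimes>\<^bsub>B\<^esub> b') \<alpha> = tensor_lift K (\<lambda>a1 a2. pr b a1 \<otimes>\<^bsub>K\<^esub> pr b' a2) w"
proof (rule iota_inj)
  have bal: "balanced_K K A A K (\<lambda>a1 a2. pr b a1 \<otimes>\<^bsub>K\<^esub> pr b' a2)"
    using b b' by (intro AA.balanced_KI) (simp_all add: additive_map_add[OF pairing_additive_right] pairing_smult_right
        N.R.l_distr N.R.r_distr N.R.m_ac del: A_simps)
  let ?f = "\<lambda>m \<in> carrier M. act \<alpha> b m"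
  have "act ?f t \<one>\<^bsub>M\<^esub> = tensor_lift M (\<lambda>a1 a2. act a1 b \<one>\<^bsub>M\<^esub> \<otimes>\<^bsub>M\<^esub> act a2 t \<one>\<^bsub>M\<^esub>) w" if t: "t \<in> carrier T" for t
  proof (rule additive_map_eqI[OF act_additive _ t])
    show "?f \<in> carrier EN" using act_EN[OF A_EN[OF \<alpha>] b] .
    show "additive_map T M (\<lambda>t. tensor_lift M (\<lambda>a1 a2. act a1 b \<one>\<^bsub>M\<^esub> \<otimes>\<^bsub>M\<^esub> act a2 t \<one>\<^bsub>M\<^esub>) w)"
      using b by (intro AA.tensor.additive_map_lift_param[OF abelian_M w] balanced_AM linear_AM_act
          additive_map_comp[OF act_additive M.additive_map_scale(1)] abelian_T)
        (simp_all add: A_EN act_closed B_T)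
    fix x y assume xy: "x \<in> carrier M" "y \<in> carrier M"
    have "act ?f (x \<otimes>N y) \<one>\<^bsub>M\<^esub> = x \<otimes>\<^bsub>M\<^esub> tensor_lift M (\<lambda>a1 a2. act a1 b \<one>\<^bsub>M\<^esub> \<otimes>\<^bsub>M\<^esub> a2 y) w"
      using xy b by (simp add: act_tens act_EN[OF A_EN[OF \<alpha>] b] act_factorization[OF \<alpha> w fact] B_T)
    also have "\<dots> = tensor_lift M (\<lambda>a1 a2. x \<otimes>\<^bsub>M\<^esub> (act a1 b \<one>\<^bsub>M\<^esub> \<otimes>\<^bsub>M\<^esub> a2 y)) w"
      using xy b by (intro AA.tensor.lift_comp[OF abelian_M abelian_M balanced_AM] linear_AM_eval linear_AM_act
          M.additive_map_scale w) (simp_all add: B_T)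
    also have "\<dots> = tensor_lift M (\<lambda>a1 a2. act a1 b \<one>\<^bsub>M\<^esub> \<otimes>\<^bsub>M\<^esub> act a2 (x \<otimes>N y) \<one>\<^bsub>M\<^esub>) w"
    proof (rule AA.lift_cong[OF abelian_M w])
      fix a1 a2 assume a: "a1 \<in> carrier A" "a2 \<in> carrier A"
      \<comment> \<open>This is where centrality of b^1 a1(b^2) is used: it passes x.\<close>
      then have "x \<otimes>\<^bsub>M\<^esub> (act a1 b \<one>\<^bsub>M\<^esub> \<otimes>\<^bsub>M\<^esub> a2 y) = act a1 b \<one>\<^bsub>M\<^esub> \<otimes>\<^bsub>M\<^esub> (x \<otimes>\<^bsub>M\<^esub> a2 y)"
        using xy b by (simp add: A_closed act_closed A_EN B_T R_comm[OF act_R] flip: M.m_assoc)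
      then show "x \<otimes>\<^bsub>M\<^esub> (act a1 b \<one>\<^bsub>M\<^esub> \<otimes>\<^bsub>M\<^esub> a2 y) = act a1 b \<one>\<^bsub>M\<^esub> \<otimes>\<^bsub>M\<^esub> act a2 (x \<otimes>N y) \<one>\<^bsub>M\<^esub>"
        using xy a by (simp add: act_tens A_EN)
    qed (use xy b in \<open>simp add: act_closed A_EN B_T tens_closed\<close>)
    finally show "act ?f (x \<otimes>N y) \<one>\<^bsub>M\<^esub> = \<dots>" .
  qed simp
  then have "\<iota> (pr (b \<otimes>\<^bsub>B\<^esub> b') \<alpha>) = tensor_lift M (\<lambda>a1 a2. act a1 b \<one>\<^bsub>M\<^esub> \<otimes>\<^bsub>M\<^esub> act a2 b' \<one>\<^bsub>M\<^esub>) w"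
    using b b' \<alpha> by (simp add: iota_pairing mult_B ins_B act_ins A_EN B_T)
  also have "\<dots> = tensor_lift M (\<lambda>a1 a2. \<iota> (pr b a1 \<otimes>\<^bsub>K\<^esub> pr b' a2)) w"
    using b b' by (intro AA.lift_cong[OF abelian_M w]) (simp_all add: iota_mult iota_pairing act_closed A_EN B_T)
  also have "\<dots> = \<iota> (tensor_lift K (\<lambda>a1 a2. pr b a1 \<otimes>\<^bsub>K\<^esub> pr b' a2) w)"
    by (rule AA.tensor.lift_comp[OF abelian_K abelian_M bal iota_additive w, symmetric])
  finally show "\<iota> (pr (b \<otimes>\<^bsub>B\<^esub> b') \<alpha>) = \<iota> (tensor_lift K (\<lambda>a1 a2. pr b a1 \<otimes>\<^bsub>K\<^esub> pr b' a2) w)" .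
  show "tensor_lift K (\<lambda>a1 a2. pr b a1 \<otimes>\<^bsub>K\<^esub> pr b' a2) w \<in> carrier K"
    by (rule AA.tensor.lift_closed[OF abelian_K bal w])
qed (use b b' \<alpha> B.m_closed in simp)

end

section \<open>Depth two quasibases\<close>

text \<open>The mirror image of the left notion, sum_i \<gamma>_i(m) c_i^1 (x) c_i^2 = 1 (x) m; it
  comes from the M-N half of the depth two condition.\<close>

definition right_D2_quasibasis ::
  "('n, 'v) ring_scheme \<Rightarrow> ('k, 'm, 'w) module_scheme \<Rightarrow> ('n \<Rightarrow> 'm)
    \<Rightarrow> nat \<Rightarrow> (nat \<Rightarrow> ('m \<times> 'm \<Rightarrow>\<^sub>0 int) set) \<Rightarrow> (nat \<Rightarrow> 'm \<Rightarrow> 'm) \<Rightarrow> bool" where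
  "right_D2_quasibasis N M \<phi> e c \<gamma> \<longleftrightarrow>
    (\<forall>i < e. c i \<in> carrier (tensor_square_centralizer N M \<phi>) \<and>
             \<gamma> i \<in> carrier (End_NN N M \<phi>)) \<and>
    (\<forall>m \<in> carrier M.
      (\<Oplus>\<^bsub>MxM N M \<phi>\<^esub>i \<in> {..<e}. lact (MxM N M \<phi>) (\<gamma> i m) (c i)) = elem_N N M \<phi> \<one>\<^bsub>M\<^esub> m)"

context alg_extension
begin

lemma same_add_tensor: "same_add (tensor N (ring_bimodule f \<phi> M) (ring_bimodule \<phi> g M)) T"
  using same_add_T[of f g] by (simp add: same_add_def tensor_simps)

lemma tensor_lact: "lact (tensor N (ring_bimodule f \<phi> M) (ring_bimodule \<phi> g M)) l t = f l \<triangleright> t"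
  and tensor_ract: "ract (tensor N (ring_bimodule f \<phi> M) (ring_bimodule \<phi> g M)) t r = t \<triangleleft> g r"
  unfolding left_mult_eq right_mult_eq same_add_tensor_lift[OF same_add_T[where f = f and g = g], symmetric]
  by (simp_all add: tensor_simps tensor_elem_ring_bimodule)

lemma abelian_ring_bimodule: "abelian_group (ring_bimodule f g M)"
  by (rule same_add_abelian_group[OF same_add_ring_bimodule abelian_M])

text \<open>With split maps f_i and g_i of N-M-bimodules, put b_i = g_i(1) and \<beta>_i(m) = f_i(m
  (x) 1). Then n g_i(1) = g_i(n) = g_i(1) n, and sum_i g_i f_i = id applied to m (x) 1 is the
  quasibasis identity.\<close>

lemma left_quasibasis_exists:
  assumes "depth_two N M \<phi>"
  obtains d b \<beta> where "left_D2_quasibasis N M \<phi> d b \<beta>"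
proof -
  let ?X = "ring_bimodule \<phi> id M" and ?Y = "tensor N (ring_bimodule \<phi> \<phi> M) (ring_bimodule \<phi> id M)"
  have sT: "same_add ?Y T" by (rule same_add_tensor)
  then have cT: "carrier ?Y = carrier T" and aT: "\<And>s t. s \<oplus>\<^bsub>?Y\<^esub> t = s \<oplus>\<^bsub>T\<^esub> t" by (simp_all add: same_add_def)
  obtain n where iso: "iso_to_direct_summand N M ?Y (bimodule_power n ?X)"
    using assms by (auto simp: depth_two_def)
  obtain f g where f: "\<And>i. i < n \<Longrightarrow> f i \<in> bimodule_hom N M ?Y ?X"
    and g: "\<And>i. i < n \<Longrightarrow> g i \<in> bimodule_hom N M ?X ?Y"
    and fg: "\<And>y. y \<in> carrier ?Y \<Longrightarrow> (\<Oplus>\<^bsub>?Y\<^esub>i \<in> {..<n}. g i (f i y)) = y"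
    by (rule iso_to_direct_summand_power[OF abelian_ring_bimodule same_add_abelian_group[OF sT abelian_T] _ _ _ _ iso])
      (auto simp: additive_map_def M.r_distr M.l_distr cT tensor_lact tensor_ract left_mult_closed right_mult_closed)
  let ?b = "\<lambda>i. g i \<one>\<^bsub>M\<^esub>" and ?\<beta> = "\<lambda>i. \<lambda>m \<in> carrier M. f i (m \<otimes>N \<one>\<^bsub>M\<^esub>)"
  have g_ract: "g i m = ?b i \<triangleleft> m" if "i < n" "m \<in> carrier M" for i m
  proof -
    have "g i (\<one>\<^bsub>M\<^esub> \<otimes>\<^bsub>M\<^esub> m) = ?b i \<triangleleft> m"
      using g[OF that(1)] that(2) by (simp add: bimodule_hom_def tensor_ract del: M.l_one)
    then show ?thesis using that by simp
  qed
  have b: "?b i \<in> carrier B" if "i < n" for i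
  proof -
    have "?b i \<in> carrier T" using g[OF that] by (auto simp: bimodule_hom_def cT)
    moreover have "\<phi> l \<triangleright> ?b i = ?b i \<triangleleft> \<phi> l" if l: "l \<in> carrier N" for l
    proof -
      have "g i (lact ?X l \<one>\<^bsub>M\<^esub>) = lact ?Y l (?b i)"
        using g[OF \<open>i < n\<close>] l by (simp add: bimodule_hom_def del: ring_bimodule_simps(4,5))
      then have "\<phi> l \<triangleright> ?b i = g i (\<phi> l)"
        using l by (simp add: tensor_lact)
      then show ?thesis using g_ract[OF \<open>i < n\<close>, of "\<phi> l"] l by simp
    qed
    ultimately show ?thesis by (simp add: B_iff)
  qed
  have \<beta>: "?\<beta> i \<in> carrier A" if "i < n" for i
  proof -
    have fc: "f i t \<in> carrier M" if "t \<in> carrier T" for t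
      using f[OF \<open>i < n\<close>] that by (auto simp: bimodule_hom_def cT)
    have fadd: "f i (s \<oplus>\<^bsub>T\<^esub> t) = f i s \<oplus>\<^bsub>M\<^esub> f i t" if "s \<in> carrier T" "t \<in> carrier T" for s t
      using f[OF \<open>i < n\<close>] that by (simp add: bimodule_hom_def cT aT)
    have fl: "f i (\<phi> l \<triangleright> t) = \<phi> l \<otimes>\<^bsub>M\<^esub> f i t" if "l \<in> carrier N" "t \<in> carrier T" for l t
      using f[OF \<open>i < n\<close>] that by (simp add: bimodule_hom_def cT tensor_lact)
    have fr: "f i (t \<triangleleft> m) = f i t \<otimes>\<^bsub>M\<^esub> m" if "m \<in> carrier M" "t \<in> carrier T" for m t
      using f[OF \<open>i < n\<close>] that by (simp add: bimodule_hom_def cT tensor_ract)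
    \<comment> \<open>f_i is right M-linear in the second leg only; balancing moves \<phi> l there
      from the first leg.\<close>
    have "f i (x \<otimes>\<^bsub>M\<^esub> \<phi> l \<otimes>N \<one>\<^bsub>M\<^esub>) = f i (x \<otimes>N \<one>\<^bsub>M\<^esub>) \<otimes>\<^bsub>M\<^esub> \<phi> l" if "x \<in> carrier M" "l \<in> carrier N" for x l
      using fr[of "\<phi> l" "x \<otimes>N \<one>\<^bsub>M\<^esub>"] that by (simp add: tens_closed right_mult_tens tens_balanced)
    moreover have "f i (\<phi> l \<otimes>\<^bsub>M\<^esub> x \<otimes>N \<one>\<^bsub>M\<^esub>) = \<phi> l \<otimes>\<^bsub>M\<^esub> f i (x \<otimes>N \<one>\<^bsub>M\<^esub>)" if "x \<in> carrier M" "l \<in> carrier N" for x l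
      using fl[of l "x \<otimes>N \<one>\<^bsub>M\<^esub>"] that by (simp add: tens_closed left_mult_tens)
    ultimately show ?thesis
      by (simp add: A_iff fc tens_closed tens_add_left fadd)
  qed
  have "(\<Oplus>\<^bsub>T\<^esub>i \<in> {..<n}. ?b i \<triangleleft> ?\<beta> i m) = m \<otimes>N \<one>\<^bsub>M\<^esub>" if m: "m \<in> carrier M" for m
  proof -
    have "(\<Oplus>\<^bsub>T\<^esub>i \<in> {..<n}. ?b i \<triangleleft> ?\<beta> i m) = (\<Oplus>\<^bsub>T\<^esub>i \<in> {..<n}. g i (f i (m \<otimes>N \<one>\<^bsub>M\<^esub>)))"
    proof (rule tensor.T.finsum_cong'[OF refl])
      fix i assume "i \<in> {..<n}"
      then have i: "i < n" by simp
      have fc: "f i (m \<otimes>N \<one>\<^bsub>M\<^esub>) \<in> carrier M" using A_closed[OF \<beta>[OF i] m] m by simp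
      show "?b i \<triangleleft> ?\<beta> i m = g i (f i (m \<otimes>N \<one>\<^bsub>M\<^esub>))"
        using g_ract[OF i fc] m by simp
    next
      show "(\<lambda>i. g i (f i (m \<otimes>N \<one>\<^bsub>M\<^esub>))) \<in> {..<n} \<rightarrow> carrier T"
      proof
        fix i assume "i \<in> {..<n}"
        then have i: "i < n" by simp
        have "f i (m \<otimes>N \<one>\<^bsub>M\<^esub>) \<in> carrier M" using A_closed[OF \<beta>[OF i] m] m by simp
        then show "g i (f i (m \<otimes>N \<one>\<^bsub>M\<^esub>)) \<in> carrier T" using g[OF i] by (auto simp: bimodule_hom_def cT)
      qed
    qed
    then show ?thesis
      using fg[of "m \<otimes>N \<one>\<^bsub>M\<^esub>"] m by (simp add: same_add_finsum[OF sT] cT tens_closed)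
  qed
  then have "left_D2_quasibasis N M \<phi> n ?b ?\<beta>"
    using b \<beta> by (simp add: left_D2_quasibasis_def)
  then show ?thesis by (rule that)
qed

text \<open>The mirror argument with split maps of M-N-bimodules: c_i = g_i(1) and \<gamma>_i(m) =
  f_i(1 (x) m).\<close>

lemma right_quasibasis_exists:
  assumes "depth_two N M \<phi>"
  obtains e c \<gamma> where "right_D2_quasibasis N M \<phi> e c \<gamma>"
proof -
  let ?X = "ring_bimodule id \<phi> M" and ?Y = "tensor N (ring_bimodule id \<phi> M) (ring_bimodule \<phi> \<phi> M)"
  have sT: "same_add ?Y T" by (rule same_add_tensor)
  then have cT: "carrier ?Y = carrier T" and aT: "\<And>s t. s \<oplus>\<^bsub>?Y\<^esub> t = s \<oplus>\<^bsub>T\<^esub> t" by (simp_all add: same_add_def)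
  obtain n where iso: "iso_to_direct_summand M N ?Y (bimodule_power n ?X)"
    using assms by (auto simp: depth_two_def)
  obtain f g where f: "\<And>i. i < n \<Longrightarrow> f i \<in> bimodule_hom M N ?Y ?X"
    and g: "\<And>i. i < n \<Longrightarrow> g i \<in> bimodule_hom M N ?X ?Y"
    and fg: "\<And>y. y \<in> carrier ?Y \<Longrightarrow> (\<Oplus>\<^bsub>?Y\<^esub>i \<in> {..<n}. g i (f i y)) = y"
    by (rule iso_to_direct_summand_power[OF abelian_ring_bimodule same_add_abelian_group[OF sT abelian_T] _ _ _ _ iso])
      (auto simp: additive_map_def M.r_distr M.l_distr cT tensor_lact tensor_ract left_mult_closed right_mult_closed)
  let ?c = "\<lambda>i. g i \<one>\<^bsub>M\<^esub>" and ?\<gamma> = "\<lambda>i. \<lambda>m \<in> carrier M. f i (\<one>\<^bsub>M\<^esub> \<otimes>N m)"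
  have g_lact: "g i m = m \<triangleright> ?c i" if "i < n" "m \<in> carrier M" for i m
  proof -
    have "g i (m \<otimes>\<^bsub>M\<^esub> \<one>\<^bsub>M\<^esub>) = m \<triangleright> ?c i"
      using g[OF that(1)] that(2) by (simp add: bimodule_hom_def tensor_lact del: M.r_one)
    then show ?thesis using that by simp
  qed
  have c: "?c i \<in> carrier B" if "i < n" for i
  proof -
    have "?c i \<in> carrier T" using g[OF that] by (auto simp: bimodule_hom_def cT)
    moreover have "\<phi> l \<triangleright> ?c i = ?c i \<triangleleft> \<phi> l" if l: "l \<in> carrier N" for l
    proof -
      have "g i (ract ?X \<one>\<^bsub>M\<^esub> l) = ract ?Y (?c i) l"
        using g[OF \<open>i < n\<close>] l by (simp add: bimodule_hom_def del: ring_bimodule_simps(4,5))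
      then have "?c i \<triangleleft> \<phi> l = g i (\<phi> l)"
        using l by (simp add: tensor_ract)
      then show ?thesis using g_lact[OF \<open>i < n\<close>, of "\<phi> l"] l by simp
    qed
    ultimately show ?thesis by (simp add: B_iff)
  qed
  have \<gamma>: "?\<gamma> i \<in> carrier A" if "i < n" for i
  proof -
    have fc: "f i t \<in> carrier M" if "t \<in> carrier T" for t
      using f[OF \<open>i < n\<close>] that by (auto simp: bimodule_hom_def cT)
    have fadd: "f i (s \<oplus>\<^bsub>T\<^esub> t) = f i s \<oplus>\<^bsub>M\<^esub> f i t" if "s \<in> carrier T" "t \<in> carrier T" for s t
      using f[OF \<open>i < n\<close>] that by (simp add: bimodule_hom_def cT aT)
    have fl: "f i (m \<triangleright> t) = m \<otimes>\<^bsub>M\<^esub> f i t" if "m \<in> carrier M" "t \<in> carrier T" for m t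
      using f[OF \<open>i < n\<close>] that by (simp add: bimodule_hom_def cT tensor_lact)
    have fr: "f i (t \<triangleleft> \<phi> l) = f i t \<otimes>\<^bsub>M\<^esub> \<phi> l" if "l \<in> carrier N" "t \<in> carrier T" for l t
      using f[OF \<open>i < n\<close>] that by (simp add: bimodule_hom_def cT tensor_ract)
    have "f i (\<one>\<^bsub>M\<^esub> \<otimes>N \<phi> l \<otimes>\<^bsub>M\<^esub> x) = \<phi> l \<otimes>\<^bsub>M\<^esub> f i (\<one>\<^bsub>M\<^esub> \<otimes>N x)" if "x \<in> carrier M" "l \<in> carrier N" for x l
      using fl[of "\<phi> l" "\<one>\<^bsub>M\<^esub> \<otimes>N x"] that tens_balanced[of "\<one>\<^bsub>M\<^esub>" l x] by (simp add: tens_closed left_mult_tens)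
    moreover have "f i (\<one>\<^bsub>M\<^esub> \<otimes>N x \<otimes>\<^bsub>M\<^esub> \<phi> l) = f i (\<one>\<^bsub>M\<^esub> \<otimes>N x) \<otimes>\<^bsub>M\<^esub> \<phi> l" if "x \<in> carrier M" "l \<in> carrier N" for x l
      using fr[of l "\<one>\<^bsub>M\<^esub> \<otimes>N x"] that by (simp add: tens_closed right_mult_tens)
    ultimately show ?thesis
      by (simp add: A_iff fc tens_closed tens_add_right fadd)
  qed
  have "(\<Oplus>\<^bsub>T\<^esub>i \<in> {..<n}. ?\<gamma> i m \<triangleright> ?c i) = \<one>\<^bsub>M\<^esub> \<otimes>N m" if m: "m \<in> carrier M" for m
  proof -
    have "(\<Oplus>\<^bsub>T\<^esub>i \<in> {..<n}. ?\<gamma> i m \<triangleright> ?c i) = (\<Oplus>\<^bsub>T\<^esub>i \<in> {..<n}. g i (f i (\<one>\<^bsub>M\<^esub> \<otimes>N m)))"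
    proof (rule tensor.T.finsum_cong'[OF refl])
      fix i assume "i \<in> {..<n}"
      then have i: "i < n" by simp
      have fc: "f i (\<one>\<^bsub>M\<^esub> \<otimes>N m) \<in> carrier M" using A_closed[OF \<gamma>[OF i] m] m by simp
      show "?\<gamma> i m \<triangleright> ?c i = g i (f i (\<one>\<^bsub>M\<^esub> \<otimes>N m))"
        using g_lact[OF i fc] m by simp
    next
      show "(\<lambda>i. g i (f i (\<one>\<^bsub>M\<^esub> \<otimes>N m))) \<in> {..<n} \<rightarrow> carrier T"
      proof
        fix i assume "i \<in> {..<n}"
        then have i: "i < n" by simp
        have "f i (\<one>\<^bsub>M\<^esub> \<otimes>N m) \<in> carrier M" using A_closed[OF \<gamma>[OF i] m] m by simp
        then show "g i (f i (\<one>\<^bsub>M\<^esub> \<otimes>N m)) \<in> carrier T" using g[OF i] by (auto simp: bimodule_hom_def cT)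
      qed
    qed
    then show ?thesis
      using fg[of "\<one>\<^bsub>M\<^esub> \<otimes>N m"] m by (simp add: same_add_finsum[OF sT] cT tens_closed)
  qed
  then have "right_D2_quasibasis N M \<phi> n ?c ?\<gamma>"
    using c \<gamma> by (simp add: right_D2_quasibasis_def)
  then show ?thesis by (rule that)
qed

end

locale depth_two_extension = irreducible_alg_extension K N M \<phi>
  for K :: "('k, 'u) ring_scheme" and N :: "('k, 'n, 'v) module_scheme"
    and M :: "('k, 'm, 'w) module_scheme" and \<phi> :: "'n \<Rightarrow> 'm" +
  fixes d :: nat and b :: "nat \<Rightarrow> ('m \<times> 'm \<Rightarrow>\<^sub>0 int) set" and \<beta> :: "nat \<Rightarrow> 'm \<Rightarrow> 'm"
    and e :: nat and c :: "nat \<Rightarrow> ('m \<times> 'm \<Rightarrow>\<^sub>0 int) set" and \<gamma> :: "nat \<Rightarrow> 'm \<Rightarrow> 'm"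
  assumes left: "left_D2_quasibasis N M \<phi> d b \<beta>" and right: "right_D2_quasibasis N M \<phi> e c \<gamma>"
begin

abbreviation (input) "\<Delta>A \<equiv> comult_A K N M \<phi> d b \<beta>"
abbreviation (input) "\<Delta>B \<equiv> comult_B K N M \<phi> d b \<beta>"
abbreviation (input) "A2 \<equiv> tensor_K K (End_NN N M \<phi>) (End_NN N M \<phi>)"
abbreviation (input) "B2 \<equiv> tensor_K K (tensor_square_centralizer N M \<phi>) (tensor_square_centralizer N M \<phi>)"

section \<open>Dual bases and summation identities from the quasibases\<close>

lemma b_B: "i < d \<Longrightarrow> b i \<in> carrier B" and beta_A: "i < d \<Longrightarrow> \<beta> i \<in> carrier A"
  and c_B: "i < e \<Longrightarrow> c i \<in> carrier B" and gamma_A: "i < e \<Longrightarrow> \<gamma> i \<in> carrier A"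
  and left_basis: "m \<in> carrier M \<Longrightarrow> (\<Oplus>\<^bsub>T\<^esub>i \<in> {..<d}. b i \<triangleleft> \<beta> i m) = m \<otimes>N \<one>\<^bsub>M\<^esub>"
  and right_basis: "m \<in> carrier M \<Longrightarrow> (\<Oplus>\<^bsub>T\<^esub>i \<in> {..<e}. \<gamma> i m \<triangleright> c i) = \<one>\<^bsub>M\<^esub> \<otimes>N m"
  using left right by (auto simp: left_D2_quasibasis_def right_D2_quasibasis_def)

text \<open>A balanced f induces a map on M (x) M; this is its value on the left quasibasis
  identity, with \<beta>_i(m) absorbed into the second argument.\<close>

lemma lift_left_basis:
  assumes G: "abelian_group G" and f: "balN G f" and m: "m \<in> carrier M"
  shows "(\<Oplus>\<^bsub>G\<^esub>i \<in> {..<d}. tensor_lift G (\<lambda>x y. f x (y \<otimes>\<^bsub>M\<^esub> \<beta> i m)) (b i)) = f m \<one>\<^bsub>M\<^esub>"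
proof -
  interpret G: abelian_group G by fact
  have "(\<Oplus>\<^bsub>G\<^esub>i \<in> {..<d}. tensor_lift G (\<lambda>x y. f x (y \<otimes>\<^bsub>M\<^esub> \<beta> i m)) (b i)) =
    (\<Oplus>\<^bsub>G\<^esub>i \<in> {..<d}. tensor_lift G f (b i \<triangleleft> \<beta> i m))"
    using m by (intro G.finsum_cong') (auto simp: lift_right_mult[OF G f] A_closed beta_A b_B B_T
        intro!: tensor.lift_closed[OF G balN_right[OF f]])
  also have "\<dots> = tensor_lift G f (\<Oplus>\<^bsub>T\<^esub>i \<in> {..<d}. b i \<triangleleft> \<beta> i m)"
    using m by (intro tensor.lift_finsum[OF G f, symmetric]) (simp add: right_mult_closed A_closed beta_A b_B B_T)
  finally show ?thesis using m by (simp add: left_basis lift_tens[OF G f])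
qed

lemma lift_right_basis:
  assumes G: "abelian_group G" and f: "balN G f" and m: "m \<in> carrier M"
  shows "(\<Oplus>\<^bsub>G\<^esub>i \<in> {..<e}. tensor_lift G (\<lambda>x y. f (\<gamma> i m \<otimes>\<^bsub>M\<^esub> x) y) (c i)) = f \<one>\<^bsub>M\<^esub> m"
proof -
  interpret G: abelian_group G by fact
  have "(\<Oplus>\<^bsub>G\<^esub>i \<in> {..<e}. tensor_lift G (\<lambda>x y. f (\<gamma> i m \<otimes>\<^bsub>M\<^esub> x) y) (c i)) =
    (\<Oplus>\<^bsub>G\<^esub>i \<in> {..<e}. tensor_lift G f (\<gamma> i m \<triangleright> c i))"
    using m by (intro G.finsum_cong') (auto simp: lift_left_mult[OF G f] A_closed gamma_A c_B B_T
        intro!: tensor.lift_closed[OF G balN_left[OF f]])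
  also have "\<dots> = tensor_lift G f (\<Oplus>\<^bsub>T\<^esub>i \<in> {..<e}. \<gamma> i m \<triangleright> c i)"
    using m by (intro tensor.lift_finsum[OF G f, symmetric]) (simp add: left_mult_closed A_closed gamma_A c_B B_T)
  finally show ?thesis using m by (simp add: right_basis lift_tens[OF G f])
qed

text \<open>Evaluated at m, the scalar <c_i, \<alpha>> commutes past \<gamma>_i(m), and the sum
  becomes \<open>act \<alpha>\<close> at 1 of sum_i \<gamma>_i(m) c_i = 1 (x) m, that is
  \<alpha>(m).\<close>

lemma A_basis:
  assumes \<alpha>: "\<alpha> \<in> carrier A"
  shows "(\<Oplus>\<^bsub>A\<^esub>i \<in> {..<e}. pr (c i) \<alpha> \<odot>\<^bsub>A\<^esub> \<gamma> i) = \<alpha>"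
proof (rule A_eqI)
  have cl: "pr (c i) \<alpha> \<odot>\<^bsub>A\<^esub> \<gamma> i \<in> carrier A" if "i < e" for i
    using that \<alpha> by (intro A.smult_closed) (simp_all add: c_B gamma_A)
  show "(\<Oplus>\<^bsub>A\<^esub>i \<in> {..<e}. pr (c i) \<alpha> \<odot>\<^bsub>A\<^esub> \<gamma> i) \<in> carrier A"
    using cl by (intro A.finsum_closed) auto
  fix m assume m: "m \<in> carrier M"
  have "(\<Oplus>\<^bsub>A\<^esub>i \<in> {..<e}. pr (c i) \<alpha> \<odot>\<^bsub>A\<^esub> \<gamma> i) m = (\<Oplus>\<^bsub>M\<^esub>i \<in> {..<e}. (pr (c i) \<alpha> \<odot>\<^bsub>A\<^esub> \<gamma> i) m)"
    using cl m by (intro additive_map_finsum[OF A.abelian_group_axioms abelian_M A_eval_additive]) auto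
  also have "\<dots> = (\<Oplus>\<^bsub>M\<^esub>i \<in> {..<e}. act \<alpha> (\<gamma> i m \<triangleright> c i) \<one>\<^bsub>M\<^esub>)"
    using m \<alpha> by (intro M.finsum_cong')
      (auto simp: pairing_smult c_B gamma_A A_closed act_left_mult A_EN B_T R_comm[OF act_R] intro!: act_closed left_mult_closed)
  also have "\<dots> = act \<alpha> (\<Oplus>\<^bsub>T\<^esub>i \<in> {..<e}. \<gamma> i m \<triangleright> c i) \<one>\<^bsub>M\<^esub>"
    using m \<alpha> by (intro additive_map_finsum[OF abelian_T abelian_M act_additive, symmetric])
      (auto simp: A_EN c_B gamma_A B_T A_closed intro!: left_mult_closed)
  also have "\<dots> = \<alpha> m"
    using m \<alpha> by (simp add: right_basis act_tens A_EN A_closed)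
  finally show "(\<Oplus>\<^bsub>A\<^esub>i \<in> {..<e}. pr (c i) \<alpha> \<odot>\<^bsub>A\<^esub> \<gamma> i) m = \<alpha> m" .
qed (rule \<alpha>)

text \<open>For t = x (x) y this is the right quasibasis identity at y multiplied by x from the
  left. Stating it on all of M (x) M permits the reduction to pure tensors.\<close>

lemma T_expand:
  assumes t: "t \<in> carrier T"
  shows "(\<Oplus>\<^bsub>T\<^esub>i \<in> {..<e}. act (\<gamma> i) t \<one>\<^bsub>M\<^esub> \<triangleright> c i) = t"
proof (rule additive_map_eqI[OF _ _ t])
  show "additive_map T T (\<lambda>t. \<Oplus>\<^bsub>T\<^esub>i \<in> {..<e}. act (\<gamma> i) t \<one>\<^bsub>M\<^esub> \<triangleright> c i)"
    by (intro additive_map_finsum_fun abelian_T additive_map_comp[OF act_additive left_mult_additive_left])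
      (simp_all add: A_EN gamma_A c_B B_T)
  show "additive_map T T (\<lambda>t. t)" by (simp add: additive_map_def)
  fix x y assume xy: "x \<in> carrier M" "y \<in> carrier M"
  have "(\<Oplus>\<^bsub>T\<^esub>i \<in> {..<e}. act (\<gamma> i) (x \<otimes>N y) \<one>\<^bsub>M\<^esub> \<triangleright> c i) = (\<Oplus>\<^bsub>T\<^esub>i \<in> {..<e}. x \<triangleright> \<gamma> i y \<triangleright> c i)"
    using xy by (intro tensor.T.finsum_cong')
      (auto simp: act_tens A_EN gamma_A left_mult_assoc c_B B_T A_closed intro!: left_mult_closed)
  also have "\<dots> = x \<triangleright> (\<Oplus>\<^bsub>T\<^esub>i \<in> {..<e}. \<gamma> i y \<triangleright> c i)"
    using xy by (intro additive_map_finsum[OF abelian_T abelian_T left_mult_additive, symmetric])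
      (auto simp: gamma_A c_B B_T A_closed intro!: left_mult_closed)
  finally show "(\<Oplus>\<^bsub>T\<^esub>i \<in> {..<e}. act (\<gamma> i) (x \<otimes>N y) \<one>\<^bsub>M\<^esub> \<triangleright> c i) = x \<otimes>N y"
    using xy by (simp add: right_basis left_mult_tens)
qed

text \<open>For x in B the coefficients x^1 \<gamma>_i(x^2) in \<open>T_expand\<close> are the
  scalars <x, \<gamma>_i>.\<close>

lemma B_basis:
  assumes x: "x \<in> carrier B"
  shows "(\<Oplus>\<^bsub>B\<^esub>i \<in> {..<e}. pr x (\<gamma> i) \<odot>\<^bsub>B\<^esub> c i) = x"
proof -
  have "(\<Oplus>\<^bsub>B\<^esub>i \<in> {..<e}. pr x (\<gamma> i) \<odot>\<^bsub>B\<^esub> c i) = (\<Oplus>\<^bsub>T\<^esub>i \<in> {..<e}. pr x (\<gamma> i) \<odot>\<^bsub>B\<^esub> c i)"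
    using x by (intro B_finsum B.smult_closed) (simp_all add: gamma_A c_B)
  also have "\<dots> = (\<Oplus>\<^bsub>T\<^esub>i \<in> {..<e}. act (\<gamma> i) x \<one>\<^bsub>M\<^esub> \<triangleright> c i)"
    using x by (intro tensor.T.finsum_cong')
      (auto simp: B_simps iota_pairing gamma_A c_B B_T A_EN intro!: left_mult_closed act_closed)
  finally show ?thesis using x by (simp add: T_expand B_T)
qed

text \<open>\<beta>_i(u) moves from the argument into the second leg of b_i, after which the sum
  over i collapses to u (x) 1.\<close>

lemma act_left_basis:
  assumes \<xi>: "\<xi> \<in> carrier EN" and "u \<in> carrier M" "y \<in> carrier M"
  shows "(\<Oplus>\<^bsub>M\<^esub>i \<in> {..<d}. act \<xi> (b i) (\<beta> i u \<otimes>\<^bsub>M\<^esub> y)) = u \<otimes>\<^bsub>M\<^esub> \<xi> y"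
proof -
  have "(\<Oplus>\<^bsub>M\<^esub>i \<in> {..<d}. act \<xi> (b i) (\<beta> i u \<otimes>\<^bsub>M\<^esub> y)) = (\<Oplus>\<^bsub>M\<^esub>i \<in> {..<d}. act \<xi> (b i \<triangleleft> \<beta> i u) y)"
    using assms by (intro M.finsum_cong')
      (auto simp: act_right_mult b_B B_T beta_A A_closed intro!: act_closed right_mult_closed)
  also have "\<dots> = act \<xi> (\<Oplus>\<^bsub>T\<^esub>i \<in> {..<d}. b i \<triangleleft> \<beta> i u) y"
    using assms by (intro additive_map_finsum[OF abelian_T abelian_M act_additive, symmetric])
      (auto simp: b_B B_T beta_A A_closed intro!: right_mult_closed)
  finally show ?thesis using assms by (simp add: left_basis act_tens)
qed

text \<open>On u (x) v the summands are \<open>act \<xi>\<close> of b_i at \<beta>_i(u) \<eta>(v y),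
  and \<open>act_left_basis\<close> sums them to u \<xi>(\<eta>(v y)). For t in B this is the
  product rule for the action of B through \<Delta>B; at y = 1 it gives the pairing with a
  composition.\<close>

lemma act_compose:
  assumes \<xi>: "\<xi> \<in> carrier EN" and \<eta>: "\<eta> \<in> carrier EN" and t: "t \<in> carrier T" and y: "y \<in> carrier M"
  shows "(\<Oplus>\<^bsub>M\<^esub>i \<in> {..<d}. act \<xi> (b i) (act \<eta> (lmap (\<beta> i) t) y)) = act (compose (carrier M) \<xi> \<eta>) t y"
proof (rule additive_map_eqI[OF _ act_additive t])
  show "compose (carrier M) \<xi> \<eta> \<in> carrier EN" using EN.m_closed[OF \<xi> \<eta>] by simp
  then have c: "compose (carrier M) \<xi> \<eta> \<in> carrier EN" .
  show "additive_map T M (\<lambda>t. \<Oplus>\<^bsub>M\<^esub>i \<in> {..<d}. act \<xi> (b i) (act \<eta> (lmap (\<beta> i) t) y))"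
    using \<xi> \<eta> y
    by (intro additive_map_finsum_fun abelian_M additive_map_comp[OF lmap_additive]
        additive_map_comp[OF act_additive act_additive_right]) (simp_all add: beta_A b_B B_T)
  fix u v assume uv: "u \<in> carrier M" "v \<in> carrier M"
  have "(\<Oplus>\<^bsub>M\<^esub>i \<in> {..<d}. act \<xi> (b i) (act \<eta> (lmap (\<beta> i) (u \<otimes>N v)) y)) =
    (\<Oplus>\<^bsub>M\<^esub>i \<in> {..<d}. act \<xi> (b i) (\<beta> i u \<otimes>\<^bsub>M\<^esub> \<eta> (v \<otimes>\<^bsub>M\<^esub> y)))"
    using uv \<xi> \<eta> y by (intro M.finsum_cong')
      (auto simp: lmap_tens act_tens beta_A A_closed EN_closed b_B B_T intro!: act_closed)
  then show "(\<Oplus>\<^bsub>M\<^esub>i \<in> {..<d}. act \<xi> (b i) (act \<eta> (lmap (\<beta> i) (u \<otimes>N v)) y)) =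
      act (compose (carrier M) \<xi> \<eta>) (u \<otimes>N v) y"
    using uv y \<xi> \<eta> by (simp add: act_left_basis EN_closed act_tens c compose_eq)
qed (rule y)

section \<open>The two coproducts and the verification of the pairing axioms\<close>

definition fst_A :: "('m \<Rightarrow> 'm) \<Rightarrow> nat \<Rightarrow> 'm \<Rightarrow> 'm" where
  "fst_A \<alpha> i = (\<lambda>m \<in> carrier M. tensor_lift M (\<lambda>u v. \<alpha> (m \<otimes>\<^bsub>M\<^esub> u) \<otimes>\<^bsub>M\<^esub> v) (b i))"

lemma balN_A_left: "\<lbrakk>\<alpha> \<in> carrier A; m \<in> carrier M\<rbrakk> \<Longrightarrow> balN M (\<lambda>u v. \<alpha> (m \<otimes>\<^bsub>M\<^esub> u) \<otimes>\<^bsub>M\<^esub> v)"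
  by (rule balN_left[OF balN_A])

text \<open>Left N-linearity comes from \<alpha>. Right N-linearity comes from b_i in B: \<alpha>(m
  n b^1) b^2 = \<alpha>(m b^1) b^2 n.\<close>

lemma fst_A_closed:
  assumes \<alpha>: "\<alpha> \<in> carrier A" and i: "i < d"
  shows "fst_A \<alpha> i \<in> carrier A"
proof -
  have bT: "b i \<in> carrier T" using i by (simp add: b_B B_T)
  have add: "additive_map M M (\<lambda>m. tensor_lift M (\<lambda>u v. \<alpha> (m \<otimes>\<^bsub>M\<^esub> u) \<otimes>\<^bsub>M\<^esub> v) (b i))"
    using \<alpha> by (intro tensor.additive_map_lift_param[OF abelian_M bT] balN_A_left abelian_M)
      (simp_all add: additive_map_def A_closed A_add M.l_distr)
  have left: "tensor_lift M (\<lambda>u v. \<alpha> (\<phi> n \<otimes>\<^bsub>M\<^esub> m \<otimes>\<^bsub>M\<^esub> u) \<otimes>\<^bsub>M\<^esub> v) (b i) =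
      \<phi> n \<otimes>\<^bsub>M\<^esub> tensor_lift M (\<lambda>u v. \<alpha> (m \<otimes>\<^bsub>M\<^esub> u) \<otimes>\<^bsub>M\<^esub> v) (b i)"
    if n: "n \<in> carrier N" and m: "m \<in> carrier M" for n m
  proof -
    have "\<phi> n \<otimes>\<^bsub>M\<^esub> tensor_lift M (\<lambda>u v. \<alpha> (m \<otimes>\<^bsub>M\<^esub> u) \<otimes>\<^bsub>M\<^esub> v) (b i) =
      tensor_lift M (\<lambda>u v. \<phi> n \<otimes>\<^bsub>M\<^esub> (\<alpha> (m \<otimes>\<^bsub>M\<^esub> u) \<otimes>\<^bsub>M\<^esub> v)) (b i)"
      using n m by (intro tensor.lift_comp[OF abelian_M abelian_M balN_A_left[OF \<alpha>]] M.additive_map_scale bT) simp_all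
    also have "\<dots> = tensor_lift M (\<lambda>u v. \<alpha> (\<phi> n \<otimes>\<^bsub>M\<^esub> m \<otimes>\<^bsub>M\<^esub> u) \<otimes>\<^bsub>M\<^esub> v) (b i)"
      using n m \<alpha> by (intro lift_cong[OF abelian_M bT]) (simp_all add: A_closed A_left M.m_assoc)
    finally show ?thesis by simp
  qed
  have right: "tensor_lift M (\<lambda>u v. \<alpha> (m \<otimes>\<^bsub>M\<^esub> \<phi> n \<otimes>\<^bsub>M\<^esub> u) \<otimes>\<^bsub>M\<^esub> v) (b i) =
      tensor_lift M (\<lambda>u v. \<alpha> (m \<otimes>\<^bsub>M\<^esub> u) \<otimes>\<^bsub>M\<^esub> v) (b i) \<otimes>\<^bsub>M\<^esub> \<phi> n"
    if n: "n \<in> carrier N" and m: "m \<in> carrier M" for n m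
  proof -
    have "tensor_lift M (\<lambda>u v. \<alpha> (m \<otimes>\<^bsub>M\<^esub> \<phi> n \<otimes>\<^bsub>M\<^esub> u) \<otimes>\<^bsub>M\<^esub> v) (b i) =
      tensor_lift M (\<lambda>u v. \<alpha> (m \<otimes>\<^bsub>M\<^esub> (\<phi> n \<otimes>\<^bsub>M\<^esub> u)) \<otimes>\<^bsub>M\<^esub> v) (b i)"
      using n m \<alpha> by (intro lift_cong[OF abelian_M bT]) (simp_all add: A_closed M.m_assoc)
    also have "\<dots> = tensor_lift M (\<lambda>u v. \<alpha> (m \<otimes>\<^bsub>M\<^esub> u) \<otimes>\<^bsub>M\<^esub> (v \<otimes>\<^bsub>M\<^esub> \<phi> n)) (b i)"
      by (rule B_lift_invariant[OF b_B[OF i] n abelian_M balN_A_left[OF \<alpha> m]])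
    also have "\<dots> = tensor_lift M (\<lambda>u v. \<alpha> (m \<otimes>\<^bsub>M\<^esub> u) \<otimes>\<^bsub>M\<^esub> v \<otimes>\<^bsub>M\<^esub> \<phi> n) (b i)"
      using n m \<alpha> by (intro lift_cong[OF abelian_M bT]) (simp_all add: A_closed M.m_assoc)
    also have "\<dots> = tensor_lift M (\<lambda>u v. \<alpha> (m \<otimes>\<^bsub>M\<^esub> u) \<otimes>\<^bsub>M\<^esub> v) (b i) \<otimes>\<^bsub>M\<^esub> \<phi> n"
      using n m by (intro tensor.lift_comp[OF abelian_M abelian_M balN_A_left[OF \<alpha>], symmetric]
          M.additive_map_scale bT) simp_all
    finally show ?thesis .
  qed
  show ?thesis
    using add by (auto simp: A_iff fst_A_def additive_map_def left right)
qed

lemma comult_A_eq: "\<Delta>A \<alpha> = (\<Oplus>\<^bsub>A2\<^esub>i \<in> {..<d}. elem_K K A A (fst_A \<alpha> i) (\<beta> i))"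
  by (simp add: comult_A_def fst_A_def Let_def)

lemma comult_B_eq: "\<Delta>B x = (\<Oplus>\<^bsub>B2\<^esub>i \<in> {..<d}. elem_K K B B (b i) (lmap (\<beta> i) x))"
  by (simp add: comult_B_def lmap_def Let_def)

lemma comult_A_closed: "\<alpha> \<in> carrier A \<Longrightarrow> \<Delta>A \<alpha> \<in> carrier A2"
  unfolding comult_A_eq
  by (intro AA.tensor.T.finsum_closed) (auto intro!: AA.elem_closed fst_A_closed beta_A)

lemma comult_B_closed: "x \<in> carrier B \<Longrightarrow> \<Delta>B x \<in> carrier B2"
  unfolding comult_B_eq
  by (intro BB.tensor.T.finsum_closed) (auto intro!: BB.elem_closed b_B lmap_B beta_A)

lemma lift_comult_A:
  assumes G: "abelian_group G" and f: "balanced_K K A A G f" and \<alpha>: "\<alpha> \<in> carrier A"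
  shows "tensor_lift G f (\<Delta>A \<alpha>) = (\<Oplus>\<^bsub>G\<^esub>i \<in> {..<d}. f (fst_A \<alpha> i) (\<beta> i))"
proof -
  interpret G: abelian_group G by fact
  have "tensor_lift G f (\<Delta>A \<alpha>) = (\<Oplus>\<^bsub>G\<^esub>i \<in> {..<d}. tensor_lift G f (elem_K K A A (fst_A \<alpha> i) (\<beta> i)))"
    unfolding comult_A_eq using \<alpha>
    by (intro AA.tensor.lift_finsum[OF G f]) (auto intro!: AA.elem_closed fst_A_closed beta_A)
  also have "\<dots> = (\<Oplus>\<^bsub>G\<^esub>i \<in> {..<d}. f (fst_A \<alpha> i) (\<beta> i))"
    using \<alpha> balanced_map_closed[OF f]
    by (intro G.finsum_cong') (auto simp: AA.lift_elem[OF G f] fst_A_closed beta_A)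
  finally show ?thesis .
qed

lemma lift_comult_B:
  assumes G: "abelian_group G" and f: "balanced_K K B B G f" and x: "x \<in> carrier B"
  shows "tensor_lift G f (\<Delta>B x) = (\<Oplus>\<^bsub>G\<^esub>i \<in> {..<d}. f (b i) (lmap (\<beta> i) x))"
proof -
  interpret G: abelian_group G by fact
  have "tensor_lift G f (\<Delta>B x) = (\<Oplus>\<^bsub>G\<^esub>i \<in> {..<d}. tensor_lift G f (elem_K K B B (b i) (lmap (\<beta> i) x)))"
    unfolding comult_B_eq using x
    by (intro BB.tensor.lift_finsum[OF G f]) (auto intro!: BB.elem_closed b_B lmap_B beta_A)
  also have "\<dots> = (\<Oplus>\<^bsub>G\<^esub>i \<in> {..<d}. f (b i) (lmap (\<beta> i) x))"
    using x balanced_map_closed[OF f]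
    by (intro G.finsum_cong') (auto simp: BB.lift_elem[OF G f] b_B lmap_B beta_A)
  finally show ?thesis .
qed

text \<open>The sum of \<alpha>(m b_i^1) b_i^2 \<beta>_i(m') is the left quasibasis identity at m'
  under the balanced map sending u, v to \<alpha>(m u) v.\<close>

lemma comult_A_eval:
  assumes \<alpha>: "\<alpha> \<in> carrier A" and m: "m \<in> carrier M" and m': "m' \<in> carrier M"
  shows "tensor_lift M (\<lambda>a1 a2. a1 m \<otimes>\<^bsub>M\<^esub> a2 m') (\<Delta>A \<alpha>) = \<alpha> (m \<otimes>\<^bsub>M\<^esub> m')"
proof -
  have "tensor_lift M (\<lambda>a1 a2. a1 m \<otimes>\<^bsub>M\<^esub> a2 m') (\<Delta>A \<alpha>) = (\<Oplus>\<^bsub>M\<^esub>i \<in> {..<d}. fst_A \<alpha> i m \<otimes>\<^bsub>M\<^esub> \<beta> i m')"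
    using m m' \<alpha> by (intro lift_comult_A abelian_M balanced_AM linear_AM_eval)
  also have "\<dots> = (\<Oplus>\<^bsub>M\<^esub>i \<in> {..<d}. tensor_lift M (\<lambda>x y. \<alpha> (m \<otimes>\<^bsub>M\<^esub> x) \<otimes>\<^bsub>M\<^esub> (y \<otimes>\<^bsub>M\<^esub> \<beta> i m')) (b i))"
  proof (rule M.finsum_cong'[OF refl])
    fix i assume "i \<in> {..<d}"
    then have i: "i < d" by simp
    have bT: "b i \<in> carrier T" and \<beta>: "\<beta> i m' \<in> carrier M" using i m' by (simp_all add: b_B B_T beta_A A_closed)
    have "fst_A \<alpha> i m \<otimes>\<^bsub>M\<^esub> \<beta> i m' = tensor_lift M (\<lambda>x y. \<alpha> (m \<otimes>\<^bsub>M\<^esub> x) \<otimes>\<^bsub>M\<^esub> y \<otimes>\<^bsub>M\<^esub> \<beta> i m') (b i)"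
      using m \<beta> by (simp add: fst_A_def)
        (intro tensor.lift_comp[OF abelian_M abelian_M balN_A_left[OF \<alpha>]] M.additive_map_scale bT)
    also have "\<dots> = tensor_lift M (\<lambda>x y. \<alpha> (m \<otimes>\<^bsub>M\<^esub> x) \<otimes>\<^bsub>M\<^esub> (y \<otimes>\<^bsub>M\<^esub> \<beta> i m')) (b i)"
      using \<alpha> m \<beta> by (intro lift_cong[OF abelian_M bT]) (simp_all add: A_closed M.m_assoc)
    finally show "fst_A \<alpha> i m \<otimes>\<^bsub>M\<^esub> \<beta> i m' = \<dots>" .
  next
    show "(\<lambda>i. tensor_lift M (\<lambda>x y. \<alpha> (m \<otimes>\<^bsub>M\<^esub> x) \<otimes>\<^bsub>M\<^esub> (y \<otimes>\<^bsub>M\<^esub> \<beta> i m')) (b i)) \<in> {..<d} \<rightarrow> carrier M"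
      using m m' by (auto intro!: tensor.lift_closed[OF abelian_M balN_right[OF balN_A_left[OF \<alpha>]]]
          simp: b_B B_T beta_A A_closed)
  qed
  also have "\<dots> = \<alpha> (m \<otimes>\<^bsub>M\<^esub> m')"
    using lift_left_basis[OF abelian_M balN_A_left[OF \<alpha> m] m'] \<alpha> m m' by (simp add: A_closed)
  finally show ?thesis .
qed

text \<open>In M the summands <b_i, \<alpha>><\<beta>_i(x^1) (x) x^2, \<alpha>'> become values of
  \<open>act \<alpha>\<close> of b_i at a scalar argument; \<open>act_compose\<close> at 1 then sums
  them to <x, \<alpha> \<alpha>'>.\<close>

lemma pairing_mult_right:
  assumes x: "x \<in> carrier B" and \<alpha>: "\<alpha> \<in> carrier A" and \<alpha>': "\<alpha>' \<in> carrier A"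
  shows "pr x (\<alpha> \<otimes>\<^bsub>A\<^esub> \<alpha>') = tensor_lift K (\<lambda>b1 b2. pr b1 \<alpha> \<otimes>\<^bsub>K\<^esub> pr b2 \<alpha>') (\<Delta>B x)"
proof (rule iota_inj)
  have bal: "balanced_K K B B K (\<lambda>b1 b2. pr b1 \<alpha> \<otimes>\<^bsub>K\<^esub> pr b2 \<alpha>')"
    using \<alpha> \<alpha>' by (intro BB.balanced_KI) (simp_all add: additive_map_add[OF pairing_additive_left] pairing_smult_left
        N.R.l_distr N.R.r_distr N.R.m_ac)
  show "tensor_lift K (\<lambda>b1 b2. pr b1 \<alpha> \<otimes>\<^bsub>K\<^esub> pr b2 \<alpha>') (\<Delta>B x) \<in> carrier K"
    using x by (intro BB.tensor.lift_closed[OF abelian_K bal] comult_B_closed)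
  have "\<iota> (tensor_lift K (\<lambda>b1 b2. pr b1 \<alpha> \<otimes>\<^bsub>K\<^esub> pr b2 \<alpha>') (\<Delta>B x)) =
      (\<Oplus>\<^bsub>M\<^esub>i \<in> {..<d}. \<iota> (pr (b i) \<alpha> \<otimes>\<^bsub>K\<^esub> pr (lmap (\<beta> i) x) \<alpha>'))"
    using x \<alpha> \<alpha>' unfolding lift_comult_B[OF abelian_K bal x]
    by (intro additive_map_finsum[OF abelian_K abelian_M iota_additive]) (auto simp: b_B lmap_B beta_A)
  also have "\<dots> = (\<Oplus>\<^bsub>M\<^esub>i \<in> {..<d}. act \<alpha> (b i) (act \<alpha>' (lmap (\<beta> i) x) \<one>\<^bsub>M\<^esub>))"
  proof (rule M.finsum_cong'[OF refl])
    fix i assume "i \<in> {..<d}"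
    then have i: "i < d" by simp
    let ?r = "act \<alpha>' (lmap (\<beta> i) x) \<one>\<^bsub>M\<^esub>"
    have r: "?r \<in> R" using i x \<alpha>' by (intro act_R lmap_B beta_A)
    \<comment> \<open>The inner pairing value is a scalar r, so N-linearity lets it serve as the
      argument instead of as a factor.\<close>
    have "act \<alpha> (b i) ?r = ?r \<otimes>\<^bsub>M\<^esub> act \<alpha> (b i) \<one>\<^bsub>M\<^esub>"
      using EN_R[OF A_EN[OF act_A[OF \<alpha> b_B[OF i]]] r M.one_closed] r by (simp add: R_closed)
    then show "\<iota> (pr (b i) \<alpha> \<otimes>\<^bsub>K\<^esub> pr (lmap (\<beta> i) x) \<alpha>') = act \<alpha> (b i) ?r"
      using i x \<alpha> \<alpha>' r R_comm[OF r, of "act \<alpha> (b i) \<one>\<^bsub>M\<^esub>"]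
      by (simp add: iota_mult iota_pairing b_B lmap_B beta_A act_closed A_EN B_T)
  qed (use x \<alpha> \<alpha>' in \<open>auto simp: A_EN b_B lmap_B beta_A B_T intro!: act_closed\<close>)
  also have "\<dots> = \<iota> (pr x (\<alpha> \<otimes>\<^bsub>A\<^esub> \<alpha>'))"
    using x \<alpha> \<alpha>' A.m_closed[OF \<alpha> \<alpha>'] by (simp add: act_compose A_EN B_T iota_pairing)
  finally show "\<iota> (pr x (\<alpha> \<otimes>\<^bsub>A\<^esub> \<alpha>')) = \<iota> (tensor_lift K (\<lambda>b1 b2. pr b1 \<alpha> \<otimes>\<^bsub>K\<^esub> pr b2 \<alpha>') (\<Delta>B x))" by simp
qed (use x A.m_closed[OF \<alpha> \<alpha>'] in simp)

text \<open>After interchanging the sums, the inner one runs over the coproduct of \<alpha> with the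
  legs of \<alpha>' fixed. It evaluates to \<alpha>(\<alpha>'_1(m) \<alpha>'_2(m')), and \<alpha>
  then leaves the outer sum.\<close>

lemma comult_A_mult_eval:
  assumes \<alpha>: "\<alpha> \<in> carrier A" and \<alpha>': "\<alpha>' \<in> carrier A" and m: "m \<in> carrier M" and m': "m' \<in> carrier M"
  shows "tensor_lift M (\<lambda>a1 a2. a1 m \<otimes>\<^bsub>M\<^esub> a2 m') (\<Delta>A \<alpha> \<otimes>\<^bsub>A2\<^esub> \<Delta>A \<alpha>') = \<alpha> (\<alpha>' (m \<otimes>\<^bsub>M\<^esub> m'))"
proof -
  let ?f = "\<lambda>a1 a2. a1 m \<otimes>\<^bsub>M\<^esub> a2 m'"
  have f: "balanced_K K A A M ?f" using m m' by (intro balanced_AM linear_AM_eval)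
  note w = comult_A_closed[OF \<alpha>] and w' = comult_A_closed[OF \<alpha>']
  have "tensor_lift M ?f (\<Delta>A \<alpha> \<otimes>\<^bsub>A2\<^esub> \<Delta>A \<alpha>') = tensor_lift M (\<lambda>a1 a2. tensor_lift M (\<lambda>a1' a2'.
      ?f (a1 \<otimes>\<^bsub>A\<^esub> a1') (a2 \<otimes>\<^bsub>A\<^esub> a2')) (\<Delta>A \<alpha>')) (\<Delta>A \<alpha>)"
    by (rule AA.lift_mult[OF abelian_M f w w'])
  also have "\<dots> = tensor_lift M (\<lambda>a1' a2'. tensor_lift M (\<lambda>a1 a2.
      ?f (a1 \<otimes>\<^bsub>A\<^esub> a1') (a2 \<otimes>\<^bsub>A\<^esub> a2')) (\<Delta>A \<alpha>)) (\<Delta>A \<alpha>')"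
    by (rule AA.tensor.lift_swap[OF AA.tensor.tensor_space_axioms abelian_M w w'])
      (use AA.balanced_mult_left[OF _ _ f] AA.balanced_mult_right[OF _ _ f] in \<open>simp_all del: A_simps\<close>)
  also have "\<dots> = tensor_lift M (\<lambda>a1' a2'. \<alpha> (?f a1' a2')) (\<Delta>A \<alpha>')"
  proof (rule AA.lift_cong[OF abelian_M w'])
    fix a1' a2' assume a: "a1' \<in> carrier A" "a2' \<in> carrier A"
    show "tensor_lift M (\<lambda>a1 a2. ?f (a1 \<otimes>\<^bsub>A\<^esub> a1') (a2 \<otimes>\<^bsub>A\<^esub> a2')) (\<Delta>A \<alpha>) = \<alpha> (?f a1' a2')"
      using m m' a comult_A_eval[OF \<alpha>, of "a1' m" "a2' m'"] by (simp add: compose_eq A_closed)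
  qed (use \<alpha> m m' in \<open>simp add: A_closed\<close>)
  also have "\<dots> = \<alpha> (tensor_lift M ?f (\<Delta>A \<alpha>'))"
    by (rule AA.tensor.lift_comp[OF abelian_M abelian_M f A_additive[OF \<alpha>] w', symmetric])
  finally show ?thesis using m m' \<alpha>' by (simp add: comult_A_eval)
qed

lemma act_id:
  assumes t: "t \<in> carrier T" and m: "m \<in> carrier M"
  shows "act (\<lambda>m \<in> carrier M. m) t m = act (\<lambda>m \<in> carrier M. m) t \<one>\<^bsub>M\<^esub> \<otimes>\<^bsub>M\<^esub> m"
  by (rule additive_map_eqI[OF act_additive additive_map_comp[OF act_additive M.additive_map_scale(2)] t])
    (use m A_EN[OF A_nonempty(1)] in \<open>simp_all add: act_tens M.m_assoc\<close>)

text \<open>The product x y contracts to y^1 (x^1 x^2) y^2, and x^1 x^2 is central.\<close>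

lemma pairing_mult_one:
  assumes x: "x \<in> carrier B" and y: "y \<in> carrier B"
  shows "pr (x \<otimes>\<^bsub>B\<^esub> y) \<one>\<^bsub>A\<^esub> = pr x \<one>\<^bsub>A\<^esub> \<otimes>\<^bsub>K\<^esub> pr y \<one>\<^bsub>A\<^esub>"
proof (rule iota_inj)
  let ?id = "\<lambda>m \<in> carrier M. m"
  note id = A_nonempty(1) and idE = A_EN[OF A_nonempty(1)]
  let ?r = "act ?id x \<one>\<^bsub>M\<^esub>"
  have r: "?r \<in> R" by (rule act_R[OF id x])
  have E: "(\<lambda>m \<in> carrier M. act ?id x m) \<in> carrier EN" by (rule act_EN[OF idE x])
  have "act (\<lambda>m \<in> carrier M. act ?id x m) t \<one>\<^bsub>M\<^esub> = ?r \<otimes>\<^bsub>M\<^esub> act ?id t \<one>\<^bsub>M\<^esub>" if "t \<in> carrier T" for t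
  proof (rule additive_map_eqI[OF act_additive[OF E] additive_map_comp[OF act_additive M.additive_map_scale(1)] that])
    fix u v assume uv: "u \<in> carrier M" "v \<in> carrier M"
    have "u \<otimes>\<^bsub>M\<^esub> (?r \<otimes>\<^bsub>M\<^esub> v) = ?r \<otimes>\<^bsub>M\<^esub> (u \<otimes>\<^bsub>M\<^esub> v)"
      using uv R_comm[OF r uv(1)] R_closed[OF r] by (simp flip: M.m_assoc)
    then show "act (\<lambda>m \<in> carrier M. act ?id x m) (u \<otimes>N v) \<one>\<^bsub>M\<^esub> = ?r \<otimes>\<^bsub>M\<^esub> act ?id (u \<otimes>N v) \<one>\<^bsub>M\<^esub>"
      using uv x by (simp add: act_tens E idE act_id[OF B_T[OF x] uv(2)])
  qed (use idE r in \<open>simp_all add: R_closed\<close>)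
  then show "\<iota> (pr (x \<otimes>\<^bsub>B\<^esub> y) \<one>\<^bsub>A\<^esub>) = \<iota> (pr x \<one>\<^bsub>A\<^esub> \<otimes>\<^bsub>K\<^esub> pr y \<one>\<^bsub>A\<^esub>)"
    using x y id idE by (simp add: iota_mult iota_pairing mult_B ins_B act_ins B_T)
qed (use x y B.m_closed[OF x y] A_nonempty(1) in simp_all)

lemma pairing_one: "\<alpha> \<in> carrier A \<Longrightarrow> pr \<one>\<^bsub>B\<^esub> \<alpha> = \<sigma> (\<alpha> \<one>\<^bsub>M\<^esub>)"
  by (simp add: pairing_eq A_EN B_simps tens_closed act_tens A_closed)

lemma counit_B_eq: "x \<in> carrier B \<Longrightarrow> counit_B K M x = pr x \<one>\<^bsub>A\<^esub>"
proof -
  assume x: "x \<in> carrier B"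
  have "tensor_lift M (\<lambda>u v. u \<otimes>\<^bsub>M\<^esub> v) x = tensor_lift M (\<lambda>u v. u \<otimes>\<^bsub>M\<^esub> (\<lambda>m \<in> carrier M. m) v) x"
    by (intro lift_cong[OF abelian_M B_T[OF x]]) simp_all
  then show ?thesis by (simp add: counit_B_def pairing_def)
qed

lemma counit_A_eq: "\<alpha> \<in> carrier A \<Longrightarrow> counit_A K M \<alpha> = pr \<one>\<^bsub>B\<^esub> \<alpha>"
  by (simp add: counit_A_def pairing_one)

text \<open>\<alpha>'(1) is a scalar, so \<alpha>(\<alpha>'(1)) = \<alpha>'(1) \<alpha>(1).\<close>

lemma pairing_one_mult:
  assumes \<alpha>: "\<alpha> \<in> carrier A" and \<alpha>': "\<alpha>' \<in> carrier A"
  shows "pr \<one>\<^bsub>B\<^esub> (\<alpha> \<otimes>\<^bsub>A\<^esub> \<alpha>') = pr \<one>\<^bsub>B\<^esub> \<alpha> \<otimes>\<^bsub>K\<^esub> pr \<one>\<^bsub>B\<^esub> \<alpha>'"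
proof (rule iota_inj)
  have "\<alpha> (\<alpha>' \<one>\<^bsub>M\<^esub>) = \<alpha> \<one>\<^bsub>M\<^esub> \<otimes>\<^bsub>M\<^esub> \<alpha>' \<one>\<^bsub>M\<^esub>"
    using EN_R[OF A_EN[OF \<alpha>] A_one_R[OF \<alpha>'] M.one_closed] R_comm[OF A_one_R[OF \<alpha>']] assms
    by (simp add: A_closed)
  then show "\<iota> (pr \<one>\<^bsub>B\<^esub> (\<alpha> \<otimes>\<^bsub>A\<^esub> \<alpha>')) = \<iota> (pr \<one>\<^bsub>B\<^esub> \<alpha> \<otimes>\<^bsub>K\<^esub> pr \<one>\<^bsub>B\<^esub> \<alpha>')"
    using assms A.m_closed[OF assms]
    by (simp add: pairing_one iota_mult iota_scalar A_one_R scalar_in_K compose_eq)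
      (metis A_one_R M.one_closed compose_eq iota_scalar)
qed (use assms A.m_closed[OF assms] in simp_all)

theorem dual_pair: "dual_pair K A B pr e c \<gamma> \<Delta>A (counit_A K M) \<Delta>B (counit_B K M)"
proof (intro dual_pair.intro dual_pair_axioms.intro)
  show "assoc_algebra K A" "assoc_algebra K B" by (rule assoc_algebra_A assoc_algebra_B)+
  show "pr \<one>\<^bsub>B\<^esub> \<one>\<^bsub>A\<^esub> = \<one>\<^bsub>K\<^esub>"
    using scalar_iota[of "\<one>\<^bsub>K\<^esub>"] A_nonempty(1) by (simp add: pairing_one)
next
  fix x y \<alpha> assume *: "x \<in> carrier B" "y \<in> carrier B" "\<alpha> \<in> carrier A"
  show "pr (x \<otimes>\<^bsub>B\<^esub> y) \<alpha> = tensor_lift K (\<lambda>a1 a2. pr x a1 \<otimes>\<^bsub>K\<^esub> pr y a2) (\<Delta>A \<alpha>)"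
    using * by (intro pairing_factorization comult_A_closed) (simp_all add: comult_A_eval)
next
  fix x y \<alpha> \<alpha>' assume *: "x \<in> carrier B" "y \<in> carrier B" "\<alpha> \<in> carrier A" "\<alpha>' \<in> carrier A"
  have bal: "balanced_K K A A K (\<lambda>a1 a2. pr x a1 \<otimes>\<^bsub>K\<^esub> pr y a2)"
    using * by (intro AA.balanced_KI) (simp_all add: additive_map_add[OF pairing_additive_right] pairing_smult_right
        N.R.l_distr N.R.r_distr N.R.m_ac del: A_simps)
  \<comment> \<open>The factorization lemma is used with w the product of the two coproducts: by
    \<open>comult_A_mult_eval\<close> it represents the composite endomorphism just as the coproduct
    of the composite does.\<close>
  have "pr (x \<otimes>\<^bsub>B\<^esub> y) (\<alpha> \<otimes>\<^bsub>A\<^esub> \<alpha>') = tensor_lift K (\<lambda>a1 a2. pr x a1 \<otimes>\<^bsub>K\<^esub> pr y a2) (\<Delta>A \<alpha> \<otimes>\<^bsub>A2\<^esub> \<Delta>A \<alpha>')"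
    using * by (intro pairing_factorization AA.mult_tensor_closed comult_A_closed A.m_closed)
      (simp_all add: comult_A_mult_eval compose_eq)
  then show "pr (x \<otimes>\<^bsub>B\<^esub> y) (\<alpha> \<otimes>\<^bsub>A\<^esub> \<alpha>') = tensor_lift K (\<lambda>a1 a2. tensor_lift K (\<lambda>a1' a2'.
          pr x (a1 \<otimes>\<^bsub>A\<^esub> a1') \<otimes>\<^bsub>K\<^esub> pr y (a2 \<otimes>\<^bsub>A\<^esub> a2')) (\<Delta>A \<alpha>')) (\<Delta>A \<alpha>)"
    using * by (simp add: AA.lift_mult[OF abelian_K bal] comult_A_closed del: A_simps)
qed (rule pairing_additive_left pairing_additive_right pairing_smult_left pairing_smult_right c_B gamma_A
    A_basis B_basis comult_A_closed comult_B_closed pairing_mult_right counit_A_eq counit_B_eq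
    pairing_one_mult pairing_mult_one; assumption)+

sublocale dual: dual_pair K A B pr e c \<gamma> \<Delta>A "counit_A K M" \<Delta>B "counit_B K M"
  by (rule dual_pair)

end

context tensor_modules
begin

lemma lift_smult:
  assumes G: "abelian_group G" and f: "balanced_K K X Y G f" and k: "k \<in> carrier K"
    and t: "t \<in> carrier (tensor_K K X Y)"
  shows "tensor_lift G f (k \<odot>\<^bsub>tensor_K K X Y\<^esub> t) = tensor_lift G (\<lambda>x y. f (k \<odot>\<^bsub>X\<^esub> x) y) t"
proof -
  have kf: "balanced_K K X Y G (\<lambda>x y. f (k \<odot>\<^bsub>X\<^esub> x) y)"
  proof (rule balanced_KI)
    fix l x y assume *: "l \<in> carrier K" "x \<in> carrier X" "y \<in> carrier Y"
    have "k \<odot>\<^bsub>X\<^esub> (l \<odot>\<^bsub>X\<^esub> x) = l \<odot>\<^bsub>X\<^esub> (k \<odot>\<^bsub>X\<^esub> x)"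
      using k * X.R.m_comm[OF k *(1)] by (simp flip: X.smult_assoc1)
    then show "f (k \<odot>\<^bsub>X\<^esub> (l \<odot>\<^bsub>X\<^esub> x)) y = f (k \<odot>\<^bsub>X\<^esub> x) (l \<odot>\<^bsub>Y\<^esub> y)"
      using f k * by (simp add: balanced_map_def)
  qed (use f k in \<open>simp_all add: balanced_map_def additive_map_def X.smult_r_distr\<close>)
  show ?thesis
    by (rule additive_map_eqI[OF additive_map_comp[OF additive_smult[OF k] tensor.additive_map_lift[OF G f]]
          tensor.additive_map_lift[OF G kf] t])
      (simp add: k smult_elem lift_elem[OF G f] lift_elem[OF G kf])
qed

end

context depth_two_extension
begin

section \<open>The antipode\<close>

text \<open>The second pairing with an endomorphism in each leg. \<open>\<alpha>' = idA\<close> is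
  the form defining the antipode; a general \<alpha>' appears when S(\<alpha>_1) \<alpha>_2 is
  paired with B.\<close>

definition Q :: "('m \<Rightarrow> 'm) \<Rightarrow> ('m \<Rightarrow> 'm) \<Rightarrow> ('m \<times> 'm \<Rightarrow>\<^sub>0 int) set \<Rightarrow> 'm" where
  "Q \<alpha> \<alpha>' t = tensor_lift M (\<lambda>u v. \<alpha> u \<otimes>\<^bsub>M\<^esub> \<alpha>' v) t"

abbreviation (input) "idA \<equiv> (\<lambda>m \<in> carrier M. m)"

lemma idA: "idA \<in> carrier A" by (rule A_nonempty)

lemma balN_AA: "\<lbrakk>\<alpha> \<in> carrier A; \<alpha>' \<in> carrier A\<rbrakk> \<Longrightarrow> balN M (\<lambda>u v. \<alpha> u \<otimes>\<^bsub>M\<^esub> \<alpha>' v)"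
  by (rule balN_A_EN[OF _ A_EN])

lemma Q_additive: "\<lbrakk>\<alpha> \<in> carrier A; \<alpha>' \<in> carrier A\<rbrakk> \<Longrightarrow> additive_map T M (Q \<alpha> \<alpha>')"
  unfolding Q_def by (rule tensor.additive_map_lift[OF abelian_M balN_AA])

lemma Q_closed: "\<lbrakk>\<alpha> \<in> carrier A; \<alpha>' \<in> carrier A; t \<in> carrier T\<rbrakk> \<Longrightarrow> Q \<alpha> \<alpha>' t \<in> carrier M"
  by (rule additive_map_closed[OF Q_additive])

lemma Q_tens: "\<lbrakk>\<alpha> \<in> carrier A; \<alpha>' \<in> carrier A; u \<in> carrier M; v \<in> carrier M\<rbrakk> \<Longrightarrow> Q \<alpha> \<alpha>' (u \<otimes>N v) = \<alpha> u \<otimes>\<^bsub>M\<^esub> \<alpha>' v"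
  unfolding Q_def by (rule lift_tens[OF abelian_M balN_AA])

lemma Q_balanced: "t \<in> carrier T \<Longrightarrow> balanced_K K A A M (\<lambda>\<alpha> \<alpha>'. Q \<alpha> \<alpha>' t)"
  unfolding Q_def
  by (rule tensor.balanced_map_lift_param[OF abelian_M _ AA.tensor.abelian_X AA.tensor.abelian_Y])
    (simp_all add: balN_AA balanced_AM linear_AM_eval del: A_simps)

lemma Q_R: "\<lbrakk>\<alpha> \<in> carrier A; \<alpha>' \<in> carrier A; x \<in> carrier B\<rbrakk> \<Longrightarrow> Q \<alpha> \<alpha>' x \<in> R"
  unfolding Q_def by (rule central_lift[OF _ balN_AA]) (simp_all add: A_left A_right A_closed M.m_assoc)

lemma Q_smult:
  assumes "k \<in> carrier K" "\<alpha> \<in> carrier A" "\<alpha>' \<in> carrier A" "t \<in> carrier T"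
  shows "Q (k \<odot>\<^bsub>A\<^esub> \<alpha>) \<alpha>' t = k \<odot>\<^bsub>M\<^esub> Q \<alpha> \<alpha>' t" "Q \<alpha> \<alpha>' (\<iota> k \<triangleright> t) = k \<odot>\<^bsub>M\<^esub> Q \<alpha> \<alpha>' t"
proof -
  have k: "additive_map T M (\<lambda>t. k \<odot>\<^bsub>M\<^esub> Q \<alpha> \<alpha>' t)"
    using assms by (intro additive_map_comp[OF Q_additive]) (simp_all add: additive_map_def M.smult_r_distr)
  have kA: "k \<odot>\<^bsub>A\<^esub> \<alpha> \<in> carrier A" using assms(1,2) by (rule A.smult_closed)
  show "Q (k \<odot>\<^bsub>A\<^esub> \<alpha>) \<alpha>' t = k \<odot>\<^bsub>M\<^esub> Q \<alpha> \<alpha>' t"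
    by (rule additive_map_eqI[OF Q_additive[OF kA assms(3)] k assms(4)])
      (use assms kA in \<open>simp add: Q_tens, simp add: A_closed M.smult_mult_left\<close>)
  show "Q \<alpha> \<alpha>' (\<iota> k \<triangleright> t) = k \<odot>\<^bsub>M\<^esub> Q \<alpha> \<alpha>' t"
    by (rule additive_map_eqI[OF additive_map_comp[OF left_mult_additive Q_additive[OF assms(2,3)]] k assms(4)])
      (use assms in \<open>simp_all add: left_mult_tens Q_tens M.smult_mult_left A_smult A_closed\<close>)
qed

definition q :: "('m \<Rightarrow> 'm) \<Rightarrow> ('m \<times> 'm \<Rightarrow>\<^sub>0 int) set \<Rightarrow> 'k" where
  "q \<alpha> x = \<sigma> (Q \<alpha> idA x)"

lemma q_closed: "\<lbrakk>\<alpha> \<in> carrier A; x \<in> carrier B\<rbrakk> \<Longrightarrow> q \<alpha> x \<in> carrier K"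
  and iota_q: "\<lbrakk>\<alpha> \<in> carrier A; x \<in> carrier B\<rbrakk> \<Longrightarrow> \<iota> (q \<alpha> x) = Q \<alpha> idA x"
  by (simp_all add: q_def scalar_in_K iota_scalar Q_R idA)

lemma q_additive: "\<alpha> \<in> carrier A \<Longrightarrow> additive_map B K (q \<alpha>)"
proof (rule additive_mapI)
  fix x y assume *: "\<alpha> \<in> carrier A" "x \<in> carrier B" "y \<in> carrier B"
  then show "q \<alpha> (x \<oplus>\<^bsub>B\<^esub> y) = q \<alpha> x \<oplus>\<^bsub>K\<^esub> q \<alpha> y"
    using additive_map_add[OF Q_additive[OF *(1) idA] B_T[OF *(2)] B_T[OF *(3)]]
    by (intro iota_inj) (simp_all add: q_closed iota_q additive_map_add[OF iota_additive], simp add: B_simps)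
qed (simp add: q_closed)

lemma q_add: "\<lbrakk>\<alpha> \<in> carrier A; \<alpha>' \<in> carrier A; x \<in> carrier B\<rbrakk> \<Longrightarrow> q (\<alpha> \<oplus>\<^bsub>A\<^esub> \<alpha>') x = q \<alpha> x \<oplus>\<^bsub>K\<^esub> q \<alpha>' x"
  using Q_balanced[OF B_T, of x] idA
  by (intro iota_inj) (simp_all add: q_closed iota_q additive_map_add[OF iota_additive]
      balanced_map_def additive_map_def A.a_closed del: A_simps)

lemma q_smult_left: "\<lbrakk>k \<in> carrier K; \<alpha> \<in> carrier A; x \<in> carrier B\<rbrakk> \<Longrightarrow> q (k \<odot>\<^bsub>A\<^esub> \<alpha>) x = k \<otimes>\<^bsub>K\<^esub> q \<alpha> x"
  by (intro iota_inj) (simp_all add: q_closed iota_q iota_mult Q_smult idA B_T Q_closed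
      M.smult_mult_left A.smult_closed del: A_simps)

lemma q_smult_right: "\<lbrakk>k \<in> carrier K; \<alpha> \<in> carrier A; x \<in> carrier B\<rbrakk> \<Longrightarrow> q \<alpha> (k \<odot>\<^bsub>B\<^esub> x) = k \<otimes>\<^bsub>K\<^esub> q \<alpha> x"
  by (intro iota_inj) (simp_all add: q_closed iota_q iota_mult Q_closed idA B_T M.smult_mult_left,
      simp add: B_simps Q_smult idA B_T)

text \<open>The functional \<open>q \<alpha>\<close> on B is represented by an element of A through
  the dual bases: \<open>A_basis\<close> forces its coefficients to be the values at c_i.\<close>

definition S :: "('m \<Rightarrow> 'm) \<Rightarrow> 'm \<Rightarrow> 'm" where
  "S = (\<lambda>\<alpha> \<in> carrier A. \<Oplus>\<^bsub>A\<^esub>i \<in> {..<e}. q \<alpha> (c i) \<odot>\<^bsub>A\<^esub> \<gamma> i)"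

lemma S_summand: "\<lbrakk>\<alpha> \<in> carrier A; i < e\<rbrakk> \<Longrightarrow> q \<alpha> (c i) \<odot>\<^bsub>A\<^esub> \<gamma> i \<in> carrier A"
  by (intro A.smult_closed q_closed c_B gamma_A)

lemma S_closed: "\<alpha> \<in> carrier A \<Longrightarrow> S \<alpha> \<in> carrier A"
  using S_summand[of \<alpha>] by (auto simp: S_def simp del: A_simps intro!: A.finsum_closed)

lemma pairing_S:
  assumes \<alpha>: "\<alpha> \<in> carrier A" and x: "x \<in> carrier B"
  shows "pr x (S \<alpha>) = q \<alpha> x"
proof -
  have "pr x (S \<alpha>) = (\<Oplus>\<^bsub>K\<^esub>i \<in> {..<e}. pr x (q \<alpha> (c i) \<odot>\<^bsub>A\<^esub> \<gamma> i))"
    unfolding S_def using \<alpha> x S_summand[OF \<alpha>]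
    by (simp del: A_simps,
        intro additive_map_finsum[OF A.abelian_group_axioms abelian_K pairing_additive_right]) auto
  \<comment> \<open>The scalars <x, \<gamma>_i> move inside \<open>q \<alpha>\<close>, so that the
    dual basis expansion of x in B can be applied.\<close>
  also have "\<dots> = (\<Oplus>\<^bsub>K\<^esub>i \<in> {..<e}. q \<alpha> (pr x (\<gamma> i) \<odot>\<^bsub>B\<^esub> c i))"
    using \<alpha> x by (intro N.R.finsum_cong') (auto simp: pairing_smult_right q_smult_right q_closed c_B gamma_A
        N.R.m_comm simp del: A_simps)
  also have "\<dots> = q \<alpha> (\<Oplus>\<^bsub>B\<^esub>i \<in> {..<e}. pr x (\<gamma> i) \<odot>\<^bsub>B\<^esub> c i)"
    using \<alpha> x by (intro additive_map_finsum[OF abelian_B abelian_K q_additive, symmetric])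
      (auto simp: gamma_A c_B intro!: B.smult_closed)
  finally show ?thesis using x by (simp add: B_basis)
qed

lemma S_linear: "S \<in> linear_maps K A A"
  unfolding linear_maps_def
proof (intro CollectI conjI ballI)
  show "S \<in> carrier A \<rightarrow>\<^sub>E carrier A"
  proof (rule PiE_I)
    show "S \<alpha> = undefined" if "\<alpha> \<notin> carrier A" for \<alpha> using that by (simp add: S_def)
  qed (rule S_closed)
  show "S (\<alpha> \<oplus>\<^bsub>A\<^esub> \<alpha>') = S \<alpha> \<oplus>\<^bsub>A\<^esub> S \<alpha>'" if "\<alpha> \<in> carrier A" "\<alpha>' \<in> carrier A" for \<alpha> \<alpha>'
    using that by (intro dual.A_eqI S_closed A.a_closed)
      (simp_all add: pairing_S q_add A.a_closed additive_map_add[OF pairing_additive_right] S_closed del: A_simps)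
  show "S (k \<odot>\<^bsub>A\<^esub> \<alpha>) = k \<odot>\<^bsub>A\<^esub> S \<alpha>" if "k \<in> carrier K" "\<alpha> \<in> carrier A" for k \<alpha>
    using that by (intro dual.A_eqI S_closed A.smult_closed)
      (simp_all add: pairing_S q_smult_left A.smult_closed pairing_smult_right S_closed del: A_simps)
qed

lemma S_apply:
  assumes \<alpha>: "\<alpha> \<in> carrier A" and m: "m \<in> carrier M"
  shows "S \<alpha> m = (\<Oplus>\<^bsub>M\<^esub>i \<in> {..<e}. Q \<alpha> idA (c i) \<otimes>\<^bsub>M\<^esub> \<gamma> i m)"
proof -
  have "S \<alpha> m = (\<Oplus>\<^bsub>M\<^esub>i \<in> {..<e}. (q \<alpha> (c i) \<odot>\<^bsub>A\<^esub> \<gamma> i) m)"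
    unfolding S_def using \<alpha> m S_summand[OF \<alpha>]
    by (simp del: A_simps,
        intro additive_map_finsum[OF A.abelian_group_axioms abelian_M A_eval_additive]) auto
  also have "\<dots> = (\<Oplus>\<^bsub>M\<^esub>i \<in> {..<e}. Q \<alpha> idA (c i) \<otimes>\<^bsub>M\<^esub> \<gamma> i m)"
    using \<alpha> m by (intro M.finsum_cong')
      (auto simp: q_def scalar_smult Q_R idA c_B gamma_A A_closed Q_closed B_T)
  finally show ?thesis .
qed

lemma compose_linear:
  assumes p: "p \<in> linear_maps K A A" and p': "p' \<in> linear_maps K A A"
  shows "balanced_K K A A A (\<lambda>a1 a2. p a1 \<otimes>\<^bsub>A\<^esub> p' a2)"
  using p p' by (intro AA.balanced_KI) (auto simp: linear_maps_def A.l_distr A.r_distr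
      A.smult_mult_left A.smult_mult_right PiE_iff simp del: A_simps)

lemma idA_linear: "(\<lambda>\<alpha> \<in> carrier A. \<alpha>) \<in> linear_maps K A A"
  by (auto simp: linear_maps_def A.a_closed A.smult_closed simp del: A_simps)

lemma balanced_S_right: "balanced_K K A A A (\<lambda>a1 a2. a1 \<otimes>\<^bsub>A\<^esub> S a2)"
  by (rule AA.tensor.balanced_map_cong[OF compose_linear[OF idA_linear S_linear]]) (simp del: A_simps)

lemma balanced_S_left: "balanced_K K A A A (\<lambda>a1 a2. S a1 \<otimes>\<^bsub>A\<^esub> a2)"
  by (rule AA.tensor.balanced_map_cong[OF compose_linear[OF S_linear idA_linear]]) (simp del: A_simps)

text \<open>For t = x (x) y, the left side is \<alpha>_1(m) \<alpha>_2(x) y = \<alpha>(m x) y by the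
  defining property of the coproduct.\<close>

lemma lift_comult_A_Q:
  assumes \<alpha>: "\<alpha> \<in> carrier A" and m: "m \<in> carrier M" and t: "t \<in> carrier T"
  shows "tensor_lift M (\<lambda>a1 a2. a1 m \<otimes>\<^bsub>M\<^esub> Q a2 idA t) (\<Delta>A \<alpha>) = tensor_lift M (\<lambda>u v. \<alpha> (m \<otimes>\<^bsub>M\<^esub> u) \<otimes>\<^bsub>M\<^esub> v) t"
proof (rule additive_map_eqI[OF _ tensor.additive_map_lift[OF abelian_M balN_A_left[OF \<alpha> m]] t])
  have lin: "linear_AM (\<lambda>\<alpha>. Q \<alpha> idA t)" if "t \<in> carrier T" for t
    using that Q_balanced[OF that] by (simp add: linear_AM_def Q_smult idA balanced_map_def del: A_simps)
  show "additive_map T M (\<lambda>t. tensor_lift M (\<lambda>a1 a2. a1 m \<otimes>\<^bsub>M\<^esub> Q a2 idA t) (\<Delta>A \<alpha>))"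
    using m by (intro AA.tensor.additive_map_lift_param[OF abelian_M comult_A_closed[OF \<alpha>]] balanced_AM
        linear_AM_eval lin additive_map_comp[OF Q_additive M.additive_map_scale(1)] abelian_T)
      (simp_all add: idA A_closed)
  fix x y assume xy: "x \<in> carrier M" "y \<in> carrier M"
  have "tensor_lift M (\<lambda>a1 a2. a1 m \<otimes>\<^bsub>M\<^esub> Q a2 idA (x \<otimes>N y)) (\<Delta>A \<alpha>) =
    tensor_lift M (\<lambda>a1 a2. a1 m \<otimes>\<^bsub>M\<^esub> a2 x \<otimes>\<^bsub>M\<^esub> y) (\<Delta>A \<alpha>)"
    using xy m by (intro AA.lift_cong[OF abelian_M comult_A_closed[OF \<alpha>]])
      (simp_all add: Q_tens idA A_closed M.m_assoc)
  also have "\<dots> = tensor_lift M (\<lambda>a1 a2. a1 m \<otimes>\<^bsub>M\<^esub> a2 x) (\<Delta>A \<alpha>) \<otimes>\<^bsub>M\<^esub> y"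
    using xy m by (intro AA.tensor.lift_comp[OF abelian_M abelian_M, symmetric] balanced_AM linear_AM_eval
        M.additive_map_scale comult_A_closed \<alpha>)
  finally show "tensor_lift M (\<lambda>a1 a2. a1 m \<otimes>\<^bsub>M\<^esub> Q a2 idA (x \<otimes>N y)) (\<Delta>A \<alpha>) =
      tensor_lift M (\<lambda>u v. \<alpha> (m \<otimes>\<^bsub>M\<^esub> u) \<otimes>\<^bsub>M\<^esub> v) (x \<otimes>N y)"
    using xy m \<alpha> by (simp add: comult_A_eval lift_tens[OF abelian_M balN_A_left[OF \<alpha> m]])
qed

text \<open>At m, \<open>S_apply\<close> gives the sum of \<alpha>_1(\<gamma>_i(m))
  \<alpha>_2(c_i^1) c_i^2. This contracts to \<alpha>(\<gamma>_i(m) c_i^1) c_i^2, which the right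
  quasibasis sums to \<alpha>(1) m.\<close>

lemma S_right_inverse:
  assumes \<alpha>: "\<alpha> \<in> carrier A"
  shows "tensor_lift A (\<lambda>a1 a2. a1 \<otimes>\<^bsub>A\<^esub> S a2) (\<Delta>A \<alpha>) = counit_A K M \<alpha> \<odot>\<^bsub>A\<^esub> \<one>\<^bsub>A\<^esub>"
proof (rule A_eqI)
  note w = comult_A_closed[OF \<alpha>]
  show "tensor_lift A (\<lambda>a1 a2. a1 \<otimes>\<^bsub>A\<^esub> S a2) (\<Delta>A \<alpha>) \<in> carrier A"
    by (rule AA.tensor.lift_closed[OF A.abelian_group_axioms balanced_S_right w])
  show "counit_A K M \<alpha> \<odot>\<^bsub>A\<^esub> \<one>\<^bsub>A\<^esub> \<in> carrier A"
    using \<alpha> by (intro A.smult_closed A.one_closed) (simp add: counit_A_def scalar_in_K A_one_R)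
  fix m assume m: "m \<in> carrier M"
  have lin: "linear_AM (\<lambda>\<alpha>. Q \<alpha> idA t)" if "t \<in> carrier T" for t
    using that Q_balanced[OF that] by (simp add: linear_AM_def Q_smult idA balanced_map_def del: A_simps)
  have "tensor_lift A (\<lambda>a1 a2. a1 \<otimes>\<^bsub>A\<^esub> S a2) (\<Delta>A \<alpha>) m = tensor_lift M (\<lambda>a1 a2. (a1 \<otimes>\<^bsub>A\<^esub> S a2) m) (\<Delta>A \<alpha>)"
    by (rule AA.tensor.lift_comp[OF A.abelian_group_axioms abelian_M balanced_S_right A_eval_additive[OF m] w])
  also have "\<dots> = tensor_lift M (\<lambda>a1 a2. \<Oplus>\<^bsub>M\<^esub>i \<in> {..<e}. a1 (\<gamma> i m) \<otimes>\<^bsub>M\<^esub> Q a2 idA (c i)) (\<Delta>A \<alpha>)"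
  proof (rule AA.lift_cong[OF abelian_M w])
    fix a1 a2 assume a: "a1 \<in> carrier A" "a2 \<in> carrier A"
    show cl: "(\<Oplus>\<^bsub>M\<^esub>i \<in> {..<e}. a1 (\<gamma> i m) \<otimes>\<^bsub>M\<^esub> Q a2 idA (c i)) \<in> carrier M"
      using a m by (intro M.finsum_closed) (auto simp: A_closed gamma_A Q_closed c_B B_T idA)
    have "(a1 \<otimes>\<^bsub>A\<^esub> S a2) m = a1 (\<Oplus>\<^bsub>M\<^esub>i \<in> {..<e}. Q a2 idA (c i) \<otimes>\<^bsub>M\<^esub> \<gamma> i m)"
      using a m by (simp add: compose_eq S_apply)
    also have "\<dots> = (\<Oplus>\<^bsub>M\<^esub>i \<in> {..<e}. a1 (Q a2 idA (c i) \<otimes>\<^bsub>M\<^esub> \<gamma> i m))"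
      using a m by (intro additive_map_finsum[OF abelian_M abelian_M A_additive])
        (auto simp: A_closed gamma_A Q_closed c_B B_T idA)
    \<comment> \<open>\<alpha>_2(c_i^1) c_i^2 is central by irreducibility, so it leaves
      \<open>a1\<close> and may be put on the right.\<close>
    also have "\<dots> = (\<Oplus>\<^bsub>M\<^esub>i \<in> {..<e}. a1 (\<gamma> i m) \<otimes>\<^bsub>M\<^esub> Q a2 idA (c i))"
      using a m by (intro M.finsum_cong')
        (auto simp: A_closed gamma_A Q_closed c_B B_T idA EN_R[OF A_EN] Q_R R_comm[OF Q_R])
    finally show "(a1 \<otimes>\<^bsub>A\<^esub> S a2) m = (\<Oplus>\<^bsub>M\<^esub>i \<in> {..<e}. a1 (\<gamma> i m) \<otimes>\<^bsub>M\<^esub> Q a2 idA (c i))" .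
  qed
  also have "\<dots> = (\<Oplus>\<^bsub>M\<^esub>i \<in> {..<e}. tensor_lift M (\<lambda>a1 a2. a1 (\<gamma> i m) \<otimes>\<^bsub>M\<^esub> Q a2 idA (c i)) (\<Delta>A \<alpha>))"
    using m by (intro AA.tensor.lift_finsum_fun[OF abelian_M _ w] balanced_AM linear_AM_eval lin)
      (simp_all add: A_closed gamma_A c_B B_T)
  also have "\<dots> = (\<Oplus>\<^bsub>M\<^esub>i \<in> {..<e}. tensor_lift M (\<lambda>u v. \<alpha> (\<gamma> i m \<otimes>\<^bsub>M\<^esub> u) \<otimes>\<^bsub>M\<^esub> v) (c i))"
    using m \<alpha> by (intro M.finsum_cong') (auto simp: lift_comult_A_Q A_closed gamma_A c_B B_T
        intro!: tensor.lift_closed[OF abelian_M balN_A_left])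
  also have "\<dots> = \<alpha> \<one>\<^bsub>M\<^esub> \<otimes>\<^bsub>M\<^esub> m"
    by (rule lift_right_basis[OF abelian_M balN_A[OF \<alpha>] m])
  also have "\<dots> = (counit_A K M \<alpha> \<odot>\<^bsub>A\<^esub> \<one>\<^bsub>A\<^esub>) m"
    using m \<alpha> by (simp add: counit_A_def scalar_smult A_one_R)
  finally show "tensor_lift A (\<lambda>a1 a2. a1 \<otimes>\<^bsub>A\<^esub> S a2) (\<Delta>A \<alpha>) m = (counit_A K M \<alpha> \<odot>\<^bsub>A\<^esub> \<one>\<^bsub>A\<^esub>) m" .
qed

text \<open>On u (x) v both sides are u \<xi>(\<eta>(v)). It transposes composition with \<eta> on
  the right to \<open>rmap \<eta>\<close> on the tensor, isolating S as the remaining factor in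
  A.\<close>

lemma act_compose_rmap:
  assumes \<xi>: "\<xi> \<in> carrier A" and \<eta>: "\<eta> \<in> carrier A" and t: "t \<in> carrier T"
  shows "act (\<xi> \<otimes>\<^bsub>A\<^esub> \<eta>) t \<one>\<^bsub>M\<^esub> = act \<xi> (rmap \<eta> t) \<one>\<^bsub>M\<^esub>"
  by (rule additive_map_eqI[OF act_additive additive_map_comp[OF rmap_additive act_additive] t])
    (use \<xi> \<eta> A.m_closed[OF \<xi> \<eta>] in \<open>simp_all add: A_EN act_tens rmap_tens A_closed compose_eq\<close>)

lemma Q_rmap:
  assumes \<xi>: "\<xi> \<in> carrier A" and \<eta>: "\<eta> \<in> carrier A" and t: "t \<in> carrier T"
  shows "Q \<xi> idA (rmap \<eta> t) = Q \<xi> \<eta> t"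
  by (rule additive_map_eqI[OF additive_map_comp[OF rmap_additive Q_additive] Q_additive t])
    (use \<xi> \<eta> idA in \<open>simp_all add: Q_tens rmap_tens A_closed\<close>)

text \<open>Paired with x, the second factor moves to x, and the defining property of S gives
  \<alpha>_1(x^1) \<alpha>_2(x^2) = \<alpha>(x^1 x^2). Since x^1 x^2 is a scalar, this is x^1 x^2
  \<alpha>(1).\<close>

lemma S_left_inverse:
  assumes \<alpha>: "\<alpha> \<in> carrier A"
  shows "tensor_lift A (\<lambda>a1 a2. S a1 \<otimes>\<^bsub>A\<^esub> a2) (\<Delta>A \<alpha>) = counit_A K M \<alpha> \<odot>\<^bsub>A\<^esub> \<one>\<^bsub>A\<^esub>"
proof (rule dual.A_eqI)
  note w = comult_A_closed[OF \<alpha>]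
  show "tensor_lift A (\<lambda>a1 a2. S a1 \<otimes>\<^bsub>A\<^esub> a2) (\<Delta>A \<alpha>) \<in> carrier A"
    by (rule AA.tensor.lift_closed[OF A.abelian_group_axioms balanced_S_left w])
  have \<epsilon>: "counit_A K M \<alpha> \<in> carrier K" using \<alpha> by (simp add: counit_A_def scalar_in_K A_one_R)
  show "counit_A K M \<alpha> \<odot>\<^bsub>A\<^esub> \<one>\<^bsub>A\<^esub> \<in> carrier A"
    by (intro A.smult_closed A.one_closed \<epsilon>)
  fix x assume x: "x \<in> carrier B"
  have id1: "act idA x \<one>\<^bsub>M\<^esub> \<in> R" by (rule act_R[OF idA x])
  have bal: "balanced_K K A A K (\<lambda>a1 a2. pr x (S a1 \<otimes>\<^bsub>A\<^esub> a2))"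
    by (rule balanced_map_comp[OF balanced_S_left pairing_additive_right[OF x]])
  have "\<iota> (pr x (tensor_lift A (\<lambda>a1 a2. S a1 \<otimes>\<^bsub>A\<^esub> a2) (\<Delta>A \<alpha>))) =
      \<iota> (tensor_lift K (\<lambda>a1 a2. pr x (S a1 \<otimes>\<^bsub>A\<^esub> a2)) (\<Delta>A \<alpha>))"
    by (rule arg_cong[of _ _ \<iota>], rule AA.tensor.lift_comp[OF A.abelian_group_axioms abelian_K balanced_S_left pairing_additive_right[OF x] w])
  also have "\<dots> = tensor_lift M (\<lambda>a1 a2. \<iota> (pr x (S a1 \<otimes>\<^bsub>A\<^esub> a2))) (\<Delta>A \<alpha>)"
    by (rule AA.tensor.lift_comp[OF abelian_K abelian_M bal iota_additive w])
  also have "\<dots> = tensor_lift M (\<lambda>a1 a2. Q a1 a2 x) (\<Delta>A \<alpha>)"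
  proof (rule AA.lift_cong[OF abelian_M w])
    fix a1 a2 assume a: "a1 \<in> carrier A" "a2 \<in> carrier A"
    have "\<iota> (pr x (S a1 \<otimes>\<^bsub>A\<^esub> a2)) = \<iota> (pr (rmap a2 x) (S a1))"
      using a x by (simp add: iota_pairing A.m_closed S_closed rmap_B act_compose_rmap B_T del: A_simps)
    also have "\<dots> = Q a1 a2 x"
      using a x by (simp add: pairing_S rmap_B iota_q Q_rmap B_T)
    finally show "\<iota> (pr x (S a1 \<otimes>\<^bsub>A\<^esub> a2)) = Q a1 a2 x" .
    show "Q a1 a2 x \<in> carrier M" using a x by (simp add: Q_closed B_T)
  qed
  also have "\<dots> = tensor_lift M (\<lambda>u v. tensor_lift M (\<lambda>a1 a2. a1 u \<otimes>\<^bsub>M\<^esub> a2 v) (\<Delta>A \<alpha>)) x"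
    unfolding Q_def
    by (rule AA.tensor.lift_swap[OF tensor.tensor_space_axioms abelian_M w B_T[OF x]])
      (simp_all add: balanced_AM linear_AM_eval balN_AA del: A_simps)
  also have "\<dots> = tensor_lift M (\<lambda>u v. \<alpha> (u \<otimes>\<^bsub>M\<^esub> idA v)) x"
    using \<alpha> by (intro lift_cong[OF abelian_M B_T[OF x]]) (simp_all add: comult_A_eval A_closed)
  also have "\<dots> = \<alpha> (tensor_lift M (\<lambda>u v. u \<otimes>\<^bsub>M\<^esub> idA v) x)"
    by (rule tensor.lift_comp[OF abelian_M abelian_M balN_EN[OF A_EN[OF idA]] A_additive[OF \<alpha>] B_T[OF x], symmetric])
  also have "\<dots> = \<alpha> (act idA x \<one>\<^bsub>M\<^esub>)"
    unfolding act_def by (intro arg_cong[of _ _ \<alpha>] lift_cong[OF abelian_M B_T[OF x]]) simp_all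
  also have "\<dots> = act idA x \<one>\<^bsub>M\<^esub> \<otimes>\<^bsub>M\<^esub> \<alpha> \<one>\<^bsub>M\<^esub>"
    using EN_R[OF A_EN[OF \<alpha>] id1 M.one_closed] R_closed[OF id1] by simp
  also have "\<dots> = \<iota> (pr x (counit_A K M \<alpha> \<odot>\<^bsub>A\<^esub> \<one>\<^bsub>A\<^esub>))"
    using x \<epsilon> \<alpha> A.one_closed idA R_comm[OF id1, of "\<alpha> \<one>\<^bsub>M\<^esub>"]
    by (simp add: pairing_smult_right iota_mult iota_pairing A_closed counit_A_def iota_scalar A_one_R del: A_simps(1,3-))
  finally show "pr x (tensor_lift A (\<lambda>a1 a2. S a1 \<otimes>\<^bsub>A\<^esub> a2) (\<Delta>A \<alpha>)) = pr x (counit_A K M \<alpha> \<odot>\<^bsub>A\<^esub> \<one>\<^bsub>A\<^esub>)"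
    using x \<epsilon> AA.tensor.lift_closed[OF A.abelian_group_axioms balanced_S_left w]
    by (intro iota_inj) (simp_all add: A.smult_closed A.one_closed del: A_simps)
qed

lemma antipode_A: "antipode K A \<Delta>A (counit_A K M) S"
  unfolding antipode_def using S_linear S_left_inverse S_right_inverse by blast

lemma hopf_A: "hopf_algebra K A \<Delta>A (counit_A K M)"
  unfolding hopf_algebra_def using dual.bialgebra_A antipode_A by blast

lemma hopf_B: "hopf_algebra K B \<Delta>B (counit_B K M)"
  unfolding hopf_algebra_def using dual.bialgebra_B dual.antipode_B[OF antipode_A] by blast

section \<open>Actions\<close>

text \<open>The product rule is \<open>comult_A_eval\<close> read as a statement on actions, and
  \<alpha>(1) is the scalar \<epsilon>(\<alpha>) by irreducibility.\<close>

lemma left_module_algebra_M: "left_module_algebra K A \<Delta>A (counit_A K M) M (\<lambda>\<alpha> m. \<alpha> m)"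
  unfolding left_module_algebra_def
proof (intro conjI ballI)
  show "assoc_algebra K M" ..
  show "(\<lambda>\<alpha> m. \<alpha> m) \<in> bilinear_maps K A M M"
    unfolding bilinear_maps_def
  proof (intro CollectI conjI ballI)
    fix \<alpha> assume "\<alpha> \<in> carrier A"
    then show "restrict \<alpha> (carrier M) \<in> linear_maps K M M"
      by (simp add: linear_maps_def A_add A_smult A_closed)
  next
    fix m assume "m \<in> carrier M"
    then show "(\<lambda>\<alpha> \<in> carrier A. \<alpha> m) \<in> linear_maps K A M"
      using A.a_closed A.smult_closed by (simp add: linear_maps_def A_closed)
  qed
qed (simp_all add: dual.bialgebra_A compose_eq comult_A_eval counit_A_def iota_scalar A_one_R)

lemma right_action_eq: "right_action_B M \<xi> x = (\<lambda>m \<in> carrier M. act \<xi> x m)"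
  by (simp add: right_action_B_def act_def)

lemma right_action_EN: "\<lbrakk>\<xi> \<in> carrier EN; x \<in> carrier B\<rbrakk> \<Longrightarrow> right_action_B M \<xi> x \<in> carrier EN"
  by (simp add: right_action_eq act_EN)

lemma right_action_linear: "\<xi> \<in> carrier EN \<Longrightarrow> restrict (right_action_B M \<xi>) (carrier B) \<in> linear_maps K B EN"
  unfolding linear_maps_def
proof (intro CollectI conjI ballI)
  assume \<xi>: "\<xi> \<in> carrier EN"
  then show "restrict (right_action_B M \<xi>) (carrier B) \<in> carrier B \<rightarrow>\<^sub>E carrier EN"
    by (simp add: right_action_EN)
  fix x assume x: "x \<in> carrier B"
  show "restrict (right_action_B M \<xi>) (carrier B) (x \<oplus>\<^bsub>B\<^esub> y) =
      restrict (right_action_B M \<xi>) (carrier B) x \<oplus>\<^bsub>EN\<^esub> restrict (right_action_B M \<xi>) (carrier B) y"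
    if y: "y \<in> carrier B" for y
    using x y B.a_closed[OF x y] additive_map_add[OF act_additive[OF \<xi>] B_T[OF x] B_T[OF y]]
    by (simp add: right_action_eq B_simps cong: restrict_cong)
  show "restrict (right_action_B M \<xi>) (carrier B) (k \<odot>\<^bsub>B\<^esub> x) = k \<odot>\<^bsub>EN\<^esub> restrict (right_action_B M \<xi>) (carrier B) x"
    if k: "k \<in> carrier K" for k
    using x k \<xi> B.smult_closed[OF k x]
    by (simp add: right_action_eq B_simps act_left_mult B_T act_closed M.smult_mult_left cong: restrict_cong)
qed

lemma act_EN_smult:
  assumes "k \<in> carrier K" "\<xi> \<in> carrier EN" "t \<in> carrier T" "m \<in> carrier M"
  shows "act (k \<odot>\<^bsub>EN\<^esub> \<xi>) t m = k \<odot>\<^bsub>M\<^esub> act \<xi> t m"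
proof (rule additive_map_eqI[OF act_additive[OF EN.smult_closed[OF assms(1,2)] assms(4)] _ assms(3)])
  show "additive_map T M (\<lambda>t. k \<odot>\<^bsub>M\<^esub> act \<xi> t m)"
    using assms by (intro additive_map_comp[OF act_additive])
      (simp_all add: additive_map_def M.smult_r_distr)
  fix x y assume "x \<in> carrier M" "y \<in> carrier M"
  then show "act (k \<odot>\<^bsub>EN\<^esub> \<xi>) (x \<otimes>N y) m = k \<odot>\<^bsub>M\<^esub> act \<xi> (x \<otimes>N y) m"
    using assms EN.smult_closed[OF assms(1,2)]
    by (simp add: act_tens EN_closed M.smult_mult_right)
qed

text \<open>The action law is \<open>act_ins\<close>, the product rule \<open>act_compose\<close>,
  and the unit rule holds because b^1 b^2 m is the scalar \<epsilon>(b) times m.\<close>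

lemma right_module_algebra_EN: "right_module_algebra K B \<Delta>B (counit_B K M) EN (right_action_B M)"
  unfolding right_module_algebra_def
proof (intro conjI ballI)
  show "bialgebra K B \<Delta>B (counit_B K M)" by (rule dual.bialgebra_B)
  show "assoc_algebra K EN" by (rule assoc_algebra_EN)
  show "right_action_B M \<in> bilinear_maps K EN B EN"
    unfolding bilinear_maps_def
  proof (intro CollectI conjI ballI)
    fix x assume x: "x \<in> carrier B"
    show "(\<lambda>\<xi> \<in> carrier EN. right_action_B M \<xi> x) \<in> linear_maps K EN EN"
      unfolding linear_maps_def
    proof (intro CollectI conjI ballI)
      show "(\<lambda>\<xi> \<in> carrier EN. right_action_B M \<xi> x) \<in> carrier EN \<rightarrow>\<^sub>E carrier EN"
        using x by (simp add: right_action_EN)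
      fix \<xi> assume \<xi>: "\<xi> \<in> carrier EN"
      show "(\<lambda>\<xi> \<in> carrier EN. right_action_B M \<xi> x) (\<xi> \<oplus>\<^bsub>EN\<^esub> \<eta>) =
          (\<lambda>\<xi> \<in> carrier EN. right_action_B M \<xi> x) \<xi> \<oplus>\<^bsub>EN\<^esub> (\<lambda>\<xi> \<in> carrier EN. right_action_B M \<xi> x) \<eta>"
        if \<eta>: "\<eta> \<in> carrier EN" for \<eta>
        using EN.a_closed[OF \<xi> \<eta>] \<xi> \<eta> additive_map_add[OF act_additive_left[OF B_T[OF x]] \<xi> \<eta>]
        by (simp add: right_action_eq cong: restrict_cong)
      show "(\<lambda>\<xi> \<in> carrier EN. right_action_B M \<xi> x) (k \<odot>\<^bsub>EN\<^esub> \<xi>) =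
          k \<odot>\<^bsub>EN\<^esub> (\<lambda>\<xi> \<in> carrier EN. right_action_B M \<xi> x) \<xi>" if k: "k \<in> carrier K" for k
        using EN.smult_closed[OF k \<xi>] \<xi> k act_EN_smult[OF k \<xi> B_T[OF x]]
        by (simp add: right_action_eq cong: restrict_cong)
    qed
  qed (rule right_action_linear)
  show "right_action_B M \<xi> \<one>\<^bsub>B\<^esub> = \<xi>" if \<xi>: "\<xi> \<in> carrier EN" for \<xi>
    using \<xi> B.one_closed by (intro EN_eqI right_action_EN)
      (simp_all add: right_action_eq B_simps act_tens EN_closed)
  show "right_action_B M \<xi> (x \<otimes>\<^bsub>B\<^esub> y) = right_action_B M (right_action_B M \<xi> x) y"
    if "x \<in> carrier B" "y \<in> carrier B" "\<xi> \<in> carrier EN" for x y \<xi>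
    using that by (simp add: right_action_eq mult_B act_ins B_T cong: restrict_cong)
  show "right_action_B M \<one>\<^bsub>EN\<^esub> x = counit_B K M x \<odot>\<^bsub>EN\<^esub> \<one>\<^bsub>EN\<^esub>" if x: "x \<in> carrier B" for x
  proof -
    have "act idA x m = pr x idA \<odot>\<^bsub>M\<^esub> m" if m: "m \<in> carrier M" for m
      using act_id[OF B_T[OF x] m] pairing_smult[OF x idA m] by simp
    then show ?thesis using x by (simp add: right_action_eq counit_B_eq cong: restrict_cong)
  qed
  fix x \<xi> \<eta> assume x: "x \<in> carrier B" and \<xi>: "\<xi> \<in> carrier EN" and \<eta>: "\<eta> \<in> carrier EN"
  have bal: "balanced_K K B B EN (\<lambda>h1 h2. right_action_B M \<xi> h1 \<otimes>\<^bsub>EN\<^esub> right_action_B M \<eta> h2)"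
    using right_action_linear[OF \<xi>] right_action_linear[OF \<eta>] right_action_EN[OF \<xi>] right_action_EN[OF \<eta>]
    by (intro BB.balanced_KI) (simp_all add: linear_maps_def EN.l_distr EN.r_distr EN.smult_mult_left
        EN.smult_mult_right B.a_closed B.smult_closed del: EN_simps)
  show "right_action_B M (\<xi> \<otimes>\<^bsub>EN\<^esub> \<eta>) x =
      tensor_lift EN (\<lambda>h1 h2. right_action_B M \<xi> h1 \<otimes>\<^bsub>EN\<^esub> right_action_B M \<eta> h2) (\<Delta>B x)"
  proof (rule EN_eqI)
    show "right_action_B M (\<xi> \<otimes>\<^bsub>EN\<^esub> \<eta>) x \<in> carrier EN"
      using x EN.m_closed[OF \<xi> \<eta>] by (intro right_action_EN)
    show "tensor_lift EN (\<lambda>h1 h2. right_action_B M \<xi> h1 \<otimes>\<^bsub>EN\<^esub> right_action_B M \<eta> h2) (\<Delta>B x) \<in> carrier EN"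
      by (rule BB.tensor.lift_closed[OF EN.abelian_group_axioms bal comult_B_closed[OF x]])
    fix m assume m: "m \<in> carrier M"
    have eval: "additive_map EN M (\<lambda>\<xi>. \<xi> m)" using m by (simp add: additive_map_def EN_closed)
    have "tensor_lift EN (\<lambda>h1 h2. right_action_B M \<xi> h1 \<otimes>\<^bsub>EN\<^esub> right_action_B M \<eta> h2) (\<Delta>B x) m =
      (\<Oplus>\<^bsub>EN\<^esub>i \<in> {..<d}. right_action_B M \<xi> (b i) \<otimes>\<^bsub>EN\<^esub> right_action_B M \<eta> (lmap (\<beta> i) x)) m"
      by (simp only: lift_comult_B[OF EN.abelian_group_axioms bal x])
    also have "\<dots> = (\<Oplus>\<^bsub>M\<^esub>i \<in> {..<d}. (right_action_B M \<xi> (b i) \<otimes>\<^bsub>EN\<^esub> right_action_B M \<eta> (lmap (\<beta> i) x)) m)"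
      by (intro additive_map_finsum[OF EN.abelian_group_axioms abelian_M eval] EN.m_closed right_action_EN \<xi> \<eta> b_B lmap_B beta_A x) simp_all
    also have "\<dots> = (\<Oplus>\<^bsub>M\<^esub>i \<in> {..<d}. act \<xi> (b i) (act \<eta> (lmap (\<beta> i) x) m))"
      using m \<xi> \<eta> x by (intro M.finsum_cong')
        (auto simp: right_action_eq compose_eq act_closed b_B lmap_B beta_A B_T)
    also have "\<dots> = right_action_B M (\<xi> \<otimes>\<^bsub>EN\<^esub> \<eta>) x m"
      using m \<xi> \<eta> x by (simp add: act_compose B_T right_action_eq)
    finally show "right_action_B M (\<xi> \<otimes>\<^bsub>EN\<^esub> \<eta>) x m =
      tensor_lift EN (\<lambda>h1 h2. right_action_B M \<xi> h1 \<otimes>\<^bsub>EN\<^esub> right_action_B M \<eta> h2) (\<Delta>B x) m" by simp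
  qed
qed

end

section \<open>The basic construction and the smash product\<close>

context depth_two_extension
begin

lemma act_right_N:
  assumes \<alpha>: "\<alpha> \<in> carrier A" and t: "t \<in> carrier T" and x: "x \<in> carrier M" and n: "n \<in> carrier N"
  shows "act \<alpha> t (x \<otimes>\<^bsub>M\<^esub> \<phi> n) = act \<alpha> t x \<otimes>\<^bsub>M\<^esub> \<phi> n"
  by (rule additive_map_eqI[OF act_additive additive_map_comp[OF act_additive M.additive_map_scale(2)] t])
    (use assms in \<open>simp_all add: A_EN act_tens A_closed A_right M.m_assoc[symmetric]\<close>)

text \<open>The common image of the two actions, as a predicate on total functions:
  \<open>act\<close> and \<open>MA_act\<close> are not cut off outside the carrier, and their values
  there are never consulted.\<close>

definition right_linear :: "('m \<Rightarrow> 'm) \<Rightarrow> bool" where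
  "right_linear f \<longleftrightarrow> additive_map M M f \<and>
    (\<forall>n \<in> carrier N. \<forall>x \<in> carrier M. f (x \<otimes>\<^bsub>M\<^esub> \<phi> n) = f x \<otimes>\<^bsub>M\<^esub> \<phi> n)"

lemma right_linear_act: "\<lbrakk>\<alpha> \<in> carrier A; t \<in> carrier T\<rbrakk> \<Longrightarrow> right_linear (act \<alpha> t)"
  by (simp add: right_linear_def act_additive_right A_EN act_right_N)

lemma balN_right_linear: "right_linear f \<Longrightarrow> balN M (\<lambda>u v. f u \<otimes>\<^bsub>M\<^esub> v)"
  by (rule balNI) (simp_all add: right_linear_def additive_map_def M.l_distr M.r_distr M.m_assoc)

sublocale MA: tensor_modules K M A ..

abbreviation (input) "MA \<equiv> tensor_K K M (End_NN N M \<phi>)"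

definition MA_act :: "('m \<times> ('m \<Rightarrow> 'm) \<Rightarrow>\<^sub>0 int) set \<Rightarrow> 'm \<Rightarrow> 'm" where
  "MA_act w z = tensor_lift M (\<lambda>m \<alpha>. m \<otimes>\<^bsub>M\<^esub> \<alpha> z) w"

lemma MA_balanced: "z \<in> carrier M \<Longrightarrow> balanced_K K M A M (\<lambda>m \<alpha>. m \<otimes>\<^bsub>M\<^esub> \<alpha> z)"
  by (rule MA.balanced_KI) (simp_all add: A_closed M.l_distr M.r_distr M.smult_mult_left M.smult_mult_right)

lemma MA_act_elem: "\<lbrakk>m \<in> carrier M; \<alpha> \<in> carrier A; z \<in> carrier M\<rbrakk> \<Longrightarrow> MA_act (elem_K K M A m \<alpha>) z = m \<otimes>\<^bsub>M\<^esub> \<alpha> z"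
  unfolding MA_act_def by (rule MA.lift_elem[OF abelian_M MA_balanced])

lemma MA_act_additive_left: "z \<in> carrier M \<Longrightarrow> additive_map MA M (\<lambda>w. MA_act w z)"
  unfolding MA_act_def by (rule MA.tensor.additive_map_lift[OF abelian_M MA_balanced])

lemma MA_act_additive: "w \<in> carrier MA \<Longrightarrow> additive_map M M (MA_act w)"
  unfolding MA_act_def
  by (rule MA.tensor.additive_map_lift_param[OF abelian_M _ MA_balanced])
    (simp_all add: additive_map_def A_closed A_add M.r_distr abelian_M)

lemma MA_act_closed: "\<lbrakk>w \<in> carrier MA; z \<in> carrier M\<rbrakk> \<Longrightarrow> MA_act w z \<in> carrier M"
  by (rule additive_map_closed[OF MA_act_additive])

lemma right_linear_MA_act:
  assumes w: "w \<in> carrier MA"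
  shows "right_linear (MA_act w)"
proof -
  have "MA_act w (x \<otimes>\<^bsub>M\<^esub> \<phi> n) = MA_act w x \<otimes>\<^bsub>M\<^esub> \<phi> n" if "x \<in> carrier M" "n \<in> carrier N" for x n
    by (rule MA.additive_map_eqI[OF MA_act_additive_left
          additive_map_comp[OF MA_act_additive_left M.additive_map_scale(2)] w])
      (use that in \<open>simp_all add: MA_act_elem A_closed A_right M.m_assoc\<close>)
  then show ?thesis using w by (simp add: right_linear_def MA_act_additive)
qed

text \<open>The inverse of \<open>MA_act\<close>. Its shape comes from f(z) = sum_i f(b_i^1) b_i^2
  \<beta>_i(z), which is the left quasibasis identity under f(u) v; right N-linearity of f makes
  that integrand balanced.\<close>

definition MA_of :: "('m \<Rightarrow> 'm) \<Rightarrow> ('m \<times> ('m \<Rightarrow> 'm) \<Rightarrow>\<^sub>0 int) set" where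
  "MA_of f = (\<Oplus>\<^bsub>MA\<^esub>i \<in> {..<d}. elem_K K M A (tensor_lift M (\<lambda>u v. f u \<otimes>\<^bsub>M\<^esub> v) (b i)) (\<beta> i))"

lemma MA_of_summand_closed: "\<lbrakk>right_linear f; i < d\<rbrakk> \<Longrightarrow> tensor_lift M (\<lambda>u v. f u \<otimes>\<^bsub>M\<^esub> v) (b i) \<in> carrier M"
  by (intro tensor.lift_closed[OF abelian_M balN_right_linear]) (simp_all add: b_B B_T)

lemma MA_of_closed: "right_linear f \<Longrightarrow> MA_of f \<in> carrier MA"
  unfolding MA_of_def
  by (intro MA.tensor.T.finsum_closed) (auto intro!: MA.elem_closed MA_of_summand_closed beta_A)

lemma MA_act_MA_of:
  assumes f: "right_linear f" and z: "z \<in> carrier M"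
  shows "MA_act (MA_of f) z = f z"
proof -
  have fc: "f x \<in> carrier M" if "x \<in> carrier M" for x
    using f that by (auto simp: right_linear_def additive_map_def)
  have "MA_act (MA_of f) z =
      (\<Oplus>\<^bsub>M\<^esub>i \<in> {..<d}. MA_act (elem_K K M A (tensor_lift M (\<lambda>u v. f u \<otimes>\<^bsub>M\<^esub> v) (b i)) (\<beta> i)) z)"
    unfolding MA_of_def
    by (intro additive_map_finsum[OF MA.tensor.abelian_T abelian_M MA_act_additive_left[OF z]])
      (auto intro!: MA.elem_closed MA_of_summand_closed f beta_A)
  also have "\<dots> = (\<Oplus>\<^bsub>M\<^esub>i \<in> {..<d}. tensor_lift M (\<lambda>u v. f u \<otimes>\<^bsub>M\<^esub> (v \<otimes>\<^bsub>M\<^esub> \<beta> i z)) (b i))"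
  proof (rule M.finsum_cong'[OF refl])
    fix i assume "i \<in> {..<d}"
    then have i: "i < d" by simp
    have bT: "b i \<in> carrier T" and \<beta>z: "\<beta> i z \<in> carrier M" using i z by (simp_all add: b_B B_T beta_A A_closed)
    have "tensor_lift M (\<lambda>u v. f u \<otimes>\<^bsub>M\<^esub> v) (b i) \<otimes>\<^bsub>M\<^esub> \<beta> i z = tensor_lift M (\<lambda>u v. f u \<otimes>\<^bsub>M\<^esub> v \<otimes>\<^bsub>M\<^esub> \<beta> i z) (b i)"
      by (rule tensor.lift_comp[OF abelian_M abelian_M balN_right_linear[OF f] M.additive_map_scale(2)[OF \<beta>z] bT])
    also have "\<dots> = tensor_lift M (\<lambda>u v. f u \<otimes>\<^bsub>M\<^esub> (v \<otimes>\<^bsub>M\<^esub> \<beta> i z)) (b i)"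
      using \<beta>z by (intro lift_cong[OF abelian_M bT]) (simp_all add: fc M.m_assoc)
    finally show "MA_act (elem_K K M A (tensor_lift M (\<lambda>u v. f u \<otimes>\<^bsub>M\<^esub> v) (b i)) (\<beta> i)) z = \<dots>"
      using i z by (simp add: MA_act_elem MA_of_summand_closed f beta_A)
  qed (use z in \<open>auto intro!: tensor.lift_closed[OF abelian_M balN_right[OF balN_right_linear[OF f]]]
      simp: b_B B_T beta_A A_closed\<close>)
  also have "\<dots> = f z"
    using lift_left_basis[OF abelian_M balN_right_linear[OF f] z] z by (simp add: fc)
  finally show ?thesis .
qed

text \<open>For m (x) \<alpha> the i-th coefficient is m \<alpha>(b_i^1) b_i^2, a scalar multiple of
  m. Moving the scalar across the tensor sign leaves an expansion of \<alpha> alone.\<close>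

lemma MA_of_MA_act:
  assumes w: "w \<in> carrier MA"
  shows "MA_of (MA_act w) = w"
proof (rule MA.additive_map_eqI[OF _ _ w])
  have "additive_map MA M (\<lambda>w. tensor_lift M (\<lambda>u v. MA_act w u \<otimes>\<^bsub>M\<^esub> v) (b i))" if "i < d" for i
    using that
    by (intro tensor.additive_map_lift_param[OF abelian_M] balN_right_linear right_linear_MA_act MA.tensor.abelian_T
        additive_map_comp[OF MA_act_additive_left M.additive_map_scale(2)])
      (simp_all add: b_B B_T)
  moreover have el: "additive_map M MA (\<lambda>m. elem_K K M A m \<alpha>)" if "\<alpha> \<in> carrier A" for \<alpha>
    using that by (simp add: additive_map_def MA.elem_closed MA.elem_add_left)
  ultimately show "additive_map MA MA (\<lambda>w. MA_of (MA_act w))"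
    unfolding MA_of_def
    by (intro additive_map_finsum_fun MA.tensor.abelian_T additive_map_comp[OF _ el] beta_A) auto
  show "additive_map MA MA (\<lambda>w. w)" by (simp add: additive_map_def)
  fix m \<alpha> assume m: "m \<in> carrier M" and \<alpha>: "\<alpha> \<in> carrier A"
  have addr: "additive_map A MA (elem_K K M A m)"
    using m by (simp add: additive_map_def MA.elem_closed MA.elem_add_right A.a_closed del: A_simps)
  have s: "q \<alpha> (b i) \<odot>\<^bsub>A\<^esub> \<beta> i \<in> carrier A" if "i < d" for i
    using that \<alpha> by (intro A.smult_closed q_closed b_B beta_A)
  have "MA_of (MA_act (elem_K K M A m \<alpha>)) = (\<Oplus>\<^bsub>MA\<^esub>i \<in> {..<d}. elem_K K M A m (q \<alpha> (b i) \<odot>\<^bsub>A\<^esub> \<beta> i))"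
    unfolding MA_of_def
  proof (rule MA.tensor.T.finsum_cong'[OF refl])
    fix i assume "i \<in> {..<d}"
    then have i: "i < d" by simp
    have bT: "b i \<in> carrier T" using i by (simp add: b_B B_T)
    have "tensor_lift M (\<lambda>u v. MA_act (elem_K K M A m \<alpha>) u \<otimes>\<^bsub>M\<^esub> v) (b i) =
        tensor_lift M (\<lambda>u v. m \<otimes>\<^bsub>M\<^esub> (\<alpha> u \<otimes>\<^bsub>M\<^esub> idA v)) (b i)"
      using m \<alpha> by (intro lift_cong[OF abelian_M bT]) (simp_all add: MA_act_elem A_closed M.m_assoc)
    also have "\<dots> = m \<otimes>\<^bsub>M\<^esub> Q \<alpha> idA (b i)"
      unfolding Q_def
      by (rule tensor.lift_comp[OF abelian_M abelian_M balN_AA[OF \<alpha> idA] M.additive_map_scale(1)[OF m] bT, symmetric])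
    also have "\<dots> = q \<alpha> (b i) \<odot>\<^bsub>M\<^esub> m"
      unfolding q_def using i m \<alpha> by (simp add: scalar_smult Q_R b_B idA R_comm[OF Q_R, symmetric])
    finally have "tensor_lift M (\<lambda>u v. MA_act (elem_K K M A m \<alpha>) u \<otimes>\<^bsub>M\<^esub> v) (b i) = q \<alpha> (b i) \<odot>\<^bsub>M\<^esub> m" .
    then show "elem_K K M A (tensor_lift M (\<lambda>u v. MA_act (elem_K K M A m \<alpha>) u \<otimes>\<^bsub>M\<^esub> v) (b i)) (\<beta> i) =
        elem_K K M A m (q \<alpha> (b i) \<odot>\<^bsub>A\<^esub> \<beta> i)"
      using i m \<alpha> by (simp add: MA.elem_balanced q_closed b_B beta_A del: A_simps)
  qed (use s m in \<open>auto intro!: MA.elem_closed simp del: A_simps\<close>)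
  also have "\<dots> = elem_K K M A m (\<Oplus>\<^bsub>A\<^esub>i \<in> {..<d}. q \<alpha> (b i) \<odot>\<^bsub>A\<^esub> \<beta> i)"
    using s by (intro additive_map_finsum[OF A.abelian_group_axioms MA.tensor.abelian_T addr, symmetric]) simp
  \<comment> \<open>The left quasibasis is a dual basis of A for the second pairing: at z the sum is
    \<alpha>(b_i^1) b_i^2 \<beta>_i(z) = \<alpha>(z).\<close>
  also have "(\<Oplus>\<^bsub>A\<^esub>i \<in> {..<d}. q \<alpha> (b i) \<odot>\<^bsub>A\<^esub> \<beta> i) = \<alpha>"
  proof (rule A_eqI[OF _ \<alpha>])
    show "(\<Oplus>\<^bsub>A\<^esub>i \<in> {..<d}. q \<alpha> (b i) \<odot>\<^bsub>A\<^esub> \<beta> i) \<in> carrier A"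
      using s by (intro A.finsum_closed) auto
    fix z assume z: "z \<in> carrier M"
    have "(\<Oplus>\<^bsub>A\<^esub>i \<in> {..<d}. q \<alpha> (b i) \<odot>\<^bsub>A\<^esub> \<beta> i) z = (\<Oplus>\<^bsub>M\<^esub>i \<in> {..<d}. (q \<alpha> (b i) \<odot>\<^bsub>A\<^esub> \<beta> i) z)"
      using s by (intro additive_map_finsum[OF A.abelian_group_axioms abelian_M A_eval_additive[OF z]]) simp
    also have "\<dots> = (\<Oplus>\<^bsub>M\<^esub>i \<in> {..<d}. tensor_lift M (\<lambda>u v. \<alpha> u \<otimes>\<^bsub>M\<^esub> (v \<otimes>\<^bsub>M\<^esub> \<beta> i z)) (b i))"
    proof (rule M.finsum_cong'[OF refl])
      fix i assume "i \<in> {..<d}"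
      then have i: "i < d" by simp
      have bT: "b i \<in> carrier T" and \<beta>z: "\<beta> i z \<in> carrier M" using i z by (simp_all add: b_B B_T beta_A A_closed)
      have "Q \<alpha> idA (b i) \<otimes>\<^bsub>M\<^esub> \<beta> i z = tensor_lift M (\<lambda>u v. \<alpha> u \<otimes>\<^bsub>M\<^esub> idA v \<otimes>\<^bsub>M\<^esub> \<beta> i z) (b i)"
        unfolding Q_def
        by (rule tensor.lift_comp[OF abelian_M abelian_M balN_AA[OF \<alpha> idA] M.additive_map_scale(2)[OF \<beta>z] bT])
      also have "\<dots> = tensor_lift M (\<lambda>u v. \<alpha> u \<otimes>\<^bsub>M\<^esub> (v \<otimes>\<^bsub>M\<^esub> \<beta> i z)) (b i)"
        using \<beta>z \<alpha> by (intro lift_cong[OF abelian_M bT]) (simp_all add: A_closed M.m_assoc)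
      finally show "(q \<alpha> (b i) \<odot>\<^bsub>A\<^esub> \<beta> i) z = \<dots>"
        using i z \<alpha> \<beta>z by (simp add: q_def scalar_smult Q_R b_B idA)
    qed (use z in \<open>auto intro!: tensor.lift_closed[OF abelian_M balN_right[OF balN_A[OF \<alpha>]]]
        simp: b_B B_T beta_A A_closed\<close>)
    also have "\<dots> = \<alpha> z"
      using lift_left_basis[OF abelian_M balN_A[OF \<alpha>] z] \<alpha> z by (simp add: A_closed)
    finally show "(\<Oplus>\<^bsub>A\<^esub>i \<in> {..<d}. q \<alpha> (b i) \<odot>\<^bsub>A\<^esub> \<beta> i) z = \<alpha> z" .
  qed
  finally show "MA_of (MA_act (elem_K K M A m \<alpha>)) = elem_K K M A m \<alpha>" .
qed

text \<open>\<open>MA_of\<close> reads its argument only on the carrier, so operators agreeing there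
  have the same preimage, which is the given tensor by \<open>MA_of_MA_act\<close>.\<close>

lemma MA_faithful:
  assumes w: "w \<in> carrier MA" "w' \<in> carrier MA" and eq: "\<And>z. z \<in> carrier M \<Longrightarrow> MA_act w z = MA_act w' z"
  shows "w = w'"
proof -
  have "MA_of (MA_act w) = MA_of (MA_act w')"
    unfolding MA_of_def
  proof (rule MA.tensor.T.finsum_cong'[OF refl])
    fix i assume "i \<in> {..<d}"
    then have i: "i < d" by simp
    have "tensor_lift M (\<lambda>u v. MA_act w u \<otimes>\<^bsub>M\<^esub> v) (b i) = tensor_lift M (\<lambda>u v. MA_act w' u \<otimes>\<^bsub>M\<^esub> v) (b i)"
      using w i by (intro lift_cong[OF abelian_M]) (simp_all add: eq MA_act_closed b_B B_T)
    then show "elem_K K M A (tensor_lift M (\<lambda>u v. MA_act w u \<otimes>\<^bsub>M\<^esub> v) (b i)) (\<beta> i) =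
      elem_K K M A (tensor_lift M (\<lambda>u v. MA_act w' u \<otimes>\<^bsub>M\<^esub> v) (b i)) (\<beta> i)" by simp
  qed (use w in \<open>auto intro!: MA.elem_closed MA_of_summand_closed right_linear_MA_act beta_A\<close>)
  then show ?thesis using w by (simp add: MA_of_MA_act)
qed

section \<open>The smash product as a ring of operators\<close>

abbreviation (input) "smash \<equiv> smash_product K M (End_NN N M \<phi>) \<Delta>A (\<lambda>\<alpha> m. \<alpha> m)"

text \<open>The smash product of the pure tensors x (x) h and x' (x) h'. Naming the innermost lift
  allows the three nested lifts to be justified one at a time.\<close>

definition J :: "'m \<Rightarrow> ('m \<Rightarrow> 'm) \<Rightarrow> 'm \<Rightarrow> ('m \<Rightarrow> 'm) \<Rightarrow> ('m \<times> ('m \<Rightarrow> 'm) \<Rightarrow>\<^sub>0 int) set" where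
  "J x h x' h' = tensor_lift MA (\<lambda>h1 h2. elem_K K M A (x \<otimes>\<^bsub>M\<^esub> h1 x') (h2 \<otimes>\<^bsub>A\<^esub> h')) (\<Delta>A h)"

lemma same_add_smash: "same_add smash MA"
  by (simp add: same_add_def smash_product_def Let_def)

lemma smash_mult: "s \<otimes>\<^bsub>smash\<^esub> t = tensor_lift MA (\<lambda>x h. tensor_lift MA (J x h) t) s"
  by (simp add: smash_product_def Let_def J_def[abs_def] del: A_simps)

lemma smash_one: "\<one>\<^bsub>smash\<^esub> = elem_K K M A \<one>\<^bsub>M\<^esub> \<one>\<^bsub>A\<^esub>"
  by (simp add: smash_product_def Let_def tensor_K_def)

lemma J_balanced_h:
  "\<lbrakk>x \<in> carrier M; x' \<in> carrier M; h' \<in> carrier A\<rbrakk>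
    \<Longrightarrow> balanced_K K A A MA (\<lambda>h1 h2. elem_K K M A (x \<otimes>\<^bsub>M\<^esub> h1 x') (h2 \<otimes>\<^bsub>A\<^esub> h'))"
proof (rule AA.balanced_KI)
  fix k g h assume *: "x \<in> carrier M" "x' \<in> carrier M" "h' \<in> carrier A" "k \<in> carrier K" "g \<in> carrier A" "h \<in> carrier A"
  have "(k \<odot>\<^bsub>A\<^esub> g) x' = k \<odot>\<^bsub>M\<^esub> g x'"
    using * by (simp add: A_smult)
  then show "elem_K K M A (x \<otimes>\<^bsub>M\<^esub> (k \<odot>\<^bsub>A\<^esub> g) x') (h \<otimes>\<^bsub>A\<^esub> h') =
      elem_K K M A (x \<otimes>\<^bsub>M\<^esub> g x') (k \<odot>\<^bsub>A\<^esub> h \<otimes>\<^bsub>A\<^esub> h')"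
    using * by (simp add: A_closed M.smult_mult_right MA.elem_balanced A.m_closed A.smult_mult_left del: A_simps)
next
  fix g g' h assume *: "x \<in> carrier M" "x' \<in> carrier M" "h' \<in> carrier A" "g \<in> carrier A" "g' \<in> carrier A" "h \<in> carrier A"
  have "(g \<oplus>\<^bsub>A\<^esub> g') x' = g x' \<oplus>\<^bsub>M\<^esub> g' x'"
    using * by simp
  then show "elem_K K M A (x \<otimes>\<^bsub>M\<^esub> (g \<oplus>\<^bsub>A\<^esub> g') x') (h \<otimes>\<^bsub>A\<^esub> h') =
      elem_K K M A (x \<otimes>\<^bsub>M\<^esub> g x') (h \<otimes>\<^bsub>A\<^esub> h') \<oplus>\<^bsub>MA\<^esub> elem_K K M A (x \<otimes>\<^bsub>M\<^esub> g' x') (h \<otimes>\<^bsub>A\<^esub> h')"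
    using * by (simp add: A_closed M.r_distr MA.elem_add_left A.m_closed del: A_simps)
qed (simp_all add: MA.elem_closed A_closed A.m_closed A.l_distr
    MA.elem_add_right del: A_simps)

lemma J_balanced_right:
  assumes x: "x \<in> carrier M" and h: "h \<in> carrier A"
  shows "balanced_K K M A MA (J x h)"
  unfolding J_def
proof (rule AA.tensor.balanced_map_lift_param[OF MA.tensor.abelian_T comult_A_closed[OF h] MA.tensor.abelian_X MA.tensor.abelian_Y])
  fix h1 h2 assume "h1 \<in> carrier (symmetric_bimodule A)" "h2 \<in> carrier (symmetric_bimodule A)"
  then have a: "h1 \<in> carrier A" "h2 \<in> carrier A" by simp_all
  show "balanced_K K M A MA (\<lambda>x' h'. elem_K K M A (x \<otimes>\<^bsub>M\<^esub> h1 x') (h2 \<otimes>\<^bsub>A\<^esub> h'))"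
  proof (rule MA.balanced_KI)
    fix k x' h' assume *: "k \<in> carrier K" "x' \<in> carrier M" "h' \<in> carrier A"
    show "elem_K K M A (x \<otimes>\<^bsub>M\<^esub> h1 (k \<odot>\<^bsub>M\<^esub> x')) (h2 \<otimes>\<^bsub>A\<^esub> h') = elem_K K M A (x \<otimes>\<^bsub>M\<^esub> h1 x') (h2 \<otimes>\<^bsub>A\<^esub> (k \<odot>\<^bsub>A\<^esub> h'))"
      using * a x by (simp add: A_smult A_closed M.smult_mult_right MA.elem_balanced A.m_closed A.smult_mult_right del: A_simps)
  qed (use a x in \<open>simp_all add: MA.elem_closed A_closed A.m_closed A_add M.r_distr MA.elem_add_left
      A.r_distr MA.elem_add_right del: A_simps\<close>)
qed (use x J_balanced_h in \<open>simp_all del: A_simps\<close>)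

text \<open>In these variables h occurs only through its coproduct, so additivity and K-linearity of
  \<Delta>A are what is needed.\<close>

lemma J_balanced_left:
  assumes x': "x' \<in> carrier M" and h': "h' \<in> carrier A"
  shows "balanced_K K M A MA (\<lambda>x h. J x h x' h')"
proof (rule MA.balanced_KI)
  note G = MA.tensor.abelian_T
  note bal = J_balanced_h[OF _ x' h']
  show "J x h x' h' \<in> carrier MA" if "x \<in> carrier M" "h \<in> carrier A" for x h
    unfolding J_def using that by (intro AA.tensor.lift_closed[OF G bal] comult_A_closed)
  show "J (x \<oplus>\<^bsub>M\<^esub> y) h x' h' = J x h x' h' \<oplus>\<^bsub>MA\<^esub> J y h x' h'"
    if "x \<in> carrier M" "y \<in> carrier M" "h \<in> carrier A" for x y h
  proof -
    have "additive_map M MA (\<lambda>x. J x h x' h')"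
      unfolding J_def using that x' h'
      by (intro AA.tensor.additive_map_lift_param[OF G comult_A_closed bal] abelian_M)
        (simp_all add: additive_map_def MA.elem_closed MA.elem_add_left M.l_distr A_closed A.m_closed del: A_simps)
    then show ?thesis using that by (simp add: additive_map_def)
  qed
  show "J x (h \<oplus>\<^bsub>A\<^esub> g) x' h' = J x h x' h' \<oplus>\<^bsub>MA\<^esub> J x g x' h'"
    if "x \<in> carrier M" "h \<in> carrier A" "g \<in> carrier A" for x h g
    unfolding J_def dual.\<Delta>A_add[OF that(2,3)]
    using that by (intro AA.tensor.lift_add[OF G bal] comult_A_closed)
  show "J (k \<odot>\<^bsub>M\<^esub> x) h x' h' = J x (k \<odot>\<^bsub>A\<^esub> h) x' h'"
    if "k \<in> carrier K" "x \<in> carrier M" "h \<in> carrier A" for k x h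
  proof -
    have "J x (k \<odot>\<^bsub>A\<^esub> h) x' h' =
      tensor_lift MA (\<lambda>h1 h2. elem_K K M A (x \<otimes>\<^bsub>M\<^esub> (k \<odot>\<^bsub>A\<^esub> h1) x') (h2 \<otimes>\<^bsub>A\<^esub> h')) (\<Delta>A h)"
      unfolding J_def dual.\<Delta>A_smult[OF that(1,3)]
      using that by (intro AA.lift_smult[OF G bal] comult_A_closed)
    also have "\<dots> = J (k \<odot>\<^bsub>M\<^esub> x) h x' h'"
      unfolding J_def
    proof (rule AA.lift_cong[OF G comult_A_closed[OF that(3)]])
      fix h1 h2 assume a: "h1 \<in> carrier A" "h2 \<in> carrier A"
      have "x \<otimes>\<^bsub>M\<^esub> (k \<odot>\<^bsub>A\<^esub> h1) x' = k \<odot>\<^bsub>M\<^esub> x \<otimes>\<^bsub>M\<^esub> h1 x'"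
        using that a x' by (simp add: M.smult_mult_left M.smult_mult_right A_closed)
      then show "elem_K K M A (x \<otimes>\<^bsub>M\<^esub> (k \<odot>\<^bsub>A\<^esub> h1) x') (h2 \<otimes>\<^bsub>A\<^esub> h') =
        elem_K K M A (k \<odot>\<^bsub>M\<^esub> x \<otimes>\<^bsub>M\<^esub> h1 x') (h2 \<otimes>\<^bsub>A\<^esub> h')" by simp
      show "elem_K K M A (k \<odot>\<^bsub>M\<^esub> x \<otimes>\<^bsub>M\<^esub> h1 x') (h2 \<otimes>\<^bsub>A\<^esub> h') \<in> carrier MA"
        using that a x' h' by (intro MA.elem_closed A.m_closed) (simp_all add: A_closed)
    qed
    finally show ?thesis by simp
  qed
qed

text \<open>The operator is x h_1(x') h_2(h'(z)), and the legs of h recombine to x h(x' h'(z)): the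
  smash relation is the Leibniz rule of the action.\<close>

lemma MA_act_J:
  assumes "x \<in> carrier M" "h \<in> carrier A" "x' \<in> carrier M" "h' \<in> carrier A" "z \<in> carrier M"
  shows "MA_act (J x h x' h') z = x \<otimes>\<^bsub>M\<^esub> h (x' \<otimes>\<^bsub>M\<^esub> h' z)"
proof -
  note w = comult_A_closed[OF assms(2)]
  have z: "h' z \<in> carrier M" using assms by (simp add: A_closed)
  have "MA_act (J x h x' h') z = tensor_lift M (\<lambda>h1 h2. MA_act (elem_K K M A (x \<otimes>\<^bsub>M\<^esub> h1 x') (h2 \<otimes>\<^bsub>A\<^esub> h')) z) (\<Delta>A h)"
    unfolding J_def using assms
    by (intro AA.tensor.lift_comp[OF MA.tensor.abelian_T abelian_M J_balanced_h] MA_act_additive_left w)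
  also have "\<dots> = tensor_lift M (\<lambda>h1 h2. x \<otimes>\<^bsub>M\<^esub> (h1 x' \<otimes>\<^bsub>M\<^esub> h2 (h' z))) (\<Delta>A h)"
  proof (rule AA.lift_cong[OF abelian_M w])
    fix h1 h2 assume a: "h1 \<in> carrier A" "h2 \<in> carrier A"
    then show "MA_act (elem_K K M A (x \<otimes>\<^bsub>M\<^esub> h1 x') (h2 \<otimes>\<^bsub>A\<^esub> h')) z = x \<otimes>\<^bsub>M\<^esub> (h1 x' \<otimes>\<^bsub>M\<^esub> h2 (h' z))"
      using assms A.m_closed[OF a(2) assms(4)]
      by (simp add: MA_act_elem A_closed compose_eq M.m_assoc)
  qed (use assms in \<open>simp add: A_closed\<close>)
  also have "\<dots> = x \<otimes>\<^bsub>M\<^esub> tensor_lift M (\<lambda>h1 h2. h1 x' \<otimes>\<^bsub>M\<^esub> h2 (h' z)) (\<Delta>A h)"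
    using assms z by (intro AA.tensor.lift_comp[OF abelian_M abelian_M balanced_AM, symmetric] linear_AM_eval
        M.additive_map_scale w)
  finally show ?thesis using assms z by (simp add: comult_A_eval)
qed

lemma smash_inner_balanced:
  assumes t: "t \<in> carrier MA"
  shows "balanced_K K M A MA (\<lambda>x h. tensor_lift MA (J x h) t)"
  by (rule MA.tensor.balanced_map_lift_param[OF MA.tensor.abelian_T t MA.tensor.abelian_X MA.tensor.abelian_Y])
    (simp_all add: J_balanced_left J_balanced_right A.smult_closed del: A_simps)

lemma smash_mult_closed: "\<lbrakk>s \<in> carrier MA; t \<in> carrier MA\<rbrakk> \<Longrightarrow> s \<otimes>\<^bsub>smash\<^esub> t \<in> carrier MA"
  unfolding smash_mult by (intro MA.tensor.lift_closed[OF MA.tensor.abelian_T smash_inner_balanced])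

text \<open>Additivity in s and then in t reduces the claim to \<open>MA_act_J\<close>.\<close>

lemma MA_act_smash_mult:
  assumes s: "s \<in> carrier MA" and t: "t \<in> carrier MA" and z: "z \<in> carrier M"
  shows "MA_act (s \<otimes>\<^bsub>smash\<^esub> t) z = MA_act s (MA_act t z)"
  unfolding smash_mult
proof (rule MA.additive_map_eqI[OF _ _ s])
  note G = MA.tensor.abelian_T
  show "additive_map MA M (\<lambda>s. MA_act (tensor_lift MA (\<lambda>x h. tensor_lift MA (J x h) t) s) z)"
    by (intro additive_map_comp[OF MA.tensor.additive_map_lift[OF G smash_inner_balanced[OF t]]] MA_act_additive_left z)
  show "additive_map MA M (\<lambda>s. MA_act s (MA_act t z))"
    using t z by (intro MA_act_additive_left MA_act_closed)
  fix x h assume xh: "x \<in> carrier M" "h \<in> carrier A"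
  have "MA_act (tensor_lift MA (J x h) t) z = x \<otimes>\<^bsub>M\<^esub> h (MA_act t z)"
  proof (rule MA.additive_map_eqI[OF _ _ t])
    show "additive_map MA M (\<lambda>t. MA_act (tensor_lift MA (J x h) t) z)"
      using xh by (intro additive_map_comp[OF MA.tensor.additive_map_lift[OF G J_balanced_right]] MA_act_additive_left z)
    show "additive_map MA M (\<lambda>t. x \<otimes>\<^bsub>M\<^esub> h (MA_act t z))"
      using xh z by (intro additive_map_comp[OF additive_map_comp[OF MA_act_additive_left A_additive]]
          M.additive_map_scale)
  qed (use xh z in \<open>simp add: MA.lift_elem[OF G J_balanced_right] MA_act_J MA_act_elem\<close>)
  then show "MA_act (tensor_lift MA (\<lambda>x h. tensor_lift MA (J x h) t) (elem_K K M A x h)) z =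
      MA_act (elem_K K M A x h) (MA_act t z)"
    using xh t z by (simp add: MA.lift_elem[OF G smash_inner_balanced] MA_act_elem MA_act_closed)
qed

lemma smash_simps: "carrier smash = carrier MA" "s \<oplus>\<^bsub>smash\<^esub> t = s \<oplus>\<^bsub>MA\<^esub> t"
  using same_add_smash by (simp_all add: same_add_def)

lemma MA_act_one: "z \<in> carrier M \<Longrightarrow> MA_act \<one>\<^bsub>smash\<^esub> z = z"
  unfolding smash_one using idA by (simp add: MA_act_elem)

lemma ring_smash: "ring smash"
proof (rule ring_of_faithful_action[OF same_add_abelian_group[OF same_add_smash MA.tensor.abelian_T] abelian_M, where F = MA_act])
  show "\<one>\<^bsub>smash\<^esub> \<in> carrier smash"
    unfolding smash_one smash_simps by (intro MA.elem_closed M.one_closed A.one_closed)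
qed (simp_all add: smash_simps smash_mult_closed MA_act_additive MA_act_smash_mult MA_act_one MA_faithful
    additive_map_add[OF MA_act_additive_left])

section \<open>The basic construction as a ring of operators on M\<close>

context
  fixes E :: "'m \<Rightarrow> 'n" and r :: nat and x y :: "nat \<Rightarrow> 'm"
  assumes frob: "frobenius_system N M \<phi> E r x y"
begin

text \<open>The Frobenius homomorphism viewed inside A as an endomorphism of M, so that
  \<open>act\<close> and the linearity lemmas for A apply to it.\<close>

definition e\<^sub>E :: "'m \<Rightarrow> 'm" where "e\<^sub>E = (\<lambda>m \<in> carrier M. \<phi> (E m))"

lemma E_closed: "m \<in> carrier M \<Longrightarrow> E m \<in> carrier N"
  using frob by (auto simp: frobenius_system_def bimodule_hom_def)

lemma e_A: "e\<^sub>E \<in> carrier A"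
proof -
  have hom: "\<phi> (n \<oplus>\<^bsub>N\<^esub> n') = \<phi> n \<oplus>\<^bsub>M\<^esub> \<phi> n'" "\<phi> (n \<otimes>\<^bsub>N\<^esub> n') = \<phi> n \<otimes>\<^bsub>M\<^esub> \<phi> n'"
    if "n \<in> carrier N" "n' \<in> carrier N" for n n'
    using algebra_extension that by (auto simp: algebra_extension_def algebra_hom_def ring_hom_def)
  show ?thesis
    using frob by (simp add: A_iff e\<^sub>E_def E_closed frobenius_system_def bimodule_hom_def hom)
qed

lemma x_closed: "i < r \<Longrightarrow> x i \<in> carrier M" and y_closed: "i < r \<Longrightarrow> y i \<in> carrier M"
  using frob by (simp_all add: frobenius_system_def)

lemma e_closed: "m \<in> carrier M \<Longrightarrow> e\<^sub>E m \<in> carrier M"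
  by (rule A_closed[OF e_A])

lemma frobenius_left: "m \<in> carrier M \<Longrightarrow> (\<Oplus>\<^bsub>M\<^esub>i \<in> {..<r}. x i \<otimes>\<^bsub>M\<^esub> e\<^sub>E (y i \<otimes>\<^bsub>M\<^esub> m)) = m"
proof -
  assume m: "m \<in> carrier M"
  have "(\<Oplus>\<^bsub>M\<^esub>i \<in> {..<r}. x i \<otimes>\<^bsub>M\<^esub> e\<^sub>E (y i \<otimes>\<^bsub>M\<^esub> m)) = (\<Oplus>\<^bsub>M\<^esub>i \<in> {..<r}. x i \<otimes>\<^bsub>M\<^esub> \<phi> (E (y i \<otimes>\<^bsub>M\<^esub> m)))"
    using m by (intro M.finsum_cong') (auto simp: e\<^sub>E_def x_closed y_closed E_closed)
  then show ?thesis using frob m by (simp add: frobenius_system_def)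
qed

lemma frobenius_right: "m \<in> carrier M \<Longrightarrow> (\<Oplus>\<^bsub>M\<^esub>i \<in> {..<r}. e\<^sub>E (m \<otimes>\<^bsub>M\<^esub> x i) \<otimes>\<^bsub>M\<^esub> y i) = m"
proof -
  assume m: "m \<in> carrier M"
  have "(\<Oplus>\<^bsub>M\<^esub>i \<in> {..<r}. e\<^sub>E (m \<otimes>\<^bsub>M\<^esub> x i) \<otimes>\<^bsub>M\<^esub> y i) = (\<Oplus>\<^bsub>M\<^esub>i \<in> {..<r}. \<phi> (E (m \<otimes>\<^bsub>M\<^esub> x i)) \<otimes>\<^bsub>M\<^esub> y i)"
    using m by (intro M.finsum_cong') (auto simp: e\<^sub>E_def x_closed y_closed E_closed)
  then show ?thesis using frob m by (simp add: frobenius_system_def)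
qed

text \<open>The value of \<open>e\<^sub>E\<close> lies in the image of N, so right N-linearity
  applies.\<close>

lemma e_mult_right: "\<lbrakk>m \<in> carrier M; m' \<in> carrier M\<rbrakk> \<Longrightarrow> e\<^sub>E (m \<otimes>\<^bsub>M\<^esub> e\<^sub>E m') = e\<^sub>E m \<otimes>\<^bsub>M\<^esub> e\<^sub>E m'"
  using A_right[OF e_A, of "E m'" m] by (simp add: e\<^sub>E_def E_closed)

lemma e_balanced: "\<lbrakk>u \<in> carrier M; m \<in> carrier M; v \<in> carrier M\<rbrakk> \<Longrightarrow> u \<otimes>\<^bsub>M\<^esub> e\<^sub>E m \<otimes>N v = u \<otimes>N e\<^sub>E m \<otimes>\<^bsub>M\<^esub> v"
  using tens_balanced[of u "E m" v] by (simp add: e\<^sub>E_def E_closed)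

text \<open>The inverse of \<open>act e\<^sub>E\<close> provided by the Frobenius system; on the
  identity it gives the unit of the basic construction.\<close>

definition T_of :: "('m \<Rightarrow> 'm) \<Rightarrow> ('m \<times> 'm \<Rightarrow>\<^sub>0 int) set" where
  "T_of f = (\<Oplus>\<^bsub>T\<^esub>i \<in> {..<r}. f (x i) \<otimes>N y i)"

lemma T_of_closed:
  assumes "\<And>m. m \<in> carrier M \<Longrightarrow> f m \<in> carrier M"
  shows "T_of f \<in> carrier T"
  unfolding T_of_def using assms by (intro tensor.T.finsum_closed) (auto simp: tens_closed x_closed y_closed)

text \<open>Right N-linearity pulls E(y_i z) into f, and the first Frobenius identity sums x_i E(y_i
  z) to z.\<close>

lemma act_T_of:
  assumes f: "right_linear f" and z: "z \<in> carrier M"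
  shows "act e\<^sub>E (T_of f) z = f z"
proof -
  have fadd: "additive_map M M f" and fN: "\<And>m n. \<lbrakk>m \<in> carrier M; n \<in> carrier N\<rbrakk> \<Longrightarrow> f (m \<otimes>\<^bsub>M\<^esub> \<phi> n) = f m \<otimes>\<^bsub>M\<^esub> \<phi> n"
    using f by (simp_all add: right_linear_def)
  note fc = additive_map_closed[OF fadd]
  have "act e\<^sub>E (T_of f) z = (\<Oplus>\<^bsub>M\<^esub>i \<in> {..<r}. act e\<^sub>E (f (x i) \<otimes>N y i) z)"
    unfolding T_of_def using z
    by (intro additive_map_finsum[OF abelian_T abelian_M act_additive[OF A_EN[OF e_A]]])
      (auto simp: tens_closed x_closed y_closed fc)
  also have "\<dots> = (\<Oplus>\<^bsub>M\<^esub>i \<in> {..<r}. f (x i \<otimes>\<^bsub>M\<^esub> e\<^sub>E (y i \<otimes>\<^bsub>M\<^esub> z)))"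
    using z fN[of "x _" "E (y _ \<otimes>\<^bsub>M\<^esub> z)"]
    by (intro M.finsum_cong') (auto simp: act_tens A_EN e_A x_closed y_closed fc e_closed, simp add: e\<^sub>E_def E_closed x_closed y_closed)
  also have "\<dots> = f (\<Oplus>\<^bsub>M\<^esub>i \<in> {..<r}. x i \<otimes>\<^bsub>M\<^esub> e\<^sub>E (y i \<otimes>\<^bsub>M\<^esub> z))"
    using z by (intro additive_map_finsum[OF abelian_M abelian_M fadd, symmetric])
      (auto simp: x_closed y_closed e_closed)
  finally show ?thesis using z by (simp add: frobenius_left)
qed

text \<open>For u (x) v, balancing moves E(v x_i) to the second leg, where the second Frobenius
  identity sums E(v x_i) y_i to v.\<close>

lemma T_of_act:
  assumes t: "t \<in> carrier T"
  shows "T_of (act e\<^sub>E t) = t"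
  unfolding T_of_def
proof (rule additive_map_eqI[OF _ _ t])
  have tadd: "additive_map M T (\<lambda>m. m \<otimes>N v)" if "v \<in> carrier M" for v
    using that by (simp add: additive_map_def tens_closed tens_add_left)
  show "additive_map T T (\<lambda>t. \<Oplus>\<^bsub>T\<^esub>i \<in> {..<r}. act e\<^sub>E t (x i) \<otimes>N y i)"
    by (intro additive_map_finsum_fun abelian_T additive_map_comp[OF act_additive tadd])
      (simp_all add: A_EN e_A x_closed y_closed)
  show "additive_map T T (\<lambda>t. t)" by (simp add: additive_map_def)
  fix u v assume uv: "u \<in> carrier M" "v \<in> carrier M"
  have uadd: "additive_map M T (\<lambda>m. u \<otimes>N m)"
    using uv by (simp add: additive_map_def tens_closed tens_add_right)
  have "(\<Oplus>\<^bsub>T\<^esub>i \<in> {..<r}. act e\<^sub>E (u \<otimes>N v) (x i) \<otimes>N y i) = (\<Oplus>\<^bsub>T\<^esub>i \<in> {..<r}. u \<otimes>N e\<^sub>E (v \<otimes>\<^bsub>M\<^esub> x i) \<otimes>\<^bsub>M\<^esub> y i)"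
    using uv by (intro tensor.T.finsum_cong')
      (auto simp: act_tens A_EN e_A e_balanced x_closed y_closed e_closed intro!: tens_closed)
  also have "\<dots> = u \<otimes>N (\<Oplus>\<^bsub>M\<^esub>i \<in> {..<r}. e\<^sub>E (v \<otimes>\<^bsub>M\<^esub> x i) \<otimes>\<^bsub>M\<^esub> y i)"
    using uv by (intro additive_map_finsum[OF abelian_M abelian_T uadd, symmetric])
      (auto simp: x_closed y_closed e_closed)
  finally show "(\<Oplus>\<^bsub>T\<^esub>i \<in> {..<r}. act e\<^sub>E (u \<otimes>N v) (x i) \<otimes>N y i) = u \<otimes>N v"
    using uv by (simp add: frobenius_right)
qed

lemma act_e_faithful:
  assumes t: "t \<in> carrier T" "t' \<in> carrier T" and eq: "\<And>z. z \<in> carrier M \<Longrightarrow> act e\<^sub>E t z = act e\<^sub>E t' z"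
  shows "t = t'"
proof -
  have "T_of (act e\<^sub>E t) = T_of (act e\<^sub>E t')"
    unfolding T_of_def using t
    by (intro tensor.T.finsum_cong') (auto simp: eq x_closed y_closed A_EN e_A intro!: tens_closed act_closed)
  then show ?thesis using t by (simp add: T_of_act)
qed

abbreviation (input) "M1 \<equiv> basic_construction N M \<phi> E r x y"

lemma same_add_M1: "same_add M1 T"
  by (simp add: same_add_def basic_construction_def Let_def)

lemma M1_simps: "carrier M1 = carrier T" "s \<oplus>\<^bsub>M1\<^esub> t = s \<oplus>\<^bsub>T\<^esub> t" "\<one>\<^bsub>M1\<^esub> = T_of (\<lambda>m. m)"
  by (simp_all add: basic_construction_def Let_def T_of_def)

lemma M1_balanced_right: "\<lbrakk>u \<in> carrier M; v \<in> carrier M\<rbrakk> \<Longrightarrow> balN T (\<lambda>u' v'. u \<otimes>\<^bsub>M\<^esub> e\<^sub>E (v \<otimes>\<^bsub>M\<^esub> u') \<otimes>N v')"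
  by (rule balNI)
    (simp_all add: tens_closed e_closed A_add[OF e_A] M.r_distr tens_add_left tens_add_right A_right[OF e_A]
      flip: tens_balanced M.m_assoc)

lemma M1_balanced_left: "\<lbrakk>u' \<in> carrier M; v' \<in> carrier M\<rbrakk> \<Longrightarrow> balN T (\<lambda>u v. u \<otimes>\<^bsub>M\<^esub> e\<^sub>E (v \<otimes>\<^bsub>M\<^esub> u') \<otimes>N v')"
  by (rule balNI)
    (simp_all add: tens_closed e_closed A_add[OF e_A] M.r_distr M.l_distr tens_add_left A_left[OF e_A] M.m_assoc)

lemma M1_inner_balanced:
  "t \<in> carrier T \<Longrightarrow> balN T (\<lambda>u v. tensor_lift T (\<lambda>u' v'. u \<otimes>\<^bsub>M\<^esub> e\<^sub>E (v \<otimes>\<^bsub>M\<^esub> u') \<otimes>N v') t)"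
  by (rule tensor.balanced_map_lift_param[OF abelian_T _ tensor.abelian_X tensor.abelian_Y])
    (simp_all add: M1_balanced_left M1_balanced_right)

text \<open>Rewriting the product with \<open>e\<^sub>E\<close> makes the linearity lemmas for A
  available for the nested integrands.\<close>

lemma M1_mult:
  assumes s: "s \<in> carrier T" and t: "t \<in> carrier T"
  shows "s \<otimes>\<^bsub>M1\<^esub> t = tensor_lift T (\<lambda>u v. tensor_lift T (\<lambda>u' v'. u \<otimes>\<^bsub>M\<^esub> e\<^sub>E (v \<otimes>\<^bsub>M\<^esub> u') \<otimes>N v') t) s"
proof -
  have "s \<otimes>\<^bsub>M1\<^esub> t = tensor_lift T (\<lambda>u v. tensor_lift T (\<lambda>u' v'. u \<otimes>\<^bsub>M\<^esub> \<phi> (E (v \<otimes>\<^bsub>M\<^esub> u')) \<otimes>N v') t) s"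
    by (simp add: basic_construction_def Let_def)
  also have "\<dots> = tensor_lift T (\<lambda>u v. tensor_lift T (\<lambda>u' v'. u \<otimes>\<^bsub>M\<^esub> e\<^sub>E (v \<otimes>\<^bsub>M\<^esub> u') \<otimes>N v') t) s"
  proof (rule lift_cong[OF abelian_T s])
    fix u v assume uv: "u \<in> carrier M" "v \<in> carrier M"
    then show "tensor_lift T (\<lambda>u' v'. u \<otimes>\<^bsub>M\<^esub> \<phi> (E (v \<otimes>\<^bsub>M\<^esub> u')) \<otimes>N v') t =
        tensor_lift T (\<lambda>u' v'. u \<otimes>\<^bsub>M\<^esub> e\<^sub>E (v \<otimes>\<^bsub>M\<^esub> u') \<otimes>N v') t"
      by (intro lift_cong[OF abelian_T t]) (simp_all add: e\<^sub>E_def tens_closed E_closed)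
    show "tensor_lift T (\<lambda>u' v'. u \<otimes>\<^bsub>M\<^esub> e\<^sub>E (v \<otimes>\<^bsub>M\<^esub> u') \<otimes>N v') t \<in> carrier T"
      by (rule tensor.lift_closed[OF abelian_T M1_balanced_right[OF uv] t])
  qed
  finally show ?thesis .
qed

lemma M1_mult_closed: "\<lbrakk>s \<in> carrier T; t \<in> carrier T\<rbrakk> \<Longrightarrow> s \<otimes>\<^bsub>M1\<^esub> t \<in> carrier T"
  by (simp add: M1_mult tensor.lift_closed[OF abelian_T M1_inner_balanced])

text \<open>On pure tensors this is u E(v u') E(v' z) = u E(v u' E(v' z)), that is, right
  N-linearity of E.\<close>

lemma act_M1_mult:
  assumes s: "s \<in> carrier T" and t: "t \<in> carrier T" and z: "z \<in> carrier M"
  shows "act e\<^sub>E (s \<otimes>\<^bsub>M1\<^esub> t) z = act e\<^sub>E s (act e\<^sub>E t z)"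
  unfolding M1_mult[OF s t]
proof (rule additive_map_eqI[OF _ _ s])
  note eE = A_EN[OF e_A]
  let ?m = "\<lambda>u v. tensor_lift T (\<lambda>u' v'. u \<otimes>\<^bsub>M\<^esub> e\<^sub>E (v \<otimes>\<^bsub>M\<^esub> u') \<otimes>N v')"
  show "additive_map T M (\<lambda>s. act e\<^sub>E (tensor_lift T (\<lambda>u v. ?m u v t) s) z)"
    by (intro additive_map_comp[OF tensor.additive_map_lift[OF abelian_T M1_inner_balanced[OF t]]] act_additive eE z)
  show "additive_map T M (\<lambda>s. act e\<^sub>E s (act e\<^sub>E t z))"
    using t z by (intro act_additive act_closed eE)
  fix u v assume uv: "u \<in> carrier M" "v \<in> carrier M"
  have "act e\<^sub>E (?m u v t) z = u \<otimes>\<^bsub>M\<^esub> e\<^sub>E (v \<otimes>\<^bsub>M\<^esub> act e\<^sub>E t z)"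
  proof (rule additive_map_eqI[OF _ _ t])
    show "additive_map T M (\<lambda>t. act e\<^sub>E (?m u v t) z)"
      using uv by (intro additive_map_comp[OF tensor.additive_map_lift[OF abelian_T M1_balanced_right]] act_additive eE z)
    show "additive_map T M (\<lambda>t. u \<otimes>\<^bsub>M\<^esub> e\<^sub>E (v \<otimes>\<^bsub>M\<^esub> act e\<^sub>E t z))"
      using uv z by (intro additive_map_comp[OF additive_map_comp[OF additive_map_comp[OF act_additive
              M.additive_map_scale(1)] A_additive]] M.additive_map_scale eE e_A)
  next
    fix u' v' assume uv': "u' \<in> carrier M" "v' \<in> carrier M"
    have "e\<^sub>E (v \<otimes>\<^bsub>M\<^esub> (u' \<otimes>\<^bsub>M\<^esub> e\<^sub>E (v' \<otimes>\<^bsub>M\<^esub> z))) = e\<^sub>E (v \<otimes>\<^bsub>M\<^esub> u') \<otimes>\<^bsub>M\<^esub> e\<^sub>E (v' \<otimes>\<^bsub>M\<^esub> z)"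
      using uv uv' z e_mult_right[of "v \<otimes>\<^bsub>M\<^esub> u'" "v' \<otimes>\<^bsub>M\<^esub> z"] by (simp add: M.m_assoc e_closed)
    then show "act e\<^sub>E (?m u v (u' \<otimes>N v')) z = u \<otimes>\<^bsub>M\<^esub> e\<^sub>E (v \<otimes>\<^bsub>M\<^esub> act e\<^sub>E (u' \<otimes>N v') z)"
      using uv uv' z by (simp add: lift_tens[OF abelian_T M1_balanced_right] act_tens eE e_closed M.m_assoc)
  qed
  then show "act e\<^sub>E (tensor_lift T (\<lambda>u v. ?m u v t) (u \<otimes>N v)) z = act e\<^sub>E (u \<otimes>N v) (act e\<^sub>E t z)"
    using uv t z by (simp add: lift_tens[OF abelian_T M1_inner_balanced] act_tens eE act_closed)
qed

lemma act_M1_one: "z \<in> carrier M \<Longrightarrow> act e\<^sub>E \<one>\<^bsub>M1\<^esub> z = z"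
  unfolding M1_simps by (rule act_T_of) (simp add: right_linear_def additive_map_def)

lemma ring_M1: "ring M1"
  by (rule ring_of_faithful_action[OF same_add_abelian_group[OF same_add_M1 abelian_T] abelian_M, where F = "act e\<^sub>E",
        OF _ _ _ _ _ _ act_e_faithful])
    (simp_all add: M1_simps(1,2) M1_mult_closed act_additive_right A_EN e_A act_M1_mult act_M1_one
      additive_map_add[OF act_additive], simp add: M1_simps T_of_closed)

lemma M1_iso_smash: "M1 \<simeq> smash"
proof (rule ring_iso_of_faithful_actions[OF ring_M1 ring_smash, where V = M and F = "act e\<^sub>E" and G = MA_act])
  fix t assume "t \<in> carrier M1"
  then have "right_linear (act e\<^sub>E t)" by (simp add: M1_simps right_linear_act e_A)
  \<comment> \<open>The witness is \<open>MA_of\<close> applied to the operator of t.\<close>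
  then show "\<exists>w \<in> carrier smash. \<forall>z \<in> carrier M. MA_act w z = act e\<^sub>E t z"
    unfolding smash_simps using MA_act_MA_of MA_of_closed by blast
next
  fix w assume "w \<in> carrier smash"
  then have w: "w \<in> carrier MA" by (simp add: smash_simps)
  \<comment> \<open>The witness comes from the Frobenius system: \<open>T_of\<close> applied to the
    operator of w.\<close>
  show "\<exists>t \<in> carrier M1. \<forall>z \<in> carrier M. act e\<^sub>E t z = MA_act w z"
    unfolding M1_simps
    by (intro bexI[of _ "T_of (MA_act w)"] ballI act_T_of T_of_closed MA_act_closed right_linear_MA_act w)
qed (simp_all add: M1_simps(1,2) smash_simps MA_act_closed MA_act_smash_mult MA_act_one MA_faithful
    act_M1_mult act_M1_one act_e_faithful A_EN e_A
    additive_map_add[OF act_additive] additive_map_add[OF MA_act_additive_left])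

end

end

theorem theorem8p1:
  fixes K :: "'k ring" and N :: "('k, 'n) module" and M :: "('k, 'm) module"
    and \<phi> :: "'n \<Rightarrow> 'm"
  assumes "algebra_extension K N M \<phi>"
    and "depth_two N M \<phi>"
    and "irreducible_extension K N M \<phi>"
    and "frobenius_extension N M \<phi>"
  shows "(\<exists>d b \<beta>. left_D2_quasibasis N M \<phi> d b \<beta>) \<and>
    (\<forall>d b \<beta>. left_D2_quasibasis N M \<phi> d b \<beta> \<longrightarrow>
      (let A = End_NN N M \<phi>; \<Delta>A = comult_A K N M \<phi> d b \<beta>; \<epsilon>A = counit_A K M;
           B = tensor_square_centralizer N M \<phi>; \<Delta>B = comult_B K N M \<phi> d b \<beta>; \<epsilon>B = counit_B K M
       in hopf_algebra K A \<Delta>A \<epsilon>A \<and>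
          hopf_algebra K B \<Delta>B \<epsilon>B \<and>
          dual_bialgebras K B \<Delta>B \<epsilon>B A \<Delta>A \<epsilon>A (pairing K M) \<and>
          left_module_algebra K A \<Delta>A \<epsilon>A M (\<lambda>\<alpha> m. \<alpha> m) \<and>
          right_module_algebra K B \<Delta>B \<epsilon>B (End_N N M \<phi>) (right_action_B M) \<and>
          (\<forall>E r x y. frobenius_system N M \<phi> E r x y \<longrightarrow>
            (let M1 = basic_construction N M \<phi> E r x y;
                 MA = smash_product K M A \<Delta>A (\<lambda>\<alpha> m. \<alpha> m)
             in ring M1 \<and> ring MA \<and> M1 \<simeq> MA))))"
proof -
  interpret irreducible_alg_extension K N M \<phi>
    using assms(1,3) by unfold_locales
  \<comment> \<open>The dual bases are fixed once; they are independent of the left quasibasis,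
    which stays universally quantified in the coproduct formulas.\<close>
  obtain e c \<gamma> where right: "right_D2_quasibasis N M \<phi> e c \<gamma>"
    using assms(2) by (rule right_quasibasis_exists)
  have "hopf_algebra K (End_NN N M \<phi>) (comult_A K N M \<phi> d b \<beta>) (counit_A K M) \<and>
      hopf_algebra K (tensor_square_centralizer N M \<phi>) (comult_B K N M \<phi> d b \<beta>) (counit_B K M) \<and>
      dual_bialgebras K (tensor_square_centralizer N M \<phi>) (comult_B K N M \<phi> d b \<beta>) (counit_B K M)
        (End_NN N M \<phi>) (comult_A K N M \<phi> d b \<beta>) (counit_A K M) (pairing K M) \<and>
      left_module_algebra K (End_NN N M \<phi>) (comult_A K N M \<phi> d b \<beta>) (counit_A K M) M (\<lambda>\<alpha> m. \<alpha> m) \<and>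
      right_module_algebra K (tensor_square_centralizer N M \<phi>) (comult_B K N M \<phi> d b \<beta>) (counit_B K M)
        (End_N N M \<phi>) (right_action_B M) \<and>
      (\<forall>E r x y. frobenius_system N M \<phi> E r x y \<longrightarrow>
        ring (basic_construction N M \<phi> E r x y) \<and>
        ring (smash_product K M (End_NN N M \<phi>) (comult_A K N M \<phi> d b \<beta>) (\<lambda>\<alpha> m. \<alpha> m)) \<and>
        basic_construction N M \<phi> E r x y \<simeq>
          smash_product K M (End_NN N M \<phi>) (comult_A K N M \<phi> d b \<beta>) (\<lambda>\<alpha> m. \<alpha> m))"
    if left: "left_D2_quasibasis N M \<phi> d b \<beta>" for d b \<beta>
  proof -
    interpret D2: depth_two_extension K N M \<phi> d b \<beta> e c \<gamma>
      using left right by unfold_locales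
    show ?thesis
      using D2.hopf_A D2.hopf_B D2.dual.dual_bialgebras D2.left_module_algebra_M D2.right_module_algebra_EN
        D2.ring_M1 D2.ring_smash D2.M1_iso_smash by blast
  qed
  moreover have "\<exists>d b \<beta>. left_D2_quasibasis N M \<phi> d b \<beta>"
    using left_quasibasis_exists[OF assms(2)] by blast
  ultimately show ?thesis by (simp only: Let_def) blast
qed

end
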